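(* Let $0\le\nu<1$, $0<\mu<1$, and let $\omega\subset\Omega$ be an arbitrary non-empty open set. Then the system $$\begin{cases}\mathbb D_t^{\mu,\nu}u+A_Bu=f|_\omega & \text{in }\Omega\times(0,T),\\ (\mathbb I_t^{(1-\nu)(1-\mu)}u)(\cdot,0)=u_0 & \text{in }\Omega\end{cases}$$ is approximately controllable at any time $T>0$; that is, for every $T>0$, every $u_0,u_1\in L^2(\Omega)$ and every $\varepsilon>0$ there exists a control function $f\in L^2((0,T);L^2(\omega))=L^2(\omega\times(0,T))$ such that the weak solution $u$ of the system satisfies $\|u(\cdot,T)-u_1\|_{L^2(\Omega)}\le\varepsilon$.
   Context: Setting. $\Omega\subset\mathbb R^N$ ($N\ge1$) is a bounded open set. $A_B$ is a non-negative selfadjoint operator on $L^2(\Omega)$ with domain $D(A_B)$ (graph norm) compactly embedded in $L^2(\Omega)$. It is associated with a symmetric, closed, non-negative bilinear form $\mathcal E_B$ with domain $V_{1/2}:=D(\mathcal E_B)$. Its eigenvalues $(\lambda_n)_{n\in\mathbb N}$ form a non-decreasing sequence tending to $\infty$, and it is assumed that the first eigenvalue satisfies $\lambda_1>0$. $V_{-1/2}$ is the dual of $V_{1/2}$ with respect to the pivot space $L^2(\Omega)$, and $\langle\cdot,\cdot\rangle_{V_{-1/2},V_{1/2}}$ is the duality pairing. Fractional calculus. For $\alpha>0$, $\mathbb I_t^\alpha g(t):=\frac1{\Gamma(\alpha)}\int_0^t(t-\tau)^{\alpha-1}g(\tau)\,d\tau$, and $\mathbb I_t^0g:=g$. For $0\le\nu\le1$,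 $0<\mu\le1$, the Hilfer derivative is $\mathbb D_t^{\mu,\nu}u(t):=\mathbb I_t^{\nu(1-\mu)}\frac{d}{dt}\big(\mathbb I_t^{(1-\nu)(1-\mu)}u\big)(t)$, $t>0$. Weak solution. The control $f$ is localized in $\omega$, so that the right-hand side $f|_\omega$ is $f$ on $\omega\times(0,T)$ and $0$ on $(\Omega\setminus\omega)\times(0,T)$. A function $u$ is a weak solution of the system if $u\in C((0,T];V_{1/2})$, $\mathbb I_t^{(1-\nu)(1-\mu)}u\in C([0,T];L^2(\Omega))$, $\mathbb D_t^{\mu,\nu}u\in C((0,T];V_{-1/2})$, $\mathbb I_t^{(1-\nu)(1-\mu)}u(\cdot,0)=u_0$, and for every $\varphi\in V_{1/2}$ and a.e. $t\in(0,T)$, $\langle\mathbb D_t^{\mu,\nu}u(\cdot,t),\varphi\rangle_{V_{-1/2},V_{1/2}}+\mathcal E_B(u(\cdot,t),\varphi)-(f(\cdot,t),\varphi)_{L^2(\Omega)}=0$ (with $f$ extended by zero outside $\omega$).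
   Formalization: The formal theorem additionally assumes unique continuation from ω: an eigenfunction of A_B vanishing a.e. on ω is zero; without this the statement fails for general A_B, and the condition is necessary for approximate controllability. *)

theory Defs
  imports "HOL-Analysis.Analysis"
begin

definition square_integrable :: "('a::euclidean_space \<Rightarrow> real) \<Rightarrow> bool" where
  "square_integrable f \<longleftrightarrow>
     f \<in> borel_measurable lborel \<and> integrable lborel (\<lambda>x. (f x)\<^sup>2)"

lemma square_integrable_mult:
  assumes "square_integrable f" "square_integrable g"
  shows "integrable lborel (\<lambda>x. f x * g x)"
proof (rule Bochner_Integration.integrable_bound)
  show "integrable lborel (\<lambda>x. (f x)\<^sup>2 + (g x)\<^sup>2)"
    using assms by (auto simp: square_integrable_def)
  show "(\<lambda>x. f x * g x) \<in> borel_measurable lborel"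
    using assms by (auto simp: square_integrable_def)
  have "\<bar>a * b\<bar> \<le> a\<^sup>2 + b\<^sup>2" for a b :: real
  proof -
    have "2 * (\<bar>a\<bar> * \<bar>b\<bar>) \<le> a\<^sup>2 + b\<^sup>2" using sum_squares_bound[of "\<bar>a\<bar>" "\<bar>b\<bar>"] by simp
    moreover have "0 \<le> \<bar>a\<bar> * \<bar>b\<bar>" by simp
    ultimately show ?thesis unfolding abs_mult by linarith
  qed
  then show "AE x in lborel. norm (f x * g x) \<le> norm ((f x)\<^sup>2 + (g x)\<^sup>2)"
    by simp
qed

lemma square_integrable_zero: "square_integrable (\<lambda>_. 0)"
  by (simp add: square_integrable_def)

lemma square_integrable_scale:
  "square_integrable f \<Longrightarrow> square_integrable (\<lambda>x. c * f x)"
  by (auto simp: square_integrable_def power_mult_distrib)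

lemma square_integrable_add:
  assumes "square_integrable f" "square_integrable g"
  shows "square_integrable (\<lambda>x. f x + g x)"
  using assms square_integrable_mult[OF assms]
  by (auto simp: square_integrable_def power2_sum mult.assoc)

lemma square_integrable_diff:
  assumes "square_integrable f" "square_integrable g"
  shows "square_integrable (\<lambda>x. f x - g x)"
  using square_integrable_add[OF assms(1) square_integrable_scale[OF assms(2), of "-1"]] by simp

lemma square_integrable_abs: "square_integrable f \<Longrightarrow> square_integrable (\<lambda>x. \<bar>f x\<bar>)"
  by (auto simp: square_integrable_def)

lemma square_integrable_bound:
  assumes "square_integrable w" "f \<in> borel_measurable lborel" "AE x in lborel. \<bar>f x\<bar> \<le> \<bar>w x\<bar>"
  shows "square_integrable f"
  unfolding square_integrable_def
proof (intro conjI)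
  show "f \<in> borel_measurable lborel" by fact
  show "integrable lborel (\<lambda>x. (f x)\<^sup>2)"
  proof (rule Bochner_Integration.integrable_bound)
    show "integrable lborel (\<lambda>x. (w x)\<^sup>2)" using assms(1) by (simp add: square_integrable_def)
    show "AE x in lborel. norm ((f x)\<^sup>2) \<le> norm ((w x)\<^sup>2)"
      using assms(3) by eventually_elim (simp add: abs_le_square_iff)
  qed (use assms(2) in auto)
qed

text \<open>The Hilbert space of square-integrable functions on the whole space modulo equality almost
  everywhere.\<close>

quotient_type (overloaded) 'a L2 = "'a::euclidean_space \<Rightarrow> real" /
  partial: "\<lambda>f g. square_integrable f \<and> square_integrable g \<and> (AE x in lborel. f x = g x)"
proof (rule part_equivpI)
  show "\<exists>f::'a \<Rightarrow> real. square_integrable f \<and> square_integrable f \<and> (AE x in lborel. f x = f x)"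
    using square_integrable_zero by auto
qed (auto simp: symp_def transp_def elim: eventually_mono)

instantiation L2 :: (euclidean_space) real_vector
begin

lift_definition zero_L2 :: "'a L2" is "\<lambda>_. 0"
  by (simp add: square_integrable_zero)

lift_definition plus_L2 :: "'a L2 \<Rightarrow> 'a L2 \<Rightarrow> 'a L2" is "\<lambda>f g x. f x + g x"
  by (auto simp: square_integrable_add)

lift_definition minus_L2 :: "'a L2 \<Rightarrow> 'a L2 \<Rightarrow> 'a L2" is "\<lambda>f g x. f x - g x"
  by (auto simp: square_integrable_diff)

lift_definition scaleR_L2 :: "real \<Rightarrow> 'a L2 \<Rightarrow> 'a L2" is "\<lambda>c f x. c * f x"
  by (auto simp: square_integrable_scale)

lift_definition uminus_L2 :: "'a L2 \<Rightarrow> 'a L2" is "\<lambda>f x. - f x"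
  by (auto simp: square_integrable_def)

instance
proof
  fix u v w :: "'a L2" and a b :: real
  show "u + v + w = u + (v + w)"
    by transfer (auto simp: square_integrable_add add.assoc)
  show "u + v = v + u"
    by transfer (auto simp: square_integrable_add add.commute)
  show "0 + u = u" by transfer auto
  show "- u + u = 0" by transfer (auto simp: square_integrable_zero)
  show "u - v = u + - v"
    by transfer (auto simp: square_integrable_diff)
  show "a *\<^sub>R (u + v) = a *\<^sub>R u + a *\<^sub>R v"
    by transfer (auto simp: square_integrable_add square_integrable_scale distrib_left)
  show "(a + b) *\<^sub>R u = a *\<^sub>R u + b *\<^sub>R u"
    by transfer (auto simp: square_integrable_add square_integrable_scale distrib_right)
  show "a *\<^sub>R b *\<^sub>R u = (a * b) *\<^sub>R u"
    by transfer (auto simp: square_integrable_scale mult.assoc)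
  show "1 *\<^sub>R u = u" by transfer auto
qed

end

instantiation L2 :: (euclidean_space) real_inner
begin

lift_definition inner_L2 :: "'a L2 \<Rightarrow> 'a L2 \<Rightarrow> real" is "\<lambda>f g. LINT x|lborel. f x * g x"
proof (rule integral_cong_AE; (elim conjE)?)
  fix f f' g g' :: "'a \<Rightarrow> real"
  assume si: "square_integrable f" "square_integrable f'" "square_integrable g" "square_integrable g'"
    and ae: "AE x in lborel. f x = f' x" "AE x in lborel. g x = g' x"
  from si show "(\<lambda>x. f x * g x) \<in> borel_measurable lborel"
    "(\<lambda>x. f' x * g' x) \<in> borel_measurable lborel"
    by (auto simp: square_integrable_def)
  show "AE x in lborel. f x * g x = f' x * g' x"
    using ae by eventually_elim simp
qed

definition norm_L2 :: "'a L2 \<Rightarrow> real" where "norm_L2 u = sqrt (inner u u)"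
definition dist_L2 :: "'a L2 \<Rightarrow> 'a L2 \<Rightarrow> real" where "dist_L2 u v = norm (u - v)"
definition sgn_L2 :: "'a L2 \<Rightarrow> 'a L2" where "sgn_L2 u = u /\<^sub>R norm u"
definition uniformity_L2 :: "('a L2 \<times> 'a L2) filter" where
  "uniformity_L2 = (INF e\<in>{0<..}. principal {(u, v). dist u v < e})"
definition open_L2 :: "'a L2 set \<Rightarrow> bool" where
  "open_L2 S \<longleftrightarrow> (\<forall>u\<in>S. \<forall>\<^sub>F (u', v) in uniformity. u' = u \<longrightarrow> v \<in> S)"

instance
proof
  fix u v w :: "'a L2" and a :: real
  show "dist u v = norm (u - v)" by (rule dist_L2_def)
  show "sgn u = u /\<^sub>R norm u" by (rule sgn_L2_def)
  show "uniformity = (INF e\<in>{0<..}. principal {(u::'a L2, v). dist u v < e})"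
    by (rule uniformity_L2_def)
  show "open S \<longleftrightarrow> (\<forall>u\<in>S. \<forall>\<^sub>F (u', v) in uniformity. u' = u \<longrightarrow> v \<in> S)" for S :: "'a L2 set"
    by (rule open_L2_def)
  show "inner u v = inner v u"
    by transfer (simp add: mult.commute)
  show "inner (u + v) w = inner u w + inner v w"
    by transfer (auto simp: distrib_right square_integrable_mult)
  show "inner (a *\<^sub>R u) v = a * inner u v"
    by transfer (simp add: mult.assoc)
  show "0 \<le> inner u u"
    by transfer (auto intro!: Bochner_Integration.integral_nonneg)
  show "inner u u = 0 \<longleftrightarrow> u = 0"
  proof (transfer, clarify)
    fix f :: "'a \<Rightarrow> real" assume f: "square_integrable f"
    have "(LINT x|lborel. f x * f x) = 0 \<longleftrightarrow> (AE x in lborel. f x * f x = 0)"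
      by (rule integral_nonneg_eq_0_iff_AE) (use f square_integrable_mult[OF f f] in auto)
    then show "(LINT x|lborel. f x * f x) = 0 \<longleftrightarrow>
        square_integrable f \<and> square_integrable (\<lambda>_::'a. 0) \<and> (AE x in lborel. f x = 0)"
      using f square_integrable_zero by auto
  qed
  show "norm u = sqrt (inner u u)" by (rule norm_L2_def)
qed

end

lemma abs_L2_surj: obtains f where "square_integrable f" "u = abs_L2 f"
  using Quotient_abs_rep[OF Quotient_L2, of u] Quotient_rep_reflp[OF Quotient_L2, of u] by metis

lemma norm_abs_L2:
  "square_integrable f \<Longrightarrow> (norm (abs_L2 f))\<^sup>2 = (LINT x|lborel. (f x)\<^sup>2)"
  unfolding power2_norm_eq_inner by (simp add: inner_L2.abs_eq power2_eq_square)

lemma abs_L2_diff: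
  "square_integrable f \<Longrightarrow> square_integrable g \<Longrightarrow> abs_L2 f - abs_L2 g = abs_L2 (\<lambda>x. f x - g x)"
  by (simp add: minus_L2.abs_eq)

lemma abs_L2_tendsto:
  assumes w: "square_integrable w" and s: "\<And>i. s i \<in> borel_measurable lborel"
    and f: "f \<in> borel_measurable lborel"
    and lim: "AE x in lborel. (\<lambda>i. s i x) \<longlonglongrightarrow> f x"
    and bnd: "\<And>i. AE x in lborel. \<bar>s i x\<bar> \<le> w x"
  shows "square_integrable f" "\<And>i. square_integrable (s i)"
    "(\<lambda>i. abs_L2 (s i)) \<longlonglongrightarrow> abs_L2 f"
proof -
  show si: "square_integrable (s i)" for i
    by (rule square_integrable_bound[OF w s]) (use bnd[of i] in \<open>auto elim: eventually_mono\<close>)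
  have "AE x in lborel. \<forall>i. \<bar>s i x\<bar> \<le> w x" using bnd by (simp add: AE_all_countable)
  then have fb: "AE x in lborel. \<bar>f x\<bar> \<le> w x" using lim
  proof eventually_elim
    case (elim x)
    then show ?case by (intro LIMSEQ_le_const2[OF tendsto_rabs[OF elim(2)]]) auto
  qed
  show sf: "square_integrable f"
    by (rule square_integrable_bound[OF w f]) (use fb in \<open>auto elim: eventually_mono\<close>)
  have "(\<lambda>i. LINT x|lborel. (s i x - f x)\<^sup>2) \<longlonglongrightarrow> (LINT x::'a|lborel. 0)"
  proof (rule integral_dominated_convergence)
    show "integrable lborel (\<lambda>x. 4 * (w x)\<^sup>2)" using w by (simp add: square_integrable_def)
    show "AE x in lborel. (\<lambda>i. (s i x - f x)\<^sup>2) \<longlonglongrightarrow> 0"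
      using lim
    proof eventually_elim
      case (elim x)
      have "(\<lambda>i. (s i x - f x)\<^sup>2) \<longlonglongrightarrow> (f x - f x)\<^sup>2" by (intro tendsto_intros elim)
      then show ?case by simp
    qed
    show "AE x in lborel. norm ((s i x - f x)\<^sup>2) \<le> 4 * (w x)\<^sup>2" for i
      using bnd[of i] fb
    proof eventually_elim
      case (elim x)
      then have "\<bar>s i x - f x\<bar> \<le> 2 * w x" by simp
      then have "\<bar>s i x - f x\<bar>\<^sup>2 \<le> (2 * w x)\<^sup>2" by (intro power_mono) auto
      then show ?case by (simp add: power_mult_distrib)
    qed
  qed (use s f in auto)
  then have "(\<lambda>i. (norm (abs_L2 (s i) - abs_L2 f))\<^sup>2) \<longlonglongrightarrow> 0"
    by (simp add: abs_L2_diff[OF si sf] norm_abs_L2[OF square_integrable_diff[OF si sf]])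
  from tendsto_real_sqrt[OF this]
  have "(\<lambda>i. norm (abs_L2 (s i) - abs_L2 f)) \<longlonglongrightarrow> 0" by simp
  then show "(\<lambda>i. abs_L2 (s i)) \<longlonglongrightarrow> abs_L2 f"
    using LIM_zero_iff tendsto_norm_zero_iff by blast
qed

instance L2 :: (euclidean_space) complete_space
proof
  fix X :: "nat \<Rightarrow> 'a L2" assume X: "Cauchy X"
  have "\<exists>N. \<forall>m\<ge>N. \<forall>n\<ge>N. dist (X m) (X n) < (1/2)^k" for k :: nat
    using X unfolding Cauchy_def by (meson half_gt_zero_iff zero_less_power zero_less_one)
  then obtain N where N: "\<And>k m n. m \<ge> N k \<Longrightarrow> n \<ge> N k \<Longrightarrow> dist (X m) (X n) < (1/2)^k"
    by metis
  define r where "r k = k + (\<Sum>j\<le>k. N j)" for k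
  have rs: "strict_mono r" unfolding strict_mono_Suc_iff r_def by auto
  have rN: "r k \<ge> N k" for k
    unfolding r_def by (simp add: member_le_sum trans_le_add2)
  have d: "norm (X (r (Suc k)) - X (r k)) < (1/2)^k" for k
  proof -
    have "r (Suc k) \<ge> N k" using rN[of k] strict_monoD[OF rs, of k "Suc k"] by auto
    then show ?thesis using N rN[of k] by (simp add: dist_norm)
  qed
  have "\<exists>f. \<forall>k. square_integrable (f k) \<and> X (r k) = abs_L2 (f k)"
    by (intro choice allI) (metis abs_L2_surj)
  then obtain f where f: "\<And>k. square_integrable (f k)" "\<And>k. X (r k) = abs_L2 (f k)" by blast
  note fm = f(1)[unfolded square_integrable_def, THEN conjunct1]
  define h where "h n x = \<bar>f 0 x\<bar> + (\<Sum>k<n. \<bar>f (Suc k) x - f k x\<bar>)" for n x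
  have h: "square_integrable (h n) \<and> norm (abs_L2 (h n)) \<le> norm (X (r 0)) + (\<Sum>k<n. (1/2)^k)" for n
  proof (induction n)
    case 0
    have "(norm (abs_L2 (h 0)))\<^sup>2 = (norm (X (r 0)))\<^sup>2"
      unfolding f(2) h_def using f(1)[of 0]
      by (simp add: norm_abs_L2 square_integrable_abs)
    then have "norm (abs_L2 (h 0)) = norm (X (r 0))" by simp
    moreover have "square_integrable (h 0)" using f(1)[of 0] by (simp add: h_def[abs_def] square_integrable_abs)
    ultimately show ?case by simp
  next
    case (Suc n)
    let ?g = "\<lambda>x. \<bar>f (Suc n) x - f n x\<bar>"
    have g: "square_integrable ?g" by (intro square_integrable_abs square_integrable_diff f)
    have hs: "h (Suc n) = (\<lambda>x. h n x + ?g x)" by (auto simp: h_def)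
    have "(norm (abs_L2 ?g))\<^sup>2 = (norm (X (r (Suc n)) - X (r n)))\<^sup>2"
      unfolding f(2) using f(1) g by (simp add: abs_L2_diff norm_abs_L2 square_integrable_diff)
    then have "norm (abs_L2 ?g) < (1/2)^n" using d[of n] by simp
    moreover have "abs_L2 (h (Suc n)) = abs_L2 (h n) + abs_L2 ?g"
      unfolding hs using Suc g by (simp add: plus_L2.abs_eq)
    ultimately have "norm (abs_L2 (h (Suc n))) \<le> norm (abs_L2 (h n)) + (1/2)^n"
      using norm_triangle_ineq[of "abs_L2 (h n)" "abs_L2 ?g"] by simp
    then show ?case using Suc g hs by (auto simp: square_integrable_add)
  qed
  define B where "B = norm (X (r 0)) + 2"
  have geo: "(\<Sum>k<n. (1/2)^k) \<le> (2::real)" for n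
    by (subst sum_gp_strict) (auto simp: field_simps)
  have hB: "(LINT x|lborel. (h n x)\<^sup>2) \<le> B\<^sup>2" for n
  proof -
    have "norm (abs_L2 (h n)) \<le> B" using h[of n] geo[of n] unfolding B_def by linarith
    then have "(norm (abs_L2 (h n)))\<^sup>2 \<le> B\<^sup>2" by (intro power_mono) auto
    then show ?thesis using norm_abs_L2 h by metis
  qed
  have hm: "h n \<in> borel_measurable lborel" for n using h unfolding square_integrable_def by blast
  have h0: "0 \<le> h n x" for n x unfolding h_def by (simp add: sum_nonneg)
  have hinc: "incseq (\<lambda>n. h n x)" for x unfolding h_def by (rule incseq_SucI) simp
  have nn: "(\<integral>\<^sup>+x. (SUP n. ennreal ((h n x)\<^sup>2)) \<partial>lborel) \<le> ennreal (B\<^sup>2)"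
  proof (subst nn_integral_monotone_convergence_SUP)
    show "incseq (\<lambda>n x. ennreal ((h n x)\<^sup>2))"
      using hinc h0 by (auto simp: incseq_def le_fun_def intro!: ennreal_leI power_mono)
    show "(SUP n. \<integral>\<^sup>+x. ennreal ((h n x)\<^sup>2) \<partial>lborel) \<le> ennreal (B\<^sup>2)"
    proof (rule SUP_least)
      fix n
      have "(\<integral>\<^sup>+x. ennreal ((h n x)\<^sup>2) \<partial>lborel) = ennreal (LINT x|lborel. (h n x)\<^sup>2)"
        using h[of n] by (intro nn_integral_eq_integral) (auto simp: square_integrable_def)
      then show "(\<integral>\<^sup>+x. ennreal ((h n x)\<^sup>2) \<partial>lborel) \<le> ennreal (B\<^sup>2)"
        using hB[of n] by (simp add: ennreal_leI)
    qed
  qed (use hm in auto)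
  have SUPm: "(\<lambda>x. SUP n. ennreal ((h n x)\<^sup>2)) \<in> borel_measurable lborel"
    using hm by (intro borel_measurable_SUP) auto
  have "(\<integral>\<^sup>+x. (SUP n. ennreal ((h n x)\<^sup>2)) \<partial>lborel) \<noteq> \<infinity>" using nn
    by (metis ennreal_less_top infinity_ennreal_def leD less_top)
  then have fin: "AE x in lborel. (SUP n. ennreal ((h n x)\<^sup>2)) \<noteq> \<infinity>"
    by (rule nn_integral_PInf_AE[OF SUPm])
  define H where "H x = (SUP n. h n x)" for x
  have bdd: "AE x in lborel. bdd_above (range (\<lambda>n. h n x))"
    using fin
  proof eventually_elim
    case (elim x)
    then obtain c where c: "(SUP n. ennreal ((h n x)\<^sup>2)) = ennreal c" "c \<ge> 0"
      by (metis ennreal_cases infinity_ennreal_def)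
    have "h n x \<le> sqrt c" for n
    proof -
      have "ennreal ((h n x)\<^sup>2) \<le> ennreal c" unfolding c(1)[symmetric] by (rule SUP_upper) simp
      then have "(h n x)\<^sup>2 \<le> c" using c(2) by simp
      then show ?thesis by (rule real_le_rsqrt)
    qed
    then show ?case by (auto simp: bdd_above_def)
  qed
  define w where "w x = lim (\<lambda>n. h n x)" for x
  have wm: "w \<in> borel_measurable lborel" unfolding w_def using hm by measurable
  have hw: "AE x in lborel. (\<lambda>n. h n x) \<longlonglongrightarrow> w x"
    using bdd
  proof eventually_elim
    case (elim x)
    then have "(\<lambda>n. h n x) \<longlonglongrightarrow> (SUP n. h n x)" using hinc by (intro LIMSEQ_incseq_SUP)
    then show ?case unfolding w_def by (simp add: limI)
  qed
  have hle: "AE x in lborel. \<forall>n. h n x \<le> w x" using hw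
    by eventually_elim (use hinc incseq_le in blast)
  have w: "square_integrable w"
    unfolding square_integrable_def
  proof (intro conjI wm integrableI_bounded)
    have "(\<integral>\<^sup>+x. ennreal (norm ((w x)\<^sup>2)) \<partial>lborel) \<le> (\<integral>\<^sup>+x. (SUP n. ennreal ((h n x)\<^sup>2)) \<partial>lborel)"
    proof (rule nn_integral_mono_AE)
      show "AE x in lborel. ennreal (norm ((w x)\<^sup>2)) \<le> (SUP n. ennreal ((h n x)\<^sup>2))"
        using hw
      proof eventually_elim
        case (elim x)
        have "(\<lambda>n. ennreal ((h n x)\<^sup>2)) \<longlonglongrightarrow> ennreal ((w x)\<^sup>2)"
          by (intro tendsto_intros tendsto_ennrealI elim)
        then have "ennreal ((w x)\<^sup>2) \<le> (SUP n. ennreal ((h n x)\<^sup>2))"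
          by (rule LIMSEQ_le_const2) (intro exI allI impI SUP_upper UNIV_I)
        then show ?case by simp
      qed
    qed
    also have "\<dots> \<le> ennreal (B\<^sup>2)" by (rule nn)
    also have "\<dots> < \<infinity>" by simp
    finally show "(\<integral>\<^sup>+x. ennreal (norm ((w x)\<^sup>2)) \<partial>lborel) < \<infinity>" .
  qed (use wm in auto)
  have fh: "\<bar>f n x\<bar> \<le> h n x" for n x
    by (induction n) (auto simp: h_def abs_if split: if_splits)
  define g where "g x = lim (\<lambda>n. f n x)" for x
  have gm: "g \<in> borel_measurable lborel" unfolding g_def using fm by measurable
  have fg: "AE x in lborel. (\<lambda>n. f n x) \<longlonglongrightarrow> g x"
    using bdd
  proof eventually_elim
    case (elim x)
    then obtain c where c: "\<And>n. h n x \<le> c" by (auto simp: bdd_above_def)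
    have "summable (\<lambda>k. \<bar>f (Suc k) x - f k x\<bar>)"
    proof (rule summableI_nonneg_bounded)
      show "(\<Sum>k<n. \<bar>f (Suc k) x - f k x\<bar>) \<le> c" for n
        using c[of n] unfolding h_def by (smt (verit) abs_ge_zero)
    qed auto
    then have "summable (\<lambda>k. f (Suc k) x - f k x)" by (rule summable_rabs_cancel)
    then have "(\<lambda>n. \<Sum>k<n. f (Suc k) x - f k x) \<longlonglongrightarrow> (\<Sum>k. f (Suc k) x - f k x)"
      by (rule summable_LIMSEQ)
    then have "(\<lambda>n. f n x - f 0 x) \<longlonglongrightarrow> (\<Sum>k. f (Suc k) x - f k x)"
      unfolding sum_lessThan_telescope[of "\<lambda>k. f k x"] .
    from tendsto_add[OF this tendsto_const[of "f 0 x"]]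
    have "convergent (\<lambda>n. f n x)" by (auto simp: convergent_def)
    then show ?case unfolding g_def by (simp add: convergent_LIMSEQ_iff)
  qed
  have "(\<lambda>k. abs_L2 (f k)) \<longlonglongrightarrow> abs_L2 g"
  proof (rule abs_L2_tendsto(3)[OF w fm gm fg])
    show "AE x in lborel. \<bar>f n x\<bar> \<le> w x" for n
      using hle by eventually_elim (use fh order_trans in blast)
  qed
  then have "(X \<circ> r) \<longlonglongrightarrow> abs_L2 g" using f(2) by (simp add: o_def)
  then show "convergent X"
    using X rs Cauchy_converges_subseq convergent_def by blast
qed


text \<open>Separability, so that the library's Bochner integral applies to functions with values in L2.\<close>

lemma separable_imp_second_countable:
  fixes Q :: "'b::metric_space set"
  assumes Q: "countable Q" "closure Q = UNIV"
  shows "\<exists>B::'b set set. countable B \<and> open = generate_topology B"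
proof -
  let ?B = "(\<lambda>(q, n::nat). ball q (1 / real (Suc n))) ` (Q \<times> UNIV)"
  have tb: "topological_basis ?B"
  proof (rule topological_basisI)
    show "open b" if "b \<in> ?B" for b using that by auto
    fix O' and x :: 'b assume O: "open O'" "x \<in> O'"
    then obtain e where e: "e > 0" "ball x e \<subseteq> O'" using open_contains_ball by blast
    obtain n where n: "1 / real (Suc n) < e / 2"
      using e(1) nat_approx_posE[of "e/2"] by auto
    have "x \<in> closure Q" using Q by simp
    then obtain q where q: "q \<in> Q" "dist q x < 1 / real (Suc n)"
      unfolding closure_approachable by (metis of_nat_0_less_iff zero_less_Suc zero_less_divide_1_iff)
    have "ball q (1 / real (Suc n)) \<subseteq> ball x e"
    proof
      fix y assume "y \<in> ball q (1 / real (Suc n))"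
      then have "dist x y < 1 / real (Suc n) + 1 / real (Suc n)"
        using q(2) dist_triangle[of x y q] by (simp add: dist_commute)
      then show "y \<in> ball x e" using n by simp
    qed
    then show "\<exists>B'\<in>?B. x \<in> B' \<and> B' \<subseteq> O'" using q e by (intro bexI[of _ "ball q (1 / real (Suc n))"]) auto
  qed
  have "countable ?B" using Q(1) by (intro countable_image countable_SIGMA) auto
  moreover have "open = generate_topology ?B"
    using topological_basis_imp_subbasis[OF tb] by (simp add: fun_eq_iff)
  ultimately show ?thesis by blast
qed

lemma countable_generator_separable:
  fixes S :: "'b::real_normed_vector set"
  assumes S: "countable S"
    and C: "\<And>C. closed C \<Longrightarrow> subspace C \<Longrightarrow> S \<subseteq> C \<Longrightarrow> C = UNIV"
  shows "\<exists>B::'b set set. countable B \<and> open = generate_topology B"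
proof -
  define Q where "Q = (\<lambda>xs. sum_list (map (\<lambda>(q, s). real_of_rat q *\<^sub>R s) xs)) ` lists (UNIV \<times> S)"
  have Qc: "countable Q" unfolding Q_def using S by (intro countable_image countable_lists) auto
  have Q0: "0 \<in> Q" unfolding Q_def by (rule image_eqI[of _ _ "[]"]) auto
  have QS: "S \<subseteq> Q"
  proof
    fix s assume "s \<in> S"
    then show "s \<in> Q" unfolding Q_def by (intro image_eqI[of _ _ "[(1, s)]"]) auto
  qed
  have Qadd: "x + y \<in> Q" if xy: "x \<in> Q" "y \<in> Q" for x y
  proof -
    from xy obtain xs ys where "xs \<in> lists (UNIV \<times> S)" "ys \<in> lists (UNIV \<times> S)"
      "x = sum_list (map (\<lambda>(q, s). real_of_rat q *\<^sub>R s) xs)"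
      "y = sum_list (map (\<lambda>(q, s). real_of_rat q *\<^sub>R s) ys)" unfolding Q_def by blast
    then show ?thesis unfolding Q_def by (intro image_eqI[of _ _ "xs @ ys"]) auto
  qed
  have Qscale: "real_of_rat q *\<^sub>R x \<in> Q" if x: "x \<in> Q" for x q
  proof -
    from x obtain xs where xs: "xs \<in> lists (UNIV \<times> S)"
      "x = sum_list (map (\<lambda>(q, s). real_of_rat q *\<^sub>R s) xs)" unfolding Q_def by blast
    have "real_of_rat q *\<^sub>R sum_list (map (\<lambda>(q, s). real_of_rat q *\<^sub>R s) xs) =
        sum_list (map (\<lambda>(q, s). real_of_rat q *\<^sub>R s) (map (\<lambda>(p, s). (q * p, s)) xs))"
      by (induction xs) (auto simp: scaleR_right_distrib of_rat_mult)
    then show ?thesis unfolding Q_def xs(2) using xs(1)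
      by (intro image_eqI[of _ _ "map (\<lambda>(p, s). (q * p, s)) xs"]) auto
  qed
  have "subspace (closure Q)"
  proof (rule subspaceI)
    show "0 \<in> closure Q" using Q0 closure_subset by blast
    fix x y assume "x \<in> closure Q" "y \<in> closure Q"
    then obtain X Y where "\<forall>n. X n \<in> Q" "X \<longlonglongrightarrow> x" "\<forall>n. Y n \<in> Q" "Y \<longlonglongrightarrow> y"
      unfolding closure_sequential by blast
    then show "x + y \<in> closure Q" unfolding closure_sequential
      by (intro exI[of _ "\<lambda>n. X n + Y n"]) (auto intro: Qadd tendsto_add)
  next
    fix x and c :: real assume "x \<in> closure Q"
    then obtain X where X: "\<forall>n. X n \<in> Q" "X \<longlonglongrightarrow> x" unfolding closure_sequential by blast
    have "\<exists>q. c < real_of_rat q \<and> real_of_rat q < c + 1 / real (Suc n)" for n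
      using of_rat_dense[of c "c + 1 / real (Suc n)"] by auto
    then obtain q where q: "\<And>n. c < real_of_rat (q n)" "\<And>n. real_of_rat (q n) < c + 1 / real (Suc n)"
      by metis
    have "(\<lambda>n. real_of_rat (q n)) \<longlonglongrightarrow> c"
    proof (rule tendsto_sandwich[OF _ _ tendsto_const])
      show "(\<lambda>n. c + 1 / real (Suc n)) \<longlonglongrightarrow> c"
        using tendsto_add[OF tendsto_const[of c] LIMSEQ_Suc[OF lim_1_over_n]] by simp
    qed (use q in \<open>auto intro!: always_eventually less_imp_le\<close>)
    then show "c *\<^sub>R x \<in> closure Q" unfolding closure_sequential
      by (intro exI[of _ "\<lambda>n. real_of_rat (q n) *\<^sub>R X n"]) (use X Qscale in \<open>auto intro: tendsto_scaleR\<close>)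
  qed
  then have "closure Q = UNIV" using C[of "closure Q"] QS closure_subset by blast
  then show ?thesis using Qc by (intro separable_imp_second_countable)
qed

lemma square_integrable_indicator:
  assumes "A \<in> sets borel" "emeasure lborel A < \<infinity>"
  shows "square_integrable (indicator A :: 'a::euclidean_space \<Rightarrow> real)"
proof -
  have "(\<lambda>x. (indicator A x :: real)\<^sup>2) = indicator A"
    by (auto simp: fun_eq_iff indicator_def)
  then show ?thesis using assms unfolding square_integrable_def by simp
qed

lemma L2_countable_generator:
  "\<exists>S :: 'a::euclidean_space L2 set. countable S \<and>
     (\<forall>C. closed C \<longrightarrow> subspace C \<longrightarrow> S \<subseteq> C \<longrightarrow> C = UNIV)"
proof -
  obtain B :: "'a set set" where B: "countable B" "topological_basis B"
    using ex_countable_basis by blast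
  define G where "G = Inter ` {F. finite F \<and> F \<subseteq> B}"
  have Gc: "countable G" unfolding G_def
    by (intro countable_image countable_Collect_finite_subset B)
  have BG: "B \<subseteq> G" unfolding G_def by (auto intro!: image_eqI[of _ _ "{_}"])
  have Go: "open A" if "A \<in> G" for A
    using that topological_basis_open[OF B(2)] unfolding G_def by (auto intro!: open_Inter)
  have Gi: "Int_stable G" unfolding Int_stable_def
  proof (intro ballI)
    fix A A' assume "A \<in> G" "A' \<in> G"
    then obtain F F' where "finite F" "F \<subseteq> B" "A = \<Inter>F" "finite F'" "F' \<subseteq> B" "A' = \<Inter>F'"
      unfolding G_def by blast
    then show "A \<inter> A' \<in> G" unfolding G_def by (intro image_eqI[of _ _ "F \<union> F'"]) auto
  qed
  have UG: "UNIV \<in> G" unfolding G_def by (rule image_eqI[of _ _ "{}"]) auto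
  have sG: "sets borel = sigma_sets UNIV G"
  proof
    have "sets borel = sigma_sets UNIV B" unfolding borel_eq_countable_basis[OF B] by (rule sets_measure_of) simp
    then show "sets borel \<subseteq> sigma_sets UNIV G" using BG sigma_sets_mono' by metis
    show "sigma_sets UNIV G \<subseteq> sets borel"
    proof -
      have "G \<subseteq> sets borel" using Go by auto
      from sets.sigma_sets_subset[OF this] show ?thesis by simp
    qed
  qed
  define ib where "ib A n = abs_L2 (indicator (A \<inter> ball 0 (real n)) :: 'a \<Rightarrow> real)" for A n
  define S where "S = (\<lambda>(A, n). ib A n) ` (G \<times> UNIV)"
  have "countable S" unfolding S_def using Gc by (intro countable_image countable_SIGMA) auto
  moreover have "C = UNIV" if C: "closed C" "subspace C" "S \<subseteq> C" for C
  proof -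
    have bf: "emeasure lborel (A \<inter> ball (0::'a) (real n)) < \<infinity>" for A n
      using emeasure_bounded_finite[of "A \<inter> ball 0 (real n)"] by (simp add: bounded_Int)
    have sib: "square_integrable (indicator (A \<inter> ball 0 (real n)) :: 'a \<Rightarrow> real)"
      if "A \<in> sets borel" for A n
      by (rule square_integrable_indicator) (use that bf in auto)
    have 1: "ib A n \<in> C" if "A \<in> sets borel" for A n
    proof -
      have "G \<subseteq> Pow UNIV" "A \<in> sigma_sets UNIV G" using that sG by auto
      from Gi this show ?thesis
      proof (induction rule: sigma_sets_induct_disjoint)
        case (basic A)
        then show ?case using C(3) unfolding S_def by blast
      next
        case empty
        have "ib {} n = 0" unfolding ib_def zero_L2_def by (simp add: indicator_def[abs_def])
        then show ?case using C(2) by (simp add: subspace_0)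
      next
        case (compl A)
        then have m: "A \<in> sets borel" using sG by simp
        have "ib (UNIV - A) n = ib UNIV n - ib A n"
        proof -
          have "(indicator ((UNIV - A) \<inter> ball 0 (real n)) :: 'a \<Rightarrow> real) =
             (\<lambda>x. indicator (UNIV \<inter> ball 0 (real n)) x - indicator (A \<inter> ball 0 (real n)) x)"
            by (auto simp: fun_eq_iff indicator_def)
          then show ?thesis unfolding ib_def using abs_L2_diff[OF sib[of UNIV n] sib[OF m]] by simp
        qed
        moreover have "ib UNIV n \<in> C" using C(3) UG unfolding S_def by blast
        ultimately show ?case using compl C(2) by (simp add: subspace_diff)
      next
        case (union A)
        have m: "A i \<in> sets borel" for i using union(2) sG by auto
        have fin: "ib (\<Union>i<k. A i) n \<in> C" for k
        proof (induction k)
          case 0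
          have "ib {} n = 0" unfolding ib_def zero_L2_def by (simp add: indicator_def[abs_def])
          then show ?case using C(2) by (simp add: subspace_0)
        next
          case (Suc k)
          have mk: "(\<Union>i<k. A i) \<in> sets borel" using m by auto
          define U where "U = (\<Union>i<k. A i)"
          have "A i \<inter> A k = {}" if "i < k" for i
            using union(1) that unfolding disjoint_family_on_def by simp
          then have dis: "U \<inter> A k = {}" unfolding U_def by blast
          have "(\<Union>i<Suc k. A i) = U \<union> A k" unfolding U_def lessThan_Suc by blast
          moreover have "(indicator ((U \<union> A k) \<inter> ball 0 (real n)) :: 'a \<Rightarrow> real) =
             (\<lambda>x. indicator (U \<inter> ball 0 (real n)) x + indicator (A k \<inter> ball 0 (real n)) x)"
            using dis by (auto simp: fun_eq_iff indicator_def)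
          ultimately have "(indicator ((\<Union>i<Suc k. A i) \<inter> ball 0 (real n)) :: 'a \<Rightarrow> real) =
             (\<lambda>x. indicator ((\<Union>i<k. A i) \<inter> ball 0 (real n)) x + indicator (A k \<inter> ball 0 (real n)) x)"
            unfolding U_def by simp
          then have "ib (\<Union>i<Suc k. A i) n = ib (\<Union>i<k. A i) n + ib (A k) n"
            unfolding ib_def using sib[OF mk, of n] sib[OF m, of k n] by (simp add: plus_L2.abs_eq)
          then show ?case using Suc union(3) C(2) by (simp add: subspace_add)
        qed
        have "(\<lambda>k. ib (\<Union>i<k. A i) n) \<longlonglongrightarrow> ib (\<Union>i. A i) n"
          unfolding ib_def
        proof (rule abs_L2_tendsto(3)[OF sib[of UNIV n]])
          show "AE x in lborel. (\<lambda>k. indicator ((\<Union>i<k. A i) \<inter> ball 0 (real n)) x :: real)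
              \<longlonglongrightarrow> indicator ((\<Union>i. A i) \<inter> ball 0 (real n)) x"
          proof (rule AE_I2)
            fix x :: 'a
            have "(\<lambda>k. indicator (\<Union>i<k. A i) x :: real) \<longlonglongrightarrow> indicator (\<Union>i. A i) x"
              by (rule LIMSEQ_indicator_UN)
            then show "(\<lambda>k. indicator ((\<Union>i<k. A i) \<inter> ball 0 (real n)) x :: real)
              \<longlonglongrightarrow> indicator ((\<Union>i. A i) \<inter> ball 0 (real n)) x"
              unfolding indicator_inter_arith by (intro tendsto_mult tendsto_const)
          qed
          have "(\<Union>i<k. A i) \<inter> ball 0 (real n) \<in> sets borel" for k using m by auto
          then show "(indicator ((\<Union>i<k. A i) \<inter> ball 0 (real n)) :: 'a \<Rightarrow> real) \<in> borel_measurable lborel" for k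
            by (simp add: borel_measurable_indicator)
          have "(\<Union>i. A i) \<inter> ball 0 (real n) \<in> sets borel" using m by auto
          then show "(indicator ((\<Union>i. A i) \<inter> ball 0 (real n)) :: 'a \<Rightarrow> real) \<in> borel_measurable lborel"
            by (simp add: borel_measurable_indicator)
          show "AE x in lborel. \<bar>indicator ((\<Union>i<k. A i) \<inter> ball 0 (real n)) x :: real\<bar>
              \<le> indicator (UNIV \<inter> ball 0 (real n)) x" for k
            by (rule AE_I2) (simp add: indicator_inter_arith mult_left_le_one_le)
        qed simp
        then show ?case by (rule closed_sequentially[OF C(1) fin])
      qed
    qed
    have 2: "abs_L2 (indicator A) \<in> C" if A: "A \<in> sets borel" "emeasure lborel A < \<infinity>" for A
    proof -
      have "(\<lambda>n. ib A n) \<longlonglongrightarrow> abs_L2 (indicator A)"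
        unfolding ib_def
      proof (rule abs_L2_tendsto(3)[OF square_integrable_indicator[OF A]])
        show "AE x in lborel. (\<lambda>n. indicator (A \<inter> ball 0 (real n)) x :: real) \<longlonglongrightarrow> indicator A x"
        proof (rule AE_I2)
          fix x :: 'a
          obtain n0 where n0: "norm x < real n0" using reals_Archimedean2 by blast
          show "(\<lambda>n. indicator (A \<inter> ball 0 (real n)) x :: real) \<longlonglongrightarrow> indicator A x"
          proof (rule tendsto_eventually, rule eventually_sequentiallyI[of n0])
            fix n assume "n0 \<le> n"
            then show "(indicator (A \<inter> ball 0 (real n)) x :: real) = indicator A x"
              using n0 by (auto simp: indicator_def)
          qed
        qed
        have "A \<inter> ball 0 (real n) \<in> sets borel" for n using A by auto
        then show "(indicator (A \<inter> ball 0 (real n)) :: 'a \<Rightarrow> real) \<in> borel_measurable lborel" for n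
          by (simp add: borel_measurable_indicator)
        show "(indicator A :: 'a \<Rightarrow> real) \<in> borel_measurable lborel"
          using A by (simp add: borel_measurable_indicator)
        show "AE x in lborel. \<bar>indicator (A \<inter> ball 0 (real n)) x :: real\<bar> \<le> indicator A x" for n
          by (rule AE_I2) (simp add: indicator_def)
      qed
      then show ?thesis by (rule closed_sequentially[OF C(1) 1[OF A(1)]])
    qed
    have 3: "abs_L2 s \<in> C" if s: "simple_function lborel s" "square_integrable s" for s :: "'a \<Rightarrow> real"
    proof -
      define Y where "Y = s ` UNIV - {0}"
      have Yf: "finite Y" using s(1) by (simp add: Y_def simple_function_def)
      have ms: "s -` {y} \<in> sets borel" for y
        using s(2) measurable_sets[of s lborel borel "{y}"] by (auto simp: square_integrable_def)
      have fs: "emeasure lborel (s -` {y}) < \<infinity>" if "y \<noteq> 0" for y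
      proof -
        have "integrable lborel (\<lambda>x. (1 / y\<^sup>2) * (s x)\<^sup>2)"
          using s(2) by (simp add: square_integrable_def)
        then have "integrable lborel (indicator (s -` {y}) :: 'a \<Rightarrow> real)"
          by (rule Bochner_Integration.integrable_bound)
             (use ms that in \<open>auto simp: indicator_def\<close>)
        then show ?thesis using ms by (simp add: integrable_indicator_iff)
      qed
      define e where "e y x = y * indicator (s -` {y}) x" for y x
      have e: "square_integrable (e y)" "abs_L2 (e y) \<in> C" if "y \<in> Y" for y
      proof -
        have "y \<noteq> 0" using that Y_def by auto
        then have i: "square_integrable (indicator (s -` {y}) :: 'a \<Rightarrow> real)"
          by (intro square_integrable_indicator ms fs)
        then show "square_integrable (e y)"
          unfolding e_def[abs_def] by (rule square_integrable_scale)
        have "y *\<^sub>R abs_L2 (indicator (s -` {y})) \<in> C"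
          using \<open>y \<noteq> 0\<close> by (intro subspace_scale[OF C(2)] 2 ms fs)
        then show "abs_L2 (e y) \<in> C"
          unfolding e_def[abs_def] using i by (simp add: scaleR_L2.abs_eq)
      qed
      have "square_integrable (\<lambda>x. \<Sum>y\<in>F. e y x) \<and> abs_L2 (\<lambda>x. \<Sum>y\<in>F. e y x) \<in> C"
        if "finite F" "F \<subseteq> Y" for F
        using that
      proof (induction F rule: finite_induct)
        case empty
        then show ?case
          using subspace_0[OF C(2)] by (simp add: zero_L2_def[symmetric] square_integrable_zero)
      next
        case (insert y F)
        then have F: "square_integrable (\<lambda>x. \<Sum>y\<in>F. e y x)" "abs_L2 (\<lambda>x. \<Sum>y\<in>F. e y x) \<in> C"
          and y: "y \<in> Y" by auto
        have "abs_L2 (e y) + abs_L2 (\<lambda>x. \<Sum>y\<in>F. e y x) \<in> C"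
          by (intro subspace_add[OF C(2)] e y F)
        moreover have "abs_L2 (e y) + abs_L2 (\<lambda>x. \<Sum>y\<in>F. e y x) = abs_L2 (\<lambda>x. \<Sum>y\<in>insert y F. e y x)"
          using e(1)[OF y] F(1) insert(1,2) by (simp add: plus_L2.abs_eq)
        moreover have "square_integrable (\<lambda>x. \<Sum>y\<in>insert y F. e y x)"
          using square_integrable_add[OF e(1)[OF y] F(1)] insert(1,2) by simp
        ultimately show ?case by simp
      qed
      from this[OF Yf order.refl] have "abs_L2 (\<lambda>x. \<Sum>y\<in>Y. e y x) \<in> C" ..
      moreover have "(\<Sum>y\<in>Y. e y x) = s x" for x
      proof -
        have "(\<Sum>y\<in>Y. e y x) = (\<Sum>y\<in>Y. if y = s x then y else 0)"
          by (intro sum.cong) (auto simp: e_def indicator_def)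
        also have "\<dots> = s x" using Yf by (auto simp: sum.delta Y_def)
        finally show ?thesis .
      qed
      ultimately show ?thesis by simp
    qed
    show "C = UNIV"
    proof (intro equalityI subset_UNIV subsetI)
      fix u :: "'a L2"
      obtain f where f: "square_integrable f" "u = abs_L2 f" by (rule abs_L2_surj)
      then have fm: "f \<in> borel_measurable lborel" by (simp add: square_integrable_def)
      obtain s where s: "\<And>i. simple_function lborel (s i)"
        "\<And>x. x \<in> space lborel \<Longrightarrow> (\<lambda>i. s i x) \<longlonglongrightarrow> f x"
        "\<And>i x. x \<in> space lborel \<Longrightarrow> dist (s i x) 0 \<le> 2 * dist (f x) 0"
        using borel_measurable_implies_sequence_metric[OF fm, of 0] by metis
      have w: "square_integrable (\<lambda>x. 2 * \<bar>f x\<bar>)" by (intro square_integrable_scale square_integrable_abs f)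
      have sm: "s i \<in> borel_measurable lborel" for i using s(1) by (rule borel_measurable_simple_function)
      have bd: "AE x in lborel. \<bar>s i x\<bar> \<le> 2 * \<bar>f x\<bar>" for i using s(3)[of _ i] by simp
      have lm: "AE x in lborel. (\<lambda>i. s i x) \<longlonglongrightarrow> f x" using s(2) by simp
      note * = abs_L2_tendsto[OF w sm fm lm bd]
      show "u \<in> C" unfolding f(2) by (rule closed_sequentially[OF C(1) 3[OF s(1) *(2)] *(3)])
    qed
  qed
  ultimately show ?thesis by blast
qed

instance L2 :: (euclidean_space) second_countable_topology
proof
  obtain S :: "'a L2 set" where S: "countable S"
    "\<And>C. closed C \<Longrightarrow> subspace C \<Longrightarrow> S \<subseteq> C \<Longrightarrow> C = UNIV"
    using L2_countable_generator by blast
  then show "\<exists>B::'a L2 set set. countable B \<and> open = generate_topology B"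
    by (rule countable_generator_separable)
qed

instance L2 :: (euclidean_space) banach ..


text \<open>For a set S the space L2(S) is identified, through extension by zero, with a closed subspace of L2.
  In particular an element of L2(\<omega>) extended by zero to a larger set is the same element of the type.\<close>

definition L2_on :: "'a::euclidean_space set \<Rightarrow> 'a L2 set" where
  "L2_on S = {u. AE x in lborel. x \<notin> S \<longrightarrow> rep_L2 u x = 0}"


section \<open>Forms and operators with a domain\<close>

text \<open>Forms and operators are total functions of which only the values on the given domain are used;
  H is the ambient closed subspace, here L2 of the bounded open set.\<close>

definition symmetric_form :: "'h::real_inner set \<Rightarrow> ('h \<Rightarrow> 'h \<Rightarrow> real) \<Rightarrow> bool" where
  "symmetric_form V E \<longleftrightarrow>
     (\<forall>u\<in>V. \<forall>v\<in>V. \<forall>w\<in>V. E (u + v) w = E u w + E v w) \<and>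
     (\<forall>c. \<forall>u\<in>V. \<forall>v\<in>V. E (c *\<^sub>R u) v = c * E u v) \<and>
     (\<forall>u\<in>V. \<forall>v\<in>V. E u v = E v u)"

definition form_norm :: "('h::real_inner \<Rightarrow> 'h \<Rightarrow> real) \<Rightarrow> 'h \<Rightarrow> real" where
  "form_norm E u = sqrt ((norm u)\<^sup>2 + E u u)"

definition closed_nonneg_form :: "'h::real_inner set \<Rightarrow> 'h set \<Rightarrow> ('h \<Rightarrow> 'h \<Rightarrow> real) \<Rightarrow> bool" where
  "closed_nonneg_form H V E \<longleftrightarrow>
     subspace V \<and> V \<subseteq> H \<and> H \<subseteq> closure V \<and> symmetric_form V E \<and> (\<forall>u\<in>V. 0 \<le> E u u) \<and>
     (\<forall>X. (\<forall>n. X n \<in> V) \<and> (\<forall>e>0. \<exists>M. \<forall>m\<ge>M. \<forall>n\<ge>M. form_norm E (X m - X n) < e)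
        \<longrightarrow> (\<exists>u\<in>V. (\<lambda>n. form_norm E (X n - u)) \<longlonglongrightarrow> 0))"

definition selfadjoint_operator :: "'h::real_inner set \<Rightarrow> 'h set \<Rightarrow> ('h \<Rightarrow> 'h) \<Rightarrow> bool" where
  "selfadjoint_operator H D A \<longleftrightarrow>
     subspace D \<and> D \<subseteq> H \<and> H \<subseteq> closure D \<and> A ` D \<subseteq> H \<and>
     (\<forall>u\<in>D. \<forall>v\<in>D. A (u + v) = A u + A v) \<and> (\<forall>c. \<forall>u\<in>D. A (c *\<^sub>R u) = c *\<^sub>R A u) \<and>
     (\<forall>v\<in>H. \<forall>w\<in>H. (\<forall>u\<in>D. inner (A u) v = inner u w) \<longleftrightarrow> v \<in> D \<and> A v = w)"

definition nonneg_operator :: "'h::real_inner set \<Rightarrow> ('h \<Rightarrow> 'h) \<Rightarrow> bool" where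
  "nonneg_operator D A \<longleftrightarrow> (\<forall>u\<in>D. 0 \<le> inner (A u) u)"

definition associated_operator ::
  "'h::real_inner set \<Rightarrow> 'h set \<Rightarrow> ('h \<Rightarrow> 'h \<Rightarrow> real) \<Rightarrow> 'h set \<Rightarrow> ('h \<Rightarrow> 'h) \<Rightarrow> bool" where
  "associated_operator H V E D A \<longleftrightarrow>
     (\<forall>u\<in>H. \<forall>w\<in>H. u \<in> D \<and> A u = w \<longleftrightarrow> u \<in> V \<and> (\<forall>v\<in>V. E u v = inner w v))"

definition graph_norm :: "('h::real_inner \<Rightarrow> 'h) \<Rightarrow> 'h \<Rightarrow> real" where
  "graph_norm A u = sqrt ((norm u)\<^sup>2 + (norm (A u))\<^sup>2)"

definition compactly_embedded_domain :: "'h::real_inner set \<Rightarrow> ('h \<Rightarrow> 'h) \<Rightarrow> bool" where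
  "compactly_embedded_domain D A \<longleftrightarrow> compact (closure {u \<in> D. graph_norm A u \<le> 1})"

definition eigenvalue :: "'h::real_vector set \<Rightarrow> ('h \<Rightarrow> 'h) \<Rightarrow> real \<Rightarrow> bool" where
  "eigenvalue D A l \<longleftrightarrow> (\<exists>u\<in>D. u \<noteq> 0 \<and> A u = l *\<^sub>R u)"

text \<open>Unique continuation from \<open>\<omega>\<close>: an eigenfunction vanishing almost everywhere on \<open>\<omega>\<close> is zero.
  The component of a solution along a nonzero eigenfunction vanishing on \<open>\<omega>\<close> is independent of the control,
  so approximate controllability from \<open>\<omega>\<close> requires this property.\<close>

definition unique_continuation ::
  "'a::euclidean_space set \<Rightarrow> 'a L2 set \<Rightarrow> ('a L2 \<Rightarrow> 'a L2) \<Rightarrow> bool" where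
  "unique_continuation \<omega> D A \<longleftrightarrow>
     (\<forall>l. \<forall>u\<in>D. A u = l *\<^sub>R u \<and> u \<in> L2_on (- \<omega>) \<longrightarrow> u = 0)"


section \<open>The dual of the form domain\<close>

text \<open>An element of the dual of V (with the form norm) is a functional of which only the values on V matter.
  The pivot space is embedded by sending h to \<open>inner h\<close>.\<close>

definition form_dual :: "'h::real_inner set \<Rightarrow> ('h \<Rightarrow> 'h \<Rightarrow> real) \<Rightarrow> ('h \<Rightarrow> real) set" where
  "form_dual V E = {F. (\<forall>u\<in>V. \<forall>v\<in>V. F (u + v) = F u + F v) \<and> (\<forall>c. \<forall>u\<in>V. F (c *\<^sub>R u) = c * F u) \<and>
     (\<exists>C. \<forall>u\<in>V. \<bar>F u\<bar> \<le> C * form_norm E u)}"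

definition dual_norm :: "'h::real_inner set \<Rightarrow> ('h \<Rightarrow> 'h \<Rightarrow> real) \<Rightarrow> ('h \<Rightarrow> real) \<Rightarrow> real" where
  "dual_norm V E F = (SUP u\<in>{u \<in> V. form_norm E u \<le> 1}. \<bar>F u\<bar>)"


section \<open>Fractional calculus\<close>

definition frac_integrable ::
  "real \<Rightarrow> (real \<Rightarrow> 'b::{banach, second_countable_topology}) \<Rightarrow> real \<Rightarrow> bool" where
  "frac_integrable \<alpha> g t \<longleftrightarrow>
     \<alpha> = 0 \<or> set_integrable lborel {0<..<t} (\<lambda>\<tau>. ((t - \<tau>) powr (\<alpha> - 1)) *\<^sub>R g \<tau>)"

definition frac_integral ::
  "real \<Rightarrow> (real \<Rightarrow> 'b::{banach, second_countable_topology}) \<Rightarrow> real \<Rightarrow> 'b" where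
  "frac_integral \<alpha> g t =
     (if \<alpha> = 0 then g t
      else (1 / Gamma \<alpha>) *\<^sub>R (LINT \<tau>:{0<..<t}|lborel. ((t - \<tau>) powr (\<alpha> - 1)) *\<^sub>R g \<tau>))"

text \<open>Derivative, in the norm of the dual, of a function with values in the pivot space.\<close>

definition has_dual_derivative ::
  "'h::real_inner set \<Rightarrow> ('h \<Rightarrow> 'h \<Rightarrow> real) \<Rightarrow> (real \<Rightarrow> 'h) \<Rightarrow> ('h \<Rightarrow> real) \<Rightarrow> real \<Rightarrow> real set \<Rightarrow> bool" where
  "has_dual_derivative V E g F t I \<longleftrightarrow> F \<in> form_dual V E \<and>
     ((\<lambda>s. dual_norm V E (\<lambda>v. inner ((g s - g t) /\<^sub>R (s - t)) v - F v)) \<longlongrightarrow> 0) (at t within I)"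

text \<open>Fractional integral of a function with values in the dual, as a Bochner integral: V is separable, so weak
  measurability is strong measurability, and the value is determined by duality with V.\<close>

definition dual_frac_integral ::
  "'h::real_inner set \<Rightarrow> ('h \<Rightarrow> 'h \<Rightarrow> real) \<Rightarrow> real \<Rightarrow> (real \<Rightarrow> 'h \<Rightarrow> real) \<Rightarrow> real \<Rightarrow> ('h \<Rightarrow> real) \<Rightarrow> bool" where
  "dual_frac_integral V E \<beta> F t G \<longleftrightarrow>
     (\<beta> = 0 \<or> (\<forall>v\<in>V. set_borel_measurable lborel {0<..<t} (\<lambda>\<tau>. F \<tau> v))) \<and>
     frac_integrable \<beta> (\<lambda>\<tau>. dual_norm V E (F \<tau>)) t \<and>
     (\<forall>v\<in>V. G v = frac_integral \<beta> (\<lambda>\<tau>. F \<tau> v) t)"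

text \<open>G is the Hilfer derivative of u, with values in the dual, on the interval from 0 (excluded) to T (included).\<close>

definition hilfer_derivative ::
  "'a::euclidean_space L2 set \<Rightarrow> ('a L2 \<Rightarrow> 'a L2 \<Rightarrow> real) \<Rightarrow> real \<Rightarrow> real \<Rightarrow> real \<Rightarrow>
   (real \<Rightarrow> 'a L2) \<Rightarrow> (real \<Rightarrow> 'a L2 \<Rightarrow> real) \<Rightarrow> bool" where
  "hilfer_derivative V E \<mu> \<nu> T u G \<longleftrightarrow>
     (\<forall>t\<in>{0<..T}. frac_integrable ((1 - \<nu>) * (1 - \<mu>)) u t) \<and>
     (\<exists>F. \<forall>t\<in>{0<..T}.
        has_dual_derivative V E (frac_integral ((1 - \<nu>) * (1 - \<mu>)) u) (F t) t {0<..T} \<and>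
        dual_frac_integral V E (\<nu> * (1 - \<mu>)) F t (G t))"


section \<open>Controls and weak solutions\<close>

definition control_space :: "real \<Rightarrow> 'a::euclidean_space set \<Rightarrow> (real \<Rightarrow> 'a L2) set" where
  "control_space T \<omega> = {f. set_borel_measurable lborel {0<..<T} f \<and>
     (AE t in lborel. t \<in> {0<..<T} \<longrightarrow> f t \<in> L2_on \<omega>) \<and>
     set_integrable lborel {0<..<T} (\<lambda>t. (norm (f t))\<^sup>2)}"

text \<open>The fractional integral of u is an integral over the empty set at time 0, so its value there (and the
  initial condition) is the one of its continuous extension g.\<close>

definition weak_solution ::
  "'a::euclidean_space L2 set \<Rightarrow> ('a L2 \<Rightarrow> 'a L2 \<Rightarrow> real) \<Rightarrow> real \<Rightarrow> real \<Rightarrow> real \<Rightarrow>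
   'a L2 \<Rightarrow> (real \<Rightarrow> 'a L2) \<Rightarrow> (real \<Rightarrow> 'a L2) \<Rightarrow> bool" where
  "weak_solution V E \<mu> \<nu> T u0 f u \<longleftrightarrow>
     (\<forall>t\<in>{0<..T}. u t \<in> V \<and> ((\<lambda>s. form_norm E (u s - u t)) \<longlongrightarrow> 0) (at t within {0<..T})) \<and>
     (\<exists>g. continuous_on {0..T} g \<and>
        (\<forall>t\<in>{0<..T}. frac_integrable ((1 - \<nu>) * (1 - \<mu>)) u t \<and>
           g t = frac_integral ((1 - \<nu>) * (1 - \<mu>)) u t) \<and>
        g 0 = u0) \<and>
     (\<exists>G. hilfer_derivative V E \<mu> \<nu> T u G \<and>
        (\<forall>t\<in>{0<..T}. G t \<in> form_dual V E \<and>
           ((\<lambda>s. dual_norm V E (\<lambda>v. G s v - G t v)) \<longlongrightarrow> 0) (at t within {0<..T})) \<and>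
        (\<forall>\<phi>\<in>V. AE t in lborel. t \<in> {0<..<T} \<longrightarrow> G t \<phi> + E (u t) \<phi> - inner (f t) \<phi> = 0))"

end

theory Submission
  imports Defs "HOL-Complex_Analysis.Complex_Analysis" "HOL-Real_Asymp.Real_Asymp"
begin

text \<open>Expanding in an orthonormal basis \<open>\<phi> n\<close> of eigenvectors of \<open>A\<close>, with
  eigenvalues \<open>lam n\<close> (\<open>eigenbasis_exists\<close>), turns the system into scalar
  fractional equations. Their solutions are built from the kernels \<open>e\<^sub>a(\<kappa>, t) = t^(a-1)
  E\<^sub>\<mu>\<^sub>,\<^sub>a(- \<kappa> t^\<mu>)\<close>, where
  \<open>E\<^sub>\<mu>\<^sub>,\<^sub>a\<close> is the Mittag-Leffler function: a fractional integral of
  order \<open>b\<close> sends \<open>e\<^sub>a\<close> to \<open>e\<close> with index \<open>a +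
  b\<close>, and \<open>e\<^sub>a\<close> equals \<open>t^(a-1) / \<Gamma>(a)\<close> minus
  \<open>\<kappa>\<close> times the kernel of index \<open>a + \<mu>\<close>. With \<open>\<beta> =
  \<nu>(1-\<mu>)\<close> the initial value \<open>u0\<close> evolves by the kernel of index \<open>\<mu> +
  \<beta>\<close>, and a control that is a power of \<open>t\<close> times a fixed element of \<open>L2_on
  \<omega>\<close> again produces a single kernel in each mode.

  All estimates come from the positivity of the kernel of index \<open>\<mu>\<close>
  (\<open>ml_kern_pos\<close>), which is proved directly from its Volterra equation. Positivity and the
  resolvent identity \<open>ml_kern_resolvent\<close> give the bound \<open>sqrt_ml_kern_le\<close>, whose
  factor \<open>sqrt \<kappa>\<close> is exactly what makes the expansion of the solution converge in the
  form norm, and that of its derivative in the dual norm, for initial data that are merely in \<open>L2_on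
  \<Omega>\<close> (\<open>weak_solution_of_coefficients\<close>). Weak solutions are unique at time
  \<open>T\<close> since each component of a difference of two of them satisfies a homogeneous Volterra
  equation (\<open>hilfer_scalar_unique\<close>, \<open>weak_solution_unique\<close>).

  It remains to see that the states reached at time \<open>T\<close> from the initial value 0 by
  polynomial controls are dense (\<open>reachable_dense\<close>). Let \<open>z\<close> be orthogonal to
  them and \<open>g\<close> be in \<open>L2_on \<omega>\<close>, and put \<open>a\<^sub>n = \<langle>g,
  \<phi> n\<rangle> \<langle>z, \<phi> n\<rangle>\<close>. All moments of \<open>\<Sum> a\<^sub>n e(lam n,
  t)\<close>, with \<open>e\<close> of index \<open>1 + \<mu>\<close>, vanish on \<open>[0, T]\<close>, so
  this series is 0 there by the Weierstrass theorem. Since \<open>\<kappa> e(\<kappa>, t) = 1 -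
  E\<^sub>\<mu>\<^sub>,\<^sub>1(- \<kappa> t^\<mu>)\<close>, the series of the \<open>a\<^sub>n / lam
  n\<close> against \<open>E\<^sub>\<mu>\<^sub>,\<^sub>1(- lam n t^\<mu>)\<close> is constant on
  \<open>[0, T]\<close>. It is analytic in \<open>t^\<mu>\<close> on a sector and tends to 0 at infinity,
  so the constant is 0 (\<open>constant_series_eq_zero\<close>). Fractional integration brings back the
  situation at the start with \<open>a\<^sub>n / lam n\<close> in place of \<open>a\<^sub>n\<close>; after
  \<open>k\<close> rounds and in the limit \<open>k \<rightarrow> \<infinity>\<close> only the smallest
  eigenvalue for which \<open>z\<close> has a component survives. The projection of \<open>z\<close> to
  that eigenspace is therefore orthogonal to \<open>L2_on \<omega>\<close>, that is, an eigenfunction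
  vanishing on \<open>\<omega>\<close>, and unique continuation makes it 0. This contradiction shows
  \<open>z = 0\<close>.\<close>

section \<open>Fractional integrals and power kernels\<close>

definition kern :: "real \<Rightarrow> real \<Rightarrow> real" where
  "kern b t = t powr (b - 1) / Gamma b"

lemma kern_nonneg: "b > 0 \<Longrightarrow> 0 \<le> kern b t"
  by (simp add: kern_def Gamma_real_pos less_imp_le)

lemma continuous_on_kern: "continuous_on {0<..} (kern b)"
  unfolding kern_def[abs_def] divide_inverse by (intro continuous_intros) auto

text \<open>The substitution \<open>\<tau> = t * x\<close> turns this into the Beta integral.\<close>

lemma has_bochner_integral_beta:
  fixes a b t :: real
  assumes "a > 0" "b > 0" "t > 0"
  shows "has_bochner_integral lborel
     (\<lambda>\<tau>. indicator {0<..<t} \<tau> * ((t - \<tau>) powr (a - 1) * \<tau> powr (b - 1))) (t powr (a + b - 1) * Beta a b)"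
proof -
  have "has_bochner_integral lborel (\<lambda>x. indicator {0..1} x *\<^sub>R (x powr (b - 1) * (1 - x) powr (a - 1))) (Beta b a)"
  proof -
    have i: "set_integrable lborel {0..1} (\<lambda>x. x powr (b - 1) * (1 - x) powr (a - 1))"
      using integrable_Beta[OF assms(2,1)] .
    have "(LINT x:{0..1}|lborel. x powr (b - 1) * (1 - x) powr (a - 1)) = Beta b a"
      using set_borel_integral_eq_integral(2)[OF i] has_integral_Beta_real[OF assms(2,1)] by (simp add: integral_unique)
    then show ?thesis using i unfolding set_integrable_def set_lebesgue_integral_def
      by (simp add: has_bochner_integral_iff)
  qed
  then have "has_bochner_integral lborel
      (\<lambda>x. t powr (a + b - 2) * (indicator {0..1} x *\<^sub>R (x powr (b - 1) * (1 - x) powr (a - 1))))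
      (t powr (a + b - 2) * Beta b a)"
    by (rule has_bochner_integral_mult_right)
  moreover have "AE x in lborel. t powr (a + b - 2) * (indicator {0..1} x *\<^sub>R (x powr (b - 1) * (1 - x) powr (a - 1)))
      = indicator {0<..<t} (t * x) * ((t - t * x) powr (a - 1) * (t * x) powr (b - 1))"
  proof -
    have "AE x in lborel. x \<noteq> 0 \<and> x \<noteq> (1::real)"
      by (intro AE_conjI AE_lborel_singleton)
    then show ?thesis
    proof eventually_elim
      case (elim x)
      show ?case
      proof (cases "x \<in> {0<..<1}")
        case True
        then have 1: "t - t * x = t * (1 - x)" by (simp add: algebra_simps)
        have "t powr (a + b - 2) = t powr (a - 1) * t powr (b - 1)" by (simp add: powr_add[symmetric])
        then show ?thesis using True \<open>t > 0\<close> unfolding 1 by (simp add: powr_mult mult_ac)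
      next
        case False
        then show ?thesis using elim \<open>t > 0\<close> by (auto simp: indicator_def zero_less_mult_iff)
      qed
    qed
  qed
  ultimately have "has_bochner_integral lborel
     (\<lambda>x. indicator {0<..<t} (t * x) * ((t - t * x) powr (a - 1) * (t * x) powr (b - 1))) (t powr (a + b - 2) * Beta b a)"
    by (subst (asm) has_bochner_integral_cong_AE) auto
  moreover have "t powr (a + b - 2) * Beta b a = (t powr (a + b - 1) * Beta a b) /\<^sub>R \<bar>t\<bar>"
  proof -
    have "t powr (a + b - 1) = t powr (a + b - 2) * t powr 1" by (subst powr_add[symmetric]) simp
    then show ?thesis using \<open>t > 0\<close> by (simp add: Beta_commute field_simps)
  qed
  ultimately show ?thesis
    using lborel_has_bochner_integral_real_affine_iff[of t
      "\<lambda>\<tau>. indicator {0<..<t} \<tau> * ((t - \<tau>) powr (a - 1) * \<tau> powr (b - 1))" "t powr (a + b - 1) * Beta a b" 0] \<open>t > 0\<close>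
    by simp
qed

lemma frac_integrable_kern:
  assumes "\<alpha> \<ge> 0" "b > 0"
  shows "frac_integrable \<alpha> (kern b) t"
proof (cases "\<alpha> = 0 \<or> t \<le> 0")
  case False
  then have "integrable lborel (\<lambda>\<tau>. (1 / Gamma b) * (indicator {0<..<t} \<tau> * ((t - \<tau>) powr (\<alpha> - 1) * \<tau> powr (b - 1))))"
    using has_bochner_integral_beta[of \<alpha> b t] assms by (intro integrable_mult_right) (auto simp: has_bochner_integral_iff)
  then show ?thesis unfolding frac_integrable_def set_integrable_def kern_def
    by (simp add: mult_ac)
qed (auto simp: frac_integrable_def set_integrable_def)

text \<open>Normalising powers by the Gamma function reduces the fractional calculus of powers to
  addition of indices.\<close>

lemma frac_integral_kern:
  assumes "\<alpha> \<ge> 0" "b > 0" "t > 0"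
  shows "frac_integral \<alpha> (kern b) t = kern (\<alpha> + b) t"
proof (cases "\<alpha> = 0")
  case False
  have "(LINT \<tau>:{0<..<t}|lborel. ((t - \<tau>) powr (\<alpha> - 1)) *\<^sub>R kern b \<tau>) =
     (LINT \<tau>|lborel. (1 / Gamma b) * (indicator {0<..<t} \<tau> * ((t - \<tau>) powr (\<alpha> - 1) * \<tau> powr (b - 1))))"
    unfolding set_lebesgue_integral_def kern_def by (simp add: mult_ac)
  also have "\<dots> = (1 / Gamma b) * (t powr (\<alpha> + b - 1) * Beta \<alpha> b)"
    using has_bochner_integral_beta[of \<alpha> b t] assms False by (simp add: has_bochner_integral_iff)
  also have "\<dots> = Gamma \<alpha> * kern (\<alpha> + b) t"
    using Gamma_real_pos[OF \<open>b > 0\<close>] by (simp add: kern_def Beta_def)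
  finally have "(LINT \<tau>:{0<..<t}|lborel. ((t - \<tau>) powr (\<alpha> - 1)) *\<^sub>R kern b \<tau>) = Gamma \<alpha> * kern (\<alpha> + b) t" .
  moreover have "Gamma \<alpha> > 0" using False assms by (intro Gamma_real_pos) auto
  ultimately show ?thesis using False by (simp add: frac_integral_def)
qed (simp add: frac_integral_def)

lemma frac_integral_cong:
  assumes "\<And>\<tau>. 0 < \<tau> \<Longrightarrow> \<tau> \<le> t \<Longrightarrow> g \<tau> = h \<tau>" "t > 0"
  shows "frac_integral \<alpha> g t = frac_integral \<alpha> h t"
  unfolding frac_integral_def using assms by (auto intro!: arg_cong2[where f = scaleR] set_lebesgue_integral_cong)

lemma frac_integrable_bound:
  fixes g :: "real \<Rightarrow> 'b::{banach, second_countable_topology}"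
  assumes g: "set_borel_measurable lborel {0<..<t} g"
    and h: "frac_integrable \<alpha> h t"
    and b: "\<And>\<tau>. 0 < \<tau> \<Longrightarrow> \<tau> < t \<Longrightarrow> norm (g \<tau>) \<le> norm (h \<tau> :: real)"
  shows "frac_integrable \<alpha> g t"
proof (cases "\<alpha> = 0")
  case False
  then have hi: "set_integrable lborel {0<..<t} (\<lambda>\<tau>. ((t - \<tau>) powr (\<alpha> - 1)) *\<^sub>R h \<tau>)"
    using h by (simp add: frac_integrable_def)
  have "set_integrable lborel {0<..<t} (\<lambda>\<tau>. ((t - \<tau>) powr (\<alpha> - 1)) *\<^sub>R g \<tau>)"
    unfolding set_integrable_def
  proof (rule Bochner_Integration.integrable_bound[OF hi[unfolded set_integrable_def]])
    have "(\<lambda>\<tau>. ((t - \<tau>) powr (\<alpha> - 1)) *\<^sub>R (indicator {0<..<t} \<tau> *\<^sub>R g \<tau>)) \<in> borel_measurable lborel"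
      using g[unfolded set_borel_measurable_def] by measurable
    then show "(\<lambda>\<tau>. indicator {0<..<t} \<tau> *\<^sub>R ((t - \<tau>) powr (\<alpha> - 1)) *\<^sub>R g \<tau>) \<in> borel_measurable lborel"
      by (simp add: mult_ac)
    show "AE \<tau> in lborel. norm (indicator {0<..<t} \<tau> *\<^sub>R ((t - \<tau>) powr (\<alpha> - 1)) *\<^sub>R g \<tau>)
        \<le> norm (indicator {0<..<t} \<tau> *\<^sub>R ((t - \<tau>) powr (\<alpha> - 1)) *\<^sub>R h \<tau>)"
      using b by (intro AE_I2) (auto simp: indicator_def abs_mult intro!: mult_left_mono)
  qed
  then show ?thesis by (simp add: frac_integrable_def)
qed (simp add: frac_integrable_def)

lemma frac_integral_mono:
  fixes g h :: "real \<Rightarrow> real"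
  assumes "frac_integrable \<alpha> g t" "frac_integrable \<alpha> h t" "\<alpha> \<ge> 0" "t > 0"
    and "\<And>\<tau>. 0 < \<tau> \<Longrightarrow> \<tau> \<le> t \<Longrightarrow> g \<tau> \<le> h \<tau>"
  shows "frac_integral \<alpha> g t \<le> frac_integral \<alpha> h t"
proof (cases "\<alpha> = 0")
  case False
  then have "(LINT \<tau>:{0<..<t}|lborel. ((t - \<tau>) powr (\<alpha> - 1)) *\<^sub>R g \<tau>)
     \<le> (LINT \<tau>:{0<..<t}|lborel. ((t - \<tau>) powr (\<alpha> - 1)) *\<^sub>R h \<tau>)"
    using assms by (intro set_integral_mono) (auto simp: frac_integrable_def intro!: mult_left_mono)
  then show ?thesis using False assms Gamma_real_pos[of \<alpha>]
    by (simp add: frac_integral_def divide_right_mono)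
qed (use assms in \<open>simp add: frac_integral_def\<close>)

lemma frac_integral_norm_le:
  fixes g :: "real \<Rightarrow> 'b::{banach, second_countable_topology}"
  assumes g: "frac_integrable \<alpha> g t" and h: "frac_integrable \<alpha> h t" and "\<alpha> \<ge> 0" "t > 0"
    and "\<And>\<tau>. 0 < \<tau> \<Longrightarrow> \<tau> \<le> t \<Longrightarrow> norm (g \<tau>) \<le> h \<tau>"
  shows "norm (frac_integral \<alpha> g t) \<le> frac_integral \<alpha> h t"
proof (cases "\<alpha> = 0")
  case False
  have "norm (LINT \<tau>:{0<..<t}|lborel. ((t - \<tau>) powr (\<alpha> - 1)) *\<^sub>R g \<tau>)
     \<le> (LINT \<tau>:{0<..<t}|lborel. norm (((t - \<tau>) powr (\<alpha> - 1)) *\<^sub>R g \<tau>))"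
    using g False by (intro set_integral_norm_bound) (simp add: frac_integrable_def)
  also have "\<dots> \<le> (LINT \<tau>:{0<..<t}|lborel. ((t - \<tau>) powr (\<alpha> - 1)) *\<^sub>R h \<tau>)"
    using assms False
    by (intro set_integral_mono set_integrable_norm) (auto simp: frac_integrable_def intro!: mult_left_mono)
  finally show ?thesis using False assms Gamma_real_pos[of \<alpha>]
    by (simp add: frac_integral_def divide_right_mono)
qed (use assms in \<open>simp add: frac_integral_def\<close>)

lemma frac_integral_mult_right:
  fixes g :: "real \<Rightarrow> real"
  shows "frac_integral \<alpha> (\<lambda>\<tau>. c * g \<tau>) t = c * frac_integral \<alpha> g t"
  by (simp add: frac_integral_def mult.left_commute[of _ c])

lemma frac_integrable_mult_right:
  fixes g :: "real \<Rightarrow> real"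
  assumes "frac_integrable \<alpha> g t"
  shows "frac_integrable \<alpha> (\<lambda>\<tau>. c * g \<tau>) t"
  using assms unfolding frac_integrable_def by (auto simp: mult.left_commute[of _ c])

lemma frac_integral_add:
  assumes "frac_integrable \<alpha> g t" "frac_integrable \<alpha> h t"
  shows "frac_integral \<alpha> (\<lambda>\<tau>. g \<tau> + h \<tau>) t = frac_integral \<alpha> g t + frac_integral \<alpha> h t"
  using assms by (auto simp: frac_integral_def frac_integrable_def scaleR_right_distrib)

lemma frac_integrable_add:
  assumes "frac_integrable \<alpha> g t" "frac_integrable \<alpha> h t"
  shows "frac_integrable \<alpha> (\<lambda>\<tau>. g \<tau> + h \<tau>) t"
  using assms by (auto simp: frac_integrable_def scaleR_right_distrib)

text \<open>Termwise fractional integration. The majorant is a product of a summable sequence and one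
  integrable function, which covers both power series in time and expansions in eigenvectors.\<close>

lemma frac_integral_sums:
  fixes g :: "nat \<Rightarrow> real \<Rightarrow> 'b::{banach, second_countable_topology}"
  assumes g: "\<And>n. set_borel_measurable lborel {0<..<t} (g n)"
    and h: "frac_integrable \<alpha> h t" and "\<alpha> \<ge> 0" "t > 0"
    and b: "\<And>n \<tau>. 0 < \<tau> \<Longrightarrow> \<tau> \<le> t \<Longrightarrow> norm (g n \<tau>) \<le> d n * h \<tau>"
    and d: "summable d" "\<And>n. 0 \<le> d n"
    and h0: "\<And>\<tau>. 0 < \<tau> \<Longrightarrow> \<tau> \<le> t \<Longrightarrow> 0 \<le> h \<tau>"
  shows "(\<lambda>n. frac_integral \<alpha> (g n) t) sums frac_integral \<alpha> (\<lambda>\<tau>. \<Sum>n. g n \<tau>) t"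
    and "frac_integrable \<alpha> (\<lambda>\<tau>. \<Sum>n. g n \<tau>) t"
proof -
  have bs: "summable (\<lambda>n. norm (g n \<tau>))" if "0 < \<tau>" "\<tau> \<le> t" for \<tau>
    by (rule summable_comparison_test'[OF summable_mult2[OF d(1), of "h \<tau>"], of 0]) (use b that in auto)
  have "((\<lambda>n. frac_integral \<alpha> (g n) t) sums frac_integral \<alpha> (\<lambda>\<tau>. \<Sum>n. g n \<tau>) t) \<and>
        frac_integrable \<alpha> (\<lambda>\<tau>. \<Sum>n. g n \<tau>) t"
  proof (cases "\<alpha> = 0")
    case True
    then show ?thesis using summable_norm_cancel[OF bs[OF \<open>t > 0\<close> order.refl]]
      by (simp add: frac_integral_def frac_integrable_def summable_sums)
  next
    case False
    define G where "G n \<tau> = indicator {0<..<t} \<tau> *\<^sub>R ((t - \<tau>) powr (\<alpha> - 1)) *\<^sub>R g n \<tau>" for n \<tau>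
    have gi: "frac_integrable \<alpha> (g n) t" for n
      by (rule frac_integrable_bound[OF g frac_integrable_mult_right[OF h, of "d n"]])
         (use b d h0 in \<open>auto simp: abs_mult\<close>)
    have G: "integrable lborel (G n)" for n
      using gi[of n] False unfolding frac_integrable_def set_integrable_def G_def[abs_def] by simp
    have 1: "AE \<tau> in lborel. summable (\<lambda>n. norm (G n \<tau>))"
      using bs by (intro AE_I2) (auto simp: G_def indicator_def intro!: summable_mult)
    define I where "I = (LINT \<tau>:{0<..<t}|lborel. ((t - \<tau>) powr (\<alpha> - 1)) *\<^sub>R h \<tau>)"
    have 2: "summable (\<lambda>n. LINT \<tau>|lborel. norm (G n \<tau>))"
    proof (rule summable_comparison_test'[OF summable_mult2[OF d(1), of I], of 0])
      fix n
      have "(LINT \<tau>|lborel. norm (G n \<tau>)) \<le> (LINT \<tau>|lborel. d n * (indicator {0<..<t} \<tau> *\<^sub>R (((t - \<tau>) powr (\<alpha> - 1)) *\<^sub>R h \<tau>)))"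
      proof (rule integral_mono)
        show "integrable lborel (\<lambda>\<tau>. d n * (indicator {0<..<t} \<tau> *\<^sub>R (((t - \<tau>) powr (\<alpha> - 1)) *\<^sub>R h \<tau>)))"
          using h False by (intro integrable_mult_right) (simp add: frac_integrable_def set_integrable_def)
        show "norm (G n \<tau>) \<le> d n * (indicator {0<..<t} \<tau> *\<^sub>R (((t - \<tau>) powr (\<alpha> - 1)) *\<^sub>R h \<tau>))" for \<tau>
          using mult_left_mono[OF b, of \<tau> "(t - \<tau>) powr (\<alpha> - 1)" n]
          by (auto simp: G_def indicator_def mult.left_commute)
      qed (use G in auto)
      also have "\<dots> = d n * I" unfolding I_def set_lebesgue_integral_def by simp
      finally show "norm (LINT \<tau>|lborel. norm (G n \<tau>)) \<le> d n * I" by simp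
    qed
    have eq: "(\<Sum>n. G n \<tau>) = indicator {0<..<t} \<tau> *\<^sub>R ((t - \<tau>) powr (\<alpha> - 1)) *\<^sub>R (\<Sum>n. g n \<tau>)" for \<tau>
      using summable_norm_cancel[OF bs[of \<tau>]]
      by (auto simp: G_def indicator_def suminf_scaleR_right)
    show ?thesis
      using sums_scaleR_right[OF sums_integral[OF G 1 2], of "1 / Gamma \<alpha>"] integrable_suminf[OF G 1 2] False
      unfolding eq by (simp add: frac_integral_def frac_integrable_def G_def set_lebesgue_integral_def set_integrable_def)
  qed
  then show "(\<lambda>n. frac_integral \<alpha> (g n) t) sums frac_integral \<alpha> (\<lambda>\<tau>. \<Sum>n. g n \<tau>) t"
    and "frac_integrable \<alpha> (\<lambda>\<tau>. \<Sum>n. g n \<tau>) t" by auto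
qed

lemma set_borel_measurable_continuous_on:
  assumes "continuous_on A f" "B \<subseteq> A" "B \<in> sets borel"
  shows "set_borel_measurable lborel B (f :: real \<Rightarrow> 'b::{banach, second_countable_topology})"
  unfolding set_borel_measurable_def
  using borel_measurable_continuous_on_indicator[OF assms(3) continuous_on_subset[OF assms(1,2)]] by simp

text \<open>By convexity of \<open>ln \<circ> Gamma\<close>, its slope between \<open>y\<close> and
  \<open>y + \<mu>\<close> is at least its slope between \<open>y - 1\<close> and \<open>y\<close>, which
  is \<open>ln (y - 1)\<close>.\<close>

lemma Gamma_quotient_le:
  fixes y \<mu> :: real
  assumes "\<mu> > 0" "y > 1"
  shows "Gamma y * (y - 1) powr \<mu> \<le> Gamma (y + \<mu>)"
proof -
  have g: "Gamma y \<noteq> 0" "Gamma y > 0" "Gamma (y + \<mu>) > 0"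
    using assms Gamma_real_pos[of y] by (force intro!: Gamma_real_pos)+
  have "(ln \<circ> Gamma) ((1 - 1 / (1 + \<mu>)) *\<^sub>R (y - 1) + (1 / (1 + \<mu>)) *\<^sub>R (y + \<mu>))
      \<le> (1 - 1 / (1 + \<mu>)) * (ln \<circ> Gamma) (y - 1) + (1 / (1 + \<mu>)) * (ln \<circ> Gamma) (y + \<mu>)"
    by (rule convex_onD[OF log_convex_Gamma_real]) (use assms in \<open>auto simp: field_simps\<close>)
  moreover have "(1 - 1 / (1 + \<mu>)) *\<^sub>R (y - 1) + (1 / (1 + \<mu>)) *\<^sub>R (y + \<mu>) = y"
  proof -
    define c where "c = 1 / (1 + \<mu>)"
    have "c * (1 + \<mu>) = 1" using assms by (simp add: c_def)
    then have "(1 - c) * (y - 1) + c * (y + \<mu>) = y" by (simp add: algebra_simps)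
    then show ?thesis by (simp add: c_def)
  qed
  moreover have "ln (Gamma (y - 1)) = ln (Gamma y) - ln (y - 1)"
  proof -
    have "Gamma y = (y - 1) * Gamma (y - 1)" using Gamma_plus1[of "y - 1"] assms nonpos_Ints_nonpos[of "y - 1"] by fastforce
    moreover have "Gamma (y - 1) \<noteq> 0" using assms Gamma_real_pos[of "y - 1"] by force
    ultimately show ?thesis using assms by (simp add: ln_mult)
  qed
  ultimately have "(1 + \<mu>) * ln (Gamma y) \<le> (1 + \<mu>) * ((1 - 1 / (1 + \<mu>)) * (ln (Gamma y) - ln (y - 1)) + (1 / (1 + \<mu>)) * ln (Gamma (y + \<mu>)))"
    using assms by (intro mult_left_mono) auto
  also have "\<dots> = \<mu> * (ln (Gamma y) - ln (y - 1)) + ln (Gamma (y + \<mu>))"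
  proof -
    have "(1 + \<mu>) * (1 - 1 / (1 + \<mu>)) = \<mu>" "(1 + \<mu>) * (1 / (1 + \<mu>)) = 1" using assms by (auto simp: field_simps)
    then show ?thesis by (simp only: distrib_left mult.assoc[symmetric])
  qed
  finally have "ln (Gamma y) + \<mu> * ln (y - 1) \<le> ln (Gamma (y + \<mu>))" by (simp add: algebra_simps)
  then have "ln (Gamma y * (y - 1) powr \<mu>) \<le> ln (Gamma (y + \<mu>))"
    using assms by (simp add: ln_mult ln_powr g(1))
  then show ?thesis using assms g(2,3) by (subst (asm) ln_le_cancel_iff) auto
qed

lemma summable_Mittag_Leffler:
  fixes x a \<mu> :: real
  assumes "\<mu> > 0" "a > 0"
  shows "summable (\<lambda>k. x ^ k / Gamma (\<mu> * k + a))"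
proof -
  have "filterlim (\<lambda>k. (\<mu> * real k + a - 1) powr \<mu>) at_top sequentially"
    using assms by real_asymp
  then have "eventually (\<lambda>k. 2 * \<bar>x\<bar> \<le> (\<mu> * real k + a - 1) powr \<mu>) sequentially"
    by (simp add: filterlim_at_top)
  moreover have "eventually (\<lambda>k. \<mu> * real k + a > 1) sequentially"
    using assms by real_asymp
  ultimately have "eventually (\<lambda>k. norm (x ^ Suc k / Gamma (\<mu> * Suc k + a)) \<le> (1/2) * norm (x ^ k / Gamma (\<mu> * k + a))) sequentially"
  proof eventually_elim
    case (elim k)
    define y where "y = \<mu> * real k + a"
    have y: "y > 1" "2 * \<bar>x\<bar> \<le> (y - 1) powr \<mu>" "Gamma y > 0" "Gamma (y + \<mu>) > 0"
      using elim assms by (auto simp: y_def intro!: Gamma_real_pos)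
    have "2 * \<bar>x\<bar> * Gamma y \<le> Gamma (y + \<mu>)"
      using Gamma_quotient_le[OF \<open>\<mu> > 0\<close> y(1)] mult_right_mono[OF y(2) less_imp_le[OF y(3)]]
      by (simp add: mult.commute)
    then have "\<bar>x\<bar> / Gamma (y + \<mu>) \<le> (1/2) / Gamma y" using y by (simp add: field_simps)
    then have "\<bar>x\<bar> ^ k * (\<bar>x\<bar> / Gamma (y + \<mu>)) \<le> \<bar>x\<bar> ^ k * ((1/2) / Gamma y)" by (rule mult_left_mono) simp
    moreover have "\<mu> * Suc k + a = y + \<mu>" by (simp add: y_def algebra_simps)
    ultimately show ?case using y by (simp add: abs_mult power_abs y_def[symmetric] mult_ac)
  qed
  then obtain N where "\<And>k. k \<ge> N \<Longrightarrow> norm (x ^ Suc k / Gamma (\<mu> * Suc k + a)) \<le> (1/2) * norm (x ^ k / Gamma (\<mu> * k + a))"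
    unfolding eventually_sequentially by blast
  then show ?thesis by (intro summable_ratio_test[of "1/2"]) auto
qed

section \<open>Mittag-Leffler kernels\<close>

locale fractional_order =
  fixes \<mu> :: real
  assumes mu0: "0 < \<mu>" and mu1: "\<mu> < 1"
begin

text \<open>The function \<open>t^(a-1) E(- z t^\<mu>)\<close> of fractional relaxation, where
  \<open>E\<close> is the Mittag-Leffler function with parameters \<open>\<mu>\<close> and
  \<open>a\<close>, as a series of power kernels. Complex \<open>z\<close> serve the analytic continuation
  of series of such functions.\<close>

definition ml_kern :: "real \<Rightarrow> 'b::{real_normed_field, banach, second_countable_topology} \<Rightarrow> real \<Rightarrow> 'b" where
  "ml_kern a z t = (\<Sum>k. kern (\<mu> * real k + a) t *\<^sub>R (- z) ^ k)"

lemma kern_split: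
  "t > 0 \<Longrightarrow> kern (\<mu> * real k + a) t = t powr (a - 1) * ((t powr \<mu>) ^ k / Gamma (\<mu> * real k + a))"
  by (simp add: kern_def powr_realpow[symmetric] powr_powr powr_add[symmetric] algebra_simps)

definition ml_coeff :: "real \<Rightarrow> nat \<Rightarrow> real" where "ml_coeff a k = 1 / Gamma (\<mu> * real k + a)"

lemma ml_coeff_pos: "a > 0 \<Longrightarrow> 0 < ml_coeff a k"
  using mu0 by (auto simp: ml_coeff_def intro!: Gamma_real_pos add_nonneg_pos)

lemma summable_ml_coeff: "a > 0 \<Longrightarrow> summable (\<lambda>k. ml_coeff a k * x ^ k)"
  using summable_Mittag_Leffler[of \<mu> a x] mu0 by (simp add: ml_coeff_def)

lemma summable_norm_ml_coeff:
  fixes x :: "'b::{real_normed_field, banach}"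
  assumes "a > 0" shows "summable (\<lambda>k. norm (of_real (ml_coeff a k) * x ^ k))"
  using summable_ml_coeff[OF assms, of "norm x"] ml_coeff_pos[OF assms]
  by (simp add: norm_mult norm_power less_imp_le)

lemma ml_kern_term: "t > 0 \<Longrightarrow> kern (\<mu> * real k + a) t *\<^sub>R (- z) ^ k =
    (t powr (a - 1)) *\<^sub>R (of_real (ml_coeff a k) * (- (of_real (t powr \<mu>) * (z :: 'b::real_normed_field))) ^ k)"
proof -
  assume t: "t > 0"
  have "- (of_real (t powr \<mu>) * z) = of_real (t powr \<mu>) * (- z)" by simp
  then show ?thesis
    unfolding kern_split[OF t] ml_coeff_def by (simp only: power_mult_distrib) (simp add: scaleR_conv_of_real)
qed

lemma summable_ml_kern:
  fixes z :: "'b::{real_normed_field, banach}"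
  assumes "a > 0" "t > 0"
  shows "summable (\<lambda>k. norm (kern (\<mu> * real k + a) t *\<^sub>R (- z) ^ k))"
  unfolding ml_kern_term[OF \<open>t > 0\<close>] norm_scaleR
  by (intro summable_mult summable_norm_ml_coeff assms)

definition mittag_leffler :: "real \<Rightarrow> 'b::{real_normed_field, banach, second_countable_topology} \<Rightarrow> 'b" where
  "mittag_leffler a x = (\<Sum>k. of_real (ml_coeff a k) * x ^ k)"

lemma ml_kern_mittag_leffler:
  assumes "a > 0" "t > 0"
  shows "ml_kern a z t = (t powr (a - 1)) *\<^sub>R mittag_leffler a (- (of_real (t powr \<mu>) * z))"
  unfolding ml_kern_def mittag_leffler_def ml_kern_term[OF \<open>t > 0\<close>]
  by (intro suminf_scaleR_right[symmetric] summable_norm_cancel[OF summable_norm_ml_coeff[OF \<open>a > 0\<close>]])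

lemma isCont_mittag_leffler: "a > 0 \<Longrightarrow> isCont (mittag_leffler a) x"
  unfolding mittag_leffler_def[abs_def]
  by (rule isCont_powser_converges_everywhere) (rule summable_norm_cancel[OF summable_norm_ml_coeff])

lemma continuous_on_ml_kern:
  assumes "a > 0" shows "continuous_on {0<..} (ml_kern a z)"
proof -
  have "continuous_on {0<..} (\<lambda>t. (t powr (a - 1)) *\<^sub>R mittag_leffler a (- (of_real (t powr \<mu>) * z)))"
    by (intro continuous_intros continuous_on_compose2[OF continuous_at_imp_continuous_on[of UNIV "mittag_leffler a"]])
       (auto simp: isCont_mittag_leffler assms)
  then show ?thesis by (rule continuous_on_eq) (simp add: ml_kern_mittag_leffler assms)
qed

text \<open>Splitting off the first term of the series. Together with
  \<open>frac_integral_ml_kern\<close> it is the Volterra equation of the kernel.\<close>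

lemma ml_kern_recurrence:
  assumes "a > 0" "t > 0"
  shows "ml_kern a z t = of_real (kern a t) - z * ml_kern (a + \<mu>) z t"
proof -
  have "ml_kern a z t = kern a t *\<^sub>R 1 + (\<Sum>k. kern (\<mu> * real (Suc k) + a) t *\<^sub>R (- z) ^ Suc k)"
    unfolding ml_kern_def using suminf_split_head[OF summable_norm_cancel[OF summable_ml_kern[OF assms, of z]]] by simp
  also have "(\<Sum>k. kern (\<mu> * real (Suc k) + a) t *\<^sub>R (- z) ^ Suc k) = (\<Sum>k. (- z) * (kern (\<mu> * real k + (a + \<mu>)) t *\<^sub>R (- z) ^ k))"
    by (simp add: algebra_simps)
  also have "\<dots> = - z * ml_kern (a + \<mu>) z t"
    unfolding ml_kern_def using mu0 assms by (intro suminf_mult summable_norm_cancel[OF summable_ml_kern]) auto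
  finally show ?thesis by (simp add: scaleR_conv_of_real)
qed

text \<open>The factor in a bound by the leading term that is uniform on a bounded time interval; see
  \<open>norm_ml_kern_le\<close>.\<close>

definition ml_bound :: "real \<Rightarrow> real \<Rightarrow> real" where
  "ml_bound a x = Gamma a * (\<Sum>k. ml_coeff a k * x ^ k)"

lemma ml_kern_term_le:
  assumes "a > 0" "0 < \<tau>" "\<tau> \<le> T"
  shows "norm (kern (\<mu> * real k + a) \<tau> *\<^sub>R (- z) ^ k) \<le> (Gamma a * (ml_coeff a k * (T powr \<mu> * norm (z::'b::real_normed_field)) ^ k)) * kern a \<tau>"
proof -
  have "(\<tau> powr \<mu>) ^ k \<le> (T powr \<mu>) ^ k" using assms mu0 by (intro power_mono powr_mono2) auto
  then have "\<tau> powr (a - 1) * (ml_coeff a k * ((\<tau> powr \<mu>) ^ k * norm z ^ k)) \<le> \<tau> powr (a - 1) * (ml_coeff a k * ((T powr \<mu>) ^ k * norm z ^ k))"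
    using ml_coeff_pos[OF assms(1), of k] by (intro mult_left_mono mult_right_mono) auto
  moreover have "norm (kern (\<mu> * real k + a) \<tau> *\<^sub>R (- z) ^ k) = \<tau> powr (a - 1) * (ml_coeff a k * ((\<tau> powr \<mu>) ^ k * norm z ^ k))"
    unfolding ml_kern_term[OF assms(2)] using ml_coeff_pos[OF assms(1), of k] assms
    by (simp add: norm_mult norm_power power_mult_distrib)
  moreover have "(Gamma a * (ml_coeff a k * (T powr \<mu> * norm z) ^ k)) * kern a \<tau> = \<tau> powr (a - 1) * (ml_coeff a k * ((T powr \<mu>) ^ k * norm z ^ k))"
    using Gamma_real_pos[OF assms(1)] by (simp add: kern_def power_mult_distrib)
  ultimately show ?thesis by (simp only:)
qed

lemma norm_ml_kern_le:
  assumes "a > 0" "0 < \<tau>" "\<tau> \<le> T"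
  shows "norm (ml_kern a z \<tau>) \<le> ml_bound a (T powr \<mu> * norm z) * kern a \<tau>"
proof -
  have s: "summable (\<lambda>k. (Gamma a * (ml_coeff a k * (T powr \<mu> * norm z) ^ k)) * kern a \<tau>)"
    by (intro summable_mult summable_mult2 summable_ml_coeff assms)
  have "norm (ml_kern a z \<tau>) \<le> (\<Sum>k. norm (kern (\<mu> * real k + a) \<tau> *\<^sub>R (- z) ^ k))"
    unfolding ml_kern_def by (rule summable_norm[OF summable_ml_kern[OF assms(1,2)]])
  also have "\<dots> \<le> (\<Sum>k. (Gamma a * (ml_coeff a k * (T powr \<mu> * norm z) ^ k)) * kern a \<tau>)"
    by (rule suminf_le[OF ml_kern_term_le[OF assms] summable_ml_kern[OF assms(1,2)] s])
  also have "\<dots> = ml_bound a (T powr \<mu> * norm z) * kern a \<tau>"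
    unfolding ml_bound_def by (simp add: suminf_mult suminf_mult2[symmetric] summable_ml_coeff assms summable_mult)
  finally show ?thesis .
qed

lemma ml_bound_nonneg: "a > 0 \<Longrightarrow> x \<ge> 0 \<Longrightarrow> 0 \<le> ml_bound a x"
  unfolding ml_bound_def using Gamma_real_pos[of a] ml_coeff_pos[of a]
  by (intro mult_nonneg_nonneg suminf_nonneg summable_ml_coeff) (auto simp: less_imp_le)

text \<open>The power rule \<open>frac_integral_kern\<close> applied to each term of the series.\<close>

lemma frac_integral_ml_kern:
  assumes "a > 0" "\<alpha> \<ge> 0" "t > 0"
  shows "frac_integrable \<alpha> (ml_kern a z) t" "frac_integral \<alpha> (ml_kern a z) t = ml_kern (\<alpha> + a) z t"
proof -
  define g where "g k \<tau> = kern (\<mu> * real k + a) \<tau> *\<^sub>R (- z) ^ k" for k \<tau>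
  have p: "\<mu> * real k + a > 0" for k using mu0 assms by (intro add_nonneg_pos) auto
  have m: "set_borel_measurable lborel {0<..<t} (g k)" for k
    unfolding g_def by (rule set_borel_measurable_continuous_on[of "{0<..}"])
      (auto intro!: continuous_intros continuous_on_kern)
  note * = frac_integral_sums[OF m frac_integrable_kern[OF \<open>\<alpha> \<ge> 0\<close> \<open>a > 0\<close>] \<open>\<alpha> \<ge> 0\<close> \<open>t > 0\<close>,
      where d = "\<lambda>k. Gamma a * (ml_coeff a k * (t powr \<mu> * norm z) ^ k)"]
  have mg: "ml_kern a z = (\<lambda>\<tau>. \<Sum>k. g k \<tau>)" by (simp add: ml_kern_def g_def fun_eq_iff)
  have d: "summable (\<lambda>k. Gamma a * (ml_coeff a k * (t powr \<mu> * norm z) ^ k))"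
    by (intro summable_mult summable_ml_coeff assms)
  have d0: "0 \<le> Gamma a * (ml_coeff a k * (t powr \<mu> * norm z) ^ k)" for k
    using Gamma_real_pos[OF \<open>a > 0\<close>] ml_coeff_pos[OF \<open>a > 0\<close>, of k] by simp
  have le: "norm (g k \<tau>) \<le> (Gamma a * (ml_coeff a k * (t powr \<mu> * norm z) ^ k)) * kern a \<tau>" if "0 < \<tau>" "\<tau> \<le> t" for k \<tau>
    unfolding g_def by (rule ml_kern_term_le[OF \<open>a > 0\<close> that])
  show "frac_integrable \<alpha> (ml_kern a z) t"
    unfolding mg by (rule *(2)) (use le d d0 kern_nonneg[OF \<open>a > 0\<close>] in auto)
  have "(\<lambda>k. frac_integral \<alpha> (g k) t) sums frac_integral \<alpha> (ml_kern a z) t"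
    unfolding mg by (rule *(1)) (use le d d0 kern_nonneg[OF \<open>a > 0\<close>] in auto)
  moreover have "frac_integral \<alpha> (g k) t = kern (\<mu> * real k + (\<alpha> + a)) t *\<^sub>R (- z) ^ k" for k
  proof -
    have "frac_integral \<alpha> (g k) t = frac_integral \<alpha> (kern (\<mu> * real k + a)) t *\<^sub>R (- z) ^ k"
      unfolding g_def frac_integral_def set_lebesgue_integral_def
      using frac_integrable_kern[OF \<open>\<alpha> \<ge> 0\<close> p, of k t]
      by (auto simp: frac_integrable_def set_integrable_def)
    then show ?thesis using frac_integral_kern[OF \<open>\<alpha> \<ge> 0\<close> p \<open>t > 0\<close>, of k] by (simp add: add_ac)
  qed
  ultimately show "frac_integral \<alpha> (ml_kern a z) t = ml_kern (\<alpha> + a) z t"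
    unfolding ml_kern_def by (simp add: sums_iff)
qed

text \<open>Differentiating the power series gives the factor \<open>\<mu> * k + a\<close> in the term
  \<open>k\<close>, which cancels one factor of \<open>Gamma (\<mu> * k + a + 1)\<close>.\<close>

lemma ml_kern_has_derivative:
  fixes z :: real
  assumes "a > 0" "t > 0"
  shows "(ml_kern (a + 1) z has_real_derivative ml_kern a z t) (at t)"
proof -
  define x where "x = - (t powr \<mu> * z)"
  have s: "summable (\<lambda>k. ml_coeff (a + 1) k * y ^ k)" for y using assms by (intro summable_ml_coeff) auto
  define D where "D = (\<Sum>k. diffs (ml_coeff (a + 1)) k * x ^ k)"
  have "((\<lambda>x. \<Sum>k. ml_coeff (a + 1) k * x ^ k) has_field_derivative D) (at x)"
    unfolding D_def by (rule termdiffs_strong_converges_everywhere[OF s])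
  then have d: "(mittag_leffler (a + 1) has_real_derivative D) (at x)" unfolding mittag_leffler_def[abs_def] by simp
  have "((\<lambda>t. t powr a * mittag_leffler (a + 1) (- (t powr \<mu> * z))) has_real_derivative
      a * t powr (a - 1) * mittag_leffler (a + 1) x + t powr a * (D * - (\<mu> * t powr (\<mu> - 1) * z))) (at t)"
    using assms by (auto intro!: derivative_eq_intros DERIV_chain2[of "mittag_leffler (a + 1)" D] d[unfolded x_def] simp: x_def)
  moreover have "a * t powr (a - 1) * mittag_leffler (a + 1) x + t powr a * (D * - (\<mu> * t powr (\<mu> - 1) * z)) = ml_kern a z t"
  proof -
    have "summable (\<lambda>k. diffs (ml_coeff (a + 1)) k * x ^ k)"
      using termdiff_converges_all[of "ml_coeff (a + 1)" x] s by simp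
    from diffs_equiv[OF this] have "(\<lambda>k. real k * ml_coeff (a + 1) k * x ^ (k - Suc 0)) sums D" by (simp add: D_def)
    from sums_mult[OF this, of "\<mu> * x"] have 1: "(\<lambda>k. \<mu> * real k * ml_coeff (a + 1) k * x ^ k) sums (\<mu> * x * D)"
    proof (rule sums_cong[THEN iffD1, rotated])
      show "\<mu> * x * (real k * ml_coeff (a + 1) k * x ^ (k - Suc 0)) = \<mu> * real k * ml_coeff (a + 1) k * x ^ k" for k
        by (cases k) auto
    qed
    have "(\<lambda>k. a * (ml_coeff (a + 1) k * x ^ k)) sums (a * mittag_leffler (a + 1) x)"
      unfolding mittag_leffler_def using s by (intro sums_mult) (simp add: summable_sums)
    from sums_add[OF this 1] have "(\<lambda>k. (\<mu> * real k + a) * ml_coeff (a + 1) k * x ^ k) sums (a * mittag_leffler (a + 1) x + \<mu> * x * D)"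
      by (simp add: algebra_simps)
    moreover have "(\<mu> * real k + a) * ml_coeff (a + 1) k = ml_coeff a k" for k
    proof -
      have p: "\<mu> * real k + a > 0" using mu0 assms by (intro add_nonneg_pos) auto
      have "Gamma (\<mu> * real k + a + 1) = (\<mu> * real k + a) * Gamma (\<mu> * real k + a)"
        by (rule Gamma_plus1) (use p nonpos_Ints_nonpos in fastforce)
      then show ?thesis using p unfolding ml_coeff_def add.assoc[symmetric] by simp
    qed
    ultimately have "mittag_leffler a x = a * mittag_leffler (a + 1) x + \<mu> * x * D" unfolding mittag_leffler_def by (simp add: sums_iff)
    then have "ml_kern a z t = t powr (a - 1) * (a * mittag_leffler (a + 1) x + \<mu> * x * D)"
      using assms by (simp add: ml_kern_mittag_leffler x_def)
    moreover have "t powr a * t powr (\<mu> - 1) = t powr (a - 1) * t powr \<mu>"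
      by (simp add: powr_add[symmetric] algebra_simps)
    ultimately show ?thesis by (simp add: x_def algebra_simps)
  qed
  ultimately have "((\<lambda>t. t powr a * mittag_leffler (a + 1) (- (t powr \<mu> * z))) has_real_derivative ml_kern a z t) (at t)" by simp
  then show ?thesis
    by (rule has_field_derivative_transform_within_open[of _ _ _ "{0<..}"]) (use assms in \<open>auto simp: ml_kern_mittag_leffler\<close>)
qed

end

section \<open>Positivity, decay and the resolvent identity\<close>

lemma frac_integral_nonneg:
  fixes g :: "real \<Rightarrow> real"
  assumes "\<alpha> \<ge> 0" "t > 0" "\<And>\<tau>. 0 < \<tau> \<Longrightarrow> \<tau> \<le> t \<Longrightarrow> 0 \<le> g \<tau>"
  shows "0 \<le> frac_integral \<alpha> g t"
proof (cases "\<alpha> = 0")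
  case False
  have "0 \<le> (LINT \<tau>:{0<..<t}|lborel. ((t - \<tau>) powr (\<alpha> - 1)) *\<^sub>R g \<tau>)"
    unfolding set_lebesgue_integral_def using assms
    by (intro Bochner_Integration.integral_nonneg) (auto simp: indicator_def)
  then show ?thesis using False assms by (simp add: frac_integral_def)
qed (use assms in \<open>simp add: frac_integral_def\<close>)

lemma kern_1 [simp]: "t > 0 \<Longrightarrow> kern 1 t = 1"
  by (simp add: kern_def)

lemma Gamma_mult_kern: "a > 0 \<Longrightarrow> Gamma a * kern a t = t powr (a - 1)"
  using Gamma_real_pos[of a] by (simp add: kern_def less_imp_neq[symmetric])

lemma has_bochner_integral_kern_reflect:
  assumes "a > 0" "s < t"
  shows "has_bochner_integral lborel (\<lambda>\<tau>. indicator {s<..<t} \<tau> * (t - \<tau>) powr (a - 1)) (Gamma a * kern (a + 1) (t - s))"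
proof -
  have "has_bochner_integral lborel (\<lambda>x. indicator {0<..<t - s} x * ((t - s - x) powr (a - 1) * x powr (1 - 1))) ((t - s) powr (a + 1 - 1) * Beta a 1)"
    using has_bochner_integral_beta[of a 1 "t - s"] assms by simp
  moreover have "(\<lambda>x. indicator {0<..<t - s} x * ((t - s - x) powr (a - 1) * x powr (1 - 1)))
     = (\<lambda>x. indicator {s<..<t} (s + 1 * x) * (t - (s + 1 * x)) powr (a - 1))"
    by (auto simp: fun_eq_iff indicator_def algebra_simps)
  moreover have "(t - s) powr (a + 1 - 1) * Beta a 1 = Gamma a * kern (a + 1) (t - s)"
    by (simp add: kern_def Beta_def)
  ultimately show ?thesis
    using lborel_has_bochner_integral_real_affine_iff[of 1 "\<lambda>\<tau>. indicator {s<..<t} \<tau> * (t - \<tau>) powr (a - 1)"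
      "Gamma a * kern (a + 1) (t - s)" s] by simp
qed

context fractional_order
begin

lemma mittag_leffler_0: "mittag_leffler a 0 = of_real (ml_coeff a 0)"
  unfolding mittag_leffler_def by (subst suminf_finite[of "{0}"]) auto

text \<open>The kernel \<open>e\<close> of index \<open>\<mu>\<close> cannot have a first zero. For
  \<open>s < t < t0\<close> the power kernel satisfies \<open>(t0 - s)^(\<mu>-1) \<le> (t0/t)^(\<mu>-1) (t
  - s)^(\<mu>-1)\<close>, so by the Volterra equation at time \<open>t\<close> the history up to
  \<open>t\<close> contributes at most \<open>(t0/t)^(\<mu>-1) (kern \<mu> t - e t)\<close> to the
  Volterra integral at time \<open>t0\<close>. If \<open>t\<close> is a maximum point of \<open>e\<close>
  on \<open>[t, t0]\<close>, the rest contributes at most \<open>e t\<close> times \<open>\<kappa> (t0 -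
  t)^\<mu> / \<Gamma>(\<mu>+1)\<close>. Altogether \<open>e t0 \<ge> e t ((t0/t)^(\<mu>-1) - \<kappa> (t0
  - t)^\<mu> / \<Gamma>(\<mu>+1))\<close>, which is positive when \<open>t\<close> is close to
  \<open>t0\<close>.\<close>

lemma ml_kern_pos_step:
  fixes \<kappa> t0 :: real
  assumes l: "\<kappa> > 0" and t0: "t0 > 0" and pos: "\<And>t. 0 < t \<Longrightarrow> t < t0 \<Longrightarrow> 0 < ml_kern \<mu> \<kappa> t"
  shows "0 < ml_kern \<mu> \<kappa> t0"
proof (rule ccontr)
  assume "\<not> 0 < ml_kern \<mu> \<kappa> t0"
  then have neg: "ml_kern \<mu> \<kappa> t0 \<le> 0" by simp
  define e where "e = ml_kern \<mu> \<kappa>"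
  have ce: "continuous_on {0<..} e" unfolding e_def by (rule continuous_on_ml_kern[OF mu0])
  have "((\<lambda>d. d powr \<mu>) \<longlongrightarrow> 0 powr \<mu>) (at_right 0)"
    by (rule tendsto_powr'[OF tendsto_ident_at tendsto_const]) (use mu0 eventually_at_right_less[of 0] in \<open>auto elim: eventually_mono\<close>)
  from tendsto_mult[OF tendsto_const[of "\<kappa> / Gamma (\<mu> + 1)"] this]
  have "((\<lambda>d. \<kappa> * kern (\<mu> + 1) d) \<longlongrightarrow> 0) (at_right 0)" using mu0 by (simp add: kern_def)
  then have "eventually (\<lambda>d. \<kappa> * kern (\<mu> + 1) d < 1/2) (at_right 0)"
    by (rule order_tendstoD) simp
  then obtain d0 where d0: "d0 > 0" "\<And>d. 0 < d \<Longrightarrow> d < d0 \<Longrightarrow> \<kappa> * kern (\<mu> + 1) d < 1/2"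
    by (auto simp: eventually_at_right_field)
  \<comment> \<open>Beyond \<open>t0 / 2\<close> the factor \<open>r\<close> below is at least
    \<open>1/2\<close>, and within \<open>d0\<close> of \<open>t0\<close> the contribution of the
    remaining history has a factor below \<open>1/2\<close>.\<close>
  define s0 where "s0 = max (t0 / 2) (t0 - d0 / 2)"
  have s0: "0 < s0" "s0 < t0" "t0 / 2 \<le> s0" "t0 - s0 < d0" using d0 t0 by (auto simp: s0_def)
  have "continuous_on {s0..t0} e" by (rule continuous_on_subset[OF ce]) (use s0 in auto)
  then obtain t where t: "t \<in> {s0..t0}" "\<And>s. s \<in> {s0..t0} \<Longrightarrow> e s \<le> e t"
    using continuous_attains_sup[of "{s0..t0}" e] s0 by auto
  have et: "e t > 0" using pos[of s0] s0 t(2)[of s0] by (auto simp: e_def)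
  have tt: "0 < t" "t < t0" "t0 / 2 \<le> t" "t0 - t < d0"
    using et neg t(1) s0 by (auto simp: e_def less_le)
  define r where "r = (t0 / t) powr (\<mu> - 1)"
  have r: "r \<ge> 1/2"
  proof -
    have "(t0 / t) powr (\<mu> - 1) \<ge> (t0 / t) powr (- 1)" using tt t0 mu0 by (intro powr_mono) auto
    moreover have "(t0 / t) powr (- 1) = t / t0" using tt t0 by (simp add: powr_minus_divide)
    moreover have "t / t0 \<ge> 1/2" using tt t0 by (simp add: field_simps)
    ultimately show ?thesis unfolding r_def by linarith
  qed
  have kr: "kern \<mu> t0 = r * kern \<mu> t"
    using tt t0 by (simp add: kern_def r_def powr_divide)
  have i1: "integrable lborel (\<lambda>\<tau>. indicator {0<..<s} \<tau> * ((s - \<tau>) powr (\<mu> - 1) * e \<tau>))"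
    and i2: "(LINT \<tau>|lborel. indicator {0<..<s} \<tau> * ((s - \<tau>) powr (\<mu> - 1) * e \<tau>)) = Gamma \<mu> * ((kern \<mu> s - e s) / \<kappa>)" if "s > 0" for s
  proof -
    have "frac_integrable \<mu> e s" "frac_integral \<mu> e s = ml_kern (\<mu> + \<mu>) \<kappa> s"
      unfolding e_def using frac_integral_ml_kern[OF mu0 less_imp_le[OF mu0] that] by auto
    moreover have "(kern \<mu> s - e s) / \<kappa> = ml_kern (\<mu> + \<mu>) \<kappa> s"
      using l ml_kern_recurrence[OF mu0 that, of \<kappa>] by (simp add: e_def)
    ultimately show "integrable lborel (\<lambda>\<tau>. indicator {0<..<s} \<tau> * ((s - \<tau>) powr (\<mu> - 1) * e \<tau>))"
      "(LINT \<tau>|lborel. indicator {0<..<s} \<tau> * ((s - \<tau>) powr (\<mu> - 1) * e \<tau>)) = Gamma \<mu> * ((kern \<mu> s - e s) / \<kappa>)"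
      using mu0 Gamma_real_pos[OF mu0]
      by (auto simp: frac_integrable_def frac_integral_def set_integrable_def set_lebesgue_integral_def field_simps)
  qed
  have k: "has_bochner_integral lborel (\<lambda>\<tau>. indicator {t<..<t0} \<tau> * (t0 - \<tau>) powr (\<mu> - 1)) (Gamma \<mu> * kern (\<mu> + 1) (t0 - t))"
    by (rule has_bochner_integral_kern_reflect) (use mu0 tt in auto)
  have "(LINT \<tau>|lborel. indicator {0<..<t0} \<tau> * ((t0 - \<tau>) powr (\<mu> - 1) * e \<tau>)) \<le>
     (LINT \<tau>|lborel. r * (indicator {0<..<t} \<tau> * ((t - \<tau>) powr (\<mu> - 1) * e \<tau>)) + e t * (indicator {t<..<t0} \<tau> * (t0 - \<tau>) powr (\<mu> - 1)))"
  proof (rule integral_mono_AE)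
    show "integrable lborel (\<lambda>\<tau>. r * (indicator {0<..<t} \<tau> * ((t - \<tau>) powr (\<mu> - 1) * e \<tau>)) + e t * (indicator {t<..<t0} \<tau> * (t0 - \<tau>) powr (\<mu> - 1)))"
      using i1[OF tt(1)] k by (intro Bochner_Integration.integrable_add integrable_mult_right) (auto simp: has_bochner_integral_iff)
    show "AE \<tau> in lborel. indicator {0<..<t0} \<tau> * ((t0 - \<tau>) powr (\<mu> - 1) * e \<tau>) \<le>
       r * (indicator {0<..<t} \<tau> * ((t - \<tau>) powr (\<mu> - 1) * e \<tau>)) + e t * (indicator {t<..<t0} \<tau> * (t0 - \<tau>) powr (\<mu> - 1))"
      using AE_lborel_singleton[of t]
    proof eventually_elim
      case (elim \<tau>)
      consider "\<tau> \<le> 0 \<or> \<tau> \<ge> t0" | "0 < \<tau>" "\<tau> < t" | "t < \<tau>" "\<tau> < t0" using elim by linarith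
      then show ?case
      proof cases
        case 1 then show ?thesis using tt by (auto simp: indicator_def)
      next
        case 2
        have "(t0 / t) * (t - \<tau>) \<le> t0 - \<tau>"
        proof -
          have "t * \<tau> \<le> t0 * \<tau>" using 2 tt by (intro mult_right_mono) auto
          then show ?thesis using tt by (simp add: field_simps)
        qed
        then have "(t0 - \<tau>) powr (\<mu> - 1) \<le> ((t0 / t) * (t - \<tau>)) powr (\<mu> - 1)"
          using 2 tt mu1 by (intro powr_mono2') auto
        also have "\<dots> = r * (t - \<tau>) powr (\<mu> - 1)" using 2 tt t0 by (subst powr_mult) (auto simp: r_def)
        finally have "(t0 - \<tau>) powr (\<mu> - 1) * e \<tau> \<le> r * (t - \<tau>) powr (\<mu> - 1) * e \<tau>"
          using pos[of \<tau>] 2 tt by (intro mult_right_mono) (auto simp: e_def)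
        then show ?thesis using 2 tt by (simp add: mult_ac)
      next
        case 3
        have "(t0 - \<tau>) powr (\<mu> - 1) * e \<tau> \<le> (t0 - \<tau>) powr (\<mu> - 1) * e t"
          using t(2)[of \<tau>] t(1) 3 by (intro mult_left_mono) auto
        then show ?thesis using 3 tt by (simp add: mult_ac)
      qed
    qed
  qed (use i1[OF t0] in auto)
  also have "\<dots> = r * (Gamma \<mu> * ((kern \<mu> t - e t) / \<kappa>)) + e t * (Gamma \<mu> * kern (\<mu> + 1) (t0 - t))"
    using i1[OF tt(1)] i2[OF tt(1)] k by (simp add: has_bochner_integral_iff)
  finally have "Gamma \<mu> * ((kern \<mu> t0 - e t0) / \<kappa>) \<le> r * (Gamma \<mu> * ((kern \<mu> t - e t) / \<kappa>)) + e t * (Gamma \<mu> * kern (\<mu> + 1) (t0 - t))"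
    unfolding i2[OF t0] .
  also have "\<dots> = Gamma \<mu> * ((r * (kern \<mu> t - e t) + e t * (\<kappa> * kern (\<mu> + 1) (t0 - t))) / \<kappa>)"
    using l by (simp add: field_simps)
  finally have "kern \<mu> t0 - e t0 \<le> r * (kern \<mu> t - e t) + e t * (\<kappa> * kern (\<mu> + 1) (t0 - t))"
    using l Gamma_real_pos[OF mu0] by (simp add: divide_le_cancel)
  moreover have "e t * (\<kappa> * kern (\<mu> + 1) (t0 - t)) < e t * r"
    using d0(2)[of "t0 - t"] tt et r by (intro mult_strict_left_mono) auto
  ultimately have "e t0 > 0" unfolding kr by (simp add: algebra_simps)
  then show False using neg by (simp add: e_def)
qed

text \<open>The function \<open>t^(1-\<mu>) e(t)\<close> is continuous up to \<open>t = 0\<close> with a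
  positive value there, so a nonpositive value would force a first zero of the kernel at a positive
  time.\<close>

lemma ml_kern_pos:
  fixes \<kappa> t :: real
  assumes l: "\<kappa> > 0" and t: "t > 0"
  shows "0 < ml_kern \<mu> \<kappa> t"
proof (rule ccontr)
  assume neg: "\<not> 0 < ml_kern \<mu> \<kappa> t"
  define q where "q s = mittag_leffler \<mu> (- (s powr \<mu> * \<kappa>))" for s
  have cq: "continuous_on {0..t} q"
    unfolding q_def using mu0
    by (intro continuous_on_compose2[OF continuous_at_imp_continuous_on[of UNIV "mittag_leffler \<mu>"]] continuous_intros continuous_on_powr')
       (auto simp: isCont_mittag_leffler)
  have eq: "ml_kern \<mu> \<kappa> s = s powr (\<mu> - 1) * q s" if "s > 0" for s
    using ml_kern_mittag_leffler[OF mu0 that, of \<kappa>] by (simp add: q_def)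
  \<comment> \<open>The infimum of \<open>Z\<close> is the first zero.\<close>
  define Z where "Z = {s \<in> {0..t}. q s \<le> 0}"
  have "closed Z" unfolding Z_def by (intro continuous_on_closed_Collect_le cq continuous_intros)
  moreover have Z: "t \<in> Z" "bdd_below Z" using neg eq[OF t] t by (auto simp: Z_def zero_less_mult_iff)
  ultimately have I: "Inf Z \<in> Z" using closed_contains_Inf[of Z] by blast
  have "q 0 > 0" using mu0 ml_coeff_pos[OF mu0, of 0] by (simp add: q_def mittag_leffler_0)
  then have t0: "0 < Inf Z" using I by (auto simp: Z_def less_le)
  have "0 < ml_kern \<mu> \<kappa> (Inf Z)"
  proof (rule ml_kern_pos_step[OF l t0])
    fix s assume s: "0 < s" "s < Inf Z"
    then have "s \<notin> Z" using cInf_lower[OF _ Z(2), of s] by auto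
    then have "q s > 0" using s I by (auto simp: Z_def)
    then show "0 < ml_kern \<mu> \<kappa> s" using eq[OF s(1)] s by simp
  qed
  then show False using eq[OF t0] I t0 by (auto simp: Z_def zero_less_mult_iff)
qed

text \<open>For \<open>a \<ge> \<mu>\<close> the kernel is a fractional integral of the positive kernel
  of index \<open>\<mu>\<close>.\<close>

lemma ml_kern_nonneg:
  fixes \<kappa> t :: real
  assumes "\<kappa> > 0" "t > 0" "a \<ge> \<mu>"
  shows "0 \<le> ml_kern a \<kappa> t"
proof -
  have "0 \<le> frac_integral (a - \<mu>) (ml_kern \<mu> \<kappa>) t"
    using assms ml_kern_pos by (intro frac_integral_nonneg) (auto intro: less_imp_le)
  then show ?thesis using frac_integral_ml_kern(2)[OF mu0, of "a - \<mu>" t \<kappa>] assms by simp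
qed

lemma ml_kern_le_kern:
  fixes \<kappa> t :: real
  assumes "\<kappa> > 0" "t > 0" "a \<ge> \<mu>"
  shows "ml_kern a \<kappa> t \<le> kern a t"
  using ml_kern_recurrence[of a t \<kappa>] ml_kern_nonneg[of \<kappa> t "a + \<mu>"] assms mu0 by (auto simp: mult_nonneg_nonneg)

lemma ml_kern_1_le_1: "\<kappa> > 0 \<Longrightarrow> t > 0 \<Longrightarrow> ml_kern 1 \<kappa> t \<le> (1 :: real)"
  using ml_kern_le_kern[of \<kappa> t 1] mu1 by simp

lemma ml_kern_1_eq: "t > 0 \<Longrightarrow> ml_kern 1 \<kappa> t = 1 - \<kappa> * ml_kern (1 + \<mu>) \<kappa> t"
  using ml_kern_recurrence[of 1 t \<kappa>] by simp

lemma ml_kern_0: "a > 0 \<Longrightarrow> t > 0 \<Longrightarrow> ml_kern a 0 t = of_real (kern a t)"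
  using ml_kern_recurrence[of a t 0] by simp

text \<open>The resolvent identity for the Volterra operators \<open>1 + x I^\<mu>\<close> and \<open>1
  + z I^\<mu>\<close>. Expanding the first factor in powers of \<open>x\<close>, the term \<open>i\<close>
  of the convolution is \<open>(-x)^i\<close> times the \<open>z\<close>-kernel of index \<open>a +
  \<mu>(i+1)\<close>. The recurrence expresses \<open>z\<close> times this term by the
  \<open>z\<close>-kernel of index \<open>a + \<mu> i\<close>, and the resulting series telescope.\<close>

lemma ml_kern_resolvent:
  fixes z :: "'b::{real_normed_field, banach, second_countable_topology}" and x :: real
  assumes a: "a > 0" and t: "t > 0"
  shows "set_integrable lborel {0<..<t} (\<lambda>s. ml_kern \<mu> x (t - s) *\<^sub>R ml_kern a z s)"
    and "(z - of_real x) * (LINT s:{0<..<t}|lborel. ml_kern \<mu> x (t - s) *\<^sub>R ml_kern a z s) = of_real (ml_kern a x t) - ml_kern a z t"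
proof -
  define G where "G i s = indicator {0<..<t} s *\<^sub>R ((kern (\<mu> * real i + \<mu>) (t - s) * (- x) ^ i) *\<^sub>R ml_kern a z s)" for i s
  have p: "\<mu> * real i + \<mu> > 0" for i using mu0 by (intro add_nonneg_pos) auto
  have G: "integrable lborel (G i)" "integral\<^sup>L lborel (G i) = (- x) ^ i *\<^sub>R ml_kern (a + \<mu> * real (Suc i)) z t" for i
  proof -
    let ?b = "\<mu> * real i + \<mu>"
    have f: "frac_integrable ?b (ml_kern a z) t" "frac_integral ?b (ml_kern a z) t = ml_kern (?b + a) z t"
      using frac_integral_ml_kern[OF a less_imp_le[OF p[of i]] t, of z] by auto
    have G': "G i s = ((- x) ^ i / Gamma ?b) *\<^sub>R (indicator {0<..<t} s *\<^sub>R ((t - s) powr (?b - 1)) *\<^sub>R ml_kern a z s)" for s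
      by (simp add: G_def kern_def mult_ac)
    show "integrable lborel (G i)"
      using f(1) p[of i] unfolding G' frac_integrable_def set_integrable_def by (intro integrable_scaleR_right) auto
    show "integral\<^sup>L lborel (G i) = (- x) ^ i *\<^sub>R ml_kern (a + \<mu> * real (Suc i)) z t"
    proof -
      have "integral\<^sup>L lborel (G i) = ((- x) ^ i / Gamma ?b) *\<^sub>R (LINT s|lborel. indicator {0<..<t} s *\<^sub>R ((t - s) powr (?b - 1)) *\<^sub>R ml_kern a z s)"
        unfolding G'[abs_def] by (rule integral_scaleR_right)
      also have "\<dots> = (- x) ^ i *\<^sub>R frac_integral ?b (ml_kern a z) t"
        using p[of i] unfolding frac_integral_def set_lebesgue_integral_def by simp
      finally have "integral\<^sup>L lborel (G i) = (- x) ^ i *\<^sub>R frac_integral ?b (ml_kern a z) t" .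
      then show ?thesis unfolding f(2) by (simp add: algebra_simps)
    qed
  qed
  define C where "C = ml_bound a (t powr \<mu> * norm z)"
  have C: "norm (ml_kern a z s) \<le> C * kern a s" if "0 < s" "s \<le> t" for s
    unfolding C_def by (rule norm_ml_kern_le[OF a that])
  have C0: "C \<ge> 0" unfolding C_def by (rule ml_bound_nonneg[OF a]) simp
  define d where "d i = Gamma \<mu> * (ml_coeff \<mu> i * (t powr \<mu> * norm x) ^ i)" for i
  have d: "summable d" unfolding d_def by (intro summable_mult summable_ml_coeff mu0)
  have le: "norm (G i s) \<le> d i * (C * (indicator {0<..<t} s * (kern \<mu> (t - s) * kern a s)))" for i s
  proof (cases "0 < s \<and> s < t")
    case True
    have "norm (kern (\<mu> * real i + \<mu>) (t - s) *\<^sub>R (- x) ^ i) \<le> d i * kern \<mu> (t - s)"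
      unfolding d_def by (rule ml_kern_term_le[OF mu0]) (use True in auto)
    then have "norm (kern (\<mu> * real i + \<mu>) (t - s) *\<^sub>R (- x) ^ i) * norm (ml_kern a z s) \<le> (d i * kern \<mu> (t - s)) * (C * kern a s)"
      using C[of s] True by (intro mult_mono) (auto intro: order_trans[OF norm_ge_zero])
    then show ?thesis using True by (simp add: G_def mult_ac)
  qed (auto simp: G_def)
  have ik: "integrable lborel (\<lambda>s. C * (indicator {0<..<t} s * (kern \<mu> (t - s) * kern a s)))"
  proof -
    have "integrable lborel (\<lambda>s. (C / (Gamma \<mu> * Gamma a)) * (indicator {0<..<t} s * ((t - s) powr (\<mu> - 1) * s powr (a - 1))))"
      using has_bochner_integral_beta[OF mu0 a t] by (intro integrable_mult_right) (simp add: has_bochner_integral_iff)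
    then show ?thesis by (simp add: kern_def mult_ac)
  qed
  have 1: "AE s in lborel. summable (\<lambda>i. norm (G i s))"
    by (intro AE_I2 summable_comparison_test'[OF summable_mult2[OF d], of 0]) (use le in auto)
  have 2: "summable (\<lambda>i. LINT s|lborel. norm (G i s))"
  proof (rule summable_comparison_test'[OF summable_mult2[OF d, of "LINT s|lborel. C * (indicator {0<..<t} s * (kern \<mu> (t - s) * kern a s))"], of 0])
    fix i
    have "(LINT s|lborel. norm (G i s)) \<le> (LINT s|lborel. d i * (C * (indicator {0<..<t} s * (kern \<mu> (t - s) * kern a s))))"
      using G(1) ik le by (intro integral_mono integrable_mult_right) auto
    also have "\<dots> = d i * (LINT s|lborel. C * (indicator {0<..<t} s * (kern \<mu> (t - s) * kern a s)))"
      by simp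
    finally show "norm (LINT s|lborel. norm (G i s)) \<le> d i * (LINT s|lborel. C * (indicator {0<..<t} s * (kern \<mu> (t - s) * kern a s)))" by simp
  qed
  have eq: "(\<Sum>i. G i s) = indicator {0<..<t} s *\<^sub>R (ml_kern \<mu> x (t - s) *\<^sub>R ml_kern a z s)" for s
  proof (cases "0 < s \<and> s < t")
    case True
    have "summable (\<lambda>i. kern (\<mu> * real i + \<mu>) (t - s) * (- x) ^ i)"
      using summable_norm_cancel[OF summable_ml_kern[OF mu0, of "t - s" x]] True by simp
    then show ?thesis using True by (simp add: G_def ml_kern_def suminf_scaleR_left)
  qed (auto simp: G_def)
  show "set_integrable lborel {0<..<t} (\<lambda>s. ml_kern \<mu> x (t - s) *\<^sub>R ml_kern a z s)"
    using integrable_suminf[OF G(1) 1 2] unfolding eq set_integrable_def .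
  define S where "S = (LINT s:{0<..<t}|lborel. ml_kern \<mu> x (t - s) *\<^sub>R ml_kern a z s)"
  \<comment> \<open>The series of the \<open>w i\<close> is summed in two ways: by shifting the
    index, and by the recurrence.\<close>
  define w where "w i = (- x) ^ i *\<^sub>R ml_kern (a + \<mu> * real i) z t" for i
  have wS: "(\<lambda>i. (- x) ^ i *\<^sub>R ml_kern (a + \<mu> * real (Suc i)) z t) sums S"
    using sums_integral[OF G(1) 1 2] unfolding eq G(2) by (simp add: S_def set_lebesgue_integral_def)
  have rec: "ml_kern (a + \<mu> * real i) z t = of_real (kern (\<mu> * real i + a) t) - z * ml_kern (a + \<mu> * real (Suc i)) z t" for i
    using ml_kern_recurrence[of "a + \<mu> * real i" t z] a t mu0 by (simp add: add_pos_nonneg algebra_simps)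
  have "(\<lambda>i. w (Suc i)) sums (- x *\<^sub>R S)"
    using sums_scaleR_right[OF wS, of "- x"] by (simp add: w_def)
  then have "w sums (- x *\<^sub>R S + w 0)" by (rule sums_Suc)
  moreover have "w sums (of_real (ml_kern a x t) - z * S)"
  proof -
    have "(\<lambda>i. kern (\<mu> * real i + a) t *\<^sub>R (- x) ^ i) sums ml_kern a x t"
      unfolding ml_kern_def by (rule summable_sums[OF summable_norm_cancel[OF summable_ml_kern[OF a t]]])
    then have "(\<lambda>i. of_real (kern (\<mu> * real i + a) t *\<^sub>R (- x) ^ i)) sums (of_real (ml_kern a x t) :: 'b)"
      by (rule sums_of_real)
    moreover have "w i = of_real (kern (\<mu> * real i + a) t *\<^sub>R (- x) ^ i) - z * ((- x) ^ i *\<^sub>R ml_kern (a + \<mu> * real (Suc i)) z t)" for i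
      unfolding w_def rec[of i] by (simp add: scaleR_conv_of_real ring_distribs)
    ultimately show ?thesis using sums_diff[OF _ sums_mult[OF wS, of z]] by presburger
  qed
  ultimately have "- x *\<^sub>R S + w 0 = of_real (ml_kern a x t) - z * S" by (rule sums_unique2)
  then show "(z - of_real x) * (LINT s:{0<..<t}|lborel. ml_kern \<mu> x (t - s) *\<^sub>R ml_kern a z s) = of_real (ml_kern a x t) - ml_kern a z t"
    unfolding S_def[symmetric] by (simp add: w_def scaleR_conv_of_real algebra_simps)
qed

text \<open>By the resolvent identity the difference is \<open>y - x\<close> times a convolution of
  positive kernels.\<close>

lemma ml_kern_antimono:
  fixes x y t :: real
  assumes "0 < x" "x \<le> y" "0 < t"
  shows "ml_kern \<mu> y t \<le> ml_kern \<mu> x t"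
proof -
  have "0 \<le> (LINT s:{0<..<t}|lborel. ml_kern \<mu> x (t - s) *\<^sub>R ml_kern \<mu> y s)"
    unfolding set_lebesgue_integral_def using ml_kern_pos[of x] ml_kern_pos[of y] assms
    by (intro Bochner_Integration.integral_nonneg) (auto simp: indicator_def less_imp_le)
  then have "0 \<le> (y - x) * (LINT s:{0<..<t}|lborel. ml_kern \<mu> x (t - s) *\<^sub>R ml_kern \<mu> y s)"
    using assms by (intro mult_nonneg_nonneg) auto
  then show ?thesis using ml_kern_resolvent(2)[OF mu0 \<open>0 < t\<close>, of y x] by simp
qed

text \<open>The factor \<open>E(- \<kappa> \<tau>^\<mu>)\<close> of the kernel decreases in
  \<open>\<tau>\<close>, so on \<open>(0, t)\<close> the kernel is at least its value at \<open>t\<close>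
  times \<open>(\<tau>/t)^(\<mu>-1)\<close>; hence \<open>t / \<mu>\<close> times the value at
  \<open>t\<close> is at most the integral of the kernel, which is at most \<open>1 /
  \<kappa>\<close>.\<close>

lemma ml_kern_decay:
  fixes \<kappa> t :: real
  assumes "0 < \<kappa>" "0 < t"
  shows "\<kappa> * t * ml_kern \<mu> \<kappa> t \<le> 1"
proof -
  define P where "P = mittag_leffler \<mu> (- (t powr \<mu> * \<kappa>))"
  have et: "ml_kern \<mu> \<kappa> t = t powr (\<mu> - 1) * P"
    using ml_kern_mittag_leffler[OF mu0 assms(2), of \<kappa>] by (simp add: P_def)
  have "(Gamma \<mu> * P) * kern \<mu> \<tau> \<le> ml_kern \<mu> \<kappa> \<tau>" if \<tau>: "0 < \<tau>" "\<tau> \<le> t" for \<tau>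
  proof -
    have m1: "ml_kern \<mu> y 1 = mittag_leffler \<mu> (- y)" for y :: real
      using ml_kern_mittag_leffler[OF mu0, of 1 y] by simp
    have "\<tau> powr \<mu> * \<kappa> \<le> t powr \<mu> * \<kappa>" using \<tau> assms mu0 by (intro mult_right_mono powr_mono2) auto
    from ml_kern_antimono[OF _ this, of 1] have "P \<le> mittag_leffler \<mu> (- (\<tau> powr \<mu> * \<kappa>))" using \<tau> assms by (simp add: P_def m1)
    then have "\<tau> powr (\<mu> - 1) * P \<le> \<tau> powr (\<mu> - 1) * mittag_leffler \<mu> (- (\<tau> powr \<mu> * \<kappa>))" by (rule mult_left_mono) simp
    then show ?thesis using ml_kern_mittag_leffler[OF mu0 \<tau>(1), of \<kappa>] Gamma_mult_kern[OF mu0, of \<tau>] by (simp add: mult_ac)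
  qed
  then have "frac_integral 1 (\<lambda>\<tau>. (Gamma \<mu> * P) * kern \<mu> \<tau>) t \<le> frac_integral 1 (ml_kern \<mu> \<kappa>) t"
    by (intro frac_integral_mono frac_integrable_mult_right frac_integrable_kern frac_integral_ml_kern assms mu0) auto
  then have "(Gamma \<mu> * P) * kern (1 + \<mu>) t \<le> ml_kern (1 + \<mu>) \<kappa> t"
    using frac_integral_kern[of 1 \<mu> t] frac_integral_ml_kern(2)[OF mu0, of 1 t \<kappa>] mu0 assms
    by (simp add: frac_integral_mult_right)
  also have "\<kappa> * ml_kern (1 + \<mu>) \<kappa> t \<le> 1"
    using ml_kern_1_eq[OF \<open>0 < t\<close>, of \<kappa>] ml_kern_nonneg[OF assms, of 1] mu1 by simp
  then have "ml_kern (1 + \<mu>) \<kappa> t \<le> 1 / \<kappa>" using assms by (simp add: field_simps)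
  finally have 1: "(Gamma \<mu> * P) * kern (1 + \<mu>) t \<le> 1 / \<kappa>" .
  have G: "Gamma (1 + \<mu>) = \<mu> * Gamma \<mu>"
    using Gamma_plus1[of \<mu>] mu0 nonpos_Ints_nonpos[of \<mu>] by (fastforce simp: add.commute)
  have "Gamma \<mu> > 0" by (rule Gamma_real_pos[OF mu0])
  have "(Gamma \<mu> * P) * kern (1 + \<mu>) t = t powr \<mu> * P / \<mu>"
    using \<open>Gamma \<mu> > 0\<close> mu0 unfolding kern_def G by (simp add: less_imp_neq[symmetric] field_simps)
  moreover have "t powr \<mu> = t * t powr (\<mu> - 1)"
    using assms by (simp add: powr_diff)
  ultimately have "t * ml_kern \<mu> \<kappa> t / \<mu> \<le> 1 / \<kappa>" using 1 by (simp add: et)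
  then have "\<kappa> * t * ml_kern \<mu> \<kappa> t \<le> \<mu>" using assms mu0 by (simp add: field_simps)
  then show ?thesis using mu1 by simp
qed

definition sqrt_const :: real where "sqrt_const = Gamma (\<mu> / 2) / sqrt (Gamma \<mu>)"

lemma sqrt_const_pos: "sqrt_const > 0"
  using mu0 by (auto simp: sqrt_const_def intro!: divide_pos_pos Gamma_real_pos)

text \<open>For \<open>b = 0\<close> this is the geometric mean of the bounds \<open>1 / (\<kappa>
  t)\<close> and \<open>kern \<mu> t\<close>; fractional integration gives the general case. The gain of
  \<open>sqrt \<kappa>\<close> takes data in the pivot space to solutions in the form domain.\<close>

lemma sqrt_ml_kern_le:
  fixes \<kappa> t :: real
  assumes "0 < \<kappa>" "0 < t" "0 \<le> b"
  shows "sqrt \<kappa> * ml_kern (b + \<mu>) \<kappa> t \<le> sqrt_const * kern (b + \<mu> / 2) t"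
proof -
  have base: "sqrt \<kappa> * ml_kern \<mu> \<kappa> \<tau> \<le> sqrt_const * kern (\<mu> / 2) \<tau>" if \<tau>: "0 < \<tau>" for \<tau>
  proof (rule power2_le_imp_le)
    have e: "0 \<le> ml_kern \<mu> \<kappa> \<tau>" using ml_kern_pos[OF assms(1) \<tau>] by simp
    have "(sqrt \<kappa> * ml_kern \<mu> \<kappa> \<tau>)\<^sup>2 = (\<kappa> * ml_kern \<mu> \<kappa> \<tau>) * ml_kern \<mu> \<kappa> \<tau>"
      using assms by (simp add: power_mult_distrib power2_eq_square)
    also have "\<dots> \<le> (1 / \<tau>) * kern \<mu> \<tau>"
      using ml_kern_decay[OF assms(1) \<tau>] ml_kern_le_kern[OF assms(1) \<tau>, of \<mu>] e \<tau> assms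
      by (intro mult_mono) (auto simp: field_simps)
    also have "\<dots> = (sqrt_const * kern (\<mu> / 2) \<tau>)\<^sup>2"
    proof -
      have "Gamma \<mu> > 0" "Gamma (\<mu> / 2) > 0" using mu0 by (auto intro!: Gamma_real_pos)
      moreover have "(\<tau> powr (\<mu> / 2 - 1))\<^sup>2 = \<tau> powr (\<mu> - 1) / \<tau>"
        using \<tau> by (simp add: power2_eq_square powr_add[symmetric] powr_diff)
      ultimately show ?thesis
        by (simp add: sqrt_const_def kern_def power_mult_distrib power_divide less_imp_neq[symmetric])
    qed
    finally show "(sqrt \<kappa> * ml_kern \<mu> \<kappa> \<tau>)\<^sup>2 \<le> (sqrt_const * kern (\<mu> / 2) \<tau>)\<^sup>2" .
    show "0 \<le> sqrt_const * kern (\<mu> / 2) \<tau>" using sqrt_const_pos kern_nonneg[of "\<mu> / 2"] mu0 by simp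
  qed
  have "frac_integral b (\<lambda>\<tau>. sqrt \<kappa> * ml_kern \<mu> \<kappa> \<tau>) t \<le> frac_integral b (\<lambda>\<tau>. sqrt_const * kern (\<mu> / 2) \<tau>) t"
    using base assms mu0
    by (intro frac_integral_mono frac_integrable_mult_right frac_integrable_kern frac_integral_ml_kern) auto
  then show ?thesis
    using frac_integral_kern[of b "\<mu> / 2" t] frac_integral_ml_kern(2)[OF mu0, of b t \<kappa>] mu0 assms
    by (simp add: frac_integral_mult_right)
qed

text \<open>The resolvent identity bounds \<open>|e(z, s)|\<close> by \<open>1\<close> plus \<open>|z -
  x|\<close> times the convolution of \<open>|e(z)|\<close> with the positive kernel of index
  \<open>\<mu>\<close> at \<open>x\<close>, whose integral is at most \<open>1 / x\<close>. Hence the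
  supremum \<open>S\<close> over \<open>(0, t]\<close> satisfies \<open>S \<le> 1 + S / 2\<close>.\<close>

lemma norm_ml_kern_1_le_2:
  fixes z :: "'b::{real_normed_field, banach, second_countable_topology}" and x t :: real
  assumes x: "x > 0" and z: "norm (z - of_real x) \<le> x / 2" and t: "t > 0"
  shows "norm (ml_kern 1 z t) \<le> 2"
proof -
  define B where "B = (\<lambda>s. norm (ml_kern 1 z s)) ` {0<..t}"
  have bd: "bdd_above B"
  proof (rule bdd_aboveI[of _ "ml_bound 1 (t powr \<mu> * norm z)"])
    fix y assume "y \<in> B"
    then show "y \<le> ml_bound 1 (t powr \<mu> * norm z)"
      using norm_ml_kern_le[of 1 _ t z] by (auto simp: B_def)
  qed
  have ne: "B \<noteq> {}" using t by (auto simp: B_def)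
  define S where "S = Sup B"
  have S: "norm (ml_kern 1 z s) \<le> S" if "0 < s" "s \<le> t" for s
    unfolding S_def by (rule cSup_upper[OF _ bd]) (use that in \<open>auto simp: B_def\<close>)
  have S0: "0 \<le> S" using S[OF t] by (meson norm_ge_zero order.trans order_refl)
  have "y \<le> 1 + S / 2" if "y \<in> B" for y
  proof -
    obtain s where s: "0 < s" "s \<le> t" "y = norm (ml_kern 1 z s)" using \<open>y \<in> B\<close> by (auto simp: B_def)
    define J where "J = (LINT r:{0<..<s}|lborel. ml_kern \<mu> x (s - r) *\<^sub>R ml_kern 1 z r)"
    define K where "K = (LINT r:{0<..<s}|lborel. ml_kern \<mu> x (s - r) *\<^sub>R ml_kern 1 (0::real) r)"
    have "x * K = 1 - ml_kern 1 x s"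
      using ml_kern_resolvent(2)[OF zero_less_one \<open>0 < s\<close>, of "0::real" x] ml_kern_0[of 1 s, where 'a = real] s by (simp add: K_def)
    then have xK: "x * K \<le> 1" using ml_kern_nonneg[OF x s(1), of 1] mu1 by simp
    have "norm J \<le> (LINT r:{0<..<s}|lborel. norm (ml_kern \<mu> x (s - r) *\<^sub>R ml_kern 1 z r))"
      unfolding J_def by (rule set_integral_norm_bound[OF ml_kern_resolvent(1)[OF zero_less_one s(1)]])
    also have "\<dots> \<le> (LINT r:{0<..<s}|lborel. S * (ml_kern \<mu> x (s - r) *\<^sub>R ml_kern 1 (0::real) r))"
    proof (rule set_integral_mono)
      show "set_integrable lborel {0<..<s} (\<lambda>r. norm (ml_kern \<mu> x (s - r) *\<^sub>R ml_kern 1 z r))"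
        by (intro set_integrable_norm ml_kern_resolvent(1) s) simp
      show "set_integrable lborel {0<..<s} (\<lambda>r. S * (ml_kern \<mu> x (s - r) *\<^sub>R ml_kern 1 (0::real) r))"
        by (intro set_integrable_mult_right ml_kern_resolvent(1) s) simp
      fix r assume "r \<in> {0<..<s}"
      then show "norm (ml_kern \<mu> x (s - r) *\<^sub>R ml_kern 1 z r) \<le> S * (ml_kern \<mu> x (s - r) *\<^sub>R ml_kern 1 (0::real) r)"
        using ml_kern_0[of 1 r, where 'a = real] S[of r] ml_kern_pos[OF x, of "s - r"] s by (simp add: mult.commute mult_left_mono)
    qed
    also have "\<dots> = S * K" unfolding K_def by simp
    finally have J: "norm J \<le> S * K" .
    have "norm (z - of_real x) * norm J \<le> x / 2 * (S * K)"
      using J z x by (intro mult_mono) auto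
    also have "\<dots> = S / 2 * (x * K)" by simp
    also have "\<dots> \<le> S / 2 * 1" by (rule mult_left_mono[OF xK]) (use S0 in simp)
    finally have "norm ((z - of_real x) * J) \<le> S / 2" by (simp add: norm_mult)
    moreover have "ml_kern 1 z s = of_real (ml_kern 1 x s) - (z - of_real x) * J"
      using ml_kern_resolvent(2)[OF zero_less_one s(1), of z x] by (simp add: J_def)
    then have "norm (ml_kern 1 z s) \<le> norm (ml_kern 1 x s) + norm ((z - of_real x) * J)"
      by (metis norm_of_real norm_triangle_ineq4 real_norm_def)
    moreover have "norm (ml_kern 1 x s) \<le> 1" using ml_kern_1_le_1[OF x s(1)] ml_kern_nonneg[OF x s(1), of 1] mu1 by simp
    ultimately show ?thesis using s(3) by linarith
  qed
  then have "S \<le> 1 + S / 2" unfolding S_def using ne by (intro cSup_least) auto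
  then show ?thesis using S[OF t] by simp
qed

end

section \<open>Vanishing series of Mittag-Leffler kernels\<close>

text \<open>The hypothesis says that \<open>g\<close> is orthogonal to all polynomials, and
  \<open>g\<close> is a uniform limit of polynomials.\<close>

lemma vanishing_moments_imp_zero:
  fixes g :: "real \<Rightarrow> real"
  assumes g: "continuous_on {0..T} g" and T: "T > 0"
    and m: "\<And>m::nat. frac_integral (real m + 1) g T = 0" and t: "t \<in> {0..T}"
  shows "g t = 0"
proof -
  have m0: "integral {0..T} (\<lambda>\<tau>. (T - \<tau>) ^ m * g \<tau>) = 0" for m
  proof -
    have "Gamma (real m + 1) \<noteq> 0" using Gamma_real_pos[of "real m + 1"] by force
    then have "(LINT \<tau>:{0<..<T}|lborel. ((T - \<tau>) powr (real m + 1 - 1)) *\<^sub>R g \<tau>) = 0"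
      using m[of m] by (simp add: frac_integral_def)
    moreover have "(LINT \<tau>:{0<..<T}|lborel. ((T - \<tau>) powr (real m + 1 - 1)) *\<^sub>R g \<tau>) = (LINT \<tau>:{0<..<T}|lborel. (T - \<tau>) ^ m * g \<tau>)"
      by (intro set_lebesgue_integral_cong) (auto simp: powr_realpow)
    moreover have "set_integrable lborel {0<..<T} (\<lambda>\<tau>. (T - \<tau>) ^ m * g \<tau>)"
      by (rule set_integrable_subset[of _ "{0..T}"])
         (auto intro!: borel_integrable_atLeastAtMost' continuous_intros g)
    ultimately show ?thesis using set_borel_integral_eq_integral(2) integral_open_interval_real by metis
  qed
  have p0: "integral {0..T} (\<lambda>\<tau>. (\<Sum>i\<le>n. a i * (T - \<tau>) ^ i) * g \<tau>) = 0" for a and n :: nat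
  proof -
    have "integral {0..T} (\<lambda>\<tau>. (\<Sum>i\<le>n. a i * (T - \<tau>) ^ i) * g \<tau>) = integral {0..T} (\<lambda>\<tau>. \<Sum>i\<le>n. a i * ((T - \<tau>) ^ i * g \<tau>))"
      by (simp add: sum_distrib_right mult.assoc)
    also have "\<dots> = (\<Sum>i\<le>n. integral {0..T} (\<lambda>\<tau>. a i * ((T - \<tau>) ^ i * g \<tau>)))"
      by (intro integral_sum integrable_continuous_interval continuous_intros g) auto
    also have "\<dots> = 0" using m0 by simp
    finally show ?thesis .
  qed
  have bound: "integral {0..T} (\<lambda>\<tau>. g \<tau> * g \<tau>) \<le> e * integral {0..T} (\<lambda>\<tau>. \<bar>g \<tau>\<bar>)" if "e > 0" for e
  proof -
    have "continuous_on {0..T} (\<lambda>x. g (T - x))"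
      by (rule continuous_on_compose2[OF g]) (auto intro!: continuous_intros)
    then obtain q where q: "real_polynomial_function q" "\<And>x. x \<in> {0..T} \<Longrightarrow> \<bar>g (T - x) - q x\<bar> < e"
      using Stone_Weierstrass_real_polynomial_function[OF compact_Icc _ \<open>e > 0\<close>] by blast
    then obtain a n where qa: "q = (\<lambda>x. \<Sum>i\<le>n. a i * x ^ i)" unfolding real_polynomial_function_iff_sum by blast
    have cq: "continuous_on {0..T} (\<lambda>\<tau>. q (T - \<tau>))" unfolding qa by (intro continuous_intros)
    have "integral {0..T} (\<lambda>\<tau>. g \<tau> * g \<tau>) = integral {0..T} (\<lambda>\<tau>. (g \<tau> - q (T - \<tau>)) * g \<tau>) + integral {0..T} (\<lambda>\<tau>. q (T - \<tau>) * g \<tau>)"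
      by (subst Henstock_Kurzweil_Integration.integral_add[symmetric])
         (auto intro!: integrable_continuous_interval continuous_intros g cq simp: algebra_simps)
    also have "\<dots> = integral {0..T} (\<lambda>\<tau>. (g \<tau> - q (T - \<tau>)) * g \<tau>)" using p0 by (simp add: qa)
    also have "\<dots> \<le> integral {0..T} (\<lambda>\<tau>. e * \<bar>g \<tau>\<bar>)"
    proof (rule integral_le)
      fix \<tau> assume "\<tau> \<in> {0..T}"
      then have "\<bar>g \<tau> - q (T - \<tau>)\<bar> \<le> e" using q(2)[of "T - \<tau>"] by simp
      then have "\<bar>g \<tau> - q (T - \<tau>)\<bar> * \<bar>g \<tau>\<bar> \<le> e * \<bar>g \<tau>\<bar>" by (rule mult_right_mono) simp
      then show "(g \<tau> - q (T - \<tau>)) * g \<tau> \<le> e * \<bar>g \<tau>\<bar>" by (metis abs_ge_self abs_mult order_trans)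
    qed (auto intro!: integrable_continuous_interval continuous_intros g cq)
    finally show ?thesis by simp
  qed
  have nn: "0 \<le> integral {0..T} (\<lambda>\<tau>. \<bar>g \<tau>\<bar>)"
    by (rule Henstock_Kurzweil_Integration.integral_nonneg) (auto intro!: integrable_continuous_interval continuous_intros g)
  have "integral {0..T} (\<lambda>\<tau>. g \<tau> * g \<tau>) \<le> 0"
  proof (rule field_le_epsilon)
    fix e :: real assume "e > 0"
    define I where "I = integral {0..T} (\<lambda>\<tau>. \<bar>g \<tau>\<bar>)"
    have "integral {0..T} (\<lambda>\<tau>. g \<tau> * g \<tau>) \<le> e / (I + 1) * I"
      unfolding I_def by (rule bound) (use nn \<open>e > 0\<close> in auto)
    also have "\<dots> \<le> e" using nn \<open>e > 0\<close> by (simp add: I_def[symmetric] field_simps)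
    finally show "integral {0..T} (\<lambda>\<tau>. g \<tau> * g \<tau>) \<le> 0 + e" by simp
  qed
  moreover have "0 \<le> integral {0..T} (\<lambda>\<tau>. g \<tau> * g \<tau>)"
    by (rule Henstock_Kurzweil_Integration.integral_nonneg) (auto intro!: integrable_continuous_interval continuous_intros g)
  ultimately have "integral {0..T} (\<lambda>\<tau>. g \<tau> * g \<tau>) = 0" by simp
  moreover have "continuous_on {0..T} (\<lambda>\<tau>. g \<tau> * g \<tau>)" by (intro continuous_intros g)
  ultimately have "\<forall>x\<in>{0..T}. g x * g x = 0" using integral_eq_0_iff[OF _ T, of "\<lambda>\<tau>. g \<tau> * g \<tau>"] by simp
  then show ?thesis using t by simp
qed

context fractional_order
begin

lemma mittag_leffler_of_real: "a > 0 \<Longrightarrow> mittag_leffler a (of_real x) = of_real (mittag_leffler a x)"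
  unfolding mittag_leffler_def by (simp add: suminf_of_real[OF summable_ml_coeff])

lemma mittag_leffler_holomorphic: "a > 0 \<Longrightarrow> mittag_leffler a holomorphic_on S"
proof -
  assume "a > 0"
  have "(mittag_leffler a has_field_derivative (\<Sum>k. diffs (\<lambda>k. of_real (ml_coeff a k)) k * x ^ k)) (at x)" for x :: complex
    unfolding mittag_leffler_def[abs_def]
    by (rule termdiffs_strong_converges_everywhere) (rule summable_norm_cancel[OF summable_norm_ml_coeff[OF \<open>a > 0\<close>]])
  then show ?thesis by (meson field_differentiable_at_within field_differentiable_def holomorphic_onI)
qed

lemma norm_mittag_leffler_1_le_2:
  fixes z :: complex
  assumes "x > 0" "cmod (z - of_real x) \<le> x / 2"
  shows "cmod (mittag_leffler 1 (- z)) \<le> 2"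
  using norm_ml_kern_1_le_2[OF assms, of 1] ml_kern_mittag_leffler[of 1 1 z] by simp

text \<open>As functions of \<open>t^\<mu>\<close> the terms are entire. On the union \<open>S\<close>
  of the discs of radius \<open>x / 2\<close> around \<open>x > 0\<close>, a sector that is invariant
  under multiplication by each \<open>lam n\<close>, they are bounded by \<open>2 * \<bar>b
  n\<bar>\<close>, so the series is holomorphic on \<open>S\<close>. Being constant on an interval it is
  constant on the half line, where it tends to 0 at infinity.\<close>

lemma constant_series_eq_zero:
  fixes b lam :: "nat \<Rightarrow> real"
  assumes b: "summable (\<lambda>n. \<bar>b n\<bar>)" and l0: "l0 > 0" "\<And>n. l0 \<le> lam n" and T: "T > 0"
    and c: "\<And>t. 0 < t \<Longrightarrow> t < T \<Longrightarrow> (\<Sum>n. b n * ml_kern 1 (lam n) t) = c"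
  shows "c = 0"
proof -
  have lp: "lam n > 0" for n using l0 less_le_trans by blast
  define S where "S = (\<Union>x\<in>{0<..}. ball (complex_of_real x) (x / 2))"
  have oS: "open S" unfolding S_def by auto
  have rS: "of_real x \<in> S" if "x > 0" for x using that by (auto simp: S_def intro!: bexI[of _ x])
  have "convex S"
  proof (rule convexI)
    fix z w u v assume zw: "z \<in> S" "w \<in> S" and uv: "0 \<le> u" "0 \<le> v" "u + v = (1::real)"
    obtain x y where xy: "x > 0" "cmod (of_real x - z) < x / 2" "y > 0" "cmod (of_real y - w) < y / 2"
      using zw by (auto simp: S_def dist_norm)
    have p: "0 < u * x + v * y" using uv xy by (metis add_nonneg_pos add_pos_nonneg add_0 less_eq_real_def mult_nonneg_nonneg mult_pos_pos zero_less_one)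
    have "of_real (u * x + v * y) - (u *\<^sub>R z + v *\<^sub>R w) = u *\<^sub>R (of_real x - z) + v *\<^sub>R (of_real y - w)"
      by (simp add: scaleR_conv_of_real algebra_simps)
    also have "cmod \<dots> \<le> u * cmod (of_real x - z) + v * cmod (of_real y - w)"
      using uv by (metis abs_of_nonneg norm_scaleR norm_triangle_ineq)
    also have "\<dots> < (u * x + v * y) / 2"
    proof -
      have "u * cmod (of_real x - z) \<le> u * (x / 2)" "v * cmod (of_real y - w) \<le> v * (y / 2)"
        by (rule mult_left_mono[OF less_imp_le[OF xy(2)] uv(1)], rule mult_left_mono[OF less_imp_le[OF xy(4)] uv(2)])
      moreover have "u * cmod (of_real x - z) < u * (x / 2)" if "u > 0" using that xy by (intro mult_strict_left_mono)
      moreover have "v * cmod (of_real y - w) < v * (y / 2)" if "v > 0" using that xy by (intro mult_strict_left_mono)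
      moreover have "(u * x + v * y) / 2 = u * (x / 2) + v * (y / 2)" by (simp add: add_divide_distrib)
      moreover have "u > 0 \<or> v > 0" using uv by linarith
      ultimately show ?thesis by linarith
    qed
    finally show "u *\<^sub>R z + v *\<^sub>R w \<in> S" using p unfolding S_def by (auto simp: dist_norm intro!: bexI[of _ "u * x + v * y"])
  qed
  then have cS: "connected S" by (rule convex_connected)
  define f where "f n z = of_real (b n) * mittag_leffler 1 (- (of_real (lam n) * z))" for n and z :: complex
  define M where "M z = (\<Sum>n. f n z)" for z
  have le: "cmod (f n z) \<le> 2 * \<bar>b n\<bar>" if zS: "z \<in> S" for n z
  proof -
    obtain x where x: "x > 0" "cmod (of_real x - z) < x / 2" using zS by (auto simp: S_def dist_norm)
    have "cmod (of_real (lam n) * z - of_real (lam n * x)) = lam n * cmod (of_real x - z)"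
      using lp[of n] by (simp add: right_diff_distrib[symmetric] norm_mult norm_minus_commute)
    also have "\<dots> \<le> lam n * (x / 2)" using x lp[of n] by (intro mult_left_mono) auto
    finally have "cmod (mittag_leffler 1 (- (of_real (lam n) * z))) \<le> 2"
      using x lp[of n] by (intro norm_mittag_leffler_1_le_2[of "lam n * x"]) auto
    then have "\<bar>b n\<bar> * cmod (mittag_leffler 1 (- (of_real (lam n) * z))) \<le> \<bar>b n\<bar> * 2" by (rule mult_left_mono) simp
    then show ?thesis by (simp add: f_def norm_mult)
  qed
  have ul: "uniform_limit S (\<lambda>k z. \<Sum>n<k. f n z) M sequentially"
    unfolding M_def by (rule Weierstrass_m_test[OF le]) (use summable_mult[OF b, of 2] in auto)
  have fh: "f n holomorphic_on S" for n
    unfolding f_def by (intro holomorphic_intros holomorphic_on_compose_gen[OF _ mittag_leffler_holomorphic[of 1 UNIV], unfolded o_def]) auto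
  have hM: "M holomorphic_on S"
  proof (rule holomorphic_uniform_sequence[OF oS])
    show "(\<lambda>z. \<Sum>n<k. f n z) holomorphic_on S" for k by (intro holomorphic_intros fh)
    fix z assume "z \<in> S"
    then obtain d where "d > 0" "cball z d \<subseteq> S" using oS open_contains_cball by blast
    then show "\<exists>d>0. cball z d \<subseteq> S \<and> uniform_limit (cball z d) (\<lambda>k z. \<Sum>n<k. f n z) M sequentially"
      using uniform_limit_on_subset[OF ul] by blast
  qed
  have eq: "M (of_real (t powr \<mu>)) = of_real (\<Sum>n. b n * ml_kern 1 (lam n) t)" "summable (\<lambda>n. b n * ml_kern 1 (lam n) t)" if t: "t > 0" for t
  proof -
    have "f n (of_real (t powr \<mu>)) = of_real (b n * ml_kern 1 (lam n) t)" for n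
    proof -
      have "- (complex_of_real (lam n) * of_real (t powr \<mu>)) = of_real (- (t powr \<mu> * lam n))" by (simp add: mult.commute)
      then show ?thesis unfolding f_def using ml_kern_mittag_leffler[of 1 t "lam n"] t mittag_leffler_of_real[of 1 "- (t powr \<mu> * lam n)", where 'a = complex] by (simp add: mult.commute)
    qed
    moreover show s: "summable (\<lambda>n. b n * ml_kern 1 (lam n) t)"
    proof (rule summable_norm_cancel, rule summable_comparison_test'[OF b, of 0])
      fix n
      have "\<bar>ml_kern 1 (lam n) t\<bar> \<le> 1" using ml_kern_1_le_1[OF lp t, of n] ml_kern_nonneg[OF lp t, of 1 n] mu1 by simp
      then show "norm (norm (b n * ml_kern 1 (lam n) t)) \<le> \<bar>b n\<bar>" by (simp add: abs_mult mult_left_le)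
    qed
    ultimately show "M (of_real (t powr \<mu>)) = of_real (\<Sum>n. b n * ml_kern 1 (lam n) t)"
      unfolding M_def by (simp only: suminf_of_real)
  qed
  define X where "X = T powr \<mu>"
  have X: "X > 0" using T by (simp add: X_def)
  have Mc: "M (of_real x) = of_real c" if "0 < x" "x < X" for x
  proof -
    have x: "(x powr (1 / \<mu>)) powr \<mu> = x" using that mu0 by (simp add: powr_powr)
    have "x powr (1 / \<mu>) < X powr (1 / \<mu>)" using that mu0 by (intro powr_less_mono2) auto
    also have "\<dots> = T" using mu0 T by (simp add: X_def powr_powr)
    finally show ?thesis using eq(1)[of "x powr (1 / \<mu>)"] c[of "x powr (1 / \<mu>)"] that unfolding x by simp
  qed
  have "M w - of_real c = 0" if "w \<in> S" for w
  proof (rule analytic_continuation[of "\<lambda>z. M z - of_real c" S "of_real ` {0<..<X}" "of_real (X / 2)"])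
    show "(\<lambda>z. M z - of_real c) holomorphic_on S" by (intro holomorphic_intros hM)
    show "complex_of_real ` {0<..<X} \<subseteq> S" using rS by auto
    show "complex_of_real (X / 2) \<in> S" using X by (intro rS) auto
    show "complex_of_real (X / 2) islimpt of_real ` {0<..<X}"
      unfolding islimpt_approachable
    proof (intro allI impI)
      fix e :: real assume "e > 0"
      define d where "d = min (e / 2) (X / 4)"
      have d: "d > 0" "d < e" "d < X / 2" using \<open>e > 0\<close> X by (auto simp: d_def min_def)
      show "\<exists>x'\<in>complex_of_real ` {0<..<X}. x' \<noteq> of_real (X / 2) \<and> dist x' (of_real (X / 2)) < e"
        using d X by (intro bexI[of _ "of_real (X / 2 + d)"]) (auto simp: dist_norm of_real_diff[symmetric] simp del: of_real_add of_real_divide of_real_diff)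
    qed
  qed (use oS cS Mc that in auto)
  then have all: "(\<Sum>n. b n * ml_kern 1 (lam n) t) = c" if "t > 0" for t
    using eq(1)[OF that] rS[of "t powr \<mu>"] that by (metis eq_iff_diff_eq_0 of_real_eq_iff powr_gt_zero less_irrefl)
  define K where "K = (\<Sum>n. \<bar>b n\<bar>) * (sqrt_const / sqrt l0 / Gamma (1 - \<mu> / 2))"
  have bnd: "\<bar>c\<bar> \<le> K * t powr (- (\<mu> / 2))" if t: "t > 0" for t
  proof -
    define C where "C = sqrt_const / sqrt l0 / Gamma (1 - \<mu> / 2) * t powr (- (\<mu> / 2))"
    have e: "\<bar>b n * ml_kern 1 (lam n) t\<bar> \<le> \<bar>b n\<bar> * C" for n
    proof -
      have m: "0 \<le> ml_kern 1 (lam n) t" using ml_kern_nonneg[OF lp t, of 1 n] mu1 by simp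
      have "sqrt l0 * ml_kern 1 (lam n) t \<le> sqrt (lam n) * ml_kern 1 (lam n) t"
        using l0 m by (intro mult_right_mono) auto
      also have "\<dots> \<le> sqrt_const * kern (1 - \<mu> + \<mu> / 2) t"
        using sqrt_ml_kern_le[OF lp t, of "1 - \<mu>" n] mu1 by simp
      also have "\<dots> = sqrt l0 * C"
      proof -
        have "1 - \<mu> + \<mu> / 2 = 1 - \<mu> / 2" by simp
        then show ?thesis using l0(1) unfolding C_def kern_def by simp
      qed
      finally have "ml_kern 1 (lam n) t \<le> C" using l0(1) by simp
      then show ?thesis using m by (simp add: abs_mult mult_left_mono)
    qed
    have "\<bar>c\<bar> \<le> (\<Sum>n. \<bar>b n * ml_kern 1 (lam n) t\<bar>)"
      unfolding all[OF t, symmetric] by (rule summable_rabs) (rule summable_comparison_test'[OF summable_mult2[OF b, of C], of 0], use e in simp)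
    also have "\<dots> \<le> (\<Sum>n. \<bar>b n\<bar> * C)"
      by (intro suminf_le e summable_mult2 b) (rule summable_comparison_test'[OF summable_mult2[OF b, of C], of 0], use e in simp)
    also have "\<dots> = K * t powr (- (\<mu> / 2))" unfolding suminf_mult2[OF b, symmetric] by (simp add: C_def K_def)
    finally show ?thesis .
  qed
  have "eventually (\<lambda>t. \<bar>c\<bar> \<le> K * t powr (- (\<mu> / 2))) at_top"
    by (rule eventually_mono[OF eventually_gt_at_top[of 0] bnd])
  moreover have "((\<lambda>t. K * t powr (- (\<mu> / 2))) \<longlongrightarrow> 0) at_top"
    using tendsto_mult_right_zero[OF tendsto_neg_powr[OF _ filterlim_ident, of "- (\<mu> / 2)"]] mu0 by simp
  ultimately have "\<bar>c\<bar> \<le> 0" by (intro tendsto_le[OF trivial_limit_at_top_linorder _ tendsto_const])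
  then show ?thesis by simp
qed

lemma continuous_on_ml_kern_0:
  fixes \<kappa> :: real
  assumes "a > 1" shows "continuous_on {0..} (ml_kern a \<kappa>)"
proof -
  have "continuous_on {0..} (\<lambda>t. t powr (a - 1) * mittag_leffler a (- (t powr \<mu> * \<kappa>)))"
    using mu0 assms
    by (intro continuous_on_compose2[OF continuous_at_imp_continuous_on[of UNIV "mittag_leffler a"]] continuous_intros continuous_on_powr')
       (auto simp: isCont_mittag_leffler)
  then show ?thesis
  proof (rule continuous_on_eq)
    fix t :: real assume "t \<in> {0..}"
    then show "t powr (a - 1) * mittag_leffler a (- (t powr \<mu> * \<kappa>)) = ml_kern a \<kappa> t"
      using ml_kern_mittag_leffler[of a t \<kappa>] assms mu0 by (cases "t = 0") (auto simp: ml_kern_def kern_def)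
  qed
qed

lemma abs_ml_kern_le_kern:
  fixes \<kappa> t :: real
  assumes "\<kappa> > 0" "t > 0" "a \<ge> \<mu>"
  shows "\<bar>ml_kern a \<kappa> t\<bar> \<le> kern a t"
  using ml_kern_le_kern[OF assms] ml_kern_nonneg[OF assms] by simp

lemma frac_integral_ml_kern_series:
  fixes a lam :: "nat \<Rightarrow> real"
  assumes a: "summable (\<lambda>n. \<bar>a n\<bar>)" and lam: "\<And>n. lam n > 0" and "c \<ge> \<mu>" "\<alpha> \<ge> 0" "t > 0"
  shows "frac_integral \<alpha> (\<lambda>\<tau>. \<Sum>n. a n * ml_kern c (lam n) \<tau>) t = (\<Sum>n. a n * ml_kern (\<alpha> + c) (lam n) t)"
proof -
  have c: "c > 0" using assms mu0 by simp
  have "(\<lambda>n. frac_integral \<alpha> (\<lambda>\<tau>. a n * ml_kern c (lam n) \<tau>) t) sums frac_integral \<alpha> (\<lambda>\<tau>. \<Sum>n. a n * ml_kern c (lam n) \<tau>) t"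
  proof (rule frac_integral_sums(1)[where h = "kern c" and d = "\<lambda>n. \<bar>a n\<bar>"])
    show "set_borel_measurable lborel {0<..<t} (\<lambda>\<tau>. a n * ml_kern c (lam n) \<tau>)" for n
      by (rule set_borel_measurable_continuous_on[of "{0<..}"])
         (auto intro!: continuous_intros continuous_on_ml_kern c)
    show "norm (a n * ml_kern c (lam n) \<tau>) \<le> \<bar>a n\<bar> * kern c \<tau>" if "0 < \<tau>" for n \<tau>
      using abs_ml_kern_le_kern[OF lam that \<open>c \<ge> \<mu>\<close>] by (simp add: abs_mult mult_left_mono)
  qed (use assms c kern_nonneg[OF c] frac_integrable_kern in auto)
  moreover have "frac_integral \<alpha> (\<lambda>\<tau>. a n * ml_kern c (lam n) \<tau>) t = a n * ml_kern (\<alpha> + c) (lam n) t" for n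
    using frac_integral_ml_kern(2)[OF c assms(4,5), of "lam n"] by (simp add: frac_integral_mult_right)
  ultimately show ?thesis by (simp add: sums_iff)
qed

lemma summable_ml_kern_series:
  fixes a lam :: "nat \<Rightarrow> real"
  assumes a: "summable (\<lambda>n. \<bar>a n\<bar>)" and lam: "\<And>n. lam n > 0" and "c \<ge> \<mu>" "t > 0"
  shows "summable (\<lambda>n. a n * ml_kern c (lam n) t)"
proof (rule summable_norm_cancel, rule summable_comparison_test'[OF summable_mult2[OF a, of "kern c t"], of 0])
  show "norm (norm (a n * ml_kern c (lam n) t)) \<le> \<bar>a n\<bar> * kern c t" for n
    using abs_ml_kern_le_kern[OF lam assms(4,3), of n] by (simp add: abs_mult mult_left_mono)
qed

text \<open>Since \<open>lam n\<close> times the kernel of index \<open>1 + \<mu>\<close> is 1 minus the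
  kernel of index 1, the hypothesis says that the series in the conclusion is constant in
  \<open>t\<close>, and \<open>constant_series_eq_zero\<close> applies.\<close>

lemma vanishing_ml_kern_series_step:
  fixes a lam :: "nat \<Rightarrow> real"
  assumes a: "summable (\<lambda>n. \<bar>a n\<bar>)" and l0: "l0 > 0" "\<And>n. l0 \<le> lam n" and T: "T > 0"
    and z: "\<And>t. 0 < t \<Longrightarrow> t < T \<Longrightarrow> (\<Sum>n. a n * ml_kern (1 + \<mu>) (lam n) t) = 0"
  shows "summable (\<lambda>n. \<bar>a n / lam n\<bar>)"
    and "\<And>t. 0 < t \<Longrightarrow> t < T \<Longrightarrow> (\<Sum>n. (a n / lam n) * ml_kern 1 (lam n) t) = 0"
proof -
  have lp: "lam n > 0" for n using l0 less_le_trans by blast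
  show s: "summable (\<lambda>n. \<bar>a n / lam n\<bar>)"
  proof (rule summable_comparison_test'[OF summable_divide[OF a, of l0], of 0])
    fix n
    have "\<bar>a n\<bar> / lam n \<le> \<bar>a n\<bar> / l0" by (rule divide_left_mono) (use l0 lp in auto)
    then show "norm \<bar>a n / lam n\<bar> \<le> \<bar>a n\<bar> / l0" using lp[of n] by simp
  qed
  have sc: "summable (\<lambda>n. a n / lam n)" using summable_rabs_cancel[OF s] .
  have eq: "(\<Sum>n. (a n / lam n) * ml_kern 1 (lam n) t) = (\<Sum>n. a n / lam n)" if t: "0 < t" "t < T" for t
  proof -
    have "(\<Sum>n. a n / lam n) - (\<Sum>n. (a n / lam n) * ml_kern 1 (lam n) t) = (\<Sum>n. a n / lam n - (a n / lam n) * ml_kern 1 (lam n) t)"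
      by (rule suminf_diff[OF sc summable_ml_kern_series[OF s lp _ t(1)]]) (use mu1 in simp)
    also have "\<dots> = (\<Sum>n. a n * ml_kern (1 + \<mu>) (lam n) t)"
      using lp by (intro suminf_cong) (simp add: ml_kern_1_eq[OF t(1)] field_simps less_imp_neq[symmetric])
    finally show ?thesis using z[OF t] by simp
  qed
  have "(\<Sum>n. a n / lam n) = 0" by (rule constant_series_eq_zero[OF s l0 T eq])
  then show "(\<Sum>n. (a n / lam n) * ml_kern 1 (lam n) t) = 0" if "0 < t" "t < T" for t using eq[OF that] by simp
qed

text \<open>A fractional integral of order \<open>\<mu>\<close> leads from the conclusion of
  \<open>vanishing_ml_kern_series_step\<close> back to its hypothesis, with one more division by
  \<open>lam n\<close>.\<close>

lemma vanishing_ml_kern_series: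
  fixes a lam :: "nat \<Rightarrow> real"
  assumes a: "summable (\<lambda>n. \<bar>a n\<bar>)" and l0: "l0 > 0" "\<And>n. l0 \<le> lam n" and T: "T > 0"
    and z: "\<And>t. 0 < t \<Longrightarrow> t < T \<Longrightarrow> (\<Sum>n. a n * ml_kern (1 + \<mu>) (lam n) t) = 0"
  shows "summable (\<lambda>n. \<bar>a n / lam n ^ k\<bar>) \<and> (\<forall>t. 0 < t \<longrightarrow> t < T \<longrightarrow> (\<Sum>n. (a n / lam n ^ k) * ml_kern (1 + \<mu>) (lam n) t) = 0)"
proof (induction k)
  case 0
  then show ?case using a z by simp
next
  case (Suc k)
  have lp: "lam n > 0" for n using l0 less_le_trans by blast
  note * = vanishing_ml_kern_series_step[OF conjunct1[OF Suc] l0 T]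
  have s: "summable (\<lambda>n. \<bar>a n / lam n ^ Suc k\<bar>)"
    and e: "\<And>t. 0 < t \<Longrightarrow> t < T \<Longrightarrow> (\<Sum>n. (a n / lam n ^ Suc k) * ml_kern 1 (lam n) t) = 0"
    using * Suc by (simp_all add: mult.commute)
  have "(\<Sum>n. (a n / lam n ^ Suc k) * ml_kern (1 + \<mu>) (lam n) t) = 0" if t: "0 < t" "t < T" for t
  proof -
    have "frac_integral \<mu> (\<lambda>\<tau>. \<Sum>n. (a n / lam n ^ Suc k) * ml_kern 1 (lam n) \<tau>) t = (\<Sum>n. (a n / lam n ^ Suc k) * ml_kern (\<mu> + 1) (lam n) t)"
      by (rule frac_integral_ml_kern_series[OF s lp]) (use mu0 mu1 t in auto)
    moreover have "frac_integral \<mu> (\<lambda>\<tau>. \<Sum>n. (a n / lam n ^ Suc k) * ml_kern 1 (lam n) \<tau>) t = frac_integral \<mu> (\<lambda>\<tau>. 0) t"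
      by (rule frac_integral_cong) (use e t in auto)
    ultimately show ?thesis by (simp add: frac_integral_def set_lebesgue_integral_def add.commute)
  qed
  then show ?case using s by blast
qed

text \<open>Multiply the series with coefficients \<open>a n / lam n ^ k\<close> by \<open>ls ^
  k\<close>. As \<open>k\<close> grows, the terms with \<open>lam n > ls\<close> tend to 0 and those with
  \<open>lam n = ls\<close> do not change.\<close>

lemma vanishing_ml_kern_series_leading:
  fixes a lam :: "nat \<Rightarrow> real"
  assumes a: "summable (\<lambda>n. \<bar>a n\<bar>)" and l0: "l0 > 0" "\<And>n. l0 \<le> lam n" and T: "T > 0"
    and z: "\<And>t. 0 < t \<Longrightarrow> t < T \<Longrightarrow> (\<Sum>n. a n * ml_kern (1 + \<mu>) (lam n) t) = 0"
    and ls: "ls > 0" "\<And>n. lam n < ls \<Longrightarrow> a n = 0"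
  shows "(\<Sum>n. if lam n = ls then a n else 0) = 0"
proof -
  have lp: "lam n > 0" for n using l0 less_le_trans by blast
  define t where "t = T / 2"
  have t: "0 < t" "t < T" using T by (auto simp: t_def)
  define E where "E n = ml_kern (1 + \<mu>) (lam n) t" for n
  have E: "\<bar>E n\<bar> \<le> kern (1 + \<mu>) t" for n unfolding E_def by (rule abs_ml_kern_le_kern[OF lp t(1)]) simp
  have z': "(\<Sum>n. a n * (ls / lam n) ^ k * E n) = 0" for k
  proof -
    have s: "summable (\<lambda>n. a n / lam n ^ k * E n)"
      unfolding E_def using vanishing_ml_kern_series[OF a l0 T z, of k] lp t mu0 by (intro summable_ml_kern_series) auto
    have "(\<Sum>n. a n * (ls / lam n) ^ k * E n) = (\<Sum>n. ls ^ k * (a n / lam n ^ k * E n))"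
      by (simp add: power_divide mult_ac)
    also have "\<dots> = ls ^ k * (\<Sum>n. a n / lam n ^ k * E n)" by (rule suminf_mult[OF s])
    also have "\<dots> = 0" using vanishing_ml_kern_series[OF a l0 T z, of k] t by (simp add: E_def)
    finally show ?thesis .
  qed
  have "(\<lambda>k. \<Sum>n. a n * (ls / lam n) ^ k * E n) \<longlonglongrightarrow> (\<Sum>n. (if lam n = ls then a n else 0) * E n)"
  proof (rule conjunct2[OF conjunct2[OF tannerys_theorem]])
    show "summable (\<lambda>n. \<bar>a n\<bar> * kern (1 + \<mu>) t)" by (rule summable_mult2[OF a])
    show "eventually (\<lambda>(n, k). norm (a n * (ls / lam n) ^ k * E n) \<le> \<bar>a n\<bar> * kern (1 + \<mu>) t) (at_top \<times>\<^sub>F sequentially)"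
    proof (rule always_eventually, clarify)
      fix n k
      show "norm (a n * (ls / lam n) ^ k * E n) \<le> \<bar>a n\<bar> * kern (1 + \<mu>) t"
      proof (cases "lam n < ls")
        case False
        then have "0 \<le> ls / lam n" "ls / lam n \<le> 1" using ls lp[of n] by (auto simp: field_simps)
        then have "\<bar>(ls / lam n) ^ k\<bar> \<le> 1" by (simp add: power_le_one)
        then have "\<bar>a n\<bar> * \<bar>(ls / lam n) ^ k\<bar> * \<bar>E n\<bar> \<le> \<bar>a n\<bar> * 1 * kern (1 + \<mu>) t"
          using E[of n] by (intro mult_mono) auto
        then show ?thesis by (simp add: abs_mult)
      qed (use ls kern_nonneg[of "1 + \<mu>" t] mu0 in auto)
    qed
    show "(\<lambda>k. a n * (ls / lam n) ^ k * E n) \<longlonglongrightarrow> (if lam n = ls then a n else 0) * E n" for n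
    proof -
      consider "lam n < ls" | "lam n = ls" | "lam n > ls" by linarith
      then show ?thesis
      proof cases
        case 3
        then have "norm (ls / lam n) < 1" using ls lp[of n] by (simp add: field_simps)
        from tendsto_mult[OF tendsto_mult[OF tendsto_const[of "a n"] LIMSEQ_power_zero[OF this]] tendsto_const[of "E n"]]
        show ?thesis using 3 by simp
      qed (use ls in auto)
    qed
  qed simp
  then have "(\<Sum>n. (if lam n = ls then a n else 0) * E n) = 0"
    unfolding z' using LIMSEQ_unique tendsto_const by blast
  moreover have "(if lam n = ls then a n else 0) * E n = (if lam n = ls then a n else 0) * ml_kern (1 + \<mu>) ls t" for n
    by (simp add: E_def)
  moreover have sl: "summable (\<lambda>n. if lam n = ls then a n else 0)"
    by (rule summable_rabs_cancel, rule summable_comparison_test'[OF a, of 0]) auto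
  ultimately have "(\<Sum>n. if lam n = ls then a n else 0) * ml_kern (1 + \<mu>) ls t = 0"
    by (simp add: suminf_mult2)
  moreover have "ml_kern (1 + \<mu>) ls t \<noteq> 0"
  proof
    \<comment> \<open>A zero would be a minimum, at which the derivative, the positive kernel of
      index \<open>\<mu>\<close>, would vanish.\<close>
    assume 0: "ml_kern (1 + \<mu>) ls t = 0"
    have "ml_kern \<mu> ls t = 0"
    proof (rule DERIV_local_min)
      show "(ml_kern (1 + \<mu>) ls has_real_derivative ml_kern \<mu> ls t) (at t)"
        using ml_kern_has_derivative[OF mu0 t(1), of ls] by (simp add: add.commute)
      show "\<forall>y. \<bar>t - y\<bar> < t \<longrightarrow> ml_kern (1 + \<mu>) ls t \<le> ml_kern (1 + \<mu>) ls y"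
        unfolding 0 using ml_kern_nonneg[OF ls(1), of _ "1 + \<mu>"] by auto
    qed (rule t)
    then show False using ml_kern_pos[OF ls(1) t(1)] by simp
  qed
  ultimately show ?thesis by simp
qed

text \<open>The hypothesis gives the moments of the series of kernels of index \<open>1 + \<mu>\<close>,
  which is a continuous function of time on \<open>[0, T]\<close>.\<close>

lemma vanishing_observations:
  fixes a lam :: "nat \<Rightarrow> real"
  assumes a: "summable (\<lambda>n. \<bar>a n\<bar>)" and l0: "l0 > 0" "\<And>n. l0 \<le> lam n" and T: "T > 0"
    and z: "\<And>m::nat. (\<Sum>n. a n * ml_kern (real m + 2 + \<mu>) (lam n) T) = 0"
    and ls: "ls > 0" "\<And>n. lam n < ls \<Longrightarrow> a n = 0"
  shows "(\<Sum>n. if lam n = ls then a n else 0) = 0"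
proof (rule vanishing_ml_kern_series_leading[OF a l0 T _ ls])
  have lp: "lam n > 0" for n using l0 less_le_trans by blast
  define g where "g t = (\<Sum>n. a n * ml_kern (1 + \<mu>) (lam n) t)" for t
  have b: "norm (a n * ml_kern (1 + \<mu>) (lam n) t) \<le> \<bar>a n\<bar> * kern (1 + \<mu>) T" if "t \<in> {0..T}" for n t
  proof (cases "t = 0")
    case True
    then show ?thesis using kern_nonneg[of "1 + \<mu>" T] mu0 by (simp add: ml_kern_def kern_def)
  next
    case False
    have "\<bar>ml_kern (1 + \<mu>) (lam n) t\<bar> \<le> kern (1 + \<mu>) t" by (rule abs_ml_kern_le_kern[OF lp]) (use that False in auto)
    also have "\<dots> \<le> kern (1 + \<mu>) T"
      using that mu0 Gamma_real_pos[of "1 + \<mu>"] unfolding kern_def by (intro divide_right_mono powr_mono2) auto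
    finally show ?thesis by (simp add: abs_mult mult_left_mono)
  qed
  have cg: "continuous_on {0..T} g"
  proof (rule uniform_limit_theorem)
    show "uniform_limit {0..T} (\<lambda>k t. \<Sum>n<k. a n * ml_kern (1 + \<mu>) (lam n) t) g sequentially"
      unfolding g_def by (rule Weierstrass_m_test[OF b]) (auto intro: summable_mult2 a)
    show "eventually (\<lambda>k. continuous_on {0..T} (\<lambda>t. \<Sum>n<k. a n * ml_kern (1 + \<mu>) (lam n) t)) sequentially"
      by (intro always_eventually allI continuous_intros continuous_on_subset[OF continuous_on_ml_kern_0]) (use mu0 in auto)
  qed simp
  have "frac_integral (real m + 1) g T = 0" for m
  proof -
    have "frac_integral (real m + 1) g T = (\<Sum>n. a n * ml_kern (real m + 1 + (1 + \<mu>)) (lam n) T)"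
      unfolding g_def by (rule frac_integral_ml_kern_series[OF a lp]) (use T mu0 in auto)
    then show ?thesis using z[of m] by (simp add: add_ac)
  qed
  from vanishing_moments_imp_zero[OF cg T this] show "(\<Sum>n. a n * ml_kern (1 + \<mu>) (lam n) t) = 0" if "0 < t" "t < T" for t
    using that by (simp add: g_def)
qed

end

section \<open>Uniqueness for the scalar Hilfer equation\<close>

lemma has_bochner_integral_beta_shift:
  fixes a b s t :: real
  assumes "a > 0" "b > 0" "s < t"
  shows "has_bochner_integral lborel (\<lambda>\<tau>. indicator {s<..<t} \<tau> * ((t - \<tau>) powr (a - 1) * (\<tau> - s) powr (b - 1)))
    ((t - s) powr (a + b - 1) * Beta a b)"
proof -
  have "(\<lambda>x. indicator {0<..<t - s} x * ((t - s - x) powr (a - 1) * x powr (b - 1)))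
     = (\<lambda>x. indicator {s<..<t} (s + 1 * x) * ((t - (s + 1 * x)) powr (a - 1) * (s + 1 * x - s) powr (b - 1)))"
    by (auto simp: fun_eq_iff indicator_def algebra_simps)
  then show ?thesis
    using lborel_has_bochner_integral_real_affine_iff[of 1 "\<lambda>\<tau>. indicator {s<..<t} \<tau> * ((t - \<tau>) powr (a - 1) * (\<tau> - s) powr (b - 1))"
      "(t - s) powr (a + b - 1) * Beta a b" s] has_bochner_integral_beta[OF assms(1,2), of "t - s"] assms(3) by simp
qed

lemma frac_integral_measurable:
  fixes g :: "real \<Rightarrow> real"
  assumes "b > 0" and g: "set_borel_measurable lborel {0<..<t} g"
  shows "set_borel_measurable lborel {0<..<t} (frac_integral b g)"
proof -
  define g0 where "g0 s = indicator {0<..<t} s *\<^sub>R g s" for s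
  have [measurable]: "g0 \<in> borel_measurable borel" using g by (simp add: g0_def[abs_def] set_borel_measurable_def)
  define f where "f \<tau> s = (if 0 < s \<and> s < \<tau> then (\<tau> - s) powr (b - 1) * g0 s else 0)" for \<tau> s
  have [measurable]: "case_prod f \<in> borel_measurable (borel \<Otimes>\<^sub>M borel)" unfolding f_def by measurable
  have m: "(\<lambda>\<tau>. indicator {0<..<t} \<tau> * ((1 / Gamma b) * (LINT s|lborel. f \<tau> s))) \<in> borel_measurable borel"
    by measurable
  have "frac_integral b g \<tau> = (1 / Gamma b) * (LINT s|lborel. f \<tau> s)" if "\<tau> \<in> {0<..<t}" for \<tau>
    using that \<open>b > 0\<close> unfolding frac_integral_def set_lebesgue_integral_def
    by (auto intro!: Bochner_Integration.integral_cong simp: f_def g0_def indicator_def)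
  then have "(\<lambda>\<tau>. indicator {0<..<t} \<tau> *\<^sub>R frac_integral b g \<tau>) = (\<lambda>\<tau>. indicator {0<..<t} \<tau> * ((1 / Gamma b) * (LINT s|lborel. f \<tau> s)))"
    by (auto simp: fun_eq_iff indicator_def)
  then show ?thesis unfolding set_borel_measurable_def using m by simp
qed

lemma frac_integrable_imp_measurable:
  fixes g :: "real \<Rightarrow> real"
  assumes "a \<noteq> 0" "frac_integrable a g t"
  shows "set_borel_measurable lborel {0<..<t} g"
proof -
  have "(\<lambda>\<tau>. indicator {0<..<t} \<tau> *\<^sub>R ((t - \<tau>) powr (a - 1) *\<^sub>R g \<tau>)) \<in> borel_measurable lborel"
    using assms unfolding frac_integrable_def set_integrable_def by (auto dest: borel_measurable_integrable)
  then have "(\<lambda>\<tau>. (t - \<tau>) powr (1 - a) * (indicator {0<..<t} \<tau> *\<^sub>R ((t - \<tau>) powr (a - 1) *\<^sub>R g \<tau>))) \<in> borel_measurable lborel"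
    by measurable
  moreover have "(\<lambda>\<tau>. (t - \<tau>) powr (1 - a) * (indicator {0<..<t} \<tau> *\<^sub>R ((t - \<tau>) powr (a - 1) *\<^sub>R g \<tau>))) = (\<lambda>\<tau>. indicator {0<..<t} \<tau> *\<^sub>R g \<tau>)"
    by (auto simp: fun_eq_iff indicator_def powr_add[symmetric] mult.assoc[symmetric])
  ultimately show ?thesis unfolding set_borel_measurable_def by (simp only:)
qed

text \<open>A larger order means a weaker singularity at the end point.\<close>

lemma frac_integrable_weaken:
  fixes g :: "real \<Rightarrow> real"
  assumes "0 < a" "a \<le> b" "frac_integrable a g t"
  shows "frac_integrable b g t"
proof -
  have "set_integrable lborel {0<..<t} (\<lambda>\<tau>. t powr (b - a) *\<^sub>R (((t - \<tau>) powr (a - 1)) *\<^sub>R g \<tau>))"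
    using assms by (intro set_integrable_scaleR_right) (simp add: frac_integrable_def)
  then have "set_integrable lborel {0<..<t} (\<lambda>\<tau>. ((t - \<tau>) powr (b - 1)) *\<^sub>R g \<tau>)"
    unfolding set_integrable_def
  proof (rule Bochner_Integration.integrable_bound)
    have "set_borel_measurable lborel {0<..<t} g" by (rule frac_integrable_imp_measurable[OF _ assms(3)]) (use assms in simp)
    then have "(\<lambda>\<tau>. ((t - \<tau>) powr (b - 1)) * (indicator {0<..<t} \<tau> *\<^sub>R g \<tau>)) \<in> borel_measurable lborel"
      unfolding set_borel_measurable_def by measurable
    then show "(\<lambda>\<tau>. indicator {0<..<t} \<tau> *\<^sub>R ((t - \<tau>) powr (b - 1)) *\<^sub>R g \<tau>) \<in> borel_measurable lborel"
      by (simp add: mult_ac)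
    show "AE \<tau> in lborel. norm (indicator {0<..<t} \<tau> *\<^sub>R ((t - \<tau>) powr (b - 1)) *\<^sub>R g \<tau>)
       \<le> norm (indicator {0<..<t} \<tau> *\<^sub>R t powr (b - a) *\<^sub>R (((t - \<tau>) powr (a - 1)) *\<^sub>R g \<tau>))"
    proof (rule AE_I2)
      fix \<tau>
      show "norm (indicator {0<..<t} \<tau> *\<^sub>R ((t - \<tau>) powr (b - 1)) *\<^sub>R g \<tau>)
       \<le> norm (indicator {0<..<t} \<tau> *\<^sub>R t powr (b - a) *\<^sub>R (((t - \<tau>) powr (a - 1)) *\<^sub>R g \<tau>))"
      proof (cases "\<tau> \<in> {0<..<t}")
        case True
        have "(t - \<tau>) powr (b - 1) = (t - \<tau>) powr (b - a) * (t - \<tau>) powr (a - 1)" by (simp add: powr_add[symmetric])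
        also have "\<dots> \<le> t powr (b - a) * (t - \<tau>) powr (a - 1)"
          using True assms by (intro mult_right_mono powr_mono2) auto
        finally have "(t - \<tau>) powr (b - 1) * \<bar>g \<tau>\<bar> \<le> t powr (b - a) * (t - \<tau>) powr (a - 1) * \<bar>g \<tau>\<bar>" by (rule mult_right_mono) simp
        then show ?thesis using True by (simp add: abs_mult mult_ac)
      qed simp
    qed
  qed
  then show ?thesis by (simp add: frac_integrable_def)
qed

text \<open>Fubini's theorem; the inner integral over the middle variable is a Beta integral.\<close>

lemma frac_integral_semigroup:
  fixes g :: "real \<Rightarrow> real"
  assumes a: "a > 0" and b: "b > 0" and t: "t > 0" and g: "frac_integrable (a + b) g t"
  shows "frac_integral a (frac_integral b g) t = frac_integral (a + b) g t"
proof -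
  have gm: "set_borel_measurable lborel {0<..<t} g" by (rule frac_integrable_imp_measurable[OF _ g]) (use a b in simp)
  define g0 where "g0 s = indicator {0<..<t} s *\<^sub>R g s" for s
  have [measurable]: "g0 \<in> borel_measurable borel" using gm by (simp add: g0_def[abs_def] set_borel_measurable_def)
  define f where "f s \<tau> = (if 0 < s \<and> s < \<tau> \<and> \<tau> < t then (t - \<tau>) powr (a - 1) * (\<tau> - s) powr (b - 1) * g0 s else 0)" for s \<tau>
  have fm: "case_prod f \<in> borel_measurable (lborel \<Otimes>\<^sub>M lborel)" unfolding f_def by measurable
  have feq: "f s \<tau> = (if 0 < s \<and> s < t then g s * (indicator {s<..<t} \<tau> * ((t - \<tau>) powr (a - 1) * (\<tau> - s) powr (b - 1))) else 0)" for s \<tau>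
    by (auto simp: f_def g0_def indicator_def)
  have hb: "has_bochner_integral lborel (f s) (if 0 < s \<and> s < t then g s * ((t - s) powr (a + b - 1) * Beta a b) else 0)" for s
    unfolding feq[abs_def] using has_bochner_integral_beta_shift[OF a b, of s t]
    by (cases "0 < s \<and> s < t") (auto intro!: has_bochner_integral_mult_right)
  have nf: "norm (f s \<tau>) = (if 0 < s \<and> s < t then \<bar>g s\<bar> * (indicator {s<..<t} \<tau> * ((t - \<tau>) powr (a - 1) * (\<tau> - s) powr (b - 1))) else 0)" for s \<tau>
    unfolding feq by (auto simp: abs_mult)
  have hbn: "has_bochner_integral lborel (\<lambda>\<tau>. norm (f s \<tau>)) (if 0 < s \<and> s < t then \<bar>g s\<bar> * ((t - s) powr (a + b - 1) * Beta a b) else 0)" for s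
    unfolding nf using has_bochner_integral_beta_shift[OF a b, of s t]
    by (cases "0 < s \<and> s < t") (auto intro!: has_bochner_integral_mult_right)
  have gi: "integrable lborel (\<lambda>s. indicator {0<..<t} s *\<^sub>R ((t - s) powr (a + b - 1) *\<^sub>R g s))"
    using g a b by (auto simp: frac_integrable_def set_integrable_def)
  have "integrable (lborel \<Otimes>\<^sub>M lborel) (case_prod f)"
  proof (rule lborel_pair.Fubini_integrable[OF fm])
    have "integrable lborel (\<lambda>s. Beta a b * norm (indicator {0<..<t} s *\<^sub>R ((t - s) powr (a + b - 1) *\<^sub>R g s)))"
      using gi by (intro integrable_mult_right integrable_norm)
    moreover have "(LINT \<tau>|lborel. norm (f s \<tau>)) = Beta a b * norm (indicator {0<..<t} s *\<^sub>R ((t - s) powr (a + b - 1) *\<^sub>R g s))" for s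
      using has_bochner_integral_integral_eq[OF hbn[of s]] by (auto simp: indicator_def abs_mult)
    ultimately show "integrable lborel (\<lambda>s. LINT \<tau>|lborel. norm (case_prod f (s, \<tau>)))" by simp
    show "AE s in lborel. integrable lborel (\<lambda>\<tau>. case_prod f (s, \<tau>))"
      using hb by (intro AE_I2) (auto simp: has_bochner_integral_iff)
  qed
  from lborel_pair.Fubini_integral[OF this]
  have "(LINT \<tau>|lborel. LINT s|lborel. f s \<tau>) = (LINT s|lborel. LINT \<tau>|lborel. f s \<tau>)" .
  also have "\<dots> = (LINT s|lborel. Beta a b * (indicator {0<..<t} s *\<^sub>R ((t - s) powr (a + b - 1) *\<^sub>R g s)))"
    using has_bochner_integral_integral_eq[OF hb] by (intro Bochner_Integration.integral_cong) (auto simp: indicator_def)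
  also have "\<dots> = Beta a b * (Gamma (a + b) * frac_integral (a + b) g t)"
    using a b Gamma_real_pos[of "a + b"] by (simp add: frac_integral_def set_lebesgue_integral_def less_imp_neq[symmetric])
  also have "\<dots> = Gamma a * Gamma b * frac_integral (a + b) g t"
    using Gamma_real_pos[of "a + b"] a b by (simp add: Beta_def less_imp_neq[symmetric])
  finally have 1: "(LINT \<tau>|lborel. LINT s|lborel. f s \<tau>) = Gamma a * Gamma b * frac_integral (a + b) g t" .
  have "(LINT s|lborel. f s \<tau>) = Gamma b * (indicator {0<..<t} \<tau> *\<^sub>R ((t - \<tau>) powr (a - 1) *\<^sub>R frac_integral b g \<tau>))" for \<tau>
  proof (cases "0 < \<tau> \<and> \<tau> < t")
    case True
    have "(LINT s|lborel. f s \<tau>) = (LINT s|lborel. (t - \<tau>) powr (a - 1) * (indicator {0<..<\<tau>} s *\<^sub>R ((\<tau> - s) powr (b - 1) *\<^sub>R g s)))"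
      using True by (intro Bochner_Integration.integral_cong) (auto simp: f_def g0_def indicator_def)
    also have "\<dots> = (t - \<tau>) powr (a - 1) * (Gamma b * frac_integral b g \<tau>)"
      using b Gamma_real_pos[of b] by (simp add: frac_integral_def set_lebesgue_integral_def less_imp_neq[symmetric])
    finally show ?thesis using True by simp
  next
    case False
    then have "f s \<tau> = 0" for s by (auto simp: f_def)
    then show ?thesis using False by auto
  qed
  then have "(LINT \<tau>|lborel. LINT s|lborel. f s \<tau>) = Gamma b * (Gamma a * frac_integral a (frac_integral b g) t)"
    using a Gamma_real_pos[of a] by (simp add: frac_integral_def set_lebesgue_integral_def less_imp_neq[symmetric])
  then show ?thesis using 1 Gamma_real_pos[OF a] Gamma_real_pos[OF b] by simp
qed

lemma frac_integral_cong_AE: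
  fixes g h :: "real \<Rightarrow> real"
  assumes "a > 0" "set_borel_measurable lborel {0<..<t} g" "set_borel_measurable lborel {0<..<t} h"
    and ae: "AE \<tau> in lborel. \<tau> \<in> {0<..<t} \<longrightarrow> g \<tau> = h \<tau>"
  shows "frac_integral a g t = frac_integral a h t"
proof -
  have m: "(\<lambda>\<tau>. indicator {0<..<t} \<tau> *\<^sub>R ((t - \<tau>) powr (a - 1) *\<^sub>R f \<tau>)) \<in> borel_measurable lborel"
    if "set_borel_measurable lborel {0<..<t} f" for f :: "real \<Rightarrow> real"
  proof -
    have "(\<lambda>\<tau>. (t - \<tau>) powr (a - 1) * (indicator {0<..<t} \<tau> *\<^sub>R f \<tau>)) \<in> borel_measurable lborel"
      using that unfolding set_borel_measurable_def by measurable
    then show ?thesis by (simp add: mult_ac)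
  qed
  have "(LINT \<tau>:{0<..<t}|lborel. (t - \<tau>) powr (a - 1) *\<^sub>R g \<tau>) = (LINT \<tau>:{0<..<t}|lborel. (t - \<tau>) powr (a - 1) *\<^sub>R h \<tau>)"
    unfolding set_lebesgue_integral_def
  proof (rule integral_cong_AE[OF m[OF assms(2)] m[OF assms(3)]])
    show "AE \<tau> in lborel. indicator {0<..<t} \<tau> *\<^sub>R (t - \<tau>) powr (a - 1) *\<^sub>R g \<tau> = indicator {0<..<t} \<tau> *\<^sub>R (t - \<tau>) powr (a - 1) *\<^sub>R h \<tau>"
      using ae by eventually_elim (auto simp: indicator_def)
  qed
  then show ?thesis using assms(1) by (simp add: frac_integral_def)
qed

lemma frac_integral_one_eq_HK:
  fixes g :: "real \<Rightarrow> real"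
  assumes "frac_integrable 1 g t"
  shows "(g has_integral frac_integral 1 g t) {0..t}"
proof -
  have s: "set_integrable lborel {0<..<t} (\<lambda>\<tau>. ((t - \<tau>) powr (1 - 1)) *\<^sub>R g \<tau>)" using assms by (simp add: frac_integrable_def)
  have c: "set_integrable lborel {0<..<t} g" by (rule set_integrable_cong[THEN iffD1, OF refl refl _ s]) auto
  have "frac_integral 1 g t = (LINT \<tau>:{0<..<t}|lborel. g \<tau>)"
    unfolding frac_integral_def by (auto intro!: set_lebesgue_integral_cong)
  then have "(g has_integral frac_integral 1 g t) {0<..<t}"
    using set_borel_integral_eq_integral[OF c] integrable_integral by metis
  then show ?thesis by (simp add: has_integral_Icc_iff_Ioo)
qed

context fractional_order
begin

text \<open>If \<open>S\<close> bounds \<open>\<bar>h\<bar>\<close>, iterating the equation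
  \<open>k\<close> times gives the bound \<open>S \<bar>c\<bar>^k t^(\<mu> k) / \<Gamma>(\<mu> k +
  1)\<close>, the term of a convergent Mittag-Leffler series.\<close>

lemma volterra_zero:
  fixes h :: "real \<Rightarrow> real"
  assumes h: "continuous_on {0..T} h" and eq: "\<And>t. 0 < t \<Longrightarrow> t \<le> T \<Longrightarrow> h t = c * frac_integral \<mu> h t"
    and t: "0 < t" "t \<le> T"
  shows "h t = 0"
proof -
  obtain S where S: "\<And>s. s \<in> {0..T} \<Longrightarrow> \<bar>h s\<bar> \<le> S"
    using compact_imp_bounded[OF compact_continuous_image[OF h compact_Icc]] unfolding bounded_iff by force
  have S0: "S \<ge> 0" using S[of t] t by auto
  have hm: "set_borel_measurable lborel {0<..<s} h" if "s \<le> T" for s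
    by (rule set_borel_measurable_continuous_on[OF h]) (use that in auto)
  have b: "\<bar>h s\<bar> \<le> (S * \<bar>c\<bar> ^ k) * kern (\<mu> * real k + 1) s" if "0 < s" "s \<le> T" for s k
    using that
  proof (induction k arbitrary: s)
    case 0
    then show ?case using S[of s] by simp
  next
    case (Suc k)
    have p: "\<mu> * real k + 1 > 0" using mu0 by (simp add: add_nonneg_pos)
    let ?g = "\<lambda>\<tau>. (S * \<bar>c\<bar> ^ k) * kern (\<mu> * real k + 1) \<tau>"
    have gi: "frac_integrable \<mu> ?g s" using frac_integrable_kern[OF less_imp_le[OF mu0] p] by (rule frac_integrable_mult_right)
    have "\<bar>frac_integral \<mu> h s\<bar> \<le> frac_integral \<mu> ?g s"
      using Suc gi mu0 unfolding real_norm_def[symmetric]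
    proof (intro frac_integral_norm_le frac_integrable_bound[OF hm gi])
      fix \<tau> assume "0 < \<tau>" "\<tau> < s"
      then have "\<bar>h \<tau>\<bar> \<le> ?g \<tau>" using Suc by auto
      then show "norm (h \<tau>) \<le> norm (?g \<tau>)" by simp
    qed auto
    also have "\<dots> = (S * \<bar>c\<bar> ^ k) * kern (\<mu> * real (Suc k) + 1) s"
      using frac_integral_kern[OF less_imp_le[OF mu0] p Suc(2)] by (simp add: frac_integral_mult_right algebra_simps)
    finally have "\<bar>c\<bar> * \<bar>frac_integral \<mu> h s\<bar> \<le> \<bar>c\<bar> * ((S * \<bar>c\<bar> ^ k) * kern (\<mu> * real (Suc k) + 1) s)"
      by (rule mult_left_mono) simp
    then show ?case using eq[OF Suc(2,3)] by (simp add: abs_mult mult_ac)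
  qed
  have "(\<lambda>k. kern (\<mu> * real k + 1) t * \<bar>c\<bar> ^ k) \<longlonglongrightarrow> 0"
    using summable_LIMSEQ_zero[OF summable_norm_cancel[OF summable_ml_kern[OF zero_less_one t(1), of "- \<bar>c\<bar>"]]] by simp
  from tendsto_mult[OF tendsto_const[of S] this] have "(\<lambda>k. (S * \<bar>c\<bar> ^ k) * kern (\<mu> * real k + 1) t) \<longlonglongrightarrow> 0" by (simp add: mult_ac)
  then have "\<bar>h t\<bar> \<le> 0" by (rule LIMSEQ_le_const) (use b t in auto)
  then show ?thesis by simp
qed

text \<open>With \<open>h = I^\<alpha> w\<close>, the equation is \<open>I^\<beta> h' = - \<kappa>
  w\<close>. Applying \<open>I^(1-\<beta>)\<close> and using \<open>h(0) = 0\<close> gives \<open>h = -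
  \<kappa> I^(1-\<beta>) w = - \<kappa> I^\<mu> h\<close> because \<open>1 - \<beta> = \<mu> +
  \<alpha>\<close>. So \<open>h = 0\<close> by \<open>volterra_zero\<close>, and the equation then gives
  \<open>w = 0\<close> almost everywhere, hence at \<open>T\<close> by continuity.\<close>

lemma hilfer_scalar_unique:
  fixes w h F :: "real \<Rightarrow> real"
  assumes T: "T > 0" and \<alpha>: "\<alpha> > 0" and \<beta>: "\<beta> \<ge> 0" and ab: "\<alpha> + \<beta> + \<mu> = 1" and k0: "\<kappa> > 0"
    and w: "continuous_on {0<..T} w" and wi: "\<And>t. 0 < t \<Longrightarrow> t \<le> T \<Longrightarrow> frac_integrable \<alpha> w t"
    and h: "continuous_on {0..T} h" "\<And>t. 0 < t \<Longrightarrow> t \<le> T \<Longrightarrow> h t = frac_integral \<alpha> w t" "h 0 = 0"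
    and F: "\<And>t. 0 < t \<Longrightarrow> t \<le> T \<Longrightarrow> (h has_real_derivative F t) (at t within {0<..T})"
      "frac_integrable \<beta> F T"
    and ae: "AE t in lborel. t \<in> {0<..<T} \<longrightarrow> frac_integral \<beta> F t = - \<kappa> * w t"
  shows "w T = 0"
proof -
  have b1: "1 - \<beta> > 0" "\<beta> < 1" "1 - \<beta> = \<mu> + \<alpha>" using ab \<alpha> mu0 by auto
  have a1: "\<alpha> \<le> 1" using ab \<beta> mu0 by simp
  have wm: "set_borel_measurable lborel {0<..<t} w" if "t \<le> T" for t
    by (rule set_borel_measurable_continuous_on[OF w]) (use that in auto)
  have ftc: "(F has_integral h t) {0..t}" if t: "0 < t" "t \<le> T" for t
  proof -
    have "(F has_integral h t - h 0) {0..t}"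
    proof (rule fundamental_theorem_of_calculus_interior)
      show "continuous_on {0..t} h" by (rule continuous_on_subset[OF h(1)]) (use t in auto)
      fix x assume x: "x \<in> {0<..<t}"
      have "(h has_real_derivative F x) (at x within {0<..<T})"
        by (rule DERIV_subset[OF F(1)]) (use x t in auto)
      then show "(h has_vector_derivative F x) (at x)"
        using x t at_within_open[of x "{0<..<T}"] by (simp add: has_real_derivative_iff_has_vector_derivative)
    qed (use t in simp)
    then show ?thesis using h(3) by simp
  qed
  \<comment> \<open>For \<open>\<beta> = 0\<close> the equation is \<open>h' = - \<kappa> w\<close>
    almost everywhere and is integrated directly; \<open>F\<close> need not be Borel measurable then,
    so the gauge integral is used.\<close>
  have volt: "h t = - \<kappa> * frac_integral (1 - \<beta>) w t" if t: "0 < t" "t \<le> T" for t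
  proof (cases "\<beta> = 0")
    case True
    have wi1: "frac_integrable 1 w t" by (rule frac_integrable_weaken[OF \<alpha> a1 wi[OF t]])
    have "((\<lambda>\<tau>. - \<kappa> * w \<tau>) has_integral - \<kappa> * frac_integral 1 w t) {0..t}"
      by (rule has_integral_mult_right[OF frac_integral_one_eq_HK[OF wi1]])
    moreover have "AE \<tau> in lborel. \<tau> \<in> {0..t} \<longrightarrow> F \<tau> = - \<kappa> * w \<tau>"
      using ae AE_lborel_singleton[of 0] AE_lborel_singleton[of t]
      by eventually_elim (use t True in \<open>auto simp: frac_integral_def\<close>)
    ultimately have "(F has_integral - \<kappa> * frac_integral 1 w t) {0..t}" using has_integral_AE by metis
    then have "h t = - \<kappa> * frac_integral 1 w t" by (rule has_integral_unique[OF ftc[OF t]])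
    then show ?thesis using True by simp
  next
    case False
    then have b0: "\<beta> > 0" using \<beta> by simp
    have Fm: "set_borel_measurable lborel {0<..<T} F" by (rule frac_integrable_imp_measurable[OF False F(2)])
    have Fm': "set_borel_measurable lborel {0<..<t} F"
      by (rule set_borel_measurable_subset[OF Fm]) (use t in auto)
    have FT: "frac_integrable 1 F T" by (rule frac_integrable_weaken[OF b0 _ F(2)]) (use b1 in simp)
    have "set_integrable lborel {0<..<T} F"
      using FT set_integrable_cong[of lborel lborel "{0<..<T}" "{0<..<T}" "\<lambda>\<tau>. ((T - \<tau>) powr (1 - 1)) *\<^sub>R F \<tau>" F] by (auto simp: frac_integrable_def)
    then have "set_integrable lborel {0<..<t} F" by (rule set_integrable_subset) (use t in auto)
    then have Ft: "frac_integrable 1 F t"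
      using set_integrable_cong[of lborel lborel "{0<..<t}" "{0<..<t}" "\<lambda>\<tau>. ((t - \<tau>) powr (1 - 1)) *\<^sub>R F \<tau>" F] by (auto simp: frac_integrable_def)
    have "h t = frac_integral 1 F t" using ftc[OF t] frac_integral_one_eq_HK[OF Ft] by (rule has_integral_unique)
    also have "\<dots> = frac_integral (1 - \<beta>) (frac_integral \<beta> F) t"
      using frac_integral_semigroup[OF b1(1) b0 t(1), of F] Ft by simp
    also have "\<dots> = frac_integral (1 - \<beta>) (\<lambda>\<tau>. - \<kappa> * w \<tau>) t"
    proof (rule frac_integral_cong_AE[OF b1(1) frac_integral_measurable[OF b0 Fm']])
      show "set_borel_measurable lborel {0<..<t} (\<lambda>\<tau>. - \<kappa> * w \<tau>)"
        by (rule set_borel_measurable_continuous_on[of "{0<..T}"]) (use t in \<open>auto intro!: continuous_intros w\<close>)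
      show "AE \<tau> in lborel. \<tau> \<in> {0<..<t} \<longrightarrow> frac_integral \<beta> F \<tau> = - \<kappa> * w \<tau>"
        using ae by eventually_elim (use t in auto)
    qed
    finally show ?thesis by (simp only: frac_integral_mult_right)
  qed
  have h0: "h t = 0" if t: "0 < t" "t \<le> T" for t
  proof (rule volterra_zero[OF h(1) _ t])
    fix s assume s: "0 < s" "s \<le> T"
    have "frac_integral (1 - \<beta>) w s = frac_integral \<mu> (frac_integral \<alpha> w) s"
      unfolding b1(3) using frac_integrable_weaken[OF \<alpha> _ wi[OF s], of "\<mu> + \<alpha>"] mu0
      by (intro frac_integral_semigroup[symmetric] mu0 \<alpha> s) auto
    also have "\<dots> = frac_integral \<mu> h s"
      by (rule frac_integral_cong) (use h(2) s in auto)
    finally show "h s = - \<kappa> * frac_integral \<mu> h s" using volt[OF s] by simp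
  qed
  have F0: "F t = 0" if t: "0 < t" "t < T" for t
  proof -
    have "(h has_real_derivative F t) (at t within {0<..<T})"
      by (rule DERIV_subset[OF F(1)]) (use t in auto)
    then have "(h has_real_derivative F t) (at t)" using t at_within_open[of t "{0<..<T}"] by simp
    moreover have "(h has_real_derivative 0) (at t)"
      by (rule has_field_derivative_transform_within_open[of "\<lambda>_. 0" _ _ "{0<..<T}"]) (use t h0 in auto)
    ultimately show ?thesis by (rule DERIV_unique)
  qed
  have "AE t in lborel. t \<in> {0<..<T} \<longrightarrow> w t = 0"
    using ae
  proof eventually_elim
    case (elim t)
    show ?case
    proof
      assume t: "t \<in> {0<..<T}"
      have "frac_integral \<beta> F t = frac_integral \<beta> (\<lambda>_. 0) t"
        by (rule frac_integral_cong) (use F0 t in auto)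
      then show "w t = 0" using elim t k0 by (auto simp: frac_integral_def set_lebesgue_integral_def split: if_splits)
    qed
  qed
  then obtain N where N: "N \<in> null_sets lborel" "{t. \<not> (t \<in> {0<..<T} \<longrightarrow> w t = 0)} \<subseteq> N"
    unfolding eventually_ae_filter by auto
  show "w T = 0"
  proof (rule ccontr)
    assume "w T \<noteq> 0"
    have "(w \<longlongrightarrow> w T) (at T within {0<..T})" using w T by (auto simp: continuous_on)
    then have "eventually (\<lambda>t. dist (w t) (w T) < \<bar>w T\<bar>) (at T within {0<..T})"
      using \<open>w T \<noteq> 0\<close> tendstoD by (metis zero_less_abs_iff)
    then obtain d where d: "d > 0" "\<And>t. t \<in> {0<..T} \<Longrightarrow> t \<noteq> T \<Longrightarrow> dist t T < d \<Longrightarrow> dist (w t) (w T) < \<bar>w T\<bar>"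
      unfolding eventually_at by blast
    define m where "m = max (T - d) 0"
    have m: "m < T" "m \<ge> 0" "T - d \<le> m" using d T by (auto simp: m_def)
    have "{m<..<T} \<subseteq> N"
    proof
      fix t assume t: "t \<in> {m<..<T}"
      then have "dist (w t) (w T) < \<bar>w T\<bar>" using m by (intro d(2)) (auto simp: dist_real_def)
      then have "w t \<noteq> 0" by (auto simp: dist_real_def)
      then show "t \<in> N" using N(2) t m by auto
    qed
    then have "{m<..<T} \<in> null_sets lborel" using null_sets_subset[OF N(1), of "{m<..<T}"] by auto
    then show False using m by (simp add: null_sets_def)
  qed
qed

end

section \<open>Eigenvector bases of operators with compact resolvent\<close>

text \<open>A minimising sequence for the distance from \<open>x\<close> to \<open>S\<close> is Cauchy
  by the parallelogram identity.\<close>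

lemma orthogonal_projection_exists:
  fixes S :: "'h::{real_inner, complete_space} set"
  assumes S: "subspace S" "closed S"
  obtains y where "y \<in> S" "\<And>s. s \<in> S \<Longrightarrow> inner (x - y) s = 0"
proof -
  define Q where "Q = (\<lambda>s. (norm (x - s))\<^sup>2) ` S"
  define q where "q = Inf Q"
  have Q: "Q \<noteq> {}" "bdd_below Q" using subspace_0[OF S(1)] by (auto simp: Q_def intro!: bdd_belowI[of _ 0])
  have qle: "q \<le> (norm (x - s))\<^sup>2" if "s \<in> S" for s
    unfolding q_def by (rule cInf_lower[OF _ Q(2)]) (use that in \<open>auto simp: Q_def\<close>)
  have "\<exists>s\<in>S. (norm (x - s))\<^sup>2 < q + 1 / real (Suc n)" for n
    using cInf_lessD[OF Q(1), of "q + 1 / real (Suc n)"] unfolding q_def Q_def by auto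
  then obtain Y where Y: "\<And>n. Y n \<in> S" "\<And>n. (norm (x - Y n))\<^sup>2 < q + 1 / real (Suc n)" by metis
  have par: "(norm (Y m - Y n))\<^sup>2 \<le> 2 / real (Suc m) + 2 / real (Suc n)" for m n
  proof -
    have "(1/2) *\<^sub>R (Y m + Y n) \<in> S" by (intro subspace_scale subspace_add S Y)
    from qle[OF this] have "4 * q \<le> 4 * (norm (x - (1/2) *\<^sub>R (Y m + Y n)))\<^sup>2" by simp
    moreover have "(norm (Y m - Y n))\<^sup>2 = 2 * (norm (x - Y m))\<^sup>2 + 2 * (norm (x - Y n))\<^sup>2 - 4 * (norm (x - (1/2) *\<^sub>R (Y m + Y n)))\<^sup>2"
      unfolding power2_norm_eq_inner by (simp add: inner_diff_left inner_diff_right inner_add_left inner_add_right inner_commute field_simps)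
    moreover have "2 * (norm (x - Y m))\<^sup>2 + 2 * (norm (x - Y n))\<^sup>2 \<le> 4 * q + (2 / real (Suc m) + 2 / real (Suc n))"
      using Y(2)[of m] Y(2)[of n] by simp
    ultimately show ?thesis by linarith
  qed
  have "Cauchy Y"
  proof (rule metric_CauchyI)
    fix e :: real assume e: "e > 0"
    obtain N where N: "1 / real (Suc N) < e\<^sup>2 / 4" using nat_approx_posE[of "e\<^sup>2 / 4"] e by auto
    have "dist (Y m) (Y n) < e" if "m \<ge> N" "n \<ge> N" for m n
    proof -
      have "1 / real (Suc m) \<le> 1 / real (Suc N)" "1 / real (Suc n) \<le> 1 / real (Suc N)"
        using that by (auto intro!: divide_left_mono)
      then have "(norm (Y m - Y n))\<^sup>2 < e\<^sup>2" using par[of m n] N by simp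
      then show ?thesis using e by (simp add: dist_norm power2_less_imp_less)
    qed
    then show "\<exists>N. \<forall>m\<ge>N. \<forall>n\<ge>N. dist (Y m) (Y n) < e" by blast
  qed
  then obtain y where y: "Y \<longlonglongrightarrow> y" using Cauchy_convergent convergent_def by blast
  have yS: "y \<in> S" by (rule closed_sequentially[OF S(2) Y(1) y])
  have l1: "(\<lambda>n. (norm (x - Y n))\<^sup>2) \<longlonglongrightarrow> (norm (x - y))\<^sup>2" by (intro tendsto_intros y)
  have l2: "(\<lambda>n. q + 1 / real (Suc n)) \<longlonglongrightarrow> q + 0"
    using LIMSEQ_Suc[OF lim_1_over_n] by (intro tendsto_intros) simp
  have "(norm (x - y))\<^sup>2 \<le> q + 0"
    by (rule LIMSEQ_le[OF l1 l2]) (use Y(2) less_imp_le in blast)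
  then have yq: "(norm (x - y))\<^sup>2 \<le> q" by simp
  have "inner (x - y) s = 0" if s: "s \<in> S" for s
  proof (cases "s = 0")
    case False
    define c where "c = inner (x - y) s / (norm s)\<^sup>2"
    have "y + c *\<^sub>R s \<in> S" by (intro subspace_add subspace_scale S yS s)
    from qle[OF this] have "(norm (x - y))\<^sup>2 \<le> (norm (x - (y + c *\<^sub>R s)))\<^sup>2" using yq by linarith
    also have "\<dots> = (norm (x - y))\<^sup>2 - 2 * c * inner (x - y) s + c\<^sup>2 * (norm s)\<^sup>2"
    proof -
      have "x - (y + c *\<^sub>R s) = (x - y) - c *\<^sub>R s" by simp
      then show ?thesis unfolding power2_norm_eq_inner
        by (simp only:) (simp add: inner_diff_left inner_diff_right inner_commute power2_eq_square algebra_simps)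
    qed
    also have "\<dots> = (norm (x - y))\<^sup>2 - (inner (x - y) s)\<^sup>2 / (norm s)\<^sup>2"
      using False by (simp add: c_def power2_eq_square field_simps)
    finally have "(inner (x - y) s)\<^sup>2 / (norm s)\<^sup>2 \<le> 0" by simp
    then have "(inner (x - y) s)\<^sup>2 \<le> 0" using False by (simp add: divide_le_0_iff)
    then show ?thesis by simp
  qed simp
  then show ?thesis using yS that by blast
qed

text \<open>Let \<open>M\<close> be the supremum of \<open>norm (K x)\<close> over the unit sphere of
  \<open>W\<close>. A maximising sequence satisfies \<open>K (K (X n)) - M^2 X n \<rightarrow> 0\<close>,
  and compactness turns it into a unit vector with \<open>K (K x) = M^2 x\<close>. Then \<open>v = K x - M
  x\<close> satisfies \<open>K v = - M v\<close>, so \<open>v = 0\<close> by positivity.\<close>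

lemma eigenvector_of_compact_positive:
  fixes K :: "'h::{real_inner, complete_space} \<Rightarrow> 'h"
  assumes W: "subspace W" "closed W" "\<And>x. x \<in> W \<Longrightarrow> K x \<in> W" and w: "w \<in> W" "w \<noteq> 0"
    and lin: "\<And>x y. x \<in> W \<Longrightarrow> y \<in> W \<Longrightarrow> K (x - y) = K x - K y" "\<And>c x. x \<in> W \<Longrightarrow> K (c *\<^sub>R x) = c *\<^sub>R K x"
    and bd: "\<And>x. x \<in> W \<Longrightarrow> norm (K x) \<le> norm x"
    and sym: "\<And>x y. x \<in> W \<Longrightarrow> y \<in> W \<Longrightarrow> inner (K x) y = inner x (K y)"
    and pos: "\<And>x. x \<in> W \<Longrightarrow> 0 \<le> inner (K x) x" and inj: "\<And>x. x \<in> W \<Longrightarrow> K x = 0 \<Longrightarrow> x = 0"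
    and C: "compact C" "\<And>x. x \<in> W \<Longrightarrow> norm x = 1 \<Longrightarrow> K x \<in> C"
  obtains x M where "x \<in> W" "norm x = 1" "K x = M *\<^sub>R x" "M > 0"
proof -
  define Q where "Q = (\<lambda>x. norm (K x)) ` {x \<in> W. norm x = 1}"
  define M where "M = Sup Q"
  define w1 where "w1 = (1 / norm w) *\<^sub>R w"
  have w1: "w1 \<in> W" "norm w1 = 1" using w W by (auto simp: w1_def subspace_scale)
  have Q: "Q \<noteq> {}" "bdd_above Q" proof -
    show "Q \<noteq> {}" using w1 by (auto simp: Q_def)
    show "bdd_above Q" by (rule bdd_aboveI[of _ 1]) (use bd in \<open>force simp: Q_def\<close>)
  qed
  have le: "norm (K x) \<le> M" if "x \<in> W" "norm x = 1" for x
    unfolding M_def by (rule cSup_upper[OF _ Q(2)]) (use that in \<open>auto simp: Q_def\<close>)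
  have M0: "M > 0"
  proof -
    have "K w1 \<noteq> 0" using inj[OF w1(1)] w1(2) by auto
    then have "0 < norm (K w1)" by simp
    also have "\<dots> \<le> M" by (rule le[OF w1])
    finally show ?thesis .
  qed
  have leM: "norm (K x) \<le> M * norm x" if "x \<in> W" for x
  proof (cases "x = 0")
    case True then show ?thesis using bd[OF that] by simp
  next
    case False
    have "norm (K ((1 / norm x) *\<^sub>R x)) \<le> M" by (rule le) (use that W False in \<open>auto simp: subspace_scale\<close>)
    then show ?thesis using False lin(2)[OF that] by (simp add: field_simps)
  qed
  have "\<exists>x. x \<in> W \<and> norm x = 1 \<and> M - 1 / real (Suc n) < norm (K x)" for n
    using less_cSupD[OF Q(1), of "M - 1 / real (Suc n)"] unfolding M_def Q_def by auto
  then obtain X where X: "\<And>n. X n \<in> W" "\<And>n. norm (X n) = 1" "\<And>n. M - 1 / real (Suc n) < norm (K (X n))" by metis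
  have lim: "(\<lambda>n. norm (K (X n))) \<longlonglongrightarrow> M"
  proof (rule tendsto_sandwich[OF _ _ _ tendsto_const])
    show "(\<lambda>n. M - 1 / real (Suc n)) \<longlonglongrightarrow> M"
      using tendsto_diff[OF tendsto_const[of M] LIMSEQ_Suc[OF lim_1_over_n]] by simp
  qed (use X le in \<open>auto intro!: always_eventually less_imp_le\<close>)
  have sq: "(norm (K (K (X n)) - M\<^sup>2 *\<^sub>R X n))\<^sup>2 \<le> M\<^sup>2 * (M\<^sup>2 - (norm (K (X n)))\<^sup>2)" for n
  proof -
    have "(norm (K (K (X n)) - M\<^sup>2 *\<^sub>R X n))\<^sup>2 = (norm (K (K (X n))))\<^sup>2 - 2 * M\<^sup>2 * inner (K (K (X n))) (X n) + M\<^sup>2 * M\<^sup>2 * (norm (X n))\<^sup>2"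
      unfolding power2_norm_eq_inner by (simp add: inner_diff_left inner_diff_right inner_commute algebra_simps)
    also have "inner (K (K (X n))) (X n) = (norm (K (X n)))\<^sup>2"
      unfolding power2_norm_eq_inner by (rule sym) (use X W in auto)
    also have "(norm (K (K (X n))))\<^sup>2 \<le> (M * norm (K (X n)))\<^sup>2"
      by (intro power_mono leM) (use X W in auto)
    finally show ?thesis using X(2) by (simp add: power_mult_distrib algebra_simps)
  qed
  have "(\<lambda>n. M\<^sup>2 * (M\<^sup>2 - (norm (K (X n)))\<^sup>2)) \<longlonglongrightarrow> M\<^sup>2 * (M\<^sup>2 - M\<^sup>2)" by (intro tendsto_intros lim)
  then have lim0: "(\<lambda>n. M\<^sup>2 * (M\<^sup>2 - (norm (K (X n)))\<^sup>2)) \<longlonglongrightarrow> 0" by simp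
  have "(\<lambda>n. (norm (K (K (X n)) - M\<^sup>2 *\<^sub>R X n))\<^sup>2) \<longlonglongrightarrow> 0"
    by (rule tendsto_sandwich[OF _ _ tendsto_const lim0]) (auto intro!: always_eventually sq)
  from tendsto_real_sqrt[OF this] have z: "(\<lambda>n. K (K (X n)) - M\<^sup>2 *\<^sub>R X n) \<longlonglongrightarrow> 0"
    by (simp add: tendsto_norm_zero_iff)
  obtain y r where y: "strict_mono r" "(\<lambda>n. K (X (r n))) \<longlonglongrightarrow> y"
    using C(1)[unfolded compact_def, rule_format, of "\<lambda>n. K (X n)"] C(2)[OF X(1,2)] by (auto simp: o_def)
  have yW: "y \<in> W" by (rule closed_sequentially[OF W(2) _ y(2)]) (use X W in auto)
  have "(\<lambda>n. K (K (X (r n)))) \<longlonglongrightarrow> K y"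
  proof (rule metric_LIMSEQ_I)
    fix e :: real assume "e > 0"
    then obtain N where "\<forall>n\<ge>N. dist (K (X (r n))) y < e" using metric_LIMSEQ_D[OF y(2)] by blast
    moreover have "dist (K (K (X (r n)))) (K y) \<le> dist (K (X (r n))) y" for n
      unfolding dist_norm using X W yW by (subst lin(1)[symmetric]) (auto intro!: bd subspace_diff)
    ultimately show "\<exists>N. \<forall>n\<ge>N. dist (K (K (X (r n)))) (K y) < e" using order.strict_trans1 by blast
  qed
  from tendsto_diff[OF this LIMSEQ_subseq_LIMSEQ[OF z y(1), unfolded o_def]]
  have "(\<lambda>n. M\<^sup>2 *\<^sub>R X (r n)) \<longlonglongrightarrow> K y" by simp
  from tendsto_scaleR[OF tendsto_const[of "1 / M\<^sup>2"] this]
  have Xl: "(\<lambda>n. X (r n)) \<longlonglongrightarrow> (1 / M\<^sup>2) *\<^sub>R K y" using M0 by simp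
  define x where "x = (1 / M\<^sup>2) *\<^sub>R K y"
  have xW: "x \<in> W" unfolding x_def by (intro subspace_scale W yW)
  have "(\<lambda>n. norm (X (r n))) \<longlonglongrightarrow> norm x" unfolding x_def by (rule tendsto_norm[OF Xl])
  then have nx: "norm x = 1" unfolding X(2) using LIMSEQ_unique tendsto_const by blast
  have KX: "(\<lambda>n. K (X (r n))) \<longlonglongrightarrow> K x"
  proof (rule metric_LIMSEQ_I)
    fix e :: real assume "e > 0"
    then obtain N where "\<forall>n\<ge>N. dist (X (r n)) x < e" using metric_LIMSEQ_D[OF Xl] unfolding x_def by blast
    moreover have "dist (K (X (r n))) (K x) \<le> dist (X (r n)) x" for n
      unfolding dist_norm using X W xW by (subst lin(1)[symmetric]) (auto intro!: bd subspace_diff)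
    ultimately show "\<exists>N. \<forall>n\<ge>N. dist (K (X (r n))) (K x) < e" using order.strict_trans1 by blast
  qed
  then have "y = K x" using y(2) LIMSEQ_unique by blast
  then have K2: "K (K x) = M\<^sup>2 *\<^sub>R x" using M0 by (simp add: x_def)
  define v where "v = K x - M *\<^sub>R x"
  have vW: "v \<in> W" unfolding v_def by (intro subspace_diff subspace_scale W xW)
  have "K v = - M *\<^sub>R v"
    unfolding v_def using W xW K2 by (simp add: lin subspace_scale power2_eq_square algebra_simps)
  then have "0 \<le> - (M * (norm v)\<^sup>2)" using pos[OF vW] by (simp add: power2_norm_eq_inner)
  then have "(norm v)\<^sup>2 \<le> 0" using M0 by (simp add: mult_le_0_iff)
  then have "K x = M *\<^sub>R x" by (simp add: v_def)
  then show ?thesis using that xW nx M0 by blast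
qed

lemma selfadjoint_symmetric:
  assumes "selfadjoint_operator H D A" "u \<in> D" "v \<in> D"
  shows "inner (A u) v = inner u (A v)"
proof -
  have "v \<in> H" "A v \<in> H" using assms unfolding selfadjoint_operator_def by auto
  then show ?thesis using assms unfolding selfadjoint_operator_def by blast
qed

text \<open>The inequality \<open>norm u \<le> norm (u + A u)\<close> makes the range of \<open>1 +
  A\<close> closed, and a vector orthogonal to it is an eigenvector for \<open>-1\<close>, hence 0 because
  \<open>A\<close> is nonnegative.\<close>

lemma selfadjoint_range:
  fixes A :: "'h::{real_inner, complete_space} \<Rightarrow> 'h"
  assumes H: "subspace H" "closed H" and sa: "selfadjoint_operator H D A" and nn: "nonneg_operator D A" and w: "w \<in> H"
  shows "\<exists>u\<in>D. u + A u = w"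
proof -
  have D: "subspace D" "D \<subseteq> H" "\<And>u. u \<in> D \<Longrightarrow> A u \<in> H"
    "\<And>u v. u \<in> D \<Longrightarrow> v \<in> D \<Longrightarrow> A (u + v) = A u + A v" "\<And>c u. u \<in> D \<Longrightarrow> A (c *\<^sub>R u) = c *\<^sub>R A u"
    using sa unfolding selfadjoint_operator_def by auto
  have adj: "v \<in> D \<and> A v = w" if "v \<in> H" "w \<in> H" "\<And>u. u \<in> D \<Longrightarrow> inner (A u) v = inner u w" for v w
    using sa that unfolding selfadjoint_operator_def by blast
  have le: "norm u \<le> norm (u + A u)" if "u \<in> D" for u
  proof (cases "u = 0")
    case False
    have "(norm u)\<^sup>2 \<le> inner (u + A u) u"
      using nn that unfolding nonneg_operator_def power2_norm_eq_inner by (auto simp: inner_add_left)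
    also have "\<dots> \<le> norm (u + A u) * norm u" by (rule norm_cauchy_schwarz)
    finally show ?thesis using False by (simp add: power2_eq_square)
  qed simp
  define R where "R = (\<lambda>u. u + A u) ` D"
  have "subspace R" unfolding R_def
  proof (rule subspaceI)
    have "A 0 = 0" using D(5)[OF subspace_0[OF D(1)], of 0] by simp
    then show "0 \<in> (\<lambda>u. u + A u) ` D" using subspace_0[OF D(1)] by force
    show "x + y \<in> (\<lambda>u. u + A u) ` D" if xy: "x \<in> (\<lambda>u. u + A u) ` D" "y \<in> (\<lambda>u. u + A u) ` D" for x y
    proof -
      obtain a b where "a \<in> D" "b \<in> D" "x = a + A a" "y = b + A b" using xy by blast
      then show ?thesis using D by (intro image_eqI[of _ _ "a + b"]) (auto simp: subspace_add)
    qed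
    show "c *\<^sub>R x \<in> (\<lambda>u. u + A u) ` D" if x: "x \<in> (\<lambda>u. u + A u) ` D" for x c
    proof -
      obtain a where "a \<in> D" "x = a + A a" using x by blast
      then show ?thesis using D by (intro image_eqI[of _ _ "c *\<^sub>R a"]) (auto simp: subspace_scale scaleR_right_distrib)
    qed
  qed
  moreover have "closed R"
    unfolding closed_sequential_limits
  proof (intro allI impI, elim conjE)
    fix x r assume x: "\<forall>n. x n \<in> R" and l: "x \<longlonglongrightarrow> r"
    then have "\<forall>n. \<exists>v. v \<in> D \<and> x n = v + A v" by (auto simp: R_def image_iff)
    then obtain u where u: "\<And>n. u n \<in> D" "\<And>n. x n = u n + A (u n)" by metis
    have "Cauchy u"
    proof (rule metric_CauchyI)
      fix e :: real assume "e > 0"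
      then obtain N where N: "\<forall>m\<ge>N. \<forall>n\<ge>N. dist (x m) (x n) < e"
        using LIMSEQ_imp_Cauchy[OF l] metric_CauchyD by blast
      have "dist (u m) (u n) \<le> dist (x m) (x n)" for m n
      proof -
        have "u m - u n \<in> D" by (intro subspace_diff D u)
        from le[OF this] show ?thesis
          using D(4)[OF u(1)[of m] subspace_scale[OF D(1) u(1)[of n], of "-1"]] D(5)[OF u(1)[of n], of "-1"]
          by (simp add: dist_norm u(2) algebra_simps)
      qed
      then show "\<exists>N. \<forall>m\<ge>N. \<forall>n\<ge>N. dist (u m) (u n) < e" using N order.strict_trans1 by blast
    qed
    then obtain u' where u': "u \<longlonglongrightarrow> u'" using Cauchy_convergent convergent_def by blast
    have "u' \<in> H" by (rule closed_sequentially[OF H(2) _ u']) (use u D in auto)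
    have Au: "(\<lambda>n. A (u n)) \<longlonglongrightarrow> r - u'" using tendsto_diff[OF l u'] by (simp add: u(2))
    have "r - u' \<in> H" by (rule closed_sequentially[OF H(2) _ Au]) (use u D in auto)
    have "u' \<in> D \<and> A u' = r - u'"
    proof (rule adj[OF \<open>u' \<in> H\<close> \<open>r - u' \<in> H\<close>])
      fix v assume v: "v \<in> D"
      have "(\<lambda>n. inner (A v) (u n)) \<longlonglongrightarrow> inner (A v) u'" by (intro tendsto_intros u')
      moreover have "(\<lambda>n. inner (A v) (u n)) \<longlonglongrightarrow> inner v (r - u')"
        unfolding selfadjoint_symmetric[OF sa v u(1)] by (intro tendsto_intros Au)
      ultimately show "inner (A v) u' = inner v (r - u')" by (rule LIMSEQ_unique)
    qed
    then show "r \<in> R" unfolding R_def by (intro image_eqI[of _ _ u']) auto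
  qed
  ultimately obtain y where y: "y \<in> R" "\<And>s. s \<in> R \<Longrightarrow> inner (w - y) s = 0"
    using orthogonal_projection_exists by blast
  have "y \<in> H" using y(1) D H by (auto simp: R_def intro!: subspace_add)
  then have zH: "w - y \<in> H" using w H by (simp add: subspace_diff)
  have "inner (A u) (w - y) = inner u (- (w - y))" if "u \<in> D" for u
  proof -
    have "inner (w - y) (u + A u) = 0" by (rule y(2)) (use that in \<open>auto simp: R_def\<close>)
    then show ?thesis
      using inner_commute[of "w - y" u] inner_commute[of "w - y" "A u"] inner_minus_right[of u "w - y"]
        inner_add_right[of "w - y" u "A u"] by linarith
  qed
  from adj[OF zH _ this] have "w - y \<in> D" "A (w - y) = - (w - y)" using zH H subspace_neg by blast+
  then have "0 \<le> - (norm (w - y))\<^sup>2" using nn unfolding nonneg_operator_def power2_norm_eq_inner by (metis inner_minus_left)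
  then have "w = y" by simp
  then show ?thesis using y(1) by (auto simp: R_def)
qed

text \<open>Take a maximal orthonormal set \<open>B\<close> of eigenvectors. The orthogonal complement
  of \<open>B\<close> is invariant under the compact operator \<open>K = (1 + A)^(-1)\<close>; if it were
  nonzero it would contain another eigenvector. \<open>B\<close> is countable by separability, and
  infinite because an eigenvalue not attained in \<open>B\<close> would have eigenvectors orthogonal to
  \<open>B\<close>.\<close>

theorem eigenbasis_exists:
  fixes A :: "'h::{real_inner, complete_space, second_countable_topology} \<Rightarrow> 'h"
  assumes H: "subspace H" "closed H" and sa: "selfadjoint_operator H D A" and nn: "nonneg_operator D A"
    and cpt: "compactly_embedded_domain D A" and inf: "infinite {l. eigenvalue D A l}"
  obtains \<phi> :: "nat \<Rightarrow> 'h" and lam :: "nat \<Rightarrow> real" where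
    "\<And>n. \<phi> n \<in> D" "\<And>n. A (\<phi> n) = lam n *\<^sub>R \<phi> n" "\<And>i j. inner (\<phi> i) (\<phi> j) = (if i = j then 1 else 0)"
    "\<And>h. h \<in> H \<Longrightarrow> (\<And>n. inner h (\<phi> n) = 0) \<Longrightarrow> h = 0"
proof -
  have D: "subspace D" "D \<subseteq> H" "\<And>u. u \<in> D \<Longrightarrow> A u \<in> H"
    "\<And>u v. u \<in> D \<Longrightarrow> v \<in> D \<Longrightarrow> A (u + v) = A u + A v" "\<And>c u. u \<in> D \<Longrightarrow> A (c *\<^sub>R u) = c *\<^sub>R A u"
    using sa unfolding selfadjoint_operator_def by auto
  have Am: "A (u - v) = A u - A v" if "u \<in> D" "v \<in> D" for u v
    using D(4)[OF that(1) subspace_scale[OF D(1) that(2), of "-1"]] D(5)[OF that(2), of "-1"] by simp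
  define K where "K w = (SOME u. u \<in> D \<and> u + A u = w)" for w
  have K: "K w \<in> D" "K w + A (K w) = w" if "w \<in> H" for w
    using someI_ex[of "\<lambda>u. u \<in> D \<and> u + A u = w"] selfadjoint_range[OF H sa nn that] unfolding K_def by blast+
  have uniq: "u = K w" if "u \<in> D" "u + A u = w" "w \<in> H" for u w
  proof -
    define v where "v = u - K w"
    have v: "v \<in> D" unfolding v_def by (intro subspace_diff D that K)
    have "v + A v = 0" unfolding v_def using K[OF that(3)] that by (simp add: Am algebra_simps)
    then have "inner v v + inner (A v) v = 0" by (metis inner_add_left inner_zero_left)
    moreover have "0 \<le> inner (A v) v" using nn v by (auto simp: nonneg_operator_def)
    ultimately have "inner v v = 0" using inner_ge_zero[of v] by linarith
    then show ?thesis by (simp add: v_def)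
  qed
  have Kdiff: "K (x - y) = K x - K y" if "x \<in> H" "y \<in> H" for x y
  proof (rule uniq[symmetric])
    show "K x - K y + A (K x - K y) = x - y" using K[OF that(1)] K[OF that(2)] by (simp add: Am algebra_simps)
  qed (use that K D H in \<open>auto intro: subspace_diff\<close>)
  have Kscale: "K (c *\<^sub>R x) = c *\<^sub>R K x" if "x \<in> H" for c x
  proof (rule uniq[symmetric])
    show "c *\<^sub>R K x + A (c *\<^sub>R K x) = c *\<^sub>R x" using K[OF that] by (simp add: D scaleR_right_distrib[symmetric])
  qed (use that K D H in \<open>auto intro: subspace_scale\<close>)
  have KA: "inner (K x) x = (norm (K x))\<^sup>2 + inner (A (K x)) (K x)" if "x \<in> H" for x
  proof -
    have "inner (K x) x = inner (K x) (K x + A (K x))" using K[OF that] by simp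
    then show ?thesis by (simp add: inner_add_right power2_norm_eq_inner inner_commute)
  qed
  have Ksq: "(norm (K x))\<^sup>2 \<le> inner (K x) x" if "x \<in> H" for x
    using KA[OF that] nn K[OF that] by (auto simp: nonneg_operator_def)
  have Kbd: "norm (K x) \<le> norm x" if "x \<in> H" for x
  proof (cases "K x = 0")
    case False
    have "norm (K x) * norm (K x) \<le> norm (K x) * norm x"
      using Ksq[OF that] norm_cauchy_schwarz[of "K x" x] by (simp add: power2_eq_square)
    then show ?thesis using False by simp
  qed simp
  have Kpos: "0 \<le> inner (K x) x" if "x \<in> H" for x using Ksq[OF that] zero_le_power2[of "norm (K x)"] by linarith
  have Kinj: "x = 0" if "x \<in> H" "K x = 0" for x
    using K[OF that(1)] D(5)[OF subspace_0[OF D(1)], of 0] that(2) by simp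
  have Ksym: "inner (K x) y = inner x (K y)" if "x \<in> H" "y \<in> H" for x y
  proof -
    have "inner (K x) y = inner (K x) (K y + A (K y))" using K[OF that(2)] by simp
    also have "\<dots> = inner (K x + A (K x)) (K y)"
      using selfadjoint_symmetric[OF sa K(1)[OF that(1)] K(1)[OF that(2)]] by (simp add: inner_add_left inner_add_right)
    finally show ?thesis using K[OF that(1)] by simp
  qed
  \<comment> \<open>On the unit sphere \<open>K x\<close> has norm at most 1 and \<open>A (K x) = x
    - K x\<close> has norm at most 2, so the graph norm of \<open>K x\<close> is at most 3.\<close>
  define C where "C = (\<lambda>x. 3 *\<^sub>R x) ` closure {u \<in> D. graph_norm A u \<le> 1}"
  have C: "compact C" unfolding C_def using cpt unfolding compactly_embedded_domain_def by (rule compact_scaling)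
  have KC: "K x \<in> C" if x: "x \<in> H" "norm x = 1" for x
  proof -
    have "norm (A (K x)) = norm (x - K x)" using K[OF x(1)] by (metis add_diff_cancel_left')
    also have "\<dots> \<le> norm x + norm (K x)" by (rule norm_triangle_ineq4)
    finally have a: "norm (A (K x)) \<le> 2" using Kbd[OF x(1)] x(2) by simp
    have b: "norm (K x) \<le> 1" using Kbd[OF x(1)] x(2) by simp
    have "(norm (K x))\<^sup>2 \<le> 1\<^sup>2" "(norm (A (K x)))\<^sup>2 \<le> 2\<^sup>2" using a b by (intro power_mono; simp)+
    then have "((1/3) * norm (K x))\<^sup>2 + ((1/3) * norm (A (K x)))\<^sup>2 \<le> 1" by (simp add: power_divide)
    then have "graph_norm A ((1/3) *\<^sub>R K x) \<le> 1" unfolding graph_norm_def using K[OF x(1)] D(5) by simp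
    then have "(1/3) *\<^sub>R K x \<in> closure {u \<in> D. graph_norm A u \<le> 1}"
      using K[OF x(1)] D by (intro subsetD[OF closure_subset]) (auto simp: subspace_scale)
    then show ?thesis unfolding C_def by (intro image_eqI[of _ _ "(1/3) *\<^sub>R K x"]) auto
  qed
  define \<A> where "\<A> = {B. B \<subseteq> {u \<in> D. norm u = 1 \<and> (\<exists>l. A u = l *\<^sub>R u)} \<and> (\<forall>u\<in>B. \<forall>v\<in>B. u \<noteq> v \<longrightarrow> inner u v = 0)}"
  have "\<exists>B\<in>\<A>. \<forall>X\<in>\<A>. B \<subseteq> X \<longrightarrow> X = B"
  proof (rule subset_Zorn')
    fix \<C> assume c: "subset.chain \<A> \<C>"
    then have cA: "\<C> \<subseteq> \<A>" and cc: "\<And>X Y. X \<in> \<C> \<Longrightarrow> Y \<in> \<C> \<Longrightarrow> X \<subseteq> Y \<or> Y \<subseteq> X"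
      by (auto simp: subset_chain_def)
    have "inner u v = 0" if uv: "u \<in> \<Union>\<C>" "v \<in> \<Union>\<C>" "u \<noteq> v" for u v
    proof -
      obtain X Y where XY: "X \<in> \<C>" "Y \<in> \<C>" "u \<in> X" "v \<in> Y" using uv by blast
      then obtain Z where "Z \<in> \<C>" "u \<in> Z" "v \<in> Z" using cc[of X Y] by blast
      then show ?thesis using cA uv unfolding \<A>_def by blast
    qed
    then show "\<Union>\<C> \<in> \<A>" using cA unfolding \<A>_def by blast
  qed
  then obtain B where B: "B \<in> \<A>" "\<And>X. X \<in> \<A> \<Longrightarrow> B \<subseteq> X \<Longrightarrow> X = B" by blast
  have BD: "u \<in> D" "norm u = 1" "\<exists>l. A u = l *\<^sub>R u" if "u \<in> B" for u using B(1) that unfolding \<A>_def by blast+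
  have Bo: "inner u v = 0" if "u \<in> B" "v \<in> B" "u \<noteq> v" for u v using B(1) that unfolding \<A>_def by blast
  have max: False if "u \<in> D" "norm u = 1" "A u = l *\<^sub>R u" "\<And>b. b \<in> B \<Longrightarrow> inner u b = 0" for u l
  proof -
    have "insert u B \<in> \<A>" unfolding \<A>_def using that BD Bo by (auto simp: inner_commute)
    then have "u \<in> B" using B(2)[of "insert u B"] by blast
    then show False using that(4)[of u] that(2) by (simp add: norm_eq_1)
  qed
  have complete: "h = 0" if h: "h \<in> H" "\<And>b. b \<in> B \<Longrightarrow> inner h b = 0" for h
  proof (rule ccontr)
    assume "h \<noteq> 0"
    define W where "W = {x \<in> H. \<forall>b\<in>B. inner x b = 0}"
    have W: "subspace W" "W \<subseteq> H" "h \<in> W" unfolding W_def using H h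
      by (auto simp: subspace_def inner_add_left)
    have "closed W"
    proof -
      have "W = H \<inter> (\<Inter>b\<in>B. {x. inner x b = 0})" by (auto simp: W_def)
      moreover have "closed {x. inner x b = 0}" for b :: 'h
        by (intro closed_Collect_eq continuous_intros)
      ultimately show ?thesis using H(2) by auto
    qed
    have KW: "K x \<in> W" if x: "x \<in> W" for x
    proof -
      have "inner (K x) b = 0" if b: "b \<in> B" for b
      proof -
        obtain l where l: "A b = l *\<^sub>R b" using BD[OF b] by blast
        have "b \<in> H" using BD[OF b] D by auto
        have l0: "0 \<le> l"
          using nn BD(1,2)[OF b] l unfolding nonneg_operator_def by (metis inner_scaleR_left mult.right_neutral norm_eq_1)
        have "(1 / (1 + l)) *\<^sub>R b = K b"
        proof (rule uniq)
          have "(1 / (1 + l)) *\<^sub>R b + A ((1 / (1 + l)) *\<^sub>R b) = ((1 / (1 + l)) * (1 + l)) *\<^sub>R b"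
            using D(5)[OF BD(1)[OF b], of "1 / (1 + l)"] l by (simp add: scaleR_left_distrib[symmetric] add_divide_distrib[symmetric] del: scaleR_left_distrib)
          then show "(1 / (1 + l)) *\<^sub>R b + A ((1 / (1 + l)) *\<^sub>R b) = b" using l0 by simp
        qed (use BD[OF b] D \<open>b \<in> H\<close> in \<open>auto simp: subspace_scale\<close>)
        then have "inner (K x) b = (1 / (1 + l)) * inner x b"
          using Ksym[of x b] x W \<open>b \<in> H\<close> by (metis inner_scaleR_right subsetD)
        then show ?thesis using x b by (simp add: W_def)
      qed
      moreover have "K x \<in> H" using K x W D by blast
      ultimately show ?thesis by (simp add: W_def)
    qed
    obtain x M where x: "x \<in> W" "norm x = 1" "K x = M *\<^sub>R x" "M > 0"
    proof (rule eigenvector_of_compact_positive[OF W(1) \<open>closed W\<close> KW W(3) \<open>h \<noteq> 0\<close>, where C = C])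
    qed (blast intro: Kdiff Kscale Kbd Ksym Kpos Kinj C KC subsetD[OF W(2)])+
    have xH: "x \<in> H" using x W by auto
    have "x = (1 / M) *\<^sub>R K x" using x by simp
    then have xD: "x \<in> D" using K[OF xH] D subspace_scale by metis
    have "M *\<^sub>R x + M *\<^sub>R A x = x" using K[OF xH] D(5)[OF xD] x(3) by simp
    then have "A x = (1 / M - 1) *\<^sub>R x"
    proof -
      assume e: "M *\<^sub>R x + M *\<^sub>R A x = x"
      have "A x = (1 / M) *\<^sub>R (M *\<^sub>R A x)" using x by simp
      also have "M *\<^sub>R A x = x - M *\<^sub>R x" using e by (metis add_diff_cancel_left')
      finally show ?thesis using x(4) by (simp add: scaleR_diff_right scaleR_left_diff_distrib)
    qed
    then show False using max[OF xD x(2)] x(1) by (auto simp: W_def)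
  qed
  have far: "1 \<le> dist u v" if uv: "u \<in> B" "v \<in> B" "u \<noteq> v" for u v
  proof -
    have "(norm (u - v))\<^sup>2 = 2"
      using Bo[OF uv] BD(2)[OF uv(1)] BD(2)[OF uv(2)] unfolding power2_norm_eq_inner norm_eq_1
      by (simp add: inner_diff_left inner_diff_right inner_commute)
    then show ?thesis unfolding dist_norm by (intro power2_le_imp_le[of 1]) auto
  qed
  have cB: "countable B"
  proof -
    have "countable ((\<lambda>b. ball b (1/2)) ` B)"
    proof (rule countable_disjoint_open_subsets)
      show "pairwise disjnt ((\<lambda>b. ball b (1/2)) ` B)"
      proof (rule pairwise_imageI)
        fix u v assume uv: "u \<in> B" "v \<in> B" "u \<noteq> v"
        have False if "dist u z < 1/2" "dist v z < 1/2" for z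
          using dist_triangle[of u v z] far[OF uv] that by (simp add: dist_commute)
        then show "disjnt (ball u (1/2)) (ball v (1/2))" unfolding disjnt_iff mem_ball by blast
      qed
    qed auto
    moreover have "inj_on (\<lambda>b. ball b (1/2)) B"
    proof (rule inj_onI, rule ccontr)
      fix x y assume xy: "x \<in> B" "y \<in> B" "ball x (1/2) = ball y (1/2)" "x \<noteq> y"
      have "x \<in> ball y (1/2)" unfolding xy(3)[symmetric] by simp
      then show False using far[OF xy(2,1)] xy(4) by simp
    qed
    ultimately show ?thesis using countable_image_inj_on by blast
  qed
  have iB: "infinite B"
  proof
    assume fB: "finite B"
    define ev where "ev u = (SOME l. A u = l *\<^sub>R u)" for u
    have ev: "A u = ev u *\<^sub>R u" if "u \<in> B" for u unfolding ev_def by (rule someI_ex[OF BD(3)[OF that]])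
    have "l \<in> ev ` B" if l: "eigenvalue D A l" for l
    proof (rule ccontr)
      assume n: "l \<notin> ev ` B"
      obtain u where u: "u \<in> D" "u \<noteq> 0" "A u = l *\<^sub>R u" using l unfolding eigenvalue_def by blast
      have "inner u b = 0" if "b \<in> B" for b
      proof -
        have "l * inner u b = ev b * inner u b"
          using selfadjoint_symmetric[OF sa u(1) BD(1)[OF that]] u(3) ev[OF that] by simp
        then show ?thesis using n that by auto
      qed
      then show False using complete[of u] u D by blast
    qed
    then have "{l. eigenvalue D A l} \<subseteq> ev ` B" by blast
    then show False using inf fB finite_subset by blast
  qed
  define \<phi> where "\<phi> = from_nat_into B"
  have bij: "bij_betw \<phi> UNIV B" unfolding \<phi>_def by (rule bij_betw_from_nat_into[OF cB iB])
  have pB: "\<phi> n \<in> B" for n using bij by (auto simp: bij_betw_def)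
  have "\<exists>lam. \<forall>n. A (\<phi> n) = lam n *\<^sub>R \<phi> n" using BD(3)[OF pB] by metis
  then obtain lam where lam: "\<And>n. A (\<phi> n) = lam n *\<^sub>R \<phi> n" by blast
  show ?thesis
  proof (rule that[of \<phi> lam])
    show "inner (\<phi> i) (\<phi> j) = (if i = j then 1 else 0)" for i j
      using Bo[OF pB[of i] pB[of j]] BD(2)[OF pB[of i]] bij by (auto simp: bij_betw_def norm_eq_1 dest: injD)
    show "h = 0" if "h \<in> H" "\<And>n. inner h (\<phi> n) = 0" for h
      using complete[OF that(1)] that(2) bij unfolding bij_betw_def by (metis imageE)
  qed (use BD(1)[OF pB] lam in auto)
qed

section \<open>Eigenvector expansions, the form and its dual\<close>

definition l2_seq :: "(nat \<Rightarrow> real) \<Rightarrow> bool" where "l2_seq b \<longleftrightarrow> summable (\<lambda>n. (b n)\<^sup>2)"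

lemma l2_seq_le:
  assumes "l2_seq b" "\<And>n. \<bar>c n\<bar> \<le> \<bar>b n\<bar>"
  shows "l2_seq c"
  unfolding l2_seq_def
proof (rule summable_comparison_test'[OF assms(1)[unfolded l2_seq_def], of 0])
  show "norm ((c n)\<^sup>2) \<le> (b n)\<^sup>2" for n using assms(2)[of n] by (simp add: abs_le_square_iff)
qed

lemma l2_seq_scale: "l2_seq b \<Longrightarrow> l2_seq (\<lambda>n. k * b n)"
  unfolding l2_seq_def by (simp add: power_mult_distrib summable_mult)

lemma l2_seq_abs: "l2_seq b \<Longrightarrow> l2_seq (\<lambda>n. \<bar>b n\<bar>)"
  unfolding l2_seq_def by simp

lemma l2_seq_mult_summable:
  assumes "l2_seq b" "l2_seq c"
  shows "summable (\<lambda>n. \<bar>b n * c n\<bar>)"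
proof (rule summable_comparison_test'[OF summable_add[OF assms[unfolded l2_seq_def]], of 0])
  fix n
  have "2 * (\<bar>b n\<bar> * \<bar>c n\<bar>) \<le> (b n)\<^sup>2 + (c n)\<^sup>2" using sum_squares_bound[of "\<bar>b n\<bar>" "\<bar>c n\<bar>"] by simp
  moreover have "0 \<le> \<bar>b n\<bar> * \<bar>c n\<bar>" by simp
  ultimately have "\<bar>b n\<bar> * \<bar>c n\<bar> \<le> (b n)\<^sup>2 + (c n)\<^sup>2" by linarith
  then show "norm \<bar>b n * c n\<bar> \<le> (b n)\<^sup>2 + (c n)\<^sup>2" by (simp add: abs_mult)
qed

lemma l2_seq_add:
  assumes "l2_seq b" "l2_seq c"
  shows "l2_seq (\<lambda>n. b n + c n)"
  unfolding l2_seq_def power2_sum mult.assoc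
  using assms summable_rabs_cancel[OF l2_seq_mult_summable[OF assms]]
  by (intro summable_add summable_mult) (auto simp: l2_seq_def)

lemma l2_seq_diff:
  assumes "l2_seq b" "l2_seq c"
  shows "l2_seq (\<lambda>n. b n - c n)"
  using l2_seq_add[OF assms(1) l2_seq_scale[OF assms(2), of "-1"]] by simp

lemma l2_seq_sum:
  assumes "\<And>i. i \<in> I \<Longrightarrow> l2_seq (b i)"
  shows "l2_seq (\<lambda>n. \<Sum>i\<in>I. b i n)"
  using assms
proof (induction I rule: infinite_finite_induct)
  case (insert i I)
  then show ?case using l2_seq_add[of "b i" "\<lambda>n. \<Sum>i\<in>I. b i n"] by simp
qed (auto simp: l2_seq_def)

lemma l2_seq_Cauchy_Schwarz:
  assumes "l2_seq b" "l2_seq c"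
  shows "\<bar>\<Sum>n. b n * c n\<bar> \<le> sqrt (\<Sum>n. (b n)\<^sup>2) * sqrt (\<Sum>n. (c n)\<^sup>2)"
proof -
  have s: "summable (\<lambda>n. \<bar>b n * c n\<bar>)" by (rule l2_seq_mult_summable[OF assms])
  have "\<bar>\<Sum>n. b n * c n\<bar> \<le> (\<Sum>n. \<bar>b n * c n\<bar>)" by (rule summable_rabs[OF s])
  also have "\<dots> \<le> sqrt (\<Sum>n. (b n)\<^sup>2) * sqrt (\<Sum>n. (c n)\<^sup>2)"
  proof (rule suminf_le_const[OF s])
    fix N
    have "(\<Sum>n<N. \<bar>b n * c n\<bar>) \<le> L2_set b {..<N} * L2_set c {..<N}"
      unfolding abs_mult by (rule L2_set_mult_ineq)
    also have "\<dots> \<le> sqrt (\<Sum>n. (b n)\<^sup>2) * sqrt (\<Sum>n. (c n)\<^sup>2)"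
      unfolding L2_set_def using assms unfolding l2_seq_def
      by (intro mult_mono real_sqrt_le_mono sum_le_suminf suminf_nonneg real_sqrt_ge_zero sum_nonneg) auto
    finally show "(\<Sum>n<N. \<bar>b n * c n\<bar>) \<le> sqrt (\<Sum>n. (b n)\<^sup>2) * sqrt (\<Sum>n. (c n)\<^sup>2)" .
  qed
  finally show ?thesis .
qed

text \<open>Tannery's theorem for the squares.\<close>

lemma l2_seq_dominated:
  fixes q :: "'c \<Rightarrow> nat \<Rightarrow> real"
  assumes b: "l2_seq b"
    and dom: "eventually (\<lambda>s. \<forall>n. \<bar>q s n\<bar> \<le> b n) F"
    and lim: "\<And>n. ((\<lambda>s. q s n) \<longlongrightarrow> 0) F"
  shows "((\<lambda>s. \<Sum>n. (q s n)\<^sup>2) \<longlongrightarrow> 0) F"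
proof (cases "F = bot")
  case False
  have "((\<lambda>s. \<Sum>n. (q s n)\<^sup>2) \<longlongrightarrow> (\<Sum>n::nat. (0::real))) F"
  proof (rule conjunct2[OF conjunct2[OF tannerys_theorem]])
    show "summable (\<lambda>n. (b n)\<^sup>2)" using b by (simp add: l2_seq_def)
    show "((\<lambda>s. (q s n)\<^sup>2) \<longlongrightarrow> 0) F" for n using tendsto_power[OF lim, of n 2] by simp
    have "eventually (\<lambda>s. \<forall>n. norm ((q s n)\<^sup>2) \<le> (b n)\<^sup>2) F"
      using dom
    proof eventually_elim
      case (elim s)
      show ?case
      proof
        fix n
        have "\<bar>q s n\<bar> \<le> \<bar>b n\<bar>" using elim abs_ge_self order_trans by blast
        then show "norm ((q s n)\<^sup>2) \<le> (b n)\<^sup>2" by (simp add: abs_le_square_iff)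
      qed
    qed
    then show "eventually (\<lambda>(n, s). norm ((q s n)\<^sup>2) \<le> (b n)\<^sup>2) (at_top \<times>\<^sub>F F)"
      unfolding eventually_prod_filter
      by (intro exI[of _ "\<lambda>_. True"] exI[of _ "\<lambda>s. \<forall>n. norm ((q s n)\<^sup>2) \<le> (b n)\<^sup>2"]) auto
  qed (use False in simp)
  then show ?thesis by simp
qed simp

lemma discriminant_bound:
  fixes a b c :: real
  assumes "\<And>t. 0 \<le> a - 2 * t * b + t\<^sup>2 * c" "0 \<le> a" "0 \<le> c"
  shows "b\<^sup>2 \<le> a * c"
proof (cases "c = 0")
  case True
  have "b = 0"
  proof (rule ccontr)
    assume b: "b \<noteq> 0"
    have "0 \<le> a - 2 * ((a + 1) / (2 * b)) * b" using assms(1)[of "(a + 1) / (2 * b)"] True by simp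
    then show False using b by simp
  qed
  then show ?thesis using True by simp
next
  case False
  then have "0 \<le> a - b\<^sup>2 / c" using assms(1)[of "b / c"] by (simp add: power2_eq_square)
  then show ?thesis using False assms(3) by (simp add: field_simps)
qed

text \<open>The situation left by the spectral theorem. The eigenvalues \<open>lam n\<close> are listed
  with multiplicity and in no particular order.\<close>

locale eigen_form =
  fixes H V :: "'h::{real_inner, banach, second_countable_topology} set"
    and E :: "'h \<Rightarrow> 'h \<Rightarrow> real" and \<phi> :: "nat \<Rightarrow> 'h" and lam :: "nat \<Rightarrow> real" and l0 :: real
  assumes H: "subspace H" "closed H" and form: "closed_nonneg_form H V E"
    and phiV: "\<And>n. \<phi> n \<in> V" and Ephi: "\<And>n v. v \<in> V \<Longrightarrow> E (\<phi> n) v = lam n * inner (\<phi> n) v"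
    and ortho: "\<And>i j. inner (\<phi> i) (\<phi> j) = (if i = j then 1 else 0)"
    and complete: "\<And>h. h \<in> H \<Longrightarrow> (\<And>n. inner h (\<phi> n) = 0) \<Longrightarrow> h = 0"
    and l0: "l0 > 0" and lam: "\<And>n. l0 \<le> lam n"
begin

lemma lam_pos: "lam n > 0" using l0 lam less_le_trans by blast

lemma V: "subspace V" "V \<subseteq> H" and E_add: "\<And>u v w. u \<in> V \<Longrightarrow> v \<in> V \<Longrightarrow> w \<in> V \<Longrightarrow> E (u + v) w = E u w + E v w"
  and E_scale: "\<And>c u v. u \<in> V \<Longrightarrow> v \<in> V \<Longrightarrow> E (c *\<^sub>R u) v = c * E u v"
  and E_sym: "\<And>u v. u \<in> V \<Longrightarrow> v \<in> V \<Longrightarrow> E u v = E v u" and E_nonneg: "\<And>u. u \<in> V \<Longrightarrow> 0 \<le> E u u"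
  using form unfolding closed_nonneg_form_def symmetric_form_def by blast+

lemma E_diff: "u \<in> V \<Longrightarrow> v \<in> V \<Longrightarrow> w \<in> V \<Longrightarrow> E (u - v) w = E u w - E v w"
  using E_add[of u "(-1) *\<^sub>R v" w] E_scale[of v w "-1"] subspace_scale[OF V(1), of v "-1"] by simp

lemma E_add2: "u \<in> V \<Longrightarrow> v \<in> V \<Longrightarrow> w \<in> V \<Longrightarrow> E w (u + v) = E w u + E w v"
  using E_add[of u v w] E_sym[of w] subspace_add[OF V(1)] by metis

lemma E_scale2: "u \<in> V \<Longrightarrow> v \<in> V \<Longrightarrow> E v (c *\<^sub>R u) = c * E v u"
  using E_scale[of u v c] E_sym[of v] subspace_scale[OF V(1)] by metis

lemma E_diff2: "u \<in> V \<Longrightarrow> v \<in> V \<Longrightarrow> w \<in> V \<Longrightarrow> E w (u - v) = E w u - E w v"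
  using E_diff[of u v w] E_sym[of w] subspace_diff[OF V(1)] by metis

lemma form_norm_sq: "u \<in> V \<Longrightarrow> (form_norm E u)\<^sup>2 = (norm u)\<^sup>2 + E u u"
  unfolding form_norm_def using E_nonneg by simp

lemma form_norm_nonneg: "u \<in> V \<Longrightarrow> 0 \<le> form_norm E u"
  unfolding form_norm_def using E_nonneg by simp

lemma norm_le_form_norm: "u \<in> V \<Longrightarrow> norm u \<le> form_norm E u"
  by (rule power2_le_imp_le) (use form_norm_sq[of u] E_nonneg[of u] form_norm_nonneg[of u] in auto)

lemma form_norm_scale: "u \<in> V \<Longrightarrow> form_norm E (c *\<^sub>R u) = \<bar>c\<bar> * form_norm E u"
proof -
  assume u: "u \<in> V"
  have cu: "c *\<^sub>R u \<in> V" using u V by (simp add: subspace_scale)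
  have "(form_norm E (c *\<^sub>R u))\<^sup>2 = (\<bar>c\<bar> * form_norm E u)\<^sup>2"
    unfolding power_mult_distrib form_norm_sq[OF u] form_norm_sq[OF cu]
    using u cu by (simp add: E_scale E_scale2 power_mult_distrib) (simp add: power2_eq_square algebra_simps)
  then show ?thesis
    using form_norm_nonneg[OF u] form_norm_nonneg[OF subspace_scale[OF V(1) u, of c]] by (simp add: power2_eq_iff_nonneg)
qed

lemma abs_E_le:
  assumes u: "u \<in> V" and v: "v \<in> V"
  shows "\<bar>E u v\<bar> \<le> form_norm E u * form_norm E v"
proof -
  have "(E u v)\<^sup>2 \<le> E u u * E v v"
  proof (rule discriminant_bound)
    fix t :: real
    have tv: "t *\<^sub>R v \<in> V" using v V by (simp add: subspace_scale)
    have "0 \<le> E (u - t *\<^sub>R v) (u - t *\<^sub>R v)" by (intro E_nonneg subspace_diff V u tv)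
    also have "\<dots> = E u u - 2 * t * E u v + t\<^sup>2 * E v v"
      using u v tv E_sym[OF u v] subspace_diff[OF V(1) u tv]
      by (simp add: E_diff E_diff2 E_scale E_scale2 power2_eq_square algebra_simps)
    finally show "0 \<le> E u u - 2 * t * E u v + t\<^sup>2 * E v v" .
  qed (use E_nonneg u v in auto)
  also have "\<dots> \<le> (form_norm E u)\<^sup>2 * (form_norm E v)\<^sup>2"
    using u v E_nonneg by (intro mult_mono) (auto simp: form_norm_sq)
  finally have "(E u v)\<^sup>2 \<le> (form_norm E u * form_norm E v)\<^sup>2" by (simp add: power_mult_distrib)
  then show ?thesis using abs_le_square_iff[of "E u v" "form_norm E u * form_norm E v"] form_norm_nonneg[OF u] form_norm_nonneg[OF v] by simp
qed

lemma finite_sum_V: "(\<Sum>n\<in>I. c n *\<^sub>R \<phi> n) \<in> V"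
  by (intro subspace_sum V subspace_scale phiV)

lemma E_finite_sum: "finite I \<Longrightarrow> v \<in> V \<Longrightarrow> E (\<Sum>n\<in>I. c n *\<^sub>R \<phi> n) v = (\<Sum>n\<in>I. lam n * c n * inner (\<phi> n) v)"
proof (induction I rule: finite_induct)
  case empty
  then show ?case using E_scale[of v v 0] by (metis mult_zero_left scale_zero_left sum.empty subspace_0[OF V(1)] E_scale)
next
  case (insert n I)
  then show ?case
    using E_add[OF subspace_scale[OF V(1) phiV, of "c n" n] finite_sum_V, of v c I]
    by (simp add: E_scale phiV Ephi)
qed

lemma inner_phi_finite_sum: "finite I \<Longrightarrow> n \<in> I \<Longrightarrow> inner (\<phi> n) (\<Sum>m\<in>I. c m *\<^sub>R \<phi> m) = c n"
proof -
  assume I: "finite I" "n \<in> I"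
  have "inner (\<phi> n) (\<Sum>m\<in>I. c m *\<^sub>R \<phi> m) = (\<Sum>m\<in>I. if n = m then c m else 0)"
    unfolding inner_sum_right by (intro sum.cong) (auto simp: ortho)
  then show ?thesis using I by simp
qed

lemma norm_finite_sum: "finite I \<Longrightarrow> (norm (\<Sum>n\<in>I. c n *\<^sub>R \<phi> n))\<^sup>2 = (\<Sum>n\<in>I. (c n)\<^sup>2)"
proof -
  assume I: "finite I"
  have "(norm (\<Sum>n\<in>I. c n *\<^sub>R \<phi> n))\<^sup>2 = (\<Sum>n\<in>I. c n * inner (\<phi> n) (\<Sum>m\<in>I. c m *\<^sub>R \<phi> m))"
    unfolding power2_norm_eq_inner by (subst inner_sum_left) simp
  also have "\<dots> = (\<Sum>n\<in>I. (c n)\<^sup>2)" by (intro sum.cong refl) (simp add: inner_phi_finite_sum I power2_eq_square)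
  finally show ?thesis .
qed

lemma form_norm_finite_sum: "finite I \<Longrightarrow> (form_norm E (\<Sum>n\<in>I. c n *\<^sub>R \<phi> n))\<^sup>2 = (\<Sum>n\<in>I. (1 + lam n) * (c n)\<^sup>2)"
proof -
  assume I: "finite I"
  have "E (\<Sum>n\<in>I. c n *\<^sub>R \<phi> n) (\<Sum>n\<in>I. c n *\<^sub>R \<phi> n) = (\<Sum>n\<in>I. lam n * (c n)\<^sup>2)"
    unfolding E_finite_sum[OF I finite_sum_V] by (intro sum.cong refl) (simp add: inner_phi_finite_sum I power2_eq_square)
  then show ?thesis unfolding form_norm_sq[OF finite_sum_V] norm_finite_sum[OF I] by (simp add: sum.distrib distrib_right)
qed

definition synth :: "(nat \<Rightarrow> real) \<Rightarrow> 'h" where "synth c = (\<Sum>n. c n *\<^sub>R \<phi> n)"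

lemma synth_sums:
  assumes "l2_seq c" shows "(\<lambda>n. c n *\<^sub>R \<phi> n) sums synth c"
proof -
  have "summable (\<lambda>n. c n *\<^sub>R \<phi> n)"
    unfolding summable_Cauchy
  proof (intro allI impI)
    fix e :: real assume e: "e > 0"
    obtain N where N: "\<And>m n. m \<ge> N \<Longrightarrow> norm (\<Sum>k=m..<n. (c k)\<^sup>2) < e\<^sup>2"
      using assms[unfolded l2_seq_def summable_Cauchy, rule_format, of "e\<^sup>2"] e by auto
    have "norm (\<Sum>k=m..<n. c k *\<^sub>R \<phi> k) < e" if "m \<ge> N" for m n
    proof (rule power2_less_imp_less)
      show "(norm (\<Sum>k=m..<n. c k *\<^sub>R \<phi> k))\<^sup>2 < e\<^sup>2"
        using N[OF that, of n] by (simp add: norm_finite_sum)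
    qed (use e in simp)
    then show "\<exists>N. \<forall>m\<ge>N. \<forall>n. norm (\<Sum>k=m..<n. c k *\<^sub>R \<phi> k) < e" by blast
  qed
  then show ?thesis unfolding synth_def by (rule summable_sums)
qed

lemma inner_synth_sums:
  assumes "l2_seq c" shows "(\<lambda>n. c n * inner (\<phi> n) x) sums inner (synth c) x"
  using bounded_linear.sums[OF bounded_linear_inner_left[of x] synth_sums[OF assms]] by simp

lemma inner_synth_phi:
  assumes "l2_seq c" shows "inner (synth c) (\<phi> n) = c n"
proof -
  have "(\<lambda>m. c m * inner (\<phi> m) (\<phi> n)) sums c n"
    using sums_single[of n c] by (rule sums_cong[THEN iffD1, rotated]) (simp add: ortho)
  then show ?thesis using inner_synth_sums[OF assms, of "\<phi> n"] sums_unique2 by blast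
qed

lemma norm_synth: 
  assumes "l2_seq c" shows "norm (synth c) = sqrt (\<Sum>n. (c n)\<^sup>2)"
proof -
  have "(\<lambda>n. c n * c n) sums inner (synth c) (synth c)"
    using inner_synth_sums[OF assms, of "synth c"] inner_synth_phi[OF assms] by (simp add: inner_commute)
  then show ?thesis by (simp add: norm_eq_sqrt_inner sums_iff power2_eq_square)
qed

lemma synth_H:
  assumes "l2_seq c" shows "synth c \<in> H"
proof (rule closed_sequentially[OF H(2)])
  show "(\<lambda>N. \<Sum>n<N. c n *\<^sub>R \<phi> n) \<longlonglongrightarrow> synth c" using synth_sums[OF assms] by (simp add: sums_def)
  show "(\<Sum>n<N. c n *\<^sub>R \<phi> n) \<in> H" for N using finite_sum_V V by blast
qed

lemma l2_seq_coeff: "l2_seq (\<lambda>n. inner h (\<phi> n))"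
  unfolding l2_seq_def
proof (rule summableI_nonneg_bounded)
  fix N
  let ?s = "\<Sum>n<N. inner h (\<phi> n) *\<^sub>R \<phi> n"
  have "inner h ?s = (\<Sum>n<N. (inner h (\<phi> n))\<^sup>2)" by (simp add: inner_sum_right power2_eq_square)
  moreover have "0 \<le> (norm (h - ?s))\<^sup>2" by simp
  ultimately show "(\<Sum>n<N. (inner h (\<phi> n))\<^sup>2) \<le> (norm h)\<^sup>2"
    using norm_finite_sum[of "{..<N}" "\<lambda>n. inner h (\<phi> n)"] unfolding power2_norm_eq_inner
    by (simp add: inner_diff_left inner_diff_right inner_commute)
qed simp

lemma synth_coeff:
  assumes "h \<in> H" shows "synth (\<lambda>n. inner h (\<phi> n)) = h"
proof -
  let ?c = "\<lambda>n. inner h (\<phi> n)"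
  have "h - synth ?c \<in> H" using assms synth_H[OF l2_seq_coeff] H by (simp add: subspace_diff)
  then have "h - synth ?c = 0"
    by (rule complete) (simp add: inner_diff_left inner_synth_phi[OF l2_seq_coeff])
  then show ?thesis by simp
qed

text \<open>The partial sums form a Cauchy sequence for the form norm, and the form is closed.\<close>

lemma synth_form:
  assumes c: "l2_seq (\<lambda>n. sqrt (lam n) * c n)"
  shows "l2_seq c" "synth c \<in> V" "\<And>v. v \<in> V \<Longrightarrow> (\<lambda>n. lam n * c n * inner (\<phi> n) v) sums E (synth c) v"
    "(form_norm E (synth c))\<^sup>2 = (\<Sum>n. (1 + lam n) * (c n)\<^sup>2)" "summable (\<lambda>n. (1 + lam n) * (c n)\<^sup>2)"
proof -
  have c2: "summable (\<lambda>n. lam n * (c n)\<^sup>2)"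
    using c lam_pos unfolding l2_seq_def by (simp add: power_mult_distrib less_imp_le)
  show lc: "l2_seq c"
    unfolding l2_seq_def
  proof (rule summable_comparison_test'[OF summable_mult[OF c2, of "1 / l0"], of 0])
    fix n
    have "1 \<le> lam n / l0" using lam[of n] l0 by simp
    then have "1 * (c n)\<^sup>2 \<le> lam n / l0 * (c n)\<^sup>2" by (rule mult_right_mono) simp
    then show "norm ((c n)\<^sup>2) \<le> 1 / l0 * (lam n * (c n)\<^sup>2)" by simp
  qed
  show s: "summable (\<lambda>n. (1 + lam n) * (c n)\<^sup>2)"
    using summable_add[OF lc[unfolded l2_seq_def] c2] by (simp add: distrib_right)
  define S where "S N = (\<Sum>n<N. c n *\<^sub>R \<phi> n)" for N
  have SV: "S N \<in> V" for N unfolding S_def by (rule finite_sum_V)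
  have Sd: "S n - S m = (\<Sum>k=m..<n. c k *\<^sub>R \<phi> k)" if "m \<le> n" for m n
    unfolding S_def lessThan_atLeast0 using sum_diff_nat_ivl[of 0 m n "\<lambda>k. c k *\<^sub>R \<phi> k"] that by simp
  have fm: "form_norm E (x - y) = form_norm E (y - x)" if "x \<in> V" "y \<in> V" for x y
    using form_norm_scale[of "y - x" "-1"] subspace_diff[OF V(1) that(2,1)] by simp
  have "\<exists>M. \<forall>m\<ge>M. \<forall>n\<ge>M. form_norm E (S m - S n) < e" if e: "e > 0" for e
  proof -
    obtain N where N: "\<And>m n. m \<ge> N \<Longrightarrow> norm (\<Sum>k=m..<n. (1 + lam k) * (c k)\<^sup>2) < e\<^sup>2"
      using s[unfolded summable_Cauchy, rule_format, of "e\<^sup>2"] e by auto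
    have *: "form_norm E (S n - S m) < e" if "m \<ge> N" "m \<le> n" for m n
    proof (rule power2_less_imp_less)
      show "(form_norm E (S n - S m))\<^sup>2 < e\<^sup>2"
        unfolding Sd[OF that(2)] using N[OF that(1), of n] by (simp add: form_norm_finite_sum)
    qed (use e in simp)
    have "form_norm E (S m - S n) < e" if "m \<ge> N" "n \<ge> N" for m n
      using *[of m n] *[of n m] that fm[OF SV SV, of m n] by (cases "m \<le> n") auto
    then show ?thesis by blast
  qed
  then obtain u where u: "u \<in> V" "(\<lambda>N. form_norm E (S N - u)) \<longlonglongrightarrow> 0"
    using form SV unfolding closed_nonneg_form_def by blast
  have "(\<lambda>N. norm (S N - u)) \<longlonglongrightarrow> 0"
    by (rule tendsto_sandwich[OF _ _ tendsto_const u(2)])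
       (auto intro!: always_eventually norm_le_form_norm subspace_diff V SV u(1))
  then have "S \<longlonglongrightarrow> u" using tendsto_norm_zero_iff LIM_zero_iff by blast
  moreover have "S \<longlonglongrightarrow> synth c" using synth_sums[OF lc] by (simp add: sums_def S_def[abs_def])
  ultimately have us: "u = synth c" by (rule LIMSEQ_unique)
  then show sV: "synth c \<in> V" using u by simp
  have Elim: "(\<lambda>N. E (S N) v) \<longlonglongrightarrow> E (synth c) v" if v: "v \<in> V" for v
  proof -
    have "(\<lambda>N. E (S N - u) v) \<longlonglongrightarrow> 0"
    proof (rule Lim_null_comparison)
      show "eventually (\<lambda>N. norm (E (S N - u) v) \<le> form_norm E (S N - u) * form_norm E v) sequentially"
        by (auto intro!: always_eventually abs_E_le subspace_diff V SV u(1) v)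
      show "(\<lambda>N. form_norm E (S N - u) * form_norm E v) \<longlonglongrightarrow> 0"
        using tendsto_mult[OF u(2) tendsto_const[of "form_norm E v"]] by simp
    qed
    then have "(\<lambda>N. E (S N) v - E u v) \<longlonglongrightarrow> 0" by (simp add: E_diff SV u(1) v)
    then show ?thesis unfolding us using LIM_zero_iff by blast
  qed
  show Esum: "(\<lambda>n. lam n * c n * inner (\<phi> n) v) sums E (synth c) v" if v: "v \<in> V" for v
    using Elim[OF v] unfolding sums_def S_def E_finite_sum[OF finite_lessThan v] .
  have "(\<lambda>n. lam n * (c n)\<^sup>2) sums E (synth c) (synth c)"
    using Esum[OF sV] inner_synth_phi[OF lc] by (simp add: inner_commute power2_eq_square mult_ac)
  moreover have "(norm (synth c))\<^sup>2 = (\<Sum>n. (c n)\<^sup>2)"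
    unfolding norm_synth[OF lc] using lc unfolding l2_seq_def by (simp add: suminf_nonneg)
  ultimately show "(form_norm E (synth c))\<^sup>2 = (\<Sum>n. (1 + lam n) * (c n)\<^sup>2)"
    unfolding form_norm_sq[OF sV] using suminf_add[OF lc[unfolded l2_seq_def] c2] by (simp add: sums_iff distrib_right)
qed

text \<open>Nonnegativity of \<open>E (v - s) (v - s)\<close> for the partial sums \<open>s\<close> of
  the expansion of \<open>v\<close>.\<close>

lemma form_Bessel:
  assumes v: "v \<in> V"
  shows "l2_seq (\<lambda>n. sqrt (lam n) * inner (\<phi> n) v)" "(\<Sum>n. (sqrt (lam n) * inner (\<phi> n) v)\<^sup>2) \<le> E v v"
proof -
  have b: "(\<Sum>n<N. (sqrt (lam n) * inner (\<phi> n) v)\<^sup>2) \<le> E v v" for N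
  proof -
    let ?c = "\<lambda>n. inner (\<phi> n) v"
    let ?s = "\<Sum>n<N. ?c n *\<^sub>R \<phi> n"
    have 1: "E ?s v = (\<Sum>n<N. (sqrt (lam n) * inner (\<phi> n) v)\<^sup>2)"
      unfolding E_finite_sum[OF finite_lessThan v]
      by (intro sum.cong refl) (simp add: power_mult_distrib less_imp_le[OF lam_pos] power2_eq_square)
    have 2: "E ?s ?s = E ?s v"
      unfolding E_finite_sum[OF finite_lessThan v] E_finite_sum[OF finite_lessThan finite_sum_V]
      by (intro sum.cong refl) (simp add: inner_phi_finite_sum)
    have "0 \<le> E (v - ?s) (v - ?s)" by (intro E_nonneg subspace_diff V v finite_sum_V)
    also have "\<dots> = E v v - E ?s v"
      using E_sym[OF v finite_sum_V[of ?c "{..<N}"]] 2 subspace_diff[OF V(1) v finite_sum_V[of ?c "{..<N}"]]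
      by (simp add: E_diff E_diff2 v finite_sum_V)
    finally show ?thesis using 1 by simp
  qed
  show s: "l2_seq (\<lambda>n. sqrt (lam n) * inner (\<phi> n) v)"
    unfolding l2_seq_def by (rule summableI_nonneg_bounded[OF _ b]) simp
  show "(\<Sum>n. (sqrt (lam n) * inner (\<phi> n) v)\<^sup>2) \<le> E v v"
    by (rule suminf_le_const[OF s[unfolded l2_seq_def] b])
qed

text \<open>The weight \<open>sqrt (lam n)\<close> is chosen so that the dual norm of the functional is
  at most the l2 norm of \<open>q\<close>.\<close>

definition dual_synth :: "(nat \<Rightarrow> real) \<Rightarrow> 'h \<Rightarrow> real" where
  "dual_synth q v = (\<Sum>n. q n * (sqrt (lam n) * inner (\<phi> n) v))"

lemma dual_synth_summable: "l2_seq q \<Longrightarrow> v \<in> V \<Longrightarrow> summable (\<lambda>n. \<bar>q n * (sqrt (lam n) * inner (\<phi> n) v)\<bar>)"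
  by (intro l2_seq_mult_summable form_Bessel)

lemma dual_synth_le:
  assumes q: "l2_seq q" and v: "v \<in> V"
  shows "\<bar>dual_synth q v\<bar> \<le> sqrt (\<Sum>n. (q n)\<^sup>2) * form_norm E v"
proof -
  have "\<bar>dual_synth q v\<bar> \<le> sqrt (\<Sum>n. (q n)\<^sup>2) * sqrt (\<Sum>n. (sqrt (lam n) * inner (\<phi> n) v)\<^sup>2)"
    unfolding dual_synth_def by (rule l2_seq_Cauchy_Schwarz[OF q form_Bessel(1)[OF v]])
  also have "\<dots> \<le> sqrt (\<Sum>n. (q n)\<^sup>2) * form_norm E v"
    unfolding form_norm_def using form_Bessel(2)[OF v] q unfolding l2_seq_def
    by (intro mult_left_mono real_sqrt_le_mono real_sqrt_ge_zero suminf_nonneg) (auto intro: add_increasing)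
  finally show ?thesis .
qed

lemma dual_synth_diff:
  assumes "l2_seq p" "l2_seq q" "v \<in> V"
  shows "dual_synth p v - dual_synth q v = dual_synth (\<lambda>n. p n - q n) v"
  unfolding dual_synth_def left_diff_distrib
  by (intro suminf_diff summable_rabs_cancel[OF dual_synth_summable] assms)

lemma dual_synth_form_dual:
  assumes q: "l2_seq q" shows "dual_synth q \<in> form_dual V E"
  unfolding form_dual_def mem_Collect_eq
proof (intro conjI ballI allI exI)
  fix u v assume uv: "u \<in> V" "v \<in> V"
  show "dual_synth q (u + v) = dual_synth q u + dual_synth q v"
    unfolding dual_synth_def
    using suminf_add[OF summable_rabs_cancel[OF dual_synth_summable[OF q uv(1)]] summable_rabs_cancel[OF dual_synth_summable[OF q uv(2)]]]
    by (simp add: inner_add_right distrib_left)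
next
  fix u assume u: "u \<in> V"
  show "dual_synth q (c *\<^sub>R u) = c * dual_synth q u" for c
    unfolding dual_synth_def
    using suminf_mult[OF summable_rabs_cancel[OF dual_synth_summable[OF q u]], of c]
    by (simp add: mult_ac)
  show "\<bar>dual_synth q u\<bar> \<le> sqrt (\<Sum>n. (q n)\<^sup>2) * form_norm E u" by (rule dual_synth_le[OF q u])
qed

lemma dual_norm_le:
  assumes "\<And>v. v \<in> V \<Longrightarrow> \<bar>F v\<bar> \<le> C * form_norm E v" "C \<ge> 0"
  shows "dual_norm V E F \<le> C"
  unfolding dual_norm_def
proof (rule cSUP_least)
  have "0 \<in> V" using V subspace_0 by blast
  moreover have "form_norm E 0 \<le> 1" using form_norm_scale[OF \<open>0 \<in> V\<close>, of 0] by simp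
  ultimately show "{u \<in> V. form_norm E u \<le> 1} \<noteq> {}" by blast
  fix v assume "v \<in> {u \<in> V. form_norm E u \<le> 1}"
  then show "\<bar>F v\<bar> \<le> C" using assms(1)[of v] assms(2) mult_left_le[of "form_norm E v" C] by force
qed

lemma abs_le_dual_norm:
  assumes F: "F \<in> form_dual V E" and v: "v \<in> V"
  shows "\<bar>F v\<bar> \<le> dual_norm V E F * form_norm E v" "0 \<le> dual_norm V E F"
proof -
  obtain C where C: "\<And>u. u \<in> V \<Longrightarrow> \<bar>F u\<bar> \<le> C * form_norm E u" and sc: "\<And>c u. u \<in> V \<Longrightarrow> F (c *\<^sub>R u) = c * F u"
    using F unfolding form_dual_def by blast
  have bdd: "bdd_above ((\<lambda>u. \<bar>F u\<bar>) ` {u \<in> V. form_norm E u \<le> 1})"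
  proof (rule bdd_aboveI2[of _ _ "\<bar>C\<bar>"])
    fix u assume u: "u \<in> {u \<in> V. form_norm E u \<le> 1}"
    have "\<bar>F u\<bar> \<le> C * form_norm E u" using C u by simp
    also have "\<dots> \<le> \<bar>C\<bar> * form_norm E u" using u form_norm_nonneg[of u] by (intro mult_right_mono) auto
    also have "\<dots> \<le> \<bar>C\<bar>" using u by (simp add: mult_left_le)
    finally show "\<bar>F u\<bar> \<le> \<bar>C\<bar>" .
  qed
  have up: "\<bar>F u\<bar> \<le> dual_norm V E F" if "u \<in> V" "form_norm E u \<le> 1" for u
    unfolding dual_norm_def by (rule cSUP_upper[OF _ bdd]) (use that in simp)
  show "\<bar>F v\<bar> \<le> dual_norm V E F * form_norm E v"
  proof (cases "form_norm E v = 0")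
    case True
    then show ?thesis using C[OF v] by simp
  next
    case False
    then have p: "form_norm E v > 0" using form_norm_nonneg[OF v] by simp
    have "\<bar>F ((1 / form_norm E v) *\<^sub>R v)\<bar> \<le> dual_norm V E F"
      by (rule up) (use v p V in \<open>auto simp: subspace_scale form_norm_scale\<close>)
    then show ?thesis using p sc[OF v] by (simp add: abs_mult field_simps)
  qed
  have "0 \<in> V" using V subspace_0 by blast
  moreover have "form_norm E 0 \<le> 1" using form_norm_scale[OF \<open>0 \<in> V\<close>, of 0] by simp
  ultimately show "0 \<le> dual_norm V E F" using up[of 0] by (meson abs_ge_zero order_trans)
qed

lemma dual_norm_dual_synth_le:
  assumes "l2_seq q" "\<And>v. v \<in> V \<Longrightarrow> F v = dual_synth q v"
  shows "dual_norm V E F \<le> sqrt (\<Sum>n. (q n)\<^sup>2)"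
  by (rule dual_norm_le) (use dual_synth_le[OF assms(1)] assms in \<open>auto simp: l2_seq_def intro!: suminf_nonneg\<close>)

lemma form_dual_diff:
  assumes "F \<in> form_dual V E" "G \<in> form_dual V E"
  shows "(\<lambda>v. F v - G v) \<in> form_dual V E"
proof -
  obtain C C' where C: "\<And>u. u \<in> V \<Longrightarrow> \<bar>F u\<bar> \<le> C * form_norm E u" "\<And>u. u \<in> V \<Longrightarrow> \<bar>G u\<bar> \<le> C' * form_norm E u"
    using assms unfolding form_dual_def by blast
  have "\<bar>F u - G u\<bar> \<le> (C + C') * form_norm E u" if "u \<in> V" for u
    using C(1)[OF that] C(2)[OF that] by (simp add: distrib_right)
  then have "\<exists>C. \<forall>u\<in>V. \<bar>F u - G u\<bar> \<le> C * form_norm E u" by blast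
  then show ?thesis using assms unfolding form_dual_def by (auto simp: right_diff_distrib)
qed

lemma dual_norm_diff_le:
  assumes F: "F \<in> form_dual V E" and G: "G \<in> form_dual V E"
  shows "\<bar>dual_norm V E F - dual_norm V E G\<bar> \<le> dual_norm V E (\<lambda>v. F v - G v)"
proof -
  have "0 \<in> V" using V subspace_0 by blast
  have FG: "(\<lambda>v. F v - G v) \<in> form_dual V E" by (rule form_dual_diff[OF F G])
  have "dual_norm V E F \<le> dual_norm V E G + dual_norm V E (\<lambda>v. F v - G v)"
  proof (rule dual_norm_le)
    fix v assume v: "v \<in> V"
    show "\<bar>F v\<bar> \<le> (dual_norm V E G + dual_norm V E (\<lambda>v. F v - G v)) * form_norm E v"
      using abs_le_dual_norm(1)[OF G v] abs_le_dual_norm(1)[OF FG v] by (simp add: distrib_right)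
  qed (use abs_le_dual_norm(2)[OF G \<open>0 \<in> V\<close>] abs_le_dual_norm(2)[OF FG \<open>0 \<in> V\<close>] in simp)
  moreover have "dual_norm V E G \<le> dual_norm V E F + dual_norm V E (\<lambda>v. F v - G v)"
  proof (rule dual_norm_le)
    fix v assume v: "v \<in> V"
    show "\<bar>G v\<bar> \<le> (dual_norm V E F + dual_norm V E (\<lambda>v. F v - G v)) * form_norm E v"
      using abs_le_dual_norm(1)[OF F v] abs_le_dual_norm(1)[OF FG v] by (simp add: distrib_right)
  qed (use abs_le_dual_norm(2)[OF F \<open>0 \<in> V\<close>] abs_le_dual_norm(2)[OF FG \<open>0 \<in> V\<close>] in simp)
  ultimately show ?thesis by simp
qed

lemma inner_form_dual: "(\<lambda>v. inner h v) \<in> form_dual V E"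
proof -
  have "\<bar>inner h v\<bar> \<le> norm h * form_norm E v" if "v \<in> V" for v
    using Cauchy_Schwarz_ineq2[of h v] mult_left_mono[OF norm_le_form_norm[OF that], of "norm h"] by simp
  then show ?thesis unfolding form_dual_def by (auto simp: inner_add_right)
qed

lemma E_form_dual: "u \<in> V \<Longrightarrow> (\<lambda>v. E u v) \<in> form_dual V E"
  unfolding form_dual_def using abs_E_le[of u] by (auto simp: E_add2 E_scale2)

end

section \<open>Weak solutions from coefficient functions\<close>

lemma frac_integral_inner:
  fixes u :: "real \<Rightarrow> 'h::{real_inner, banach, second_countable_topology}"
  assumes "frac_integrable \<alpha> u t"
  shows "inner (frac_integral \<alpha> u t) x = frac_integral \<alpha> (\<lambda>\<tau>. inner (u \<tau>) x) t"
proof (cases "\<alpha> = 0")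
  case False
  then have "integrable lborel (\<lambda>\<tau>. indicator {0<..<t} \<tau> *\<^sub>R ((t - \<tau>) powr (\<alpha> - 1)) *\<^sub>R u \<tau>)"
    using assms by (simp add: frac_integrable_def set_integrable_def)
  from integral_inner_left[OF this, of x] show ?thesis
    using False by (simp add: frac_integral_def set_lebesgue_integral_def mult.assoc)
qed (simp add: frac_integral_def)

lemma frac_integrable_inner:
  fixes u :: "real \<Rightarrow> 'h::{real_inner, banach, second_countable_topology}"
  assumes "frac_integrable \<alpha> u t"
  shows "frac_integrable \<alpha> (\<lambda>\<tau>. inner (u \<tau>) x) t"
proof (cases "\<alpha> = 0")
  case False
  then have "integrable lborel (\<lambda>\<tau>. indicator {0<..<t} \<tau> *\<^sub>R ((t - \<tau>) powr (\<alpha> - 1)) *\<^sub>R u \<tau>)"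
    using assms by (simp add: frac_integrable_def set_integrable_def)
  from integrable_inner_left[OF this, of x] show ?thesis
    using False by (simp add: frac_integrable_def set_integrable_def mult.assoc)
qed (simp add: frac_integrable_def)

lemma tendsto_zero_within_le:
  fixes f :: "'c::topological_space \<Rightarrow> 'b::real_normed_vector"
  assumes "(g \<longlongrightarrow> 0) (at t within S)" "\<And>s. s \<in> S \<Longrightarrow> norm (f s) \<le> g s"
  shows "(f \<longlongrightarrow> 0) (at t within S)"
  by (rule Lim_null_comparison[OF _ assms(1)]) (auto simp: eventually_at_filter assms(2))

lemma kern_shift_le:
  assumes "a > 0" "b \<ge> 0" "T > 0"
  obtains K where "K \<ge> 0" "\<And>t. 0 < t \<Longrightarrow> t \<le> T \<Longrightarrow> kern (b + a) t \<le> K * kern a t"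
proof
  have G: "Gamma a > 0" "Gamma (b + a) > 0" using assms by (auto intro!: Gamma_real_pos)
  show "0 \<le> T powr b * Gamma a / Gamma (b + a)" using G by simp
  fix t assume t: "0 < t" "t \<le> T"
  have "t powr (b + a - 1) = t powr b * t powr (a - 1)" by (simp add: powr_add[symmetric] algebra_simps)
  also have "\<dots> \<le> T powr b * t powr (a - 1)" using t assms by (intro mult_right_mono powr_mono2) auto
  finally show "kern (b + a) t \<le> T powr b * Gamma a / Gamma (b + a) * kern a t"
    using G(2) by (simp add: kern_def Gamma_mult_kern divide_right_mono less_imp_neq[OF G(1), symmetric])
qed

locale hilfer_setting = fractional_order \<mu> + eigen_form H V E \<phi> lam l0
  for \<mu> :: real and H V :: "'a::euclidean_space L2 set" and E \<phi> lam l0 +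
  fixes \<nu> :: real
  assumes nu0: "0 \<le> \<nu>" and nu1: "\<nu> < 1"
begin

abbreviation "\<alpha> \<equiv> (1 - \<nu>) * (1 - \<mu>)"
abbreviation "\<beta> \<equiv> \<nu> * (1 - \<mu>)"

lemma alpha_pos: "\<alpha> > 0" using mu1 nu1 by simp
lemma beta_nonneg: "\<beta> \<ge> 0" using mu1 nu0 by simp
lemma alpha_beta: "\<alpha> + \<beta> + \<mu> = 1" by (simp add: algebra_simps)
lemma beta_less: "\<beta> < 1 - \<mu>" using mult_strict_right_mono[OF nu1, of "1 - \<mu>"] mu1 by simp

lemma synth_diff:
  assumes "l2_seq c" "l2_seq d"
  shows "synth c - synth d = synth (\<lambda>n. c n - d n)"
  using sums_unique2[OF sums_diff[OF synth_sums[OF assms(1)] synth_sums[OF assms(2)]]]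
    synth_sums[OF l2_seq_diff[OF assms]] by (simp add: scaleR_left_diff_distrib)

lemma synth_scale:
  assumes "l2_seq c"
  shows "k *\<^sub>R synth c = synth (\<lambda>n. k * c n)"
  using sums_unique2[OF sums_scaleR_right[OF synth_sums[OF assms], of k]] synth_sums[OF l2_seq_scale[OF assms, of k]] by simp

text \<open>The components \<open>c n\<close> of a solution, their fractional integrals \<open>h
  n\<close> and the derivatives \<open>F n\<close> of these, under bounds with one square-summable
  \<open>b\<close> and one integrable singularity at time 0 for all modes. The factors \<open>sqrt (lam
  n)\<close> are those for which the solution converges in the form norm and the derivative in the dual
  norm.\<close>

definition coefficient_solution ::
  "real \<Rightarrow> real \<Rightarrow> 'a L2 \<Rightarrow> (real \<Rightarrow> 'a L2) \<Rightarrow> (nat \<Rightarrow> real \<Rightarrow> real) \<Rightarrow> (nat \<Rightarrow> real \<Rightarrow> real) \<Rightarrow> (nat \<Rightarrow> real \<Rightarrow> real) \<Rightarrow> (nat \<Rightarrow> real) \<Rightarrow> bool" where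
  "coefficient_solution a T u0 f c h F b \<longleftrightarrow>
     u0 \<in> H \<and> (\<forall>t\<in>{0<..T}. f t \<in> H) \<and> continuous_on {0<..T} f \<and> l2_seq b \<and> (\<forall>n. 0 \<le> b n) \<and>
     (\<forall>n. continuous_on {0<..T} (c n) \<and> continuous_on {0..T} (h n) \<and> continuous_on {0<..T} (F n) \<and>
        h n 0 = inner u0 (\<phi> n) \<and> (\<forall>t\<in>{0..T}. \<bar>h n t\<bar> \<le> b n) \<and>
        (\<forall>t\<in>{0<..T}. sqrt (lam n) * \<bar>c n t\<bar> \<le> b n * kern a t \<and> \<bar>F n t\<bar> \<le> sqrt (lam n) * (b n * kern a t) \<and>
           h n t = frac_integral \<alpha> (c n) t \<and> (h n has_real_derivative F n t) (at t within {0<..T}) \<and>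
           frac_integral \<beta> (F n) t = inner (f t) (\<phi> n) - lam n * c n t))"

text \<open>Near \<open>t\<close> the singular factor is at most \<open>kern a t + 1\<close>, so
  dominated convergence applies.\<close>

lemma weighted_differences_tendsto_zero:
  assumes b: "l2_seq b" and c: "\<And>n. continuous_on {0<..T} (c n)" and bd: "\<And>n s. s \<in> {0<..T} \<Longrightarrow> sqrt (lam n) * \<bar>c n s\<bar> \<le> b n * kern a s"
    and b0: "\<And>n. 0 \<le> b n" and t: "t \<in> {0<..T}"
  shows "((\<lambda>s. \<Sum>n. (sqrt (lam n) * (c n s - c n t))\<^sup>2) \<longlongrightarrow> 0) (at t within {0<..T})"
proof (rule l2_seq_dominated)
  define K where "K = 2 * kern a t + 1"
  show "l2_seq (\<lambda>n. K * b n)" by (rule l2_seq_scale[OF b])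
  have "continuous_on {0<..T} (kern a)" by (rule continuous_on_subset[OF continuous_on_kern]) auto
  then have "(kern a \<longlongrightarrow> kern a t) (at t within {0<..T})" using t by (simp add: continuous_on)
  then have "eventually (\<lambda>s. kern a s < kern a t + 1) (at t within {0<..T})" by (rule order_tendstoD) simp
  moreover have "eventually (\<lambda>s. s \<in> {0<..T}) (at t within {0<..T})" by (simp add: eventually_at_filter)
  ultimately show "eventually (\<lambda>s. \<forall>n. \<bar>sqrt (lam n) * (c n s - c n t)\<bar> \<le> K * b n) (at t within {0<..T})"
  proof eventually_elim
    case (elim s)
    show ?case
    proof
      fix n
      have "\<bar>sqrt (lam n) * (c n s - c n t)\<bar> = sqrt (lam n) * \<bar>c n s - c n t\<bar>"
        using less_imp_le[OF lam_pos[of n]] by (simp add: abs_mult)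
      also have "\<dots> \<le> sqrt (lam n) * (\<bar>c n s\<bar> + \<bar>c n t\<bar>)"
        using less_imp_le[OF lam_pos[of n]] by (intro mult_left_mono) auto
      also have "\<dots> = sqrt (lam n) * \<bar>c n s\<bar> + sqrt (lam n) * \<bar>c n t\<bar>" by (rule distrib_left)
      also have "\<dots> \<le> b n * kern a s + b n * kern a t" by (intro add_mono bd elim t)
      also have "\<dots> = b n * (kern a s + kern a t)" by (simp add: distrib_left)
      also have "\<dots> \<le> b n * K" using elim b0[of n] by (intro mult_left_mono) (auto simp: K_def)
      finally show "\<bar>sqrt (lam n) * (c n s - c n t)\<bar> \<le> K * b n" by (simp add: mult.commute)
    qed
  qed
  fix n
  have "(c n \<longlongrightarrow> c n t) (at t within {0<..T})" using c t by (simp add: continuous_on)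
  from tendsto_mult[OF tendsto_const[of "sqrt (lam n)"] tendsto_diff[OF this tendsto_const[of "c n t"]]]
  show "((\<lambda>s. sqrt (lam n) * (c n s - c n t)) \<longlongrightarrow> 0) (at t within {0<..T})" by simp
qed

lemma form_continuous_imp_continuous:
  assumes uV: "\<And>t. t \<in> S \<Longrightarrow> u t \<in> V"
    and uc: "\<And>t. t \<in> S \<Longrightarrow> ((\<lambda>s. form_norm E (u s - u t)) \<longlongrightarrow> 0) (at t within S)"
  shows "continuous_on S u"
  unfolding continuous_on
proof
  fix t assume t: "t \<in> S"
  have "((\<lambda>s. u s - u t) \<longlongrightarrow> 0) (at t within S)"
    by (rule tendsto_zero_within_le[OF uc[OF t]]) (intro norm_le_form_norm subspace_diff V uV t)
  then show "(u \<longlongrightarrow> u t) (at t within S)" by (rule LIM_zero_cancel)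
qed

text \<open>The bounds in \<open>coefficient_solution\<close> dominate every series involved, so each
  property of a weak solution follows from the corresponding property of the components.\<close>

lemma weak_solution_of_coefficients:
  assumes T: "T > 0" and a: "a > 0" and cs: "coefficient_solution a T u0 f c h F b"
  shows "weak_solution V E \<mu> \<nu> T u0 f (\<lambda>t. synth (\<lambda>n. c n t))"
proof -
  have u0: "u0 \<in> H" and f: "\<And>t. t \<in> {0<..T} \<Longrightarrow> f t \<in> H" "continuous_on {0<..T} f" and b: "l2_seq b" and b0: "\<And>n. 0 \<le> b n"
    and cc: "\<And>n. continuous_on {0<..T} (c n)" and hc: "\<And>n. continuous_on {0..T} (h n)" and Fc: "\<And>n. continuous_on {0<..T} (F n)"
    and h0: "\<And>n. h n 0 = inner u0 (\<phi> n)" and hb: "\<And>n t. t \<in> {0..T} \<Longrightarrow> \<bar>h n t\<bar> \<le> b n"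
    and cb: "\<And>n t. t \<in> {0<..T} \<Longrightarrow> sqrt (lam n) * \<bar>c n t\<bar> \<le> b n * kern a t"
    and Fb: "\<And>n t. t \<in> {0<..T} \<Longrightarrow> \<bar>F n t\<bar> \<le> sqrt (lam n) * (b n * kern a t)"
    and hf: "\<And>n t. t \<in> {0<..T} \<Longrightarrow> h n t = frac_integral \<alpha> (c n) t"
    and hF: "\<And>n t. t \<in> {0<..T} \<Longrightarrow> (h n has_real_derivative F n t) (at t within {0<..T})"
    and eq: "\<And>n t. t \<in> {0<..T} \<Longrightarrow> frac_integral \<beta> (F n) t = inner (f t) (\<phi> n) - lam n * c n t"
    using cs unfolding coefficient_solution_def by blast+
  have sl: "sqrt (lam n) > 0" "sqrt l0 \<le> sqrt (lam n)" "sqrt l0 > 0" for n using lam_pos lam l0 by auto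
  have k0: "0 \<le> kern a t" for t by (rule kern_nonneg[OF a])
  have lc: "l2_seq (\<lambda>n. sqrt (lam n) * c n t)" if "t \<in> {0<..T}" for t
    by (rule l2_seq_le[OF l2_seq_scale[OF b, of "kern a t"]])
       (use cb[OF that] b0 k0[of t] in \<open>auto simp: abs_mult abs_of_pos[OF sl(1)] mult.commute\<close>)
  have lc': "l2_seq (\<lambda>n. c n t)" if "t \<in> {0<..T}" for t by (rule synth_form(1)[OF lc[OF that]])
  have cb': "\<bar>c n t\<bar> \<le> (b n / sqrt l0) * kern a t" if "t \<in> {0<..T}" for n t
  proof -
    have "sqrt l0 * \<bar>c n t\<bar> \<le> sqrt (lam n) * \<bar>c n t\<bar>" by (rule mult_right_mono[OF sl(2)]) simp
    also have "\<dots> \<le> b n * kern a t" by (rule cb[OF that])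
    finally show ?thesis using sl(3) by (simp add: field_simps)
  qed
  have lh: "l2_seq (\<lambda>n. h n t)" if "t \<in> {0..T}" for t
    by (rule l2_seq_le[OF b]) (use hb[OF that] b0 in auto)
  define u where "u t = synth (\<lambda>n. c n t)" for t
  define g where "g t = synth (\<lambda>n. h n t)" for t
  have uV: "u t \<in> V" if "t \<in> {0<..T}" for t unfolding u_def by (rule synth_form(2)[OF lc[OF that]])
  have ucont: "((\<lambda>s. form_norm E (u s - u t)) \<longlongrightarrow> 0) (at t within {0<..T})" if t: "t \<in> {0<..T}" for t
  proof -
    define S where "S s = (\<Sum>n. (sqrt (lam n) * (c n s - c n t))\<^sup>2)" for s
    have S: "(S \<longlongrightarrow> 0) (at t within {0<..T})"
      unfolding S_def by (rule weighted_differences_tendsto_zero[OF b cc cb b0 t])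
    have le: "form_norm E (u s - u t) \<le> sqrt ((1 + 1 / l0) * S s)" if s: "s \<in> {0<..T}" for s
    proof -
      have ld: "l2_seq (\<lambda>n. sqrt (lam n) * (c n s - c n t))"
        using l2_seq_diff[OF lc[OF s] lc[OF t]] by (simp add: right_diff_distrib)
      have e: "u s - u t = synth (\<lambda>n. c n s - c n t)"
        unfolding u_def by (rule synth_diff[OF lc'[OF s] lc'[OF t]])
      have "(form_norm E (u s - u t))\<^sup>2 = (\<Sum>n. (1 + lam n) * (c n s - c n t)\<^sup>2)"
        unfolding e by (rule synth_form(4)[OF ld])
      also have "\<dots> \<le> (\<Sum>n. (1 + 1 / l0) * (sqrt (lam n) * (c n s - c n t))\<^sup>2)"
      proof (rule suminf_le[OF _ synth_form(5)[OF ld] summable_mult[OF ld[unfolded l2_seq_def]]])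
        fix n
        have "1 + lam n \<le> (1 + 1 / l0) * lam n" using lam[of n] l0 by (simp add: field_simps)
        then have "(1 + lam n) * (c n s - c n t)\<^sup>2 \<le> (1 + 1 / l0) * lam n * (c n s - c n t)\<^sup>2" by (rule mult_right_mono) simp
        then show "(1 + lam n) * (c n s - c n t)\<^sup>2 \<le> (1 + 1 / l0) * (sqrt (lam n) * (c n s - c n t))\<^sup>2"
          using lam_pos[of n] by (simp add: power_mult_distrib)
      qed
      also have "\<dots> = (1 + 1 / l0) * S s" unfolding S_def by (rule suminf_mult[OF ld[unfolded l2_seq_def]])
      finally show ?thesis by (rule real_le_rsqrt)
    qed
    have lim: "((\<lambda>s. sqrt ((1 + 1 / l0) * S s)) \<longlongrightarrow> 0) (at t within {0<..T})"
      using tendsto_real_sqrt[OF tendsto_mult[OF tendsto_const[of "1 + 1 / l0"] S]] by simp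
    show ?thesis
    proof (rule tendsto_zero_within_le[OF lim])
      fix s assume s: "s \<in> {0<..T}"
      show "norm (form_norm E (u s - u t)) \<le> sqrt ((1 + 1 / l0) * S s)"
        using le[OF s] form_norm_nonneg[OF subspace_diff[OF V(1) uV[OF s] uV[OF t]]] by simp
    qed
  qed
  have ucontn: "continuous_on {0<..T} u" by (rule form_continuous_imp_continuous[OF uV ucont])
  have ui: "frac_integrable \<alpha> u t" and ug: "frac_integral \<alpha> u t = g t" if t: "t \<in> {0<..T}" for t
  proof -
    have um: "set_borel_measurable lborel {0<..<t} u"
      by (rule set_borel_measurable_continuous_on[OF ucontn]) (use t in auto)
    define K where "K = sqrt (\<Sum>n. (b n / sqrt l0)\<^sup>2)"
    have lb: "l2_seq (\<lambda>n. b n / sqrt l0)" using l2_seq_scale[OF b, of "1 / sqrt l0"] by simp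
    have nu: "norm (u \<tau>) \<le> K * kern a \<tau>" if \<tau>: "\<tau> \<in> {0<..T}" for \<tau>
    proof -
      have "norm (u \<tau>) = sqrt (\<Sum>n. (c n \<tau>)\<^sup>2)" unfolding u_def by (rule norm_synth[OF lc'[OF \<tau>]])
      also have "\<dots> \<le> sqrt (\<Sum>n. (b n / sqrt l0)\<^sup>2 * (kern a \<tau>)\<^sup>2)"
      proof (intro real_sqrt_le_mono suminf_le)
        show "(c n \<tau>)\<^sup>2 \<le> (b n / sqrt l0)\<^sup>2 * (kern a \<tau>)\<^sup>2" for n
          using power_mono[OF cb'[OF \<tau>, of n], of 2] by (simp only: power_mult_distrib power2_abs abs_ge_zero)
      qed (use lc'[OF \<tau>] lb in \<open>auto simp: l2_seq_def intro!: summable_mult2\<close>)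
      also have "\<dots> = K * kern a \<tau>"
        unfolding suminf_mult2[OF lb[unfolded l2_seq_def], symmetric] real_sqrt_mult K_def using k0[of \<tau>] by simp
      finally show ?thesis .
    qed
    show i: "frac_integrable \<alpha> u t"
    proof (rule frac_integrable_bound[OF um frac_integrable_mult_right[OF frac_integrable_kern[of \<alpha> a t], of K]])
      show "norm (u \<tau>) \<le> norm (K * kern a \<tau>)" if "0 < \<tau>" "\<tau> < t" for \<tau>
        using nu[of \<tau>] that t by (auto intro: order_trans[OF _ abs_ge_self])
    qed (use alpha_pos a in auto)
    \<comment> \<open>The Bochner integral is identified through its inner products, by termwise
      integration.\<close>
    have "inner (frac_integral \<alpha> u t) x = inner (g t) x" for x
    proof -
      let ?x = "\<lambda>n. inner (\<phi> n) x"
      have lx: "l2_seq ?x" using l2_seq_coeff[of x] by (simp add: inner_commute)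
      have "(\<lambda>n. frac_integral \<alpha> (\<lambda>\<tau>. ?x n * c n \<tau>) t) sums frac_integral \<alpha> (\<lambda>\<tau>. \<Sum>n. ?x n * c n \<tau>) t"
      proof (rule frac_integral_sums(1)[where h = "kern a" and d = "\<lambda>n. \<bar>?x n * (b n / sqrt l0)\<bar>"])
        show "set_borel_measurable lborel {0<..<t} (\<lambda>\<tau>. ?x n * c n \<tau>)" for n
          by (rule set_borel_measurable_continuous_on[of "{0<..T}"]) (use t in \<open>auto intro!: continuous_intros cc\<close>)
        show "summable (\<lambda>n. \<bar>?x n * (b n / sqrt l0)\<bar>)" by (rule l2_seq_mult_summable[OF lx lb])
        show "norm (?x n * c n \<tau>) \<le> \<bar>?x n * (b n / sqrt l0)\<bar> * kern a \<tau>" if "0 < \<tau>" "\<tau> \<le> t" for n \<tau>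
          using mult_left_mono[OF cb'[of \<tau> n], of "\<bar>?x n\<bar>"] that t b0[of n] sl(3) by (auto simp: abs_mult mult.assoc)
      qed (use alpha_pos a t k0 in \<open>auto intro!: frac_integrable_kern\<close>)
      moreover have "frac_integral \<alpha> (\<lambda>\<tau>. ?x n * c n \<tau>) t = h n t * ?x n" for n
        using hf[OF t, of n] by (simp add: frac_integral_mult_right)
      moreover have "frac_integral \<alpha> (\<lambda>\<tau>. \<Sum>n. ?x n * c n \<tau>) t = frac_integral \<alpha> (\<lambda>\<tau>. inner (u \<tau>) x) t"
      proof (rule frac_integral_cong)
        fix \<tau> assume "0 < \<tau>" "\<tau> \<le> t"
        then have "\<tau> \<in> {0<..T}" using t by auto
        from inner_synth_sums[OF lc'[OF this], of x] show "(\<Sum>n. ?x n * c n \<tau>) = inner (u \<tau>) x"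
          by (simp add: u_def sums_iff mult.commute)
      qed (use t in auto)
      ultimately have "(\<lambda>n. h n t * ?x n) sums inner (frac_integral \<alpha> u t) x"
        by (simp add: frac_integral_inner[OF i])
      moreover have "(\<lambda>n. h n t * ?x n) sums inner (g t) x"
        unfolding g_def by (rule inner_synth_sums[OF lh]) (use t in auto)
      ultimately show ?thesis by (rule sums_unique2)
    qed
    then show "frac_integral \<alpha> u t = g t" using inner_eq_zero_iff[of "frac_integral \<alpha> u t - g t"]
      by (simp add: inner_diff_left)
  qed
  have gcont: "continuous_on {0..T} g"
    unfolding continuous_on
  proof
    fix t assume t: "t \<in> {0..T}"
    have "((\<lambda>s. \<Sum>n. (h n s - h n t)\<^sup>2) \<longlongrightarrow> 0) (at t within {0..T})"
    proof (rule l2_seq_dominated[OF l2_seq_scale[OF b, of 2]])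
      show "eventually (\<lambda>s. \<forall>n. \<bar>h n s - h n t\<bar> \<le> 2 * b n) (at t within {0..T})"
        unfolding eventually_at_filter
      proof (intro always_eventually allI impI)
        fix s n assume "s \<in> {0..T}"
        then show "\<bar>h n s - h n t\<bar> \<le> 2 * b n" using hb[of s n] hb[OF t, of n] by linarith
      qed
      show "((\<lambda>s. h n s - h n t) \<longlongrightarrow> 0) (at t within {0..T})" for n
        using hc[of n] t LIM_zero unfolding continuous_on by blast
    qed
    from tendsto_real_sqrt[OF this]
    have lim: "((\<lambda>s. sqrt (\<Sum>n. (h n s - h n t)\<^sup>2)) \<longlongrightarrow> 0) (at t within {0..T})" by simp
    have "((\<lambda>s. g s - g t) \<longlongrightarrow> 0) (at t within {0..T})"
    proof (rule tendsto_zero_within_le[OF lim])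
      fix s assume s: "s \<in> {0..T}"
      show "norm (g s - g t) \<le> sqrt (\<Sum>n. (h n s - h n t)\<^sup>2)"
        unfolding g_def synth_diff[OF lh[OF s] lh[OF t]] norm_synth[OF l2_seq_diff[OF lh[OF s] lh[OF t]]] by simp
    qed
    then show "(g \<longlongrightarrow> g t) (at t within {0..T})" by (rule LIM_zero_cancel)
  qed
  have g0: "g 0 = u0" unfolding g_def h0 by (rule synth_coeff[OF u0])
  define q where "q t n = F n t / sqrt (lam n)" for t n
  have qb: "\<bar>q t n\<bar> \<le> b n * kern a t" if "t \<in> {0<..T}" for t n
    using Fb[OF that, of n] sl(1)[of n] by (simp add: q_def field_simps)
  have lq: "l2_seq (q t)" if "t \<in> {0<..T}" for t
    by (rule l2_seq_le[OF l2_seq_scale[OF b, of "kern a t"]])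
       (use qb[OF that] b0 k0[of t] in \<open>auto simp: mult.commute\<close>)
  define FF where "FF t = dual_synth (q t)" for t
  have FFd: "FF t \<in> form_dual V E" if "t \<in> {0<..T}" for t
    unfolding FF_def by (rule dual_synth_form_dual[OF lq[OF that]])
  have der: "has_dual_derivative V E (frac_integral \<alpha> u) (FF t) t {0<..T}" if t: "t \<in> {0<..T}" for t
    unfolding has_dual_derivative_def
  proof (intro conjI FFd[OF t])
    define d where "d s n = ((h n s - h n t) / (s - t) - F n t) / sqrt (lam n)" for s n
    have "continuous_on {t/2..T} (kern a)" by (rule continuous_on_subset[OF continuous_on_kern]) (use t in auto)
    from compact_imp_bounded[OF compact_continuous_image[OF this compact_Icc]]
    obtain K where K: "\<And>s. s \<in> {t/2..T} \<Longrightarrow> \<bar>kern a s\<bar> \<le> K" unfolding bounded_iff by force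
    \<comment> \<open>The mean value theorem bounds the difference quotients by the derivatives,
      uniformly for \<open>s\<close> in \<open>[t/2, T]\<close>, away from the singularity at
      0.\<close>
    have quot: "\<bar>(h n s - h n t) / (s - t)\<bar> \<le> sqrt (lam n) * (b n * K)" if s: "s \<in> {t/2..T}" "s \<noteq> t" for s n
    proof -
      have *: "\<bar>(h n y - h n x) / (y - x)\<bar> \<le> sqrt (lam n) * (b n * K)" if xy: "x < y" "x \<in> {t/2..T}" "y \<in> {t/2..T}" for x y
      proof -
        have "\<exists>\<xi>\<in>{x<..<y}. h n y - h n x = F n \<xi> * (y - x)"
        proof (rule mvt[OF xy(1)])
          show "continuous_on {x..y} (h n)" by (rule continuous_on_subset[OF hc]) (use xy t in auto)
          fix z assume z: "x < z" "z < y"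
          have "(h n has_real_derivative F n z) (at z within {0<..<T})"
            by (rule DERIV_subset[OF hF]) (use z xy t in auto)
          then have "(h n has_real_derivative F n z) (at z)" using z xy t at_within_open[of z "{0<..<T}"] by simp
          then show "(h n has_derivative (*) (F n z)) (at z)" by (simp add: has_field_derivative_def)
        qed auto
        then obtain \<xi> where xi: "\<xi> \<in> {x<..<y}" "h n y - h n x = F n \<xi> * (y - x)" by blast
        have "\<bar>F n \<xi>\<bar> \<le> sqrt (lam n) * (b n * kern a \<xi>)" by (rule Fb) (use xi xy t in auto)
        also have "\<dots> \<le> sqrt (lam n) * (b n * K)"
          using K[of \<xi>] xi xy b0[of n] sl(1)[of n] by (intro mult_left_mono) auto
        finally show ?thesis using xi xy by simp
      qed
      have "(h n s - h n t) / (s - t) = (h n t - h n s) / (t - s)" by (metis minus_diff_eq minus_divide_divide)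
      then show ?thesis using *[of s t] *[of t s] s t by (cases "s < t") auto
    qed
    have near: "eventually (\<lambda>s. s \<in> {t/2..T} \<and> s \<noteq> t) (at t within {0<..T})"
    proof -
      have "eventually (\<lambda>s. s \<in> {t/2<..}) (at t within {0<..T})"
        unfolding greaterThan_iff by (rule order_tendstoD(1)[OF tendsto_ident_at]) (use t in simp)
      then show ?thesis unfolding eventually_at_filter by eventually_elim auto
    qed
    have "((\<lambda>s. \<Sum>n. (d s n)\<^sup>2) \<longlongrightarrow> 0) (at t within {0<..T})"
    proof (rule l2_seq_dominated[OF l2_seq_scale[OF b, of "K + kern a t"]])
      show "eventually (\<lambda>s. \<forall>n. \<bar>d s n\<bar> \<le> (K + kern a t) * b n) (at t within {0<..T})"
        using near
      proof eventually_elim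
        case (elim s)
        show ?case
        proof
          fix n
          have "\<bar>(h n s - h n t) / (s - t) - F n t\<bar> \<le> sqrt (lam n) * (b n * K) + sqrt (lam n) * (b n * kern a t)"
            using quot[of s n] Fb[OF t, of n] elim by linarith
          also have "\<dots> = sqrt (lam n) * ((K + kern a t) * b n)" by (simp add: algebra_simps)
          finally show "\<bar>d s n\<bar> \<le> (K + kern a t) * b n" using sl(1)[of n] by (simp add: d_def field_simps)
        qed
      qed
      fix n
      have "((\<lambda>s. (h n s - h n t) / (s - t)) \<longlongrightarrow> F n t) (at t within {0<..T})"
        using hF[OF t, of n] by (simp add: has_field_derivative_iff)
      from tendsto_divide[OF LIM_zero[OF this] tendsto_const[of "sqrt (lam n)"]]
      show "((\<lambda>s. d s n) \<longlongrightarrow> 0) (at t within {0<..T})" using sl(1)[of n] by (simp add: d_def)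
    qed
    from tendsto_real_sqrt[OF this]
    have lim: "((\<lambda>s. sqrt (\<Sum>n. (d s n)\<^sup>2)) \<longlongrightarrow> 0) (at t within {0<..T})" by simp
    have ev: "eventually (\<lambda>s. s \<in> {0<..T} \<and> s \<noteq> t) (at t within {0<..T})" by (simp add: eventually_at_filter)
    have lds: "l2_seq (d s)" and ds: "\<And>v. v \<in> V \<Longrightarrow> inner ((g s - g t) /\<^sub>R (s - t)) v - FF t v = dual_synth (d s) v"
      if s: "s \<in> {0<..T}" for s
    proof -
      have s': "s \<in> {0..T}" "t \<in> {0..T}" using s t by auto
      have lD: "l2_seq (\<lambda>n. inverse (s - t) * (h n s - h n t))" by (intro l2_seq_scale l2_seq_diff lh s')
      have lD': "l2_seq (\<lambda>n. (inverse (s - t) * (h n s - h n t)) / sqrt (lam n))"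
      proof (rule l2_seq_le[OF l2_seq_scale[OF lD, of "1 / sqrt l0"]])
        fix n
        have "1 / sqrt (lam n) \<le> 1 / sqrt l0" using sl(1,2)[of n] sl(3) by (intro divide_left_mono) auto
        then have "1 / sqrt (lam n) * \<bar>inverse (s - t) * (h n s - h n t)\<bar> \<le> 1 / sqrt l0 * \<bar>inverse (s - t) * (h n s - h n t)\<bar>"
          by (rule mult_right_mono) simp
        then show "\<bar>(inverse (s - t) * (h n s - h n t)) / sqrt (lam n)\<bar> \<le> \<bar>1 / sqrt l0 * (inverse (s - t) * (h n s - h n t))\<bar>"
          using less_imp_le[OF lam_pos[of n]] l0 by (simp add: abs_mult)
      qed
      have dd: "d s = (\<lambda>n. (inverse (s - t) * (h n s - h n t)) / sqrt (lam n) - q t n)"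
        by (auto simp: d_def q_def fun_eq_iff divide_inverse algebra_simps)
      show "l2_seq (d s)" unfolding dd by (rule l2_seq_diff[OF lD' lq[OF t]])
      fix v assume v: "v \<in> V"
      have "(g s - g t) /\<^sub>R (s - t) = synth (\<lambda>n. inverse (s - t) * (h n s - h n t))"
        unfolding g_def synth_diff[OF lh[OF s'(1)] lh[OF s'(2)]] by (rule synth_scale[OF l2_seq_diff[OF lh[OF s'(1)] lh[OF s'(2)]]])
      then have "inner ((g s - g t) /\<^sub>R (s - t)) v = (\<Sum>n. (inverse (s - t) * (h n s - h n t)) * inner (\<phi> n) v)"
        using inner_synth_sums[OF lD, of v] by (simp add: sums_iff)
      also have "\<dots> = dual_synth (\<lambda>n. (inverse (s - t) * (h n s - h n t)) / sqrt (lam n)) v"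
        unfolding dual_synth_def using sl(1) by (intro suminf_cong) (simp add: less_imp_neq[symmetric])
      finally show "inner ((g s - g t) /\<^sub>R (s - t)) v - FF t v = dual_synth (d s) v"
        unfolding FF_def dd using dual_synth_diff[OF lD' lq[OF t] v] by simp
    qed
    show "((\<lambda>s. dual_norm V E (\<lambda>v. inner ((frac_integral \<alpha> u s - frac_integral \<alpha> u t) /\<^sub>R (s - t)) v - FF t v)) \<longlongrightarrow> 0) (at t within {0<..T})"
    proof (rule tendsto_sandwich[OF _ _ tendsto_const lim])
      show "eventually (\<lambda>s. 0 \<le> dual_norm V E (\<lambda>v. inner ((frac_integral \<alpha> u s - frac_integral \<alpha> u t) /\<^sub>R (s - t)) v - FF t v)) (at t within {0<..T})"
        by (intro always_eventually allI abs_le_dual_norm(2)[OF form_dual_diff[OF inner_form_dual FFd[OF t]] subspace_0[OF V(1)]])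
      show "eventually (\<lambda>s. dual_norm V E (\<lambda>v. inner ((frac_integral \<alpha> u s - frac_integral \<alpha> u t) /\<^sub>R (s - t)) v - FF t v) \<le> sqrt (\<Sum>n. (d s n)\<^sup>2)) (at t within {0<..T})"
        using ev
      proof eventually_elim
        case (elim s)
        then show ?case unfolding ug[OF t] using ug[of s] by (intro dual_norm_dual_synth_le lds) (use ds in auto)
      qed
    qed
  qed
  define Q where "Q t s = (\<Sum>n. (q s n - q t n)\<^sup>2)" for t s
  have Qlim: "(Q t \<longlongrightarrow> 0) (at t within {0<..T})" if t: "t \<in> {0<..T}" for t
  proof -
    \<comment> \<open>The functions \<open>F n / lam n\<close> satisfy the same bounds as the
      components \<open>c n\<close>.\<close>
    have "((\<lambda>s. \<Sum>n. (sqrt (lam n) * (F n s / lam n - F n t / lam n))\<^sup>2) \<longlongrightarrow> 0) (at t within {0<..T})"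
    proof (rule weighted_differences_tendsto_zero[OF b _ _ b0 t])
      show "continuous_on {0<..T} (\<lambda>s. F n s / lam n)" for n
        using lam_pos[of n] by (intro continuous_intros Fc) auto
      show "sqrt (lam n) * \<bar>F n s / lam n\<bar> \<le> b n * kern a s" if "s \<in> {0<..T}" for n s
      proof -
        have "sqrt (lam n) * \<bar>F n s / lam n\<bar> = \<bar>q s n\<bar>"
          using lam_pos[of n] real_div_sqrt[of "lam n"] by (simp add: q_def abs_mult field_simps)
        then show ?thesis using qb[OF that, of n] by simp
      qed
    qed
    moreover have "sqrt (lam n) * (F n s / lam n - F n t / lam n) = q s n - q t n" for n s
      using lam_pos[of n] real_div_sqrt[of "lam n"] by (simp add: q_def field_simps)
    ultimately show ?thesis by (simp add: Q_def[abs_def])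
  qed
  have FFcont: "continuous_on {0<..T} (\<lambda>s. FF s v)" if v: "v \<in> V" for v
    unfolding continuous_on
  proof
    fix t assume t: "t \<in> {0<..T}"
    have lim: "((\<lambda>s. sqrt (Q t s) * form_norm E v) \<longlongrightarrow> 0) (at t within {0<..T})"
      using tendsto_mult[OF tendsto_real_sqrt[OF Qlim[OF t]] tendsto_const[of "form_norm E v"]] by simp
    have "((\<lambda>s. FF s v - FF t v) \<longlongrightarrow> 0) (at t within {0<..T})"
    proof (rule tendsto_zero_within_le[OF lim])
      fix s assume s: "s \<in> {0<..T}"
      show "norm (FF s v - FF t v) \<le> sqrt (Q t s) * form_norm E v"
        unfolding FF_def dual_synth_diff[OF lq[OF s] lq[OF t] v] Q_def real_norm_def
        by (rule dual_synth_le[OF l2_seq_diff[OF lq[OF s] lq[OF t]] v])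
    qed
    then show "((\<lambda>s. FF s v) \<longlongrightarrow> FF t v) (at t within {0<..T})" using LIM_zero_iff by blast
  qed
  have dncont: "continuous_on {0<..T} (\<lambda>s. dual_norm V E (FF s))"
    unfolding continuous_on
  proof
    fix t assume t: "t \<in> {0<..T}"
    have lim: "((\<lambda>s. sqrt (Q t s)) \<longlongrightarrow> 0) (at t within {0<..T})"
      using tendsto_real_sqrt[OF Qlim[OF t]] by simp
    have "((\<lambda>s. dual_norm V E (FF s) - dual_norm V E (FF t)) \<longlongrightarrow> 0) (at t within {0<..T})"
    proof (rule tendsto_zero_within_le[OF lim])
      fix s assume s: "s \<in> {0<..T}"
      have "norm (dual_norm V E (FF s) - dual_norm V E (FF t)) \<le> dual_norm V E (\<lambda>v. FF s v - FF t v)"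
        using dual_norm_diff_le[OF FFd[OF s] FFd[OF t]] by simp
      also have "\<dots> \<le> sqrt (Q t s)"
        unfolding Q_def by (rule dual_norm_dual_synth_le[OF l2_seq_diff[OF lq[OF s] lq[OF t]]])
          (simp add: FF_def dual_synth_diff[OF lq[OF s] lq[OF t]])
      finally show "norm (dual_norm V E (FF s) - dual_norm V E (FF t)) \<le> sqrt (Q t s)" .
    qed
    then show "((\<lambda>s. dual_norm V E (FF s)) \<longlongrightarrow> dual_norm V E (FF t)) (at t within {0<..T})" using LIM_zero_iff by blast
  qed
  \<comment> \<open>The Hilfer derivative is prescribed by the equation, and then shown to be the
    fractional integral of \<open>FF\<close>.\<close>
  define G where "G t v = inner (f t) v - E (u t) v" for t v
  have dfi: "dual_frac_integral V E \<beta> FF t (G t)" if t: "t \<in> {0<..T}" for t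
    unfolding dual_frac_integral_def
  proof (intro conjI ballI disjI2)
    show "set_borel_measurable lborel {0<..<t} (\<lambda>\<tau>. FF \<tau> v)" if "v \<in> V" for v
      by (rule set_borel_measurable_continuous_on[OF FFcont[OF that]]) (use t in auto)
    define K where "K = sqrt (\<Sum>n. (b n)\<^sup>2)"
    show "frac_integrable \<beta> (\<lambda>\<tau>. dual_norm V E (FF \<tau>)) t"
    proof (rule frac_integrable_bound[OF _ frac_integrable_mult_right[OF frac_integrable_kern[of \<beta> a t], of K]])
      show "set_borel_measurable lborel {0<..<t} (\<lambda>\<tau>. dual_norm V E (FF \<tau>))"
        by (rule set_borel_measurable_continuous_on[OF dncont]) (use t in auto)
      fix \<tau> assume "0 < \<tau>" "\<tau> < t"
      then have \<tau>: "\<tau> \<in> {0<..T}" using t by auto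
      have "dual_norm V E (FF \<tau>) \<le> sqrt (\<Sum>n. (q \<tau> n)\<^sup>2)"
        by (rule dual_norm_dual_synth_le[OF lq[OF \<tau>]]) (simp add: FF_def)
      also have "\<dots> \<le> sqrt (\<Sum>n. (b n)\<^sup>2 * (kern a \<tau>)\<^sup>2)"
      proof (intro real_sqrt_le_mono suminf_le)
        show "(q \<tau> n)\<^sup>2 \<le> (b n)\<^sup>2 * (kern a \<tau>)\<^sup>2" for n
          using power_mono[OF qb[OF \<tau>, of n], of 2] by (simp only: power_mult_distrib power2_abs abs_ge_zero)
      qed (use lq[OF \<tau>] b in \<open>auto simp: l2_seq_def intro!: summable_mult2\<close>)
      also have "\<dots> = K * kern a \<tau>"
        unfolding suminf_mult2[OF b[unfolded l2_seq_def], symmetric] real_sqrt_mult K_def using k0[of \<tau>] by simp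
      finally show "norm (dual_norm V E (FF \<tau>)) \<le> norm (K * kern a \<tau>)"
        using abs_le_dual_norm(2)[OF FFd[OF \<tau>] subspace_0[OF V(1)]] by simp
    qed (use beta_nonneg a in auto)
    fix v assume v: "v \<in> V"
    let ?v = "\<lambda>n. inner (\<phi> n) v"
    have "(\<lambda>n. frac_integral \<beta> (\<lambda>\<tau>. ?v n * F n \<tau>) t) sums frac_integral \<beta> (\<lambda>\<tau>. \<Sum>n. ?v n * F n \<tau>) t"
    proof (rule frac_integral_sums(1)[where h = "kern a" and d = "\<lambda>n. \<bar>b n * (sqrt (lam n) * ?v n)\<bar>"])
      show "set_borel_measurable lborel {0<..<t} (\<lambda>\<tau>. ?v n * F n \<tau>)" for n
        by (rule set_borel_measurable_continuous_on[of "{0<..T}"]) (use t in \<open>auto intro!: continuous_intros Fc\<close>)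
      show "summable (\<lambda>n. \<bar>b n * (sqrt (lam n) * ?v n)\<bar>)" by (rule dual_synth_summable[OF b v])
      show "norm (?v n * F n \<tau>) \<le> \<bar>b n * (sqrt (lam n) * ?v n)\<bar> * kern a \<tau>" if "0 < \<tau>" "\<tau> \<le> t" for n \<tau>
        using mult_left_mono[OF Fb[of \<tau> n], of "\<bar>?v n\<bar>"] that t b0[of n] less_imp_le[OF lam_pos[of n]] by (auto simp: abs_mult mult_ac)
    qed (use beta_nonneg a t k0 in \<open>auto intro!: frac_integrable_kern\<close>)
    moreover have "frac_integral \<beta> (\<lambda>\<tau>. ?v n * F n \<tau>) t = inner (f t) (\<phi> n) * ?v n - lam n * c n t * ?v n" for n
      unfolding frac_integral_mult_right eq[OF t] by (simp add: algebra_simps)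
    moreover have "frac_integral \<beta> (\<lambda>\<tau>. \<Sum>n. ?v n * F n \<tau>) t = frac_integral \<beta> (\<lambda>\<tau>. FF \<tau> v) t"
    proof (rule frac_integral_cong)
      fix \<tau>
      show "(\<Sum>n. ?v n * F n \<tau>) = FF \<tau> v"
        unfolding FF_def dual_synth_def using sl(1) by (intro suminf_cong) (simp add: q_def less_imp_neq[symmetric])
    qed (use t in auto)
    ultimately have "(\<lambda>n. inner (f t) (\<phi> n) * ?v n - lam n * c n t * ?v n) sums frac_integral \<beta> (\<lambda>\<tau>. FF \<tau> v) t" by simp
    moreover have "(\<lambda>n. inner (f t) (\<phi> n) * ?v n - lam n * c n t * ?v n) sums (inner (f t) v - E (u t) v)"
      using sums_diff[OF inner_synth_sums[OF l2_seq_coeff[of "f t"], of v] synth_form(3)[OF lc[OF t] v]]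
      unfolding synth_coeff[OF f(1)[OF t]] u_def .
    ultimately show "G t v = frac_integral \<beta> (\<lambda>\<tau>. FF \<tau> v) t" unfolding G_def using sums_unique2 by blast
  qed
  have Gd: "G t \<in> form_dual V E" if "t \<in> {0<..T}" for t
    using form_dual_diff[OF inner_form_dual E_form_dual[OF uV[OF that]], of "f t"] by (simp add: G_def[abs_def])
  have Gcont: "((\<lambda>s. dual_norm V E (\<lambda>v. G s v - G t v)) \<longlongrightarrow> 0) (at t within {0<..T})" if t: "t \<in> {0<..T}" for t
  proof -
    have "(f \<longlongrightarrow> f t) (at t within {0<..T})" using f(2) t by (simp add: continuous_on)
    then have "((\<lambda>s. norm (f s - f t)) \<longlongrightarrow> 0) (at t within {0<..T})" using LIM_zero tendsto_norm_zero by blast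
    from tendsto_add[OF this ucont[OF t]]
    have lim: "((\<lambda>s. norm (f s - f t) + form_norm E (u s - u t)) \<longlongrightarrow> 0) (at t within {0<..T})" by simp
    show ?thesis
    proof (rule tendsto_zero_within_le[OF lim])
      fix s assume s: "s \<in> {0<..T}"
      have du: "u s - u t \<in> V" by (intro subspace_diff V uV s t)
      have "dual_norm V E (\<lambda>v. G s v - G t v) \<le> norm (f s - f t) + form_norm E (u s - u t)"
      proof (rule dual_norm_le)
        fix v assume v: "v \<in> V"
        have "G s v - G t v = inner (f s - f t) v - E (u s - u t) v"
          by (simp add: G_def inner_diff_left E_diff[OF uV[OF s] uV[OF t] v])
        then have "\<bar>G s v - G t v\<bar> \<le> \<bar>inner (f s - f t) v\<bar> + \<bar>E (u s - u t) v\<bar>" by linarith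
        also have "\<dots> \<le> norm (f s - f t) * form_norm E v + form_norm E (u s - u t) * form_norm E v"
          using Cauchy_Schwarz_ineq2[of "f s - f t" v] mult_left_mono[OF norm_le_form_norm[OF v], of "norm (f s - f t)"] abs_E_le[OF du v]
          by simp
        finally show "\<bar>G s v - G t v\<bar> \<le> (norm (f s - f t) + form_norm E (u s - u t)) * form_norm E v" by (simp add: distrib_right)
      qed (use form_norm_nonneg[OF du] in simp)
      then show "norm (dual_norm V E (\<lambda>v. G s v - G t v)) \<le> norm (f s - f t) + form_norm E (u s - u t)"
        using abs_le_dual_norm(2)[OF form_dual_diff[OF Gd[OF s] Gd[OF t]] subspace_0[OF V(1)]] by simp
    qed
  qed
  show ?thesis
    unfolding weak_solution_def u_def[symmetric]
  proof (intro conjI)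
    show "\<forall>t\<in>{0<..T}. u t \<in> V \<and> ((\<lambda>s. form_norm E (u s - u t)) \<longlongrightarrow> 0) (at t within {0<..T})"
      using uV ucont by blast
    show "\<exists>g. continuous_on {0..T} g \<and> (\<forall>t\<in>{0<..T}. frac_integrable \<alpha> u t \<and> g t = frac_integral \<alpha> u t) \<and> g 0 = u0"
      by (intro exI[of _ g]) (use gcont ui ug g0 in auto)
    show "\<exists>G. hilfer_derivative V E \<mu> \<nu> T u G \<and> (\<forall>t\<in>{0<..T}. G t \<in> form_dual V E \<and>
           ((\<lambda>s. dual_norm V E (\<lambda>v. G s v - G t v)) \<longlongrightarrow> 0) (at t within {0<..T})) \<and>
        (\<forall>\<phi>\<in>V. AE t in lborel. t \<in> {0<..<T} \<longrightarrow> G t \<phi> + E (u t) \<phi> - inner (f t) \<phi> = 0)"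
    proof (intro exI[of _ G] conjI)
      show "hilfer_derivative V E \<mu> \<nu> T u G"
        unfolding hilfer_derivative_def using ui der dfi by blast
    qed (use Gd Gcont in \<open>auto simp: G_def\<close>)
  qed
qed

end

section \<open>Explicit solutions and uniqueness\<close>

context fractional_order
begin

lemma ml_kern_at_0: "ml_kern a \<kappa> 0 = 0"
  by (simp add: ml_kern_def kern_def)

end

context hilfer_setting
begin

lemma coefficient_solution_add:
  assumes a: "a > 0" and 1: "coefficient_solution a T u0 f c h F b" and 2: "coefficient_solution a T u0' f' c' h' F' b'"
  shows "coefficient_solution a T (u0 + u0') (\<lambda>t. f t + f' t) (\<lambda>n t. c n t + c' n t) (\<lambda>n t. h n t + h' n t)
    (\<lambda>n t. F n t + F' n t) (\<lambda>n. b n + b' n)"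
proof -
  have intg: "frac_integrable \<alpha> (c n) t \<and> frac_integrable \<beta> (F n) t"
    if cs: "coefficient_solution a T u0 f c h F b" and t: "t \<in> {0<..T}" for u0 f c h F b n t
  proof -
    have cc: "continuous_on {0<..T} (c n)" "continuous_on {0<..T} (F n)"
      and cb: "\<And>\<tau>. \<tau> \<in> {0<..T} \<Longrightarrow> sqrt (lam n) * \<bar>c n \<tau>\<bar> \<le> b n * kern a \<tau>"
      and Fb: "\<And>\<tau>. \<tau> \<in> {0<..T} \<Longrightarrow> \<bar>F n \<tau>\<bar> \<le> sqrt (lam n) * (b n * kern a \<tau>)"
      using cs unfolding coefficient_solution_def by blast+
    have m: "set_borel_measurable lborel {0<..<t} (c n)" "set_borel_measurable lborel {0<..<t} (F n)"
      using t by (auto intro!: set_borel_measurable_continuous_on[OF cc(1)] set_borel_measurable_continuous_on[OF cc(2)])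
    have "frac_integrable \<alpha> (c n) t"
    proof (rule frac_integrable_bound[OF m(1) frac_integrable_mult_right[OF frac_integrable_kern[of \<alpha> a t], of "b n / sqrt (lam n)"]])
      fix \<tau> assume "0 < \<tau>" "\<tau> < t"
      then have "\<bar>c n \<tau>\<bar> \<le> b n / sqrt (lam n) * kern a \<tau>" using cb[of \<tau>] t lam_pos[of n] by (simp add: field_simps)
      then show "norm (c n \<tau>) \<le> norm (b n / sqrt (lam n) * kern a \<tau>)"
        unfolding real_norm_def using abs_ge_self[of "b n / sqrt (lam n) * kern a \<tau>"] by linarith
    qed (use a alpha_pos in auto)
    moreover have "frac_integrable \<beta> (F n) t"
    proof (rule frac_integrable_bound[OF m(2) frac_integrable_mult_right[OF frac_integrable_kern[of \<beta> a t], of "sqrt (lam n) * b n"]])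
      fix \<tau> assume "0 < \<tau>" "\<tau> < t"
      then have "\<bar>F n \<tau>\<bar> \<le> sqrt (lam n) * b n * kern a \<tau>" using Fb[of \<tau>] t by (simp add: mult.assoc)
      then show "norm (F n \<tau>) \<le> norm (sqrt (lam n) * b n * kern a \<tau>)"
        unfolding real_norm_def using abs_ge_self[of "sqrt (lam n) * b n * kern a \<tau>"] by linarith
    qed (use a beta_nonneg in auto)
    ultimately show ?thesis ..
  qed
  show ?thesis
    unfolding coefficient_solution_def
  proof (intro conjI allI ballI)
    show "u0 + u0' \<in> H" "continuous_on {0<..T} (\<lambda>t. f t + f' t)" "l2_seq (\<lambda>n. b n + b' n)"
      using 1 2 H unfolding coefficient_solution_def by (auto intro!: subspace_add continuous_intros l2_seq_add)
    show "f t + f' t \<in> H" if "t \<in> {0<..T}" for t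
      using 1 2 H that unfolding coefficient_solution_def by (auto intro!: subspace_add)
    fix n
    show "0 \<le> b n + b' n" "continuous_on {0<..T} (\<lambda>t. c n t + c' n t)" "continuous_on {0..T} (\<lambda>t. h n t + h' n t)"
      "continuous_on {0<..T} (\<lambda>t. F n t + F' n t)" "h n 0 + h' n 0 = inner (u0 + u0') (\<phi> n)"
      using 1 2 unfolding coefficient_solution_def by (auto intro!: continuous_intros add_nonneg_nonneg simp: inner_add_left)
    show "\<bar>h n t + h' n t\<bar> \<le> b n + b' n" if "t \<in> {0..T}" for t
    proof -
      have "\<bar>h n t\<bar> \<le> b n" "\<bar>h' n t\<bar> \<le> b' n" using 1 2 that unfolding coefficient_solution_def by blast+
      then show ?thesis by linarith
    qed
    fix t assume t: "t \<in> {0<..T}"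
    have c: "sqrt (lam n) * \<bar>c n t\<bar> \<le> b n * kern a t" "sqrt (lam n) * \<bar>c' n t\<bar> \<le> b' n * kern a t"
      and F: "\<bar>F n t\<bar> \<le> sqrt (lam n) * (b n * kern a t)" "\<bar>F' n t\<bar> \<le> sqrt (lam n) * (b' n * kern a t)"
      and e: "h n t = frac_integral \<alpha> (c n) t" "h' n t = frac_integral \<alpha> (c' n) t"
        "(h n has_real_derivative F n t) (at t within {0<..T})" "(h' n has_real_derivative F' n t) (at t within {0<..T})"
        "frac_integral \<beta> (F n) t = inner (f t) (\<phi> n) - lam n * c n t" "frac_integral \<beta> (F' n) t = inner (f' t) (\<phi> n) - lam n * c' n t"
      using 1 2 t unfolding coefficient_solution_def by blast+
    have "sqrt (lam n) * \<bar>c n t + c' n t\<bar> \<le> sqrt (lam n) * (\<bar>c n t\<bar> + \<bar>c' n t\<bar>)"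
      using less_imp_le[OF lam_pos[of n]] by (intro mult_left_mono) auto
    then show "sqrt (lam n) * \<bar>c n t + c' n t\<bar> \<le> (b n + b' n) * kern a t" using c by (simp add: distrib_left distrib_right)
    show "\<bar>F n t + F' n t\<bar> \<le> sqrt (lam n) * ((b n + b' n) * kern a t)" using F by (simp add: distrib_left distrib_right)
    show "h n t + h' n t = frac_integral \<alpha> (\<lambda>t. c n t + c' n t) t"
      using intg[OF 1 t] intg[OF 2 t] e by (simp add: frac_integral_add)
    show "((\<lambda>t. h n t + h' n t) has_real_derivative F n t + F' n t) (at t within {0<..T})" by (rule DERIV_add[OF e(3,4)])
    show "frac_integral \<beta> (\<lambda>t. F n t + F' n t) t = inner (f t + f' t) (\<phi> n) - lam n * (c n t + c' n t)"
      using intg[OF 1 t] intg[OF 2 t] e by (simp add: frac_integral_add inner_add_left algebra_simps)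
  qed
qed

text \<open>The component functions are the kernels of index \<open>\<mu> + \<beta>\<close>, their
  fractional integrals those of index 1. The latter are written as \<open>1 - lam n * ml_kern (1 + \<mu>)
  (lam n) t\<close> because this expression has the right value 1 also at time 0, where the kernels
  themselves are 0 by the conventions on powers of 0.\<close>

lemma coefficient_solution_homogeneous:
  assumes T: "T > 0" and u0: "u0 \<in> H"
  shows "\<exists>h F b. coefficient_solution (\<mu> / 2) T u0 (\<lambda>_. 0) (\<lambda>n t. inner u0 (\<phi> n) * ml_kern (\<mu> + \<beta>) (lam n) t) h F b"
proof -
  have m2: "\<mu> / 2 > 0" using mu0 by simp
  obtain K where K: "K \<ge> 0" "\<And>t. 0 < t \<Longrightarrow> t \<le> T \<Longrightarrow> kern (\<beta> + \<mu> / 2) t \<le> K * kern (\<mu> / 2) t"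
    using kern_shift_le[OF m2 beta_nonneg T] by blast
  define B where "B = 1 + sqrt_const * K + sqrt_const"
  have B: "1 \<le> B" "sqrt_const * K \<le> B" "sqrt_const \<le> B" using K(1) sqrt_const_pos by (auto simp: B_def)
  define h where "h n t = inner u0 (\<phi> n) * (1 - lam n * ml_kern (1 + \<mu>) (lam n) t)" for n t
  define F where "F n t = - lam n * inner u0 (\<phi> n) * ml_kern \<mu> (lam n) t" for n t
  define b where "b n = B * \<bar>inner u0 (\<phi> n)\<bar>" for n
  have sub: "{0<..T} \<subseteq> {0<..}" "{0..T} \<subseteq> {0..}" by auto
  have k0: "0 \<le> kern (\<mu> / 2) t" for t by (rule kern_nonneg[OF m2])
  have mb: "\<mu> + \<beta> > 0" using mu0 beta_nonneg by simp
  have "coefficient_solution (\<mu> / 2) T u0 (\<lambda>_. 0) (\<lambda>n t. inner u0 (\<phi> n) * ml_kern (\<mu> + \<beta>) (lam n) t) h F b"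
    unfolding coefficient_solution_def
  proof (intro conjI allI ballI)
    show "u0 \<in> H" "(0 :: 'a L2) \<in> H" "continuous_on {0<..T} (\<lambda>_. 0 :: 'a L2)" using u0 H subspace_0 by auto
    show "l2_seq b" unfolding b_def by (intro l2_seq_scale l2_seq_abs l2_seq_coeff)
    fix n
    show "0 \<le> b n" using B by (simp add: b_def)
    show "continuous_on {0<..T} (\<lambda>t. inner u0 (\<phi> n) * ml_kern (\<mu> + \<beta>) (lam n) t)" "continuous_on {0<..T} (F n)"
      unfolding F_def[abs_def] by (intro continuous_intros continuous_on_subset[OF continuous_on_ml_kern sub(1)] mb mu0)+
    show "continuous_on {0..T} (h n)"
      unfolding h_def[abs_def] by (intro continuous_intros continuous_on_subset[OF continuous_on_ml_kern_0 sub(2)]) (use mu0 in simp)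
    show "h n 0 = inner u0 (\<phi> n)" by (simp add: h_def ml_kern_at_0)
    show "\<bar>h n t\<bar> \<le> b n" if t: "t \<in> {0..T}" for t
    proof -
      have "\<bar>1 - lam n * ml_kern (1 + \<mu>) (lam n) t\<bar> \<le> 1"
      proof (cases "t = 0")
        case False
        then have "t > 0" using t by simp
        then show ?thesis using ml_kern_1_eq[of t "lam n"] ml_kern_1_le_1[OF lam_pos, of t n] ml_kern_nonneg[OF lam_pos, of t 1 n] mu1 by simp
      qed (simp add: ml_kern_at_0)
      then have "\<bar>h n t\<bar> \<le> \<bar>inner u0 (\<phi> n)\<bar> * 1" unfolding h_def abs_mult by (rule mult_left_mono) simp
      also have "\<dots> \<le> b n" using mult_right_mono[OF B(1), of "\<bar>inner u0 (\<phi> n)\<bar>"] by (simp add: b_def)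
      finally show ?thesis .
    qed
    fix t assume t: "t \<in> {0<..T}"
    have t': "t > 0" using t by simp
    have n1: "0 \<le> ml_kern (\<mu> + \<beta>) (lam n) t" "0 \<le> ml_kern \<mu> (lam n) t" using ml_kern_nonneg[OF lam_pos t'] beta_nonneg by auto
    have "sqrt (lam n) * ml_kern (\<mu> + \<beta>) (lam n) t \<le> sqrt_const * kern (\<beta> + \<mu> / 2) t"
      using sqrt_ml_kern_le[OF lam_pos t' beta_nonneg, of n] by (simp add: add.commute)
    also have "\<dots> \<le> sqrt_const * (K * kern (\<mu> / 2) t)" using K(2)[OF t'] t sqrt_const_pos by (intro mult_left_mono) auto
    also have "\<dots> = (sqrt_const * K) * kern (\<mu> / 2) t" by simp
    also have "\<dots> \<le> B * kern (\<mu> / 2) t" by (rule mult_right_mono[OF B(2) k0])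
    finally have "\<bar>inner u0 (\<phi> n)\<bar> * (sqrt (lam n) * ml_kern (\<mu> + \<beta>) (lam n) t) \<le> \<bar>inner u0 (\<phi> n)\<bar> * (B * kern (\<mu> / 2) t)"
      by (rule mult_left_mono) simp
    then show "sqrt (lam n) * \<bar>inner u0 (\<phi> n) * ml_kern (\<mu> + \<beta>) (lam n) t\<bar> \<le> b n * kern (\<mu> / 2) t"
      using n1 by (simp add: b_def abs_mult mult_ac)
    have "sqrt (lam n) * ml_kern \<mu> (lam n) t \<le> sqrt_const * kern (\<mu> / 2) t"
      using sqrt_ml_kern_le[OF lam_pos t', of 0 n] by simp
    also have "\<dots> \<le> B * kern (\<mu> / 2) t" by (rule mult_right_mono[OF B(3) k0])
    finally have "(sqrt (lam n) * \<bar>inner u0 (\<phi> n)\<bar>) * (sqrt (lam n) * ml_kern \<mu> (lam n) t) \<le> (sqrt (lam n) * \<bar>inner u0 (\<phi> n)\<bar>) * (B * kern (\<mu> / 2) t)"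
      using lam_pos[of n] by (intro mult_left_mono) auto
    moreover have "\<bar>F n t\<bar> = (sqrt (lam n) * \<bar>inner u0 (\<phi> n)\<bar>) * (sqrt (lam n) * ml_kern \<mu> (lam n) t)"
    proof -
      have "lam n = sqrt (lam n) * sqrt (lam n)" using lam_pos[of n] by simp
      moreover have "\<bar>F n t\<bar> = lam n * \<bar>inner u0 (\<phi> n)\<bar> * ml_kern \<mu> (lam n) t"
        using n1 lam_pos[of n] by (simp add: F_def abs_mult)
      ultimately show ?thesis by (metis (no_types, opaque_lifting) mult.assoc mult.commute)
    qed
    ultimately show "\<bar>F n t\<bar> \<le> sqrt (lam n) * (b n * kern (\<mu> / 2) t)" by (simp add: b_def mult_ac)
    show "h n t = frac_integral \<alpha> (\<lambda>t. inner u0 (\<phi> n) * ml_kern (\<mu> + \<beta>) (lam n) t) t"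
    proof -
      have "\<alpha> + (\<mu> + \<beta>) = 1" using alpha_beta by simp
      then show ?thesis
        using frac_integral_ml_kern(2)[OF mb less_imp_le[OF alpha_pos] t', of "lam n"] ml_kern_1_eq[OF t', of "lam n"]
        by (simp only: frac_integral_mult_right h_def)
    qed
    show "(h n has_real_derivative F n t) (at t within {0<..T})"
    proof (rule has_field_derivative_at_within)
      have "(ml_kern (1 + \<mu>) (lam n) has_real_derivative ml_kern \<mu> (lam n) t) (at t)"
        using ml_kern_has_derivative[OF mu0 t', of "lam n"] by (simp add: add.commute)
      then show "(h n has_real_derivative F n t) (at t)"
        unfolding h_def[abs_def] F_def by (auto intro!: derivative_eq_intros)
    qed
    show "frac_integral \<beta> (F n) t = inner 0 (\<phi> n) - lam n * (inner u0 (\<phi> n) * ml_kern (\<mu> + \<beta>) (lam n) t)"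
      unfolding F_def[abs_def] frac_integral_mult_right frac_integral_ml_kern(2)[OF mu0 beta_nonneg t']
      by (simp add: add.commute)
  qed
  then show ?thesis by blast
qed

text \<open>The component functions are the fractional integrals of order \<open>m + 2\<close> of the
  kernel of index \<open>\<mu>\<close>, so the final states for varying \<open>m\<close>, tested with a
  fixed vector, give the sums in \<open>vanishing_observations\<close>.\<close>

lemma coefficient_solution_control:
  fixes m :: nat
  assumes T: "T > 0" and g: "g \<in> H"
  shows "\<exists>h F b. coefficient_solution (\<mu> / 2) T 0 (\<lambda>t. kern (real m + 2) t *\<^sub>R g) (\<lambda>n t. inner g (\<phi> n) * ml_kern (real m + 2 + \<mu>) (lam n) t) h F b"
proof -
  have m2: "\<mu> / 2 > 0" using mu0 by simp
  define d where "d = real m + 2 - \<beta>"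
  have d: "d > 1" "d \<ge> \<mu>" "d - \<mu> / 2 \<ge> 0" "d > 0" using beta_less mu0 mu1 unfolding d_def by linarith+
  obtain K where K: "K \<ge> 0" "\<And>t. 0 < t \<Longrightarrow> t \<le> T \<Longrightarrow> kern (real m + 2 + \<mu> / 2) t \<le> K * kern (\<mu> / 2) t"
    using kern_shift_le[OF m2 _ T, of "real m + 2"] by auto
  obtain K2 where K2: "K2 \<ge> 0" "\<And>t. 0 < t \<Longrightarrow> t \<le> T \<Longrightarrow> kern (d - \<mu> / 2 + \<mu> / 2) t \<le> K2 * kern (\<mu> / 2) t"
    using kern_shift_le[OF m2 d(3) T] by blast
  obtain K3 where K3: "K3 \<ge> 0" "\<And>t. 0 < t \<Longrightarrow> t \<le> T \<Longrightarrow> kern (d + 1) t \<le> K3 * kern 1 t"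
    using kern_shift_le[OF zero_less_one less_imp_le[OF d(4)] T] by blast
  define B where "B = K3 + sqrt_const * K + K2 / sqrt l0"
  have B: "K3 \<le> B" "sqrt_const * K \<le> B" "K2 / sqrt l0 \<le> B" using K(1) K2(1) K3(1) sqrt_const_pos l0 by (auto simp: B_def)
  define h where "h n t = inner g (\<phi> n) * ml_kern (d + 1) (lam n) t" for n t
  define F where "F n t = inner g (\<phi> n) * ml_kern d (lam n) t" for n t
  define b where "b n = B * \<bar>inner g (\<phi> n)\<bar>" for n
  have sub: "{0<..T} \<subseteq> {0<..}" "{0..T} \<subseteq> {0..}" by auto
  have k0: "0 \<le> kern (\<mu> / 2) t" for t by (rule kern_nonneg[OF m2])
  have mp: "real m + 2 + \<mu> > 0" "real m + 2 + \<mu> \<ge> \<mu>" using mu0 by auto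
  have "coefficient_solution (\<mu> / 2) T 0 (\<lambda>t. kern (real m + 2) t *\<^sub>R g) (\<lambda>n t. inner g (\<phi> n) * ml_kern (real m + 2 + \<mu>) (lam n) t) h F b"
    unfolding coefficient_solution_def
  proof (intro conjI allI ballI)
    show "(0 :: 'a L2) \<in> H" using H subspace_0 by auto
    show "kern (real m + 2) t *\<^sub>R g \<in> H" for t using g H by (simp add: subspace_scale)
    show "continuous_on {0<..T} (\<lambda>t. kern (real m + 2) t *\<^sub>R g)"
      by (intro continuous_intros continuous_on_subset[OF continuous_on_kern sub(1)])
    show "l2_seq b" unfolding b_def by (intro l2_seq_scale l2_seq_abs l2_seq_coeff)
    fix n
    show "0 \<le> b n" using B K3 by (simp add: b_def)
    show "continuous_on {0<..T} (\<lambda>t. inner g (\<phi> n) * ml_kern (real m + 2 + \<mu>) (lam n) t)" "continuous_on {0<..T} (F n)"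
      unfolding F_def[abs_def] by (intro continuous_intros continuous_on_subset[OF continuous_on_ml_kern sub(1)] mp d)+
    show "continuous_on {0..T} (h n)"
      unfolding h_def[abs_def] by (intro continuous_intros continuous_on_subset[OF continuous_on_ml_kern_0 sub(2)]) (use d in simp)
    show "h n 0 = inner 0 (\<phi> n)" by (simp add: h_def ml_kern_at_0)
    show "\<bar>h n t\<bar> \<le> b n" if t: "t \<in> {0..T}" for t
    proof -
      have "\<bar>ml_kern (d + 1) (lam n) t\<bar> \<le> B"
      proof (cases "t = 0")
        case False
        then have "t > 0" using t by simp
        have "\<bar>ml_kern (d + 1) (lam n) t\<bar> \<le> kern (d + 1) t" by (rule abs_ml_kern_le_kern[OF lam_pos \<open>t > 0\<close>]) (use d in simp)
        also have "\<dots> \<le> K3" using K3(2)[OF \<open>t > 0\<close>] t \<open>t > 0\<close> by simp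
        finally show ?thesis using B by simp
      qed (use B K3 in \<open>simp add: ml_kern_at_0\<close>)
      then have "\<bar>inner g (\<phi> n)\<bar> * \<bar>ml_kern (d + 1) (lam n) t\<bar> \<le> \<bar>inner g (\<phi> n)\<bar> * B" by (rule mult_left_mono) simp
      then show ?thesis by (simp add: h_def b_def abs_mult mult.commute)
    qed
    fix t assume t: "t \<in> {0<..T}"
    have t': "t > 0" using t by simp
    have n1: "0 \<le> ml_kern (real m + 2 + \<mu>) (lam n) t" using ml_kern_nonneg[OF lam_pos t'] by auto
    have "sqrt (lam n) * ml_kern (real m + 2 + \<mu>) (lam n) t \<le> sqrt_const * kern (real m + 2 + \<mu> / 2) t"
      using sqrt_ml_kern_le[OF lam_pos t', of "real m + 2" n] by simp
    also have "\<dots> \<le> sqrt_const * (K * kern (\<mu> / 2) t)" using K(2)[OF t'] t sqrt_const_pos by (intro mult_left_mono) auto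
    also have "\<dots> = (sqrt_const * K) * kern (\<mu> / 2) t" by simp
    also have "\<dots> \<le> B * kern (\<mu> / 2) t" by (rule mult_right_mono[OF B(2) k0])
    finally have "\<bar>inner g (\<phi> n)\<bar> * (sqrt (lam n) * ml_kern (real m + 2 + \<mu>) (lam n) t) \<le> \<bar>inner g (\<phi> n)\<bar> * (B * kern (\<mu> / 2) t)"
      by (rule mult_left_mono) simp
    then show "sqrt (lam n) * \<bar>inner g (\<phi> n) * ml_kern (real m + 2 + \<mu>) (lam n) t\<bar> \<le> b n * kern (\<mu> / 2) t"
      using n1 by (simp add: b_def abs_mult mult_ac)
    have "\<bar>ml_kern d (lam n) t\<bar> \<le> K2 * kern (\<mu> / 2) t"
      using abs_ml_kern_le_kern[OF lam_pos t' d(2), of n] K2(2)[OF t'] t by simp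
    also have "\<dots> = sqrt l0 * (K2 / sqrt l0 * kern (\<mu> / 2) t)" using l0 by simp
    also have "\<dots> \<le> sqrt (lam n) * (B * kern (\<mu> / 2) t)"
      using lam[of n] l0 B(1,3) k0[of t] K2(1) K3(1) by (intro mult_mono) auto
    finally have "\<bar>inner g (\<phi> n)\<bar> * \<bar>ml_kern d (lam n) t\<bar> \<le> \<bar>inner g (\<phi> n)\<bar> * (sqrt (lam n) * (B * kern (\<mu> / 2) t))"
      by (rule mult_left_mono) simp
    then show "\<bar>F n t\<bar> \<le> sqrt (lam n) * (b n * kern (\<mu> / 2) t)" by (simp add: F_def b_def abs_mult mult_ac)
    show "h n t = frac_integral \<alpha> (\<lambda>t. inner g (\<phi> n) * ml_kern (real m + 2 + \<mu>) (lam n) t) t"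
    proof -
      have "\<alpha> + (real m + 2 + \<mu>) = d + 1" using alpha_beta by (simp add: d_def)
      then show ?thesis
        using frac_integral_ml_kern(2)[OF mp(1) less_imp_le[OF alpha_pos] t', of "lam n"]
        by (simp only: frac_integral_mult_right h_def)
    qed
    show "(h n has_real_derivative F n t) (at t within {0<..T})"
      unfolding h_def[abs_def] F_def
      by (rule has_field_derivative_at_within, rule DERIV_cmult[OF ml_kern_has_derivative[OF d(4) t']])
    show "frac_integral \<beta> (F n) t = inner (kern (real m + 2) t *\<^sub>R g) (\<phi> n) - lam n * (inner g (\<phi> n) * ml_kern (real m + 2 + \<mu>) (lam n) t)"
    proof -
      have "\<beta> + d = real m + 2" by (simp add: d_def)
      then show ?thesis
        unfolding F_def[abs_def] frac_integral_mult_right frac_integral_ml_kern(2)[OF d(4) beta_nonneg t']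
        using ml_kern_recurrence[of "real m + 2" t "lam n"] t' by (simp add: right_diff_distrib mult_ac)
    qed
  qed
  then show ?thesis by blast
qed

lemma coefficient_solution_exists:
  assumes T: "T > 0" and u0: "u0 \<in> H" and g: "\<And>m. g m \<in> H"
  shows "\<exists>c h F b. coefficient_solution (\<mu> / 2) T u0 (\<lambda>t. \<Sum>m<M. kern (real m + 2) t *\<^sub>R g m) c h F b \<and>
     (\<forall>n t. c n t = inner u0 (\<phi> n) * ml_kern (\<mu> + \<beta>) (lam n) t + (\<Sum>m<M. inner (g m) (\<phi> n) * ml_kern (real m + 2 + \<mu>) (lam n) t))"
proof (induction M)
  case 0
  then show ?case using coefficient_solution_homogeneous[OF T u0] by auto
next
  case (Suc M)
  then obtain c h F b where 1: "coefficient_solution (\<mu> / 2) T u0 (\<lambda>t. \<Sum>m<M. kern (real m + 2) t *\<^sub>R g m) c h F b"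
    "\<And>n t. c n t = inner u0 (\<phi> n) * ml_kern (\<mu> + \<beta>) (lam n) t + (\<Sum>m<M. inner (g m) (\<phi> n) * ml_kern (real m + 2 + \<mu>) (lam n) t)"
    by blast
  obtain h' F' b' where 2: "coefficient_solution (\<mu> / 2) T 0 (\<lambda>t. kern (real M + 2) t *\<^sub>R g M) (\<lambda>n t. inner (g M) (\<phi> n) * ml_kern (real M + 2 + \<mu>) (lam n) t) h' F' b'"
    using coefficient_solution_control[OF T g, of M M] by blast
  have "\<mu> / 2 > 0" using mu0 by simp
  from coefficient_solution_add[OF this 1(1) 2] show ?case
    by (intro exI conjI) (simp, simp add: 1(2))
qed

text \<open>Testing the weak formulation with an eigenvector. Convergence of difference quotients in the
  dual norm gives differentiability of the component.\<close>

lemma weak_solution_coefficient: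
  assumes T: "T > 0" and ws: "weak_solution V E \<mu> \<nu> T u0 f u"
  shows "\<exists>h F. continuous_on {0<..T} (\<lambda>t. inner (u t) (\<phi> n)) \<and> (\<forall>t\<in>{0<..T}. u t \<in> V \<and> frac_integrable \<alpha> (\<lambda>t. inner (u t) (\<phi> n)) t \<and>
     h t = frac_integral \<alpha> (\<lambda>t. inner (u t) (\<phi> n)) t \<and> (h has_real_derivative F t) (at t within {0<..T}) \<and> frac_integrable \<beta> F t) \<and>
     continuous_on {0..T} h \<and> h 0 = inner u0 (\<phi> n) \<and>
     (AE t in lborel. t \<in> {0<..<T} \<longrightarrow> frac_integral \<beta> F t = inner (f t) (\<phi> n) - lam n * inner (u t) (\<phi> n))"
proof -
  have uV: "\<And>t. t \<in> {0<..T} \<Longrightarrow> u t \<in> V" and uc: "\<And>t. t \<in> {0<..T} \<Longrightarrow> ((\<lambda>s. form_norm E (u s - u t)) \<longlongrightarrow> 0) (at t within {0<..T})"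
    using ws unfolding weak_solution_def by blast+
  obtain g where g: "continuous_on {0..T} g" "\<And>t. t \<in> {0<..T} \<Longrightarrow> frac_integrable \<alpha> u t"
    "\<And>t. t \<in> {0<..T} \<Longrightarrow> g t = frac_integral \<alpha> u t" "g 0 = u0"
    using ws unfolding weak_solution_def by blast
  obtain G where G: "hilfer_derivative V E \<mu> \<nu> T u G"
    and ae: "\<And>\<psi>. \<psi> \<in> V \<Longrightarrow> AE t in lborel. t \<in> {0<..<T} \<longrightarrow> G t \<psi> + E (u t) \<psi> - inner (f t) \<psi> = 0"
    using ws unfolding weak_solution_def by blast
  obtain F where F: "\<And>t. t \<in> {0<..T} \<Longrightarrow> has_dual_derivative V E (frac_integral \<alpha> u) (F t) t {0<..T}"
    "\<And>t. t \<in> {0<..T} \<Longrightarrow> dual_frac_integral V E \<beta> F t (G t)"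
    using G unfolding hilfer_derivative_def by blast
  have ucont: "continuous_on {0<..T} u" by (rule form_continuous_imp_continuous[OF uV uc])
  have Fd: "F t \<in> form_dual V E" if "t \<in> {0<..T}" for t using F(1)[OF that] by (simp add: has_dual_derivative_def)
  define h where "h t = inner (g t) (\<phi> n)" for t
  show ?thesis
  proof (rule exI[of _ h], rule exI[of _ "\<lambda>t. F t (\<phi> n)"], intro conjI ballI)
    show "continuous_on {0<..T} (\<lambda>t. inner (u t) (\<phi> n))" by (intro continuous_intros ucont)
    show "continuous_on {0..T} h" unfolding h_def by (intro continuous_intros g)
    show "h 0 = inner u0 (\<phi> n)" by (simp add: h_def g)
    show "AE t in lborel. t \<in> {0<..<T} \<longrightarrow> frac_integral \<beta> (\<lambda>t. F t (\<phi> n)) t = inner (f t) (\<phi> n) - lam n * inner (u t) (\<phi> n)"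
      using ae[OF phiV[of n]]
    proof eventually_elim
      case (elim t)
      show ?case
      proof
        assume t: "t \<in> {0<..<T}"
        then have t': "t \<in> {0<..T}" by auto
        have "G t (\<phi> n) = frac_integral \<beta> (\<lambda>t. F t (\<phi> n)) t"
          using F(2)[OF t'] phiV[of n] unfolding dual_frac_integral_def by blast
        moreover have "E (u t) (\<phi> n) = lam n * inner (u t) (\<phi> n)"
          using Ephi[OF uV[OF t'], of n] E_sym[OF uV[OF t'] phiV, of n] by (simp add: inner_commute)
        ultimately show "frac_integral \<beta> (\<lambda>t. F t (\<phi> n)) t = inner (f t) (\<phi> n) - lam n * inner (u t) (\<phi> n)"
          using elim t by simp
      qed
    qed
    fix t assume t: "t \<in> {0<..T}"
    show "u t \<in> V" by (rule uV[OF t])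
    show "frac_integrable \<alpha> (\<lambda>t. inner (u t) (\<phi> n)) t" by (rule frac_integrable_inner[OF g(2)[OF t]])
    show "h t = frac_integral \<alpha> (\<lambda>t. inner (u t) (\<phi> n)) t"
      unfolding h_def g(3)[OF t] by (rule frac_integral_inner[OF g(2)[OF t]])
    show "frac_integrable \<beta> (\<lambda>t. F t (\<phi> n)) t"
    proof (cases "\<beta> = 0")
      case False
      have d: "frac_integrable \<beta> (\<lambda>\<tau>. dual_norm V E (F \<tau>)) t" and m: "set_borel_measurable lborel {0<..<t} (\<lambda>\<tau>. F \<tau> (\<phi> n))"
        using F(2)[OF t] phiV[of n] False unfolding dual_frac_integral_def by blast+
      show ?thesis
      proof (rule frac_integrable_bound[OF m frac_integrable_mult_right[OF d, of "form_norm E (\<phi> n)"]])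
        fix \<tau> assume "0 < \<tau>" "\<tau> < t"
        then have "\<tau> \<in> {0<..T}" using t by auto
        from abs_le_dual_norm(1)[OF Fd[OF this] phiV[of n]]
        show "norm (F \<tau> (\<phi> n)) \<le> norm (form_norm E (\<phi> n) * dual_norm V E (F \<tau>))"
          by (auto simp: mult.commute intro: order_trans[OF _ abs_ge_self])
      qed
    qed (simp add: frac_integrable_def)
    define q where "q s v = inner ((frac_integral \<alpha> u s - frac_integral \<alpha> u t) /\<^sub>R (s - t)) v - F t v" for s v
    have "((\<lambda>s. dual_norm V E (q s)) \<longlongrightarrow> 0) (at t within {0<..T})"
      using F(1)[OF t] by (simp add: has_dual_derivative_def q_def[abs_def])
    from tendsto_mult[OF this tendsto_const[of "form_norm E (\<phi> n)"]]
    have lim: "((\<lambda>s. dual_norm V E (q s) * form_norm E (\<phi> n)) \<longlongrightarrow> 0) (at t within {0<..T})" by simp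
    have "q s \<in> form_dual V E" for s
      unfolding q_def[abs_def] by (rule form_dual_diff[OF inner_form_dual Fd[OF t]])
    from abs_le_dual_norm(1)[OF this phiV[of n]]
    have "((\<lambda>s. q s (\<phi> n)) \<longlongrightarrow> 0) (at t within {0<..T})"
      by (intro Lim_null_comparison[OF _ lim]) auto
    then have "((\<lambda>s. (h s - h t) / (s - t) - F t (\<phi> n)) \<longlongrightarrow> 0) (at t within {0<..T})"
    proof (rule Lim_transform_eventually)
      show "eventually (\<lambda>s. q s (\<phi> n) = (h s - h t) / (s - t) - F t (\<phi> n)) (at t within {0<..T})"
        unfolding eventually_at_filter
        by (intro always_eventually) (auto simp: q_def h_def g(3) t[simplified] inner_diff_left divide_inverse mult.commute g(3)[OF t])
    qed
    then show "(h has_real_derivative F t (\<phi> n)) (at t within {0<..T})"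
      unfolding has_field_derivative_iff using LIM_zero_iff by blast
  qed
qed

text \<open>Each component of the difference satisfies the hypotheses of
  \<open>hilfer_scalar_unique\<close>, and the eigenvectors are complete.\<close>

lemma weak_solution_unique:
  assumes T: "T > 0" and 1: "weak_solution V E \<mu> \<nu> T u0 f u" and 2: "weak_solution V E \<mu> \<nu> T u0 f u'"
  shows "u T = u' T"
proof -
  have "inner (u T - u' T) (\<phi> n) = 0" for n
  proof -
    obtain h F where a: "continuous_on {0<..T} (\<lambda>t. inner (u t) (\<phi> n))"
      "\<And>t. t \<in> {0<..T} \<Longrightarrow> frac_integrable \<alpha> (\<lambda>t. inner (u t) (\<phi> n)) t" "\<And>t. t \<in> {0<..T} \<Longrightarrow> h t = frac_integral \<alpha> (\<lambda>t. inner (u t) (\<phi> n)) t"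
      "\<And>t. t \<in> {0<..T} \<Longrightarrow> (h has_real_derivative F t) (at t within {0<..T})" "\<And>t. t \<in> {0<..T} \<Longrightarrow> frac_integrable \<beta> F t"
      "continuous_on {0..T} h" "h 0 = inner u0 (\<phi> n)"
      "AE t in lborel. t \<in> {0<..<T} \<longrightarrow> frac_integral \<beta> F t = inner (f t) (\<phi> n) - lam n * inner (u t) (\<phi> n)"
      using weak_solution_coefficient[OF T 1, of n] by blast
    obtain h' F' where b: "continuous_on {0<..T} (\<lambda>t. inner (u' t) (\<phi> n))"
      "\<And>t. t \<in> {0<..T} \<Longrightarrow> frac_integrable \<alpha> (\<lambda>t. inner (u' t) (\<phi> n)) t" "\<And>t. t \<in> {0<..T} \<Longrightarrow> h' t = frac_integral \<alpha> (\<lambda>t. inner (u' t) (\<phi> n)) t"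
      "\<And>t. t \<in> {0<..T} \<Longrightarrow> (h' has_real_derivative F' t) (at t within {0<..T})" "\<And>t. t \<in> {0<..T} \<Longrightarrow> frac_integrable \<beta> F' t"
      "continuous_on {0..T} h'" "h' 0 = inner u0 (\<phi> n)"
      "AE t in lborel. t \<in> {0<..<T} \<longrightarrow> frac_integral \<beta> F' t = inner (f t) (\<phi> n) - lam n * inner (u' t) (\<phi> n)"
      using weak_solution_coefficient[OF T 2, of n] by blast
    have sub: "frac_integrable r (\<lambda>t. p t - q t) t \<and> frac_integral r (\<lambda>t. p t - q t) t = frac_integral r p t - frac_integral r q t"
      if "frac_integrable r p t" "frac_integrable r q t" for r t and p q :: "real \<Rightarrow> real"
      using frac_integrable_add[OF that(1) frac_integrable_mult_right[OF that(2), of "-1"]]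
        frac_integral_add[OF that(1) frac_integrable_mult_right[OF that(2), of "-1"]] frac_integral_mult_right[of r "-1" q t]
      by simp
    have "(\<lambda>t. inner (u t) (\<phi> n) - inner (u' t) (\<phi> n)) T = 0"
    proof (rule hilfer_scalar_unique[OF T alpha_pos beta_nonneg alpha_beta lam_pos[of n], where h = "\<lambda>t. h t - h' t" and F = "\<lambda>t. F t - F' t"])
      show "continuous_on {0<..T} (\<lambda>t. inner (u t) (\<phi> n) - inner (u' t) (\<phi> n))" by (intro continuous_intros a b)
      show "continuous_on {0..T} (\<lambda>t. h t - h' t)" by (intro continuous_intros a b)
      show "h 0 - h' 0 = 0" using a b by simp
      show "frac_integrable \<beta> (\<lambda>t. F t - F' t) T" using sub[OF a(5) b(5), of T] T by simp
      show "AE t in lborel. t \<in> {0<..<T} \<longrightarrow> frac_integral \<beta> (\<lambda>t. F t - F' t) t = - lam n * (inner (u t) (\<phi> n) - inner (u' t) (\<phi> n))"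
        using a(8) b(8)
      proof eventually_elim
        case (elim t)
        show ?case
        proof
          assume t: "t \<in> {0<..<T}"
          then have "t \<in> {0<..T}" by auto
          then show "frac_integral \<beta> (\<lambda>t. F t - F' t) t = - lam n * (inner (u t) (\<phi> n) - inner (u' t) (\<phi> n))"
            using sub[OF a(5) b(5), of t] elim t by (simp add: algebra_simps)
        qed
      qed
      fix t assume "0 < t" "t \<le> T"
      then have t: "t \<in> {0<..T}" by simp
      show "frac_integrable \<alpha> (\<lambda>t. inner (u t) (\<phi> n) - inner (u' t) (\<phi> n)) t" using sub[OF a(2)[OF t] b(2)[OF t]] by simp
      show "h t - h' t = frac_integral \<alpha> (\<lambda>t. inner (u t) (\<phi> n) - inner (u' t) (\<phi> n)) t"
        using sub[OF a(2)[OF t] b(2)[OF t]] a(3)[OF t] b(3)[OF t] by simp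
      show "((\<lambda>t. h t - h' t) has_real_derivative F t - F' t) (at t within {0<..T})" by (rule DERIV_diff[OF a(4)[OF t] b(4)[OF t]])
    qed
    then show ?thesis by (simp add: inner_diff_left)
  qed
  moreover have "u T - u' T \<in> H"
  proof -
    have "u T \<in> V" "u' T \<in> V" using 1 2 T unfolding weak_solution_def by auto
    then show ?thesis using V subspace_diff by blast
  qed
  ultimately have "u T - u' T = 0" using complete by blast
  then show ?thesis by simp
qed

end

section \<open>Density of the reachable states and controllability\<close>

lemma square_integrable_rep_L2: "square_integrable (rep_L2 u)"
  using Quotient_rep_reflp[OF Quotient_L2, of u] by simp

lemma abs_rep_L2: "abs_L2 (rep_L2 u) = u"
  by (rule Quotient_abs_rep[OF Quotient_L2])

lemma rep_abs_L2: "square_integrable f \<Longrightarrow> AE x in lborel. rep_L2 (abs_L2 f) x = f x"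
  using Quotient_rep_abs[OF Quotient_L2, of f] by simp

lemma inner_L2_rep: "inner u v = (LINT x|lborel. rep_L2 u x * rep_L2 v x)"
  using inner_L2.abs_eq[of "rep_L2 u" "rep_L2 v"] square_integrable_rep_L2[of u] square_integrable_rep_L2[of v]
  by (simp add: abs_rep_L2)

text \<open>For the nontrivial inclusion, test \<open>u\<close> against its own restriction to the
  complement of \<open>S\<close>. This makes \<open>L2_on S\<close> a closed subspace without reference to
  representatives.\<close>

lemma L2_on_eq_orthogonal:
  fixes S :: "'a::euclidean_space set"
  assumes S: "S \<in> sets borel"
  shows "L2_on S = {u. \<forall>g\<in>L2_on (- S). inner u g = 0}"
proof (intro equalityI subsetI)
  fix u assume u: "u \<in> L2_on S"
  have "inner u g = 0" if g: "g \<in> L2_on (- S)" for g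
  proof -
    have "AE x in lborel. rep_L2 u x * rep_L2 g x = 0"
      using u g unfolding L2_on_def mem_Collect_eq by eventually_elim auto
    then have "(LINT x|lborel. rep_L2 u x * rep_L2 g x) = 0"
      by (rule integral_eq_zero_AE)
    then show ?thesis by (simp add: inner_L2_rep)
  qed
  then show "u \<in> {u. \<forall>g\<in>L2_on (- S). inner u g = 0}" by blast
next
  fix u assume "u \<in> {u. \<forall>g\<in>L2_on (- S). inner u g = 0}"
  then have orth: "\<And>g. g \<in> L2_on (- S) \<Longrightarrow> inner u g = 0" by blast
  define f where "f x = indicator (- S) x * rep_L2 u x" for x
  have mu: "rep_L2 u \<in> borel_measurable lborel" using square_integrable_rep_L2[of u] by (simp add: square_integrable_def)
  have fm: "f \<in> borel_measurable lborel" unfolding f_def[abs_def] using mu S by measurable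
  have fs: "square_integrable f"
    by (rule square_integrable_bound[OF square_integrable_rep_L2[of u] fm]) (auto simp: f_def indicator_def)
  have "abs_L2 f \<in> L2_on (- S)"
    unfolding L2_on_def mem_Collect_eq using rep_abs_L2[OF fs] by eventually_elim (auto simp: f_def)
  then have "inner u (abs_L2 f) = 0" by (rule orth)
  moreover have "inner u (abs_L2 f) = (LINT x|lborel. rep_L2 u x * f x)"
    using inner_L2.abs_eq[of "rep_L2 u" f] square_integrable_rep_L2[of u] fs by (simp add: abs_rep_L2)
  moreover have "rep_L2 u x * f x = (f x)\<^sup>2" for x by (cases "x \<in> S") (auto simp: f_def power2_eq_square)
  ultimately have "(LINT x|lborel. (f x)\<^sup>2) = 0" by simp
  then have "AE x in lborel. (f x)\<^sup>2 = 0"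
    using integral_nonneg_eq_0_iff_AE[of lborel "\<lambda>x. (f x)\<^sup>2"] fs by (auto simp: square_integrable_def)
  then show "u \<in> L2_on S"
    unfolding L2_on_def mem_Collect_eq by eventually_elim (auto simp: f_def)
qed

lemma subspace_L2_on: "S \<in> sets borel \<Longrightarrow> subspace (L2_on S)"
  unfolding L2_on_eq_orthogonal by (auto simp: subspace_def inner_add_left)

lemma closed_L2_on: "S \<in> sets borel \<Longrightarrow> closed (L2_on S)"
proof -
  assume "S \<in> sets borel"
  then have "L2_on S = (\<Inter>g\<in>L2_on (- S). {u. inner u g = 0})" by (auto simp: L2_on_eq_orthogonal)
  moreover have "closed {u. inner u g = 0}" for g :: "'a L2" by (intro closed_Collect_eq continuous_intros)
  ultimately show ?thesis by auto
qed

lemma subspace_closure: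
  fixes S :: "'h::real_normed_vector set"
  assumes S: "subspace S"
  shows "subspace (closure S)"
proof (rule subspaceI)
  show "0 \<in> closure S" using subspace_0[OF S] closure_subset by blast
  fix x y assume "x \<in> closure S" "y \<in> closure S"
  then obtain X Y where "\<forall>n. X n \<in> S" "X \<longlonglongrightarrow> x" "\<forall>n. Y n \<in> S" "Y \<longlonglongrightarrow> y"
    unfolding closure_sequential by blast
  then show "x + y \<in> closure S" unfolding closure_sequential
    by (intro exI[of _ "\<lambda>n. X n + Y n"]) (auto intro: subspace_add[OF S] tendsto_add)
next
  fix x and c :: real assume "x \<in> closure S"
  then obtain X where "\<forall>n. X n \<in> S" "X \<longlonglongrightarrow> x" unfolding closure_sequential by blast
  then show "c *\<^sub>R x \<in> closure S" unfolding closure_sequential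
    by (intro exI[of _ "\<lambda>n. c *\<^sub>R X n"]) (auto intro: subspace_scale[OF S] tendsto_scaleR)
qed

context hilfer_setting
begin

text \<open>The state at time \<open>T\<close> reached from the initial value 0 with the control
  \<open>kern (m + 2) t *\<^sub>R g\<close>.\<close>

definition control_map :: "real \<Rightarrow> nat \<Rightarrow> 'a L2 \<Rightarrow> 'a L2" where
  "control_map T m g = synth (\<lambda>n. inner g (\<phi> n) * ml_kern (real m + 2 + \<mu>) (lam n) T)"

lemma l2_seq_times_bounded:
  assumes "l2_seq b" "\<And>n. \<bar>e n\<bar> \<le> K"
  shows "l2_seq (\<lambda>n. b n * e n)"
proof (rule l2_seq_le[OF l2_seq_scale[OF assms(1), of K]])
  fix n
  have "\<bar>b n\<bar> * \<bar>e n\<bar> \<le> \<bar>b n\<bar> * \<bar>K\<bar>" using assms(2)[of n] by (intro mult_left_mono) auto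
  then show "\<bar>b n * e n\<bar> \<le> \<bar>K * b n\<bar>" by (simp add: abs_mult mult.commute)
qed

lemma l2_seq_control:
  assumes "T > 0"
  shows "l2_seq (\<lambda>n. inner g (\<phi> n) * ml_kern (real m + 2 + \<mu>) (lam n) T)"
  by (rule l2_seq_times_bounded[OF l2_seq_coeff abs_ml_kern_le_kern[OF lam_pos assms]]) simp

lemma synth_add:
  assumes "l2_seq c" "l2_seq d"
  shows "synth (\<lambda>n. c n + d n) = synth c + synth d"
  using synth_diff[OF l2_seq_add[OF assms] assms(2)] by (simp add: diff_eq_eq)

lemma control_map_add: "T > 0 \<Longrightarrow> control_map T m (g + g') = control_map T m g + control_map T m g'"
  unfolding control_map_def using synth_add[OF l2_seq_control[where g = g and m = m] l2_seq_control[where g = g' and m = m]]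
  by (simp add: inner_add_left distrib_right)

lemma control_map_scale: "T > 0 \<Longrightarrow> control_map T m (c *\<^sub>R g) = c *\<^sub>R control_map T m g"
  unfolding control_map_def using synth_scale[OF l2_seq_control[where g = g and m = m], where k = c] by (simp add: mult.assoc)

lemma control_map_zero: "T > 0 \<Longrightarrow> control_map T m 0 = 0"
  using control_map_scale[of T m 0 0] by simp

text \<open>The condition that \<open>g\<close> vanishes from \<open>M\<close> on lets two such sums be
  brought to a common length.\<close>

definition reachable :: "real \<Rightarrow> 'a L2 set \<Rightarrow> 'a L2 set" where
  "reachable T S = {\<Sum>m<M. control_map T m (g m) | M g. (\<forall>m. g m \<in> S) \<and> (\<forall>m\<ge>M. g m = 0)}"

lemma control_map_reachable:
  assumes T: "T > 0" and S: "subspace S" "g \<in> S"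
  shows "control_map T m g \<in> reachable T S"
proof -
  define g' where "g' k = (if k = m then g else 0)" for k
  have "(\<Sum>k<Suc m. control_map T k (g' k)) = control_map T m g"
    by (simp add: g'_def control_map_zero[OF T])
  moreover have "\<forall>k. g' k \<in> S" "\<forall>k\<ge>Suc m. g' k = 0" using S subspace_0 by (auto simp: g'_def)
  ultimately show ?thesis unfolding reachable_def
    by (intro CollectI exI[of _ "Suc m"] exI[of _ g']) simp
qed

lemma subspace_reachable:
  assumes T: "T > 0" and S: "subspace S"
  shows "subspace (reachable T S)"
proof (rule subspaceI)
  show "0 \<in> reachable T S"
    unfolding reachable_def using subspace_0[OF S] by (auto intro!: exI[of _ 0] exI[of _ "\<lambda>_. 0"])
  fix x y assume "x \<in> reachable T S" "y \<in> reachable T S"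
  then obtain M N g k where x: "x = (\<Sum>m<M. control_map T m (g m))" "\<And>m. g m \<in> S" "\<And>m. m \<ge> M \<Longrightarrow> g m = 0"
    and y: "y = (\<Sum>m<N. control_map T m (k m))" "\<And>m. k m \<in> S" "\<And>m. m \<ge> N \<Longrightarrow> k m = 0"
    unfolding reachable_def by blast
  have "x = (\<Sum>m<max M N. control_map T m (g m))"
    unfolding x(1) by (rule sum.mono_neutral_left) (auto simp: x(3) control_map_zero[OF T])
  moreover have "y = (\<Sum>m<max M N. control_map T m (k m))"
    unfolding y(1) by (rule sum.mono_neutral_left) (auto simp: y(3) control_map_zero[OF T])
  ultimately have "x + y = (\<Sum>m<max M N. control_map T m (g m + k m))"
    by (simp add: control_map_add[OF T] sum.distrib)
  moreover have "\<forall>m. g m + k m \<in> S" "\<forall>m\<ge>max M N. g m + k m = 0" using x y S by (auto intro: subspace_add)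
  ultimately show "x + y \<in> reachable T S" unfolding reachable_def by (intro CollectI exI[of _ "max M N"] exI[of _ "\<lambda>m. g m + k m"]) blast
next
  fix x and c :: real assume "x \<in> reachable T S"
  then obtain M g where x: "x = (\<Sum>m<M. control_map T m (g m))" "\<And>m. g m \<in> S" "\<And>m. m \<ge> M \<Longrightarrow> g m = 0"
    unfolding reachable_def by blast
  have "c *\<^sub>R x = (\<Sum>m<M. control_map T m (c *\<^sub>R g m))"
    unfolding x(1) by (simp add: control_map_scale[OF T] scaleR_sum_right)
  moreover have "\<forall>m. c *\<^sub>R g m \<in> S" "\<forall>m\<ge>M. c *\<^sub>R g m = 0" using x S by (auto intro: subspace_scale)
  ultimately show "c *\<^sub>R x \<in> reachable T S" unfolding reachable_def by (intro CollectI exI[of _ M] exI[of _ "\<lambda>m. c *\<^sub>R g m"]) blast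
qed

text \<open>Orthogonality of \<open>z\<close> to the reachable states is the hypothesis of
  \<open>vanishing_observations\<close> for the products of the coefficients of \<open>g\<close> and
  \<open>z\<close>.\<close>

lemma lowest_mode_unobservable:
  assumes T: "T > 0" and S: "subspace S"
    and orth: "\<And>x. x \<in> reachable T S \<Longrightarrow> inner x z = 0"
    and ls: "ls > 0" "\<And>n. lam n < ls \<Longrightarrow> inner z (\<phi> n) = 0" and g: "g \<in> S"
  shows "inner g (synth (\<lambda>n. if lam n = ls then inner z (\<phi> n) else 0)) = 0"
proof -
  define a where "a n = inner g (\<phi> n) * inner z (\<phi> n)" for n
  have sa: "summable (\<lambda>n. \<bar>a n\<bar>)" unfolding a_def by (rule l2_seq_mult_summable[OF l2_seq_coeff l2_seq_coeff])
  have "(\<Sum>n. if lam n = ls then a n else 0) = 0"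
  proof (rule vanishing_observations[OF sa l0 lam T _ ls(1)])
    fix m
    have "inner (control_map T m g) z = 0" by (rule orth[OF control_map_reachable[OF T S g]])
    then show "(\<Sum>n. a n * ml_kern (real m + 2 + \<mu>) (lam n) T) = 0"
      using inner_synth_sums[OF l2_seq_control[OF T], of g m z]
      by (simp add: control_map_def sums_iff a_def inner_commute mult_ac)
    show "a n = 0" if "lam n < ls" for n using ls(2)[OF that] by (simp add: a_def)
  qed
  moreover have lz: "l2_seq (\<lambda>n. if lam n = ls then inner z (\<phi> n) else 0)"
    by (rule l2_seq_le[OF l2_seq_coeff[of z]]) auto
  have "(\<lambda>n. if lam n = ls then a n else 0) sums inner (synth (\<lambda>n. if lam n = ls then inner z (\<phi> n) else 0)) g"
    using inner_synth_sums[OF lz, of g] by (rule sums_cong[THEN iffD1, rotated]) (auto simp: a_def inner_commute)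
  ultimately show ?thesis by (simp add: sums_iff inner_commute)
qed

text \<open>By selfadjointness it suffices to compare inner products with \<open>A u\<close> and
  \<open>u\<close> for \<open>u\<close> in the domain, so the sum over the eigenspace may be
  infinite.\<close>

lemma synth_eigenspace:
  assumes sa: "selfadjoint_operator H D A" and ph: "\<And>n. \<phi> n \<in> D" "\<And>n. A (\<phi> n) = lam n *\<^sub>R \<phi> n"
    and c: "l2_seq c" "\<And>n. c n \<noteq> 0 \<Longrightarrow> lam n = ls"
  shows "synth c \<in> D \<and> A (synth c) = ls *\<^sub>R synth c"
proof -
  have "inner (A u) (synth c) = inner u (ls *\<^sub>R synth c)" if u: "u \<in> D" for u
  proof -
    have e: "c n * inner (\<phi> n) (A u) = ls * (c n * inner (\<phi> n) u)" for n
      using selfadjoint_symmetric[OF sa ph(1)[of n] u] ph(2)[of n] c(2)[of n] by (cases "c n = 0") auto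
    have "(\<lambda>n. ls * (c n * inner (\<phi> n) u)) sums inner (synth c) (A u)"
      using inner_synth_sums[OF c(1), of "A u"] unfolding e .
    then show ?thesis
      using sums_unique2[OF _ sums_mult[OF inner_synth_sums[OF c(1), of u], of ls]] by (simp add: inner_commute)
  qed
  moreover have "synth c \<in> H" "ls *\<^sub>R synth c \<in> H" using synth_H[OF c(1)] H by (auto simp: subspace_scale)
  ultimately show ?thesis using sa unfolding selfadjoint_operator_def by blast
qed

text \<open>Let \<open>z\<close> be the component of \<open>x\<close> orthogonal to the reachable
  states. If \<open>z\<close> were nonzero, its projection to the lowest eigenspace in which it has a
  component would be an eigenvector orthogonal to \<open>S\<close>.\<close>

lemma reachable_dense:
  assumes T: "T > 0" and S: "subspace S" and x: "x \<in> H"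
    and sa: "selfadjoint_operator H D A" and ph: "\<And>n. \<phi> n \<in> D" "\<And>n. A (\<phi> n) = lam n *\<^sub>R \<phi> n"
    and eig: "incseq eig" "\<And>n. lam n \<in> range eig"
    and uc: "\<And>l v. v \<in> D \<Longrightarrow> A v = l *\<^sub>R v \<Longrightarrow> (\<And>g. g \<in> S \<Longrightarrow> inner g v = 0) \<Longrightarrow> v = 0"
  shows "x \<in> closure (reachable T S)"
proof -
  have RH: "reachable T S \<subseteq> H"
    unfolding reachable_def control_map_def using synth_H[OF l2_seq_control[OF T]] H by (auto intro!: subspace_sum)
  obtain y where y: "y \<in> closure (reachable T S)" "\<And>s. s \<in> closure (reachable T S) \<Longrightarrow> inner (x - y) s = 0"
    using orthogonal_projection_exists[OF subspace_closure[OF subspace_reachable[OF T S]] closed_closure] by blast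
  define z where "z = x - y"
  have "y \<in> H" using y(1) closure_minimal[OF RH H(2)] by blast
  then have zH: "z \<in> H" unfolding z_def using x H by (simp add: subspace_diff)
  have orth: "inner v z = 0" if "v \<in> reachable T S" for v
    using y(2)[of v] closure_subset that by (auto simp: z_def inner_commute)
  have "z = 0"
  proof (rule ccontr)
    assume "z \<noteq> 0"
    then obtain n0 where "inner z (\<phi> n0) \<noteq> 0" using complete[OF zH] by blast
    then have ex: "\<exists>k n. inner z (\<phi> n) \<noteq> 0 \<and> lam n = eig k" using eig(2)[of n0] by blast
    \<comment> \<open>The eigenvalues are well ordered, being the values of the increasing sequence
      \<open>eig\<close>.\<close>
    define k where "k = (LEAST k. \<exists>n. inner z (\<phi> n) \<noteq> 0 \<and> lam n = eig k)"
    obtain n1 where n1: "inner z (\<phi> n1) \<noteq> 0" "lam n1 = eig k" using LeastI_ex[OF ex] unfolding k_def by blast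
    define c where "c n = (if lam n = eig k then inner z (\<phi> n) else 0)" for n
    have lc: "l2_seq c" by (rule l2_seq_le[OF l2_seq_coeff[of z]]) (auto simp: c_def)
    have low: "inner z (\<phi> n) = 0" if "lam n < eig k" for n
    proof (rule ccontr)
      assume nz: "inner z (\<phi> n) \<noteq> 0"
      obtain j where j: "lam n = eig j" using eig(2)[of n] by blast
      have "k \<le> j" unfolding k_def by (rule Least_le) (use nz j in blast)
      then show False using incseqD[OF eig(1)] j that by fastforce
    qed
    have "synth c = 0"
    proof (rule uc)
      show "synth c \<in> D" "A (synth c) = eig k *\<^sub>R synth c"
        using synth_eigenspace[OF sa ph lc, of "eig k"] by (auto simp: c_def split: if_splits)
      show "inner g (synth c) = 0" if "g \<in> S" for g
        using lowest_mode_unobservable[OF T S orth _ low that] lam_pos[of n1] n1 by (simp add: c_def[abs_def])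
    qed
    then have "c n1 = 0" using inner_synth_phi[OF lc, of n1] by simp
    then show False using n1 by (simp add: c_def)
  qed
  then show ?thesis using y(1) by (simp add: z_def)
qed

lemma control_space_polynomial:
  assumes S: "\<omega> \<in> sets borel" and g: "\<And>m. g m \<in> L2_on \<omega>"
  shows "(\<lambda>t. \<Sum>m<M. kern (real m + 2) t *\<^sub>R g m) \<in> control_space T \<omega>"
proof -
  have "continuous_on {0..T} (kern (real m + 2))" for m
    unfolding kern_def[abs_def] divide_inverse by (intro continuous_intros continuous_on_powr') auto
  then have c: "continuous_on {0..T} (\<lambda>t. \<Sum>m<M. kern (real m + 2) t *\<^sub>R g m)" by (intro continuous_intros)
  show ?thesis
    unfolding control_space_def mem_Collect_eq
  proof (intro conjI)
    show "set_borel_measurable lborel {0<..<T} (\<lambda>t. \<Sum>m<M. kern (real m + 2) t *\<^sub>R g m)"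
      by (rule set_borel_measurable_continuous_on[OF c]) auto
    show "AE t in lborel. t \<in> {0<..<T} \<longrightarrow> (\<Sum>m<M. kern (real m + 2) t *\<^sub>R g m) \<in> L2_on \<omega>"
      using subspace_L2_on[OF S] g by (intro AE_I2) (auto intro!: subspace_sum subspace_scale)
    show "set_integrable lborel {0<..<T} (\<lambda>t. (norm (\<Sum>m<M. kern (real m + 2) t *\<^sub>R g m))\<^sup>2)"
      by (rule set_integrable_subset[of _ "{0..T}"]) (auto intro!: borel_integrable_atLeastAtMost' continuous_intros c)
  qed
qed

text \<open>The free evolution of \<open>u0\<close> contributes a fixed state \<open>synth p\<close> at
  time \<open>T\<close>, and the control has to approximate \<open>u1 - synth p\<close>.\<close>

theorem approximately_controllable:
  assumes T: "T > 0" and u0: "u0 \<in> H" and u1: "u1 \<in> H" and \<epsilon>: "\<epsilon> > 0"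
    and \<omega>: "\<omega> \<in> sets borel" "L2_on \<omega> \<subseteq> H"
    and sa: "selfadjoint_operator H D A" and ph: "\<And>n. \<phi> n \<in> D" "\<And>n. A (\<phi> n) = lam n *\<^sub>R \<phi> n"
    and eig: "incseq eig" "\<And>n. lam n \<in> range eig"
    and uc: "unique_continuation \<omega> D A"
  shows "\<exists>f\<in>control_space T \<omega>. (\<exists>u. weak_solution V E \<mu> \<nu> T u0 f u) \<and>
           (\<forall>u. weak_solution V E \<mu> \<nu> T u0 f u \<longrightarrow> norm (u T - u1) \<le> \<epsilon>)"
proof -
  have mb: "\<mu> + \<beta> \<ge> \<mu>" using beta_nonneg by simp
  define p where "p n = inner u0 (\<phi> n) * ml_kern (\<mu> + \<beta>) (lam n) T" for n
  have lp: "l2_seq p"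
    unfolding p_def by (rule l2_seq_times_bounded[OF l2_seq_coeff abs_ml_kern_le_kern[OF lam_pos T mb]])
  have "u1 - synth p \<in> closure (reachable T (L2_on \<omega>))"
  proof (rule reachable_dense[OF T subspace_L2_on[OF \<omega>(1)] _ sa ph eig])
    show "u1 - synth p \<in> H" using u1 synth_H[OF lp] H by (simp add: subspace_diff)
    fix l v assume v: "v \<in> D" "A v = l *\<^sub>R v" "\<And>g. g \<in> L2_on \<omega> \<Longrightarrow> inner g v = 0"
    have "- \<omega> \<in> sets borel" using \<omega>(1) by auto
    then have "v \<in> L2_on (- \<omega>)" using v(3) by (simp add: L2_on_eq_orthogonal inner_commute)
    then show "v = 0" using uc v unfolding unique_continuation_def by blast
  qed
  then obtain r where r: "r \<in> reachable T (L2_on \<omega>)" "dist r (u1 - synth p) < \<epsilon>"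
    using \<epsilon> unfolding closure_approachable by blast
  then obtain M g where g: "r = (\<Sum>m<M. control_map T m (g m))" "\<And>m. g m \<in> L2_on \<omega>"
    unfolding reachable_def by blast
  define f where "f t = (\<Sum>m<M. kern (real m + 2) t *\<^sub>R g m)" for t
  have gH: "g m \<in> H" for m using g(2) \<omega>(2) by blast
  obtain c h F b where cs: "coefficient_solution (\<mu> / 2) T u0 f c h F b"
    and c: "\<And>n t. c n t = inner u0 (\<phi> n) * ml_kern (\<mu> + \<beta>) (lam n) t + (\<Sum>m<M. inner (g m) (\<phi> n) * ml_kern (real m + 2 + \<mu>) (lam n) t)"
    using coefficient_solution_exists[OF T u0, of g M, OF gH] unfolding f_def[abs_def] by blast
  define u where "u t = synth (\<lambda>n. c n t)" for t
  have "\<mu> / 2 > 0" using mu0 by simp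
  then have ws: "weak_solution V E \<mu> \<nu> T u0 f u"
    unfolding u_def[abs_def] by (rule weak_solution_of_coefficients[OF T _ cs])
  have "synth (\<lambda>n. \<Sum>m<M. inner (g m) (\<phi> n) * ml_kern (real m + 2 + \<mu>) (lam n) T) = r"
    if "r = (\<Sum>m<M. control_map T m (g m))" for r M
    unfolding that
  proof (induction M)
    case 0
    then show ?case using synth_scale[of "\<lambda>_. 0" 0] by (simp add: l2_seq_def)
  next
    case (Suc M)
    then show ?case
      using synth_add[OF l2_seq_sum[OF l2_seq_control[OF T]] l2_seq_control[OF T], of "\<lambda>m. g m" "\<lambda>m. m" "{..<M}" "g M" M]
      by (simp add: control_map_def)
  qed
  note sr = this[OF g(1)]
  have "u T = synth p + r"
    unfolding u_def c sr[symmetric] p_def[symmetric]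
    by (rule synth_add[OF lp l2_seq_sum[OF l2_seq_control[OF T]]])
  then have "norm (u T - u1) \<le> \<epsilon>" using r(2) by (simp add: dist_norm algebra_simps)
  then have "norm (v T - u1) \<le> \<epsilon>" if "weak_solution V E \<mu> \<nu> T u0 f v" for v
    using weak_solution_unique[OF T that ws] by simp
  moreover have "f \<in> control_space T \<omega>" unfolding f_def[abs_def] by (rule control_space_polynomial[OF \<omega>(1) g(2)])
  ultimately show ?thesis using ws by blast
qed

end

theorem theorem2p6:
  fixes \<Omega> \<omega> :: "'a::euclidean_space set"
    and V D :: "'a L2 set"
    and E :: "'a L2 \<Rightarrow> 'a L2 \<Rightarrow> real"
    and A :: "'a L2 \<Rightarrow> 'a L2"
    and eig :: "nat \<Rightarrow> real"
    and \<mu> \<nu> :: real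
  assumes "open \<Omega>" and "bounded \<Omega>"
    and "selfadjoint_operator (L2_on \<Omega>) D A" and "nonneg_operator D A"
    and "compactly_embedded_domain D A"
    and "closed_nonneg_form (L2_on \<Omega>) V E"
    and "associated_operator (L2_on \<Omega>) V E D A"
    and "incseq eig" and "filterlim eig at_top sequentially"
    and "range eig = {l. eigenvalue D A l}" and "eig 0 > 0"
    and "open \<omega>" and "\<omega> \<noteq> {}" and "\<omega> \<subseteq> \<Omega>"
    and "unique_continuation \<omega> D A"
    and "0 \<le> \<nu>" and "\<nu> < 1" and "0 < \<mu>" and "\<mu> < 1"
  shows "\<forall>T>0. \<forall>u0\<in>L2_on \<Omega>. \<forall>u1\<in>L2_on \<Omega>. \<forall>\<epsilon>>0. \<exists>f\<in>control_space T \<omega>.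
           (\<exists>u. weak_solution V E \<mu> \<nu> T u0 f u) \<and>
           (\<forall>u. weak_solution V E \<mu> \<nu> T u0 f u \<longrightarrow> norm (u T - u1) \<le> \<epsilon>)"
proof -
  have H: "subspace (L2_on \<Omega>)" "closed (L2_on \<Omega>)" using assms(1) by (auto intro!: subspace_L2_on closed_L2_on)
  have "infinite (range eig)"
  proof
    assume "finite (range eig)"
    then obtain B where "\<And>n. eig n \<le> B" using bdd_above_finite[of "range eig"] by (auto simp: bdd_above_def)
    moreover have "eventually (\<lambda>n. B < eig n) sequentially" using assms(9) by (simp add: filterlim_at_top_dense)
    ultimately have "eventually (\<lambda>n. False) sequentially" by (auto elim!: eventually_mono simp: not_less[symmetric])
    then show False by simp
  qed
  then have inf: "infinite {l. eigenvalue D A l}" using assms(10) by simp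
  obtain \<phi> :: "nat \<Rightarrow> 'a L2" and lam :: "nat \<Rightarrow> real" where ph: "\<And>n. \<phi> n \<in> D" "\<And>n. A (\<phi> n) = lam n *\<^sub>R \<phi> n"
    and on: "\<And>i j. inner (\<phi> i) (\<phi> j) = (if i = j then 1 else 0 :: real)"
    and cp: "\<And>h. h \<in> L2_on \<Omega> \<Longrightarrow> (\<And>n. inner h (\<phi> n) = 0) \<Longrightarrow> h = 0"
    using eigenbasis_exists[OF H assms(3,4,5) inf] by blast
  have er: "lam n \<in> range eig" for n
  proof -
    have "\<phi> n \<noteq> 0" using on[of n n] by auto
    then have "eigenvalue D A (lam n)" unfolding eigenvalue_def using ph by blast
    then show ?thesis using assms(10) by blast
  qed
  have el: "eig 0 \<le> lam n" for n using er[of n] incseqD[OF assms(8), of 0] by auto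
  have phH: "\<phi> n \<in> L2_on \<Omega>" "lam n *\<^sub>R \<phi> n \<in> L2_on \<Omega>" for n
  proof -
    show "\<phi> n \<in> L2_on \<Omega>" using ph(1)[of n] assms(3) unfolding selfadjoint_operator_def by blast
    then show "lam n *\<^sub>R \<phi> n \<in> L2_on \<Omega>" using H by (simp add: subspace_scale)
  qed
  have assoc: "\<phi> n \<in> V \<and> (\<forall>v\<in>V. E (\<phi> n) v = inner (lam n *\<^sub>R \<phi> n) v)" for n
    using assms(7) phH[of n] ph[of n] unfolding associated_operator_def by blast
  interpret hilfer_setting \<mu> "L2_on \<Omega>" V E \<phi> lam "eig 0" \<nu>
    by unfold_locales (use assms H assoc on cp el in auto)
  have "\<omega> \<in> sets borel" using assms(12) by simp
  moreover have "L2_on \<omega> \<subseteq> L2_on \<Omega>"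
  proof
    fix u assume "u \<in> L2_on \<omega>"
    then show "u \<in> L2_on \<Omega>" unfolding L2_on_def mem_Collect_eq by eventually_elim (use assms(14) in blast)
  qed
  ultimately show ?thesis
    using approximately_controllable[OF _ _ _ _ _ _ assms(3) ph assms(8) er assms(15)] by blast
qed

end
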